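(* Let $G$ be a higher-rank Sol-type group with left-invariant Riemannian metric $g$ and $s_g$ a perpendicular splitting, and let $d$ be the distance induced by $g$. Then there is a $K$ depending only on $g$ such that any two points $x,y\in G$ are connected by a half-space visiting box path whose $g$-length is at most $d(x,y)+K$ (a $K$-coarse HSV box geodesic).
   Context: Higher-rank Sol-type group: $G=\mathbf{N}\rtimes\mathbb{R}^k$ with $k\ge2$, $\mathbf{N}=\prod_{i=1}^n\mathbf{N}_i$, where each $\mathbf{N}_i$ is a simply connected nilpotent Lie group with Lie algebra $\mathfrak{n}_i$, $D_i$ is a derivation of $\mathfrak{n}_i$ all of whose eigenvalues have positive real part (normalized so that the smallest real part of an eigenvalue of $D_i$ is $1$), $\alpha_i:\mathbb{R}^k\to\mathbb{R}$ is a nonzero linear map (a root), and $v\in\mathbb{R}^k$ acts on $\mathbf{N}_i$ by conjugation through the automorphism with differential $e^{\alpha_i(v)D_i}$. The quotient map by $\mathbf{N}$ is $\pi:G\to\mathbb{R}^k$. A perpendicular splitting of $g$ is a Lie group homomorphism $s_g:\mathbb{R}^k\to G$ with $\pi\circ s_g=\mathrm{id}$ whose image has tangent space at the identity $g$-orthogonal to the Lie algebra of $\mathbf{N}$. Write elements of $G$ as $(h,v)=h\,s_g(v)$, $h\in\mathbf{N}$, $v\in\mathbb{R}^k$, and let $D_i$ be the derivation for this semidirect decomposition, i.e. conjugation by $s_g(v)$ acts on $\mathfrak{n}_i$ by $e^{\alpha_i(v)D_i}$. Half-spaces: let $d_i$ be the path metric on $\mathbf{N}_i$ induced by $g$. For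 $x,y\in G$ write $x^{-1}y=(\prod_i h_i,v)$ with $h_i\in\mathbf{N}_i$. Let $H_i\in[-\infty,\infty)$ be the smallest number such that $d_i(e,e^{-HD_i}(h_i))\le1$ for all $H\ge H_i$ (here $e^{-HD_i}$ denotes the automorphism of $\mathbf{N}_i$ with this differential; $H_i=-\infty$ if $h_i=e$). The $i$-th half-space associated to $x,y$ is $\{v\in\mathbb{R}^k:\alpha_i(v)\ge H_i\}$. A (piecewise smooth) path $\gamma$ from $x$ to $y$ is half-space visiting (HSV) if for each $i$ the path $\pi(x^{-1}\gamma)$ meets the $i$-th half-space associated to $x,y$. It is a box path if its derivative is tangent to left cosets of $s_g(\mathbb{R}^k)$ everywhere except on at most $n+1$ subintervals, along each of which its derivative is tangent to a coset of a different one of the $\mathbf{N}_i$. *)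

theory Defs
  imports "HOL-Analysis.Analysis" "HOL-Algebra.Generated_Groups"
begin

section \<open>Smooth functions and Lie groups\<close>

text \<open>
  Manifolds are modelled on a linear subspace \<open>V\<close> of a Euclidean space, so that Lie groups of
  different dimensions can share one type.  Below, \<open>S\<close> is relatively open in \<open>V\<close>, or, for paths,
  relatively open in a compact interval (with \<open>V = UNIV\<close>; derivatives at the end points are then
  one-sided).  The derivative \<open>f'\<close> is determined only on \<open>V\<close>.
\<close>

fun Ck_on :: "nat \<Rightarrow> 'e::euclidean_space set \<Rightarrow> 'e set \<Rightarrow> ('e \<Rightarrow> 'f::real_normed_vector) \<Rightarrow> bool"
  where
    "Ck_on 0 V S f \<longleftrightarrow> continuous_on S f"
  | "Ck_on (Suc n) V S f \<longleftrightarrow>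
       (\<exists>f'. (\<forall>x\<in>S. (f has_derivative f' x) (at x within S)) \<and>
             (\<forall>h\<in>V. Ck_on n V S (\<lambda>x. f' x h)))"

definition smooth_on :: "'e::euclidean_space set \<Rightarrow> 'e set \<Rightarrow> ('e \<Rightarrow> 'f::real_normed_vector) \<Rightarrow> bool"
  where "smooth_on V S f \<longleftrightarrow> (\<forall>n. Ck_on n V S f)"

type_synonym ('a, 'e) chart = "'a set \<times> ('a \<Rightarrow> 'e)"

definition smooth_atlas ::
  "'a::{t2_space, second_countable_topology} set \<Rightarrow> 'e::euclidean_space set \<Rightarrow>
     ('a, 'e) chart set \<Rightarrow> bool"
  where
    "smooth_atlas M V A \<longleftrightarrow>
       subspace V \<and> (\<Union>(U, \<phi>)\<in>A. U) = M \<and>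
       (\<forall>(U, \<phi>)\<in>A. openin (top_of_set M) U \<and> openin (top_of_set V) (\<phi> ` U) \<and>
                    homeomorphism U (\<phi> ` U) \<phi> (inv_into U \<phi>)) \<and>
       (\<forall>(U, \<phi>)\<in>A. \<forall>(W, \<psi>)\<in>A. smooth_on V (\<phi> ` (U \<inter> W)) (\<psi> \<circ> inv_into U \<phi>))"

definition smooth_map ::
  "'a::topological_space set \<Rightarrow> 'e::euclidean_space set \<Rightarrow> ('a, 'e) chart set \<Rightarrow>
   'b::topological_space set \<Rightarrow> ('b, 'f::euclidean_space) chart set \<Rightarrow> ('a \<Rightarrow> 'b) \<Rightarrow> bool"
  where
    "smooth_map M V A M' A' f \<longleftrightarrow>
       f ` M \<subseteq> M' \<and> continuous_on M f \<and>
       (\<forall>(U, \<phi>)\<in>A. \<forall>(W, \<psi>)\<in>A'.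
          smooth_on V (\<phi> ` (U \<inter> f -` W)) (\<psi> \<circ> f \<circ> inv_into U \<phi>))"

definition prod_atlas :: "('a, 'e) chart set \<Rightarrow> ('b, 'f) chart set \<Rightarrow> ('a \<times> 'b, 'e \<times> 'f) chart set"
  where
    "prod_atlas A B =
       {(U \<times> W, \<lambda>(x, y). (\<phi> x, \<psi> y)) | U \<phi> W \<psi>. (U, \<phi>) \<in> A \<and> (W, \<psi>) \<in> B}"

text \<open>
  The tangent space at the identity is identified with \<open>model G\<close> through the derivative of the
  distinguished chart \<open>id_chart G\<close>, which is centred at the identity.  So \<open>model G\<close> plays the role
  of the Lie algebra of \<open>G\<close>.
\<close>

record ('a, 'e) lie_struct = "'a monoid" +
  model :: "'e set"
  atlas :: "('a, 'e) chart set"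
  id_chart :: "('a, 'e) chart"

abbreviation coord :: "('a, 'e) lie_struct \<Rightarrow> 'a \<Rightarrow> 'e"
  where "coord G \<equiv> snd (id_chart G)"

abbreviation uncoord :: "('a, 'e) lie_struct \<Rightarrow> 'e \<Rightarrow> 'a"
  where "uncoord G \<equiv> inv_into (fst (id_chart G)) (coord G)"

definition lie_group ::
  "('a::{t2_space, second_countable_topology}, 'e::euclidean_space) lie_struct \<Rightarrow> bool"
  where
    "lie_group G \<longleftrightarrow>
       group G \<and> smooth_atlas (carrier G) (model G) (atlas G) \<and>
       smooth_map (carrier G \<times> carrier G) (model G \<times> model G) (prod_atlas (atlas G) (atlas G))
         (carrier G) (atlas G) (\<lambda>(x, y). x \<otimes>\<^bsub>G\<^esub> y) \<and>
       smooth_map (carrier G) (model G) (atlas G) (carrier G) (atlas G) (\<lambda>x. inv\<^bsub>G\<^esub> x) \<and>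
       id_chart G \<in> atlas G \<and> \<one>\<^bsub>G\<^esub> \<in> fst (id_chart G) \<and> coord G \<one>\<^bsub>G\<^esub> = 0"

definition lie_hom ::
  "('a::topological_space, 'e::euclidean_space) lie_struct \<Rightarrow>
   ('b::topological_space, 'f::euclidean_space) lie_struct \<Rightarrow> ('a \<Rightarrow> 'b) \<Rightarrow> bool"
  where
    "lie_hom G H f \<longleftrightarrow>
       f \<in> hom G H \<and> smooth_map (carrier G) (model G) (atlas G) (carrier H) (atlas H) f"

definition lie_automorphism ::
  "('a::topological_space, 'e::euclidean_space) lie_struct \<Rightarrow> ('a \<Rightarrow> 'a) \<Rightarrow> bool"
  where
    "lie_automorphism G f \<longleftrightarrow>
       lie_hom G G f \<and> bij_betw f (carrier G) (carrier G) \<and>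
       lie_hom G G (inv_into (carrier G) f)"

text \<open>
  The differential at the identity of a map \<open>f\<close> with \<open>f \<one> = \<one>\<close>: it sends the velocity \<open>X\<close> of the
  curve \<open>t \<mapsto> uncoord G (t X)\<close> to the velocity of the image curve.
\<close>

definition differential ::
  "('a, 'e::euclidean_space) lie_struct \<Rightarrow> ('b, 'f::euclidean_space) lie_struct \<Rightarrow>
   ('a \<Rightarrow> 'b) \<Rightarrow> 'e \<Rightarrow> 'f"
  where
    "differential G H f X =
       vector_derivative (\<lambda>t::real. coord H (f (uncoord G (t *\<^sub>R X)))) (at 0)"

definition Ad :: "('a, 'e::euclidean_space) lie_struct \<Rightarrow> 'a \<Rightarrow> 'e \<Rightarrow> 'e"
  where "Ad G a = differential G G (\<lambda>x. a \<otimes>\<^bsub>G\<^esub> x \<otimes>\<^bsub>G\<^esub> inv\<^bsub>G\<^esub> a)"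

text \<open>The bracket is \<open>[X, Y] = ad X Y\<close>, where \<open>ad\<close> is the differential of \<open>Ad\<close> at the identity.\<close>

definition lie_bracket :: "('a, 'e::euclidean_space) lie_struct \<Rightarrow> 'e \<Rightarrow> 'e \<Rightarrow> 'e"
  where "lie_bracket G X Y = vector_derivative (\<lambda>t::real. Ad G (uncoord G (t *\<^sub>R X)) Y) (at 0)"

text \<open>Derivations are total linear maps; only their values on \<open>model G\<close> matter.\<close>

definition lie_derivation :: "('a, 'e::euclidean_space) lie_struct \<Rightarrow> ('e \<Rightarrow> 'e) \<Rightarrow> bool"
  where
    "lie_derivation G D \<longleftrightarrow>
       linear D \<and> D ` model G \<subseteq> model G \<and>
       (\<forall>X\<in>model G. \<forall>Y\<in>model G.
          D (lie_bracket G X Y) = lie_bracket G (D X) Y + lie_bracket G X (D Y))"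

definition lin_exp :: "('e::euclidean_space \<Rightarrow> 'e) \<Rightarrow> 'e \<Rightarrow> 'e"
  where "lin_exp D X = (\<Sum>n. (D ^^ n) X /\<^sub>R fact n)"

text \<open>
  Complex eigenvalues of a real linear map of \<open>V\<close>:
  \<open>D (a + \<i> b) = z (a + \<i> b)\<close> in the complexification of \<open>V\<close>, split into real and imaginary parts.
\<close>

definition eigenvalue_on :: "'e::real_vector set \<Rightarrow> ('e \<Rightarrow> 'e) \<Rightarrow> complex \<Rightarrow> bool"
  where
    "eigenvalue_on V D z \<longleftrightarrow>
       (\<exists>a\<in>V. \<exists>b\<in>V. (a \<noteq> 0 \<or> b \<noteq> 0) \<and>
          D a = Re z *\<^sub>R a - Im z *\<^sub>R b \<and> D b = Im z *\<^sub>R a + Re z *\<^sub>R b)"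

fun lower_central :: "('a, 'b) monoid_scheme \<Rightarrow> nat \<Rightarrow> 'a set"
  where
    "lower_central G 0 = carrier G"
  | "lower_central G (Suc n) =
       generate G {a \<otimes>\<^bsub>G\<^esub> b \<otimes>\<^bsub>G\<^esub> inv\<^bsub>G\<^esub> a \<otimes>\<^bsub>G\<^esub> inv\<^bsub>G\<^esub> b | a b. a \<in> carrier G \<and> b \<in> lower_central G n}"

definition nilpotent_group :: "('a, 'b) monoid_scheme \<Rightarrow> bool"
  where "nilpotent_group G \<longleftrightarrow> group G \<and> (\<exists>n. lower_central G n = {\<one>\<^bsub>G\<^esub>})"


section \<open>Left-invariant Riemannian metrics\<close>

text \<open>
  A left-invariant Riemannian metric is given by its value at the identity, an inner product \<open>q\<close> on
  \<open>model G\<close>.  Derivatives of paths are translated to the identity: \<open>left_velocity G c t\<close> is the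
  image of \<open>c'(t)\<close> under the differential of left translation by the inverse of \<open>c t\<close>.
\<close>

definition inner_product_on :: "'e::real_vector set \<Rightarrow> ('e \<Rightarrow> 'e \<Rightarrow> real) \<Rightarrow> bool"
  where
    "inner_product_on V q \<longleftrightarrow>
       (\<forall>X\<in>V. \<forall>Y\<in>V. q X Y = q Y X) \<and>
       (\<forall>X\<in>V. \<forall>Y\<in>V. \<forall>Z\<in>V. \<forall>c. q (c *\<^sub>R X + Y) Z = c * q X Z + q Y Z) \<and>
       (\<forall>X\<in>V. X \<noteq> 0 \<longrightarrow> q X X > 0)"

definition left_curve :: "('a, 'e) lie_struct \<Rightarrow> (real \<Rightarrow> 'a) \<Rightarrow> real \<Rightarrow> real \<Rightarrow> 'e"
  where "left_curve G c t r = coord G (inv\<^bsub>G\<^esub> (c t) \<otimes>\<^bsub>G\<^esub> c r)"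

definition left_velocity ::
  "('a, 'e::euclidean_space) lie_struct \<Rightarrow> (real \<Rightarrow> 'a) \<Rightarrow> real \<Rightarrow> 'e"
  where "left_velocity G c t = vector_derivative (left_curve G c t) (at t within {0..1})"

definition smooth_path_on ::
  "('a::topological_space, 'e::euclidean_space) lie_struct \<Rightarrow> real set \<Rightarrow> (real \<Rightarrow> 'a) \<Rightarrow> bool"
  where
    "smooth_path_on G J c \<longleftrightarrow>
       c ` J \<subseteq> carrier G \<and> continuous_on J c \<and>
       (\<forall>(U, \<phi>)\<in>atlas G. smooth_on UNIV (J \<inter> c -` U) (\<phi> \<circ> c))"

definition piecewise_smooth_path ::
  "('a::topological_space, 'e::euclidean_space) lie_struct \<Rightarrow> 'a \<Rightarrow> 'a \<Rightarrow> (real \<Rightarrow> 'a) \<Rightarrow> bool"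
  where
    "piecewise_smooth_path G x y c \<longleftrightarrow>
       c 0 = x \<and> c 1 = y \<and> c ` {0..1} \<subseteq> carrier G \<and> continuous_on {0..1} c \<and>
       (\<exists>F. finite F \<and>
          (\<forall>a b. 0 \<le> a \<and> a < b \<and> b \<le> 1 \<and> {a<..<b} \<inter> F = {} \<longrightarrow> smooth_path_on G {a..b} c))"

definition path_length ::
  "('a, 'e::euclidean_space) lie_struct \<Rightarrow> ('e \<Rightarrow> 'e \<Rightarrow> real) \<Rightarrow> (real \<Rightarrow> 'a) \<Rightarrow> real"
  where
    "path_length G q c = integral {0..1} (\<lambda>t. sqrt (q (left_velocity G c t) (left_velocity G c t)))"

definition path_dist ::
  "('a::topological_space, 'e::euclidean_space) lie_struct \<Rightarrow> ('e \<Rightarrow> 'e \<Rightarrow> real) \<Rightarrow> 'a \<Rightarrow> 'a \<Rightarrow> real"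
  where "path_dist G q x y = Inf {path_length G q c | c. piecewise_smooth_path G x y c}"


section \<open>Sol-type groups\<close>

definition vector_group :: "('v::euclidean_space, 'v) lie_struct"
  where
    "vector_group =
       \<lparr>carrier = UNIV, mult = (+), one = 0,
        model = UNIV, atlas = {(UNIV, id)}, id_chart = (UNIV, id)\<rparr>"

definition pi_chart :: "('i \<Rightarrow> ('a, 'e) chart) \<Rightarrow> ('i::finite \<Rightarrow> 'a, 'e ^ 'i) chart"
  where "pi_chart C = ({h. \<forall>i. h i \<in> fst (C i)}, \<lambda>h. \<chi> i. snd (C i) (h i))"

text \<open>
  The semidirect product \<open>(\<Prod>i. N i) \<rtimes> \<real>\<^sup>k\<close>, where \<open>v\<close> acts on \<open>N i\<close> by \<open>act i v\<close>, with the product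
  manifold structure.  The projection to \<open>\<real>\<^sup>k\<close> is \<open>snd\<close>.
\<close>

definition semidirect ::
  "('i::finite \<Rightarrow> ('a, 'e::euclidean_space) lie_struct) \<Rightarrow> ('i \<Rightarrow> real ^ 'k \<Rightarrow> 'a \<Rightarrow> 'a) \<Rightarrow>
     (('i \<Rightarrow> 'a) \<times> (real ^ 'k), ('e ^ 'i) \<times> (real ^ 'k)) lie_struct"
  where
    "semidirect N act =
       \<lparr>carrier = {h. \<forall>i. h i \<in> carrier (N i)} \<times> UNIV,
        mult = (\<lambda>(h, v) (h', v'). (\<lambda>i. h i \<otimes>\<^bsub>N i\<^esub> act i v (h' i), v + v')),
        one = (\<lambda>i. \<one>\<^bsub>N i\<^esub>, 0),
        model = {X. \<forall>i. X $ i \<in> model (N i)} \<times> UNIV,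
        atlas = prod_atlas {pi_chart C | C. \<forall>i. C i \<in> atlas (N i)} {(UNIV, id)},
        id_chart = (fst (pi_chart (\<lambda>i. id_chart (N i))) \<times> UNIV,
                    \<lambda>(h, v). (snd (pi_chart (\<lambda>i. id_chart (N i))) h, v))\<rparr>"

definition higher_rank_sol_type ::
  "('i::finite \<Rightarrow> ('a::{t2_space, second_countable_topology}, 'e::euclidean_space) lie_struct) \<Rightarrow>
   ('i \<Rightarrow> real ^ 'k \<Rightarrow> real) \<Rightarrow> ('i \<Rightarrow> 'e \<Rightarrow> 'e) \<Rightarrow> ('i \<Rightarrow> real ^ 'k \<Rightarrow> 'a \<Rightarrow> 'a) \<Rightarrow> bool"
  where
    "higher_rank_sol_type N \<alpha> D act \<longleftrightarrow>
       CARD('k) \<ge> 2 \<and>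
       (\<forall>i. lie_group (N i) \<and> simply_connected (carrier (N i)) \<and> nilpotent_group (N i)) \<and>
       (\<forall>i. lie_derivation (N i) (D i) \<and>
            (\<forall>z. eigenvalue_on (model (N i)) (D i) z \<longrightarrow> Re z > 0) \<and>
            (\<forall>z. eigenvalue_on (model (N i)) (D i) z \<longrightarrow> Re z \<ge> 1) \<and>
            (\<exists>z. eigenvalue_on (model (N i)) (D i) z \<and> Re z = 1)) \<and>
       (\<forall>i. linear (\<alpha> i) \<and> (\<exists>v. \<alpha> i v \<noteq> 0)) \<and>
       (\<forall>i v. lie_automorphism (N i) (act i v) \<and>
              (\<forall>X\<in>model (N i).
                 differential (N i) (N i) (act i v) X = lin_exp (\<lambda>Y. \<alpha> i v *\<^sub>R D i Y) X))"

text \<open>The Lie algebras of the factors \<open>N i\<close> and of their product, inside that of the whole group.\<close>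

definition factor_algebra ::
  "('i::finite \<Rightarrow> ('a, 'e::euclidean_space) lie_struct) \<Rightarrow> 'i \<Rightarrow> (('e ^ 'i) \<times> (real ^ 'k)) set"
  where "factor_algebra N i = {(axis i X, 0) | X. X \<in> model (N i)}"

definition nil_algebra ::
  "('i::finite \<Rightarrow> ('a, 'e::euclidean_space) lie_struct) \<Rightarrow> (('e ^ 'i) \<times> (real ^ 'k)) set"
  where "nil_algebra N = {(X, 0) | X. \<forall>i. X $ i \<in> model (N i)}"

definition perpendicular_splitting ::
  "('i::finite \<Rightarrow> ('a::topological_space, 'e::euclidean_space) lie_struct) \<Rightarrow>
   ('i \<Rightarrow> real ^ 'k \<Rightarrow> 'a \<Rightarrow> 'a) \<Rightarrow> (('e ^ 'i) \<times> (real ^ 'k) \<Rightarrow> ('e ^ 'i) \<times> (real ^ 'k) \<Rightarrow> real) \<Rightarrow>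
   (real ^ 'k \<Rightarrow> ('i \<Rightarrow> 'a) \<times> (real ^ 'k)) \<Rightarrow> bool"
  where
    "perpendicular_splitting N act q s \<longleftrightarrow>
       lie_hom vector_group (semidirect N act) s \<and>
       (\<forall>v. snd (s v) = v) \<and>
       (\<forall>v. \<forall>X\<in>nil_algebra N. q (differential vector_group (semidirect N act) s v) X = 0)"

text \<open>
  The derivation \<open>D\<^sub>i\<close> belonging to the semidirect decomposition given by \<open>s\<close>; it may differ from the
  one in \<^const>\<open>higher_rank_sol_type\<close>.  It is determined on \<open>model (N i)\<close>, since \<open>\<alpha> i \<noteq> 0\<close>.
\<close>

definition splitting_derivation ::
  "('i::finite \<Rightarrow> ('a, 'e::euclidean_space) lie_struct) \<Rightarrow> ('i \<Rightarrow> real ^ 'k \<Rightarrow> real) \<Rightarrow>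
   ('i \<Rightarrow> real ^ 'k \<Rightarrow> 'a \<Rightarrow> 'a) \<Rightarrow> (real ^ 'k \<Rightarrow> ('i \<Rightarrow> 'a) \<times> (real ^ 'k)) \<Rightarrow> 'i \<Rightarrow> 'e \<Rightarrow> 'e"
  where
    "splitting_derivation N \<alpha> act s i =
       (SOME D. lie_derivation (N i) D \<and>
          (\<forall>v. \<forall>X\<in>model (N i).
             Ad (semidirect N act) (s v) (axis i X, 0) =
               (axis i (lin_exp (\<lambda>Y. \<alpha> i v *\<^sub>R D Y) X), 0)))"

definition automorphism_of ::
  "('a::topological_space, 'e::euclidean_space) lie_struct \<Rightarrow> ('e \<Rightarrow> 'e) \<Rightarrow> 'a \<Rightarrow> 'a"
  where
    "automorphism_of G A =
       (SOME f. lie_automorphism G f \<and> (\<forall>X\<in>model G. differential G G f X = A X))"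

definition factor_dist ::
  "('i::finite \<Rightarrow> ('a::topological_space, 'e::euclidean_space) lie_struct) \<Rightarrow>
   (('e ^ 'i) \<times> (real ^ 'k) \<Rightarrow> ('e ^ 'i) \<times> (real ^ 'k) \<Rightarrow> real) \<Rightarrow> 'i \<Rightarrow> 'a \<Rightarrow> 'a \<Rightarrow> real"
  where "factor_dist N q i = path_dist (N i) (\<lambda>X Y. q (axis i X, 0) (axis i Y, 0))"

text \<open>The component \<open>h\<^sub>i\<close> of \<open>x\<inverse> y = (\<Prod>i. h\<^sub>i) s(v)\<close>.\<close>

definition nil_component ::
  "('i::finite \<Rightarrow> ('a, 'e::euclidean_space) lie_struct) \<Rightarrow> ('i \<Rightarrow> real ^ 'k \<Rightarrow> 'a \<Rightarrow> 'a) \<Rightarrow>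
   (real ^ 'k \<Rightarrow> ('i \<Rightarrow> 'a) \<times> (real ^ 'k)) \<Rightarrow>
   ('i \<Rightarrow> 'a) \<times> (real ^ 'k) \<Rightarrow> ('i \<Rightarrow> 'a) \<times> (real ^ 'k) \<Rightarrow> 'i \<Rightarrow> 'a"
  where
    "nil_component N act s x y i =
       (let G = semidirect N act; z = inv\<^bsub>G\<^esub> x \<otimes>\<^bsub>G\<^esub> y
        in fst (z \<otimes>\<^bsub>G\<^esub> inv\<^bsub>G\<^esub> (s (snd z))) i)"

text \<open>
  The number \<open>H\<^sub>i \<in> [-\<infinity>, \<infinity>)\<close>; the infimum is \<open>-\<infinity>\<close> when every real \<open>H\<close> is admissible.
\<close>

definition half_space_level ::
  "('i::finite \<Rightarrow> ('a::topological_space, 'e::euclidean_space) lie_struct) \<Rightarrow>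
   ('i \<Rightarrow> real ^ 'k \<Rightarrow> real) \<Rightarrow> ('i \<Rightarrow> real ^ 'k \<Rightarrow> 'a \<Rightarrow> 'a) \<Rightarrow>
   (('e ^ 'i) \<times> (real ^ 'k) \<Rightarrow> ('e ^ 'i) \<times> (real ^ 'k) \<Rightarrow> real) \<Rightarrow>
   (real ^ 'k \<Rightarrow> ('i \<Rightarrow> 'a) \<times> (real ^ 'k)) \<Rightarrow>
   ('i \<Rightarrow> 'a) \<times> (real ^ 'k) \<Rightarrow> ('i \<Rightarrow> 'a) \<times> (real ^ 'k) \<Rightarrow> 'i \<Rightarrow> ereal"
  where
    "half_space_level N \<alpha> act q s x y i =
       Inf (ereal ` {H. \<forall>H'\<ge>H.
         factor_dist N q i \<one>\<^bsub>N i\<^esub>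
           (automorphism_of (N i) (lin_exp (\<lambda>Y. - H' *\<^sub>R splitting_derivation N \<alpha> act s i Y))
             (nil_component N act s x y i)) \<le> 1})"

definition half_space ::
  "('i::finite \<Rightarrow> ('a::topological_space, 'e::euclidean_space) lie_struct) \<Rightarrow>
   ('i \<Rightarrow> real ^ 'k \<Rightarrow> real) \<Rightarrow> ('i \<Rightarrow> real ^ 'k \<Rightarrow> 'a \<Rightarrow> 'a) \<Rightarrow>
   (('e ^ 'i) \<times> (real ^ 'k) \<Rightarrow> ('e ^ 'i) \<times> (real ^ 'k) \<Rightarrow> real) \<Rightarrow>
   (real ^ 'k \<Rightarrow> ('i \<Rightarrow> 'a) \<times> (real ^ 'k)) \<Rightarrow>
   ('i \<Rightarrow> 'a) \<times> (real ^ 'k) \<Rightarrow> ('i \<Rightarrow> 'a) \<times> (real ^ 'k) \<Rightarrow> 'i \<Rightarrow> (real ^ 'k) set"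
  where
    "half_space N \<alpha> act q s x y i = {v. ereal (\<alpha> i v) \<ge> half_space_level N \<alpha> act q s x y i}"

definition half_space_visiting ::
  "('i::finite \<Rightarrow> ('a::topological_space, 'e::euclidean_space) lie_struct) \<Rightarrow>
   ('i \<Rightarrow> real ^ 'k \<Rightarrow> real) \<Rightarrow> ('i \<Rightarrow> real ^ 'k \<Rightarrow> 'a \<Rightarrow> 'a) \<Rightarrow>
   (('e ^ 'i) \<times> (real ^ 'k) \<Rightarrow> ('e ^ 'i) \<times> (real ^ 'k) \<Rightarrow> real) \<Rightarrow>
   (real ^ 'k \<Rightarrow> ('i \<Rightarrow> 'a) \<times> (real ^ 'k)) \<Rightarrow>
   ('i \<Rightarrow> 'a) \<times> (real ^ 'k) \<Rightarrow> ('i \<Rightarrow> 'a) \<times> (real ^ 'k) \<Rightarrow> (real \<Rightarrow> ('i \<Rightarrow> 'a) \<times> (real ^ 'k)) \<Rightarrow> bool"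
  where
    "half_space_visiting N \<alpha> act q s x y \<gamma> \<longleftrightarrow>
       (\<forall>i. \<exists>t\<in>{0..1}.
          snd (inv\<^bsub>semidirect N act\<^esub> x \<otimes>\<^bsub>semidirect N act\<^esub> \<gamma> t) \<in> half_space N \<alpha> act q s x y i)"

text \<open>
  After left translation to the identity, being tangent to a left coset of a subgroup means lying in
  its Lie algebra.  For the \<open>N i\<close>, which are normal, left and right cosets agree.  The subintervals
  are \<open>{a j..b j}\<close> for \<open>j < m\<close>; the finite set \<open>F\<close> contains the break points of \<open>\<gamma>\<close>, where there is
  no derivative.
\<close>

definition box_path ::
  "('i::finite \<Rightarrow> ('a::topological_space, 'e::euclidean_space) lie_struct) \<Rightarrow>
   ('i \<Rightarrow> real ^ 'k \<Rightarrow> 'a \<Rightarrow> 'a) \<Rightarrow> (real ^ 'k \<Rightarrow> ('i \<Rightarrow> 'a) \<times> (real ^ 'k)) \<Rightarrow>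
   (real \<Rightarrow> ('i \<Rightarrow> 'a) \<times> (real ^ 'k)) \<Rightarrow> bool"
  where
    "box_path N act s \<gamma> \<longleftrightarrow>
       (\<exists>(m::nat) (a :: nat \<Rightarrow> real) (b :: nat \<Rightarrow> real) (\<iota> :: nat \<Rightarrow> 'i) F.
          m \<le> CARD('i) + 1 \<and> inj_on \<iota> {..<m} \<and> finite F \<and>
          (\<forall>j<m. 0 \<le> a j \<and> a j \<le> b j \<and> b j \<le> 1) \<and>
          (\<forall>j<m. \<forall>l<m. j \<noteq> l \<longrightarrow> {a j<..<b j} \<inter> {a l<..<b l} = {}) \<and>
          (\<forall>t\<in>{0..1} - F.
             left_curve (semidirect N act) \<gamma> t differentiable (at t within {0..1}) \<and>
             (\<forall>j<m. t \<in> {a j..b j} \<longrightarrow>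
                left_velocity (semidirect N act) \<gamma> t \<in> factor_algebra N (\<iota> j)) \<and>
             (t \<notin> (\<Union>j<m. {a j..b j}) \<longrightarrow>
                left_velocity (semidirect N act) \<gamma> t
                  \<in> range (differential vector_group (semidirect N act) s))))"

end

theory Submission
 imports Defs "HOL-Computational_Algebra.Fundamental_Theorem_Algebra"
begin

text \<open>
  The component in \<open>N i\<close> of a splitting is a cocycle; as the action contracts \<open>N i\<close> where \<open>\<alpha> i\<close> is
  negative, it is a coboundary.  So conjugation by \<open>s v\<close> contracts \<open>N i\<close> at the exponential rate of
  \<open>act i v\<close>, and half-space levels are finite.

  Cut a path from \<open>1\<close> to \<open>x\<inverse> y\<close> of length at most \<open>d x y + 1\<close> into pieces of length at most 1, with
  projections \<open>w j\<close> to \<open>\<real>\<^sup>k\<close>.  By perpendicularity the vertical length \<open>x j\<close> of a piece satisfies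
  \<open>Q (w (j + 1) - w j) + (x j)\<^sup>2 \<le> 1\<close>.  If the polygon \<open>w\<close> stays below the \<open>i\<close>-th half-space, then the
  vertical part, rescaled to the level of that half-space, still has length at least 1, so the
  \<open>x j\<close>, weighted by an exponential of the depth of \<open>w j\<close>, sum up to at least a constant.  Hence either
  a bounded detour into the half-space is affordable, because vertical length has been traded for
  horizontal length, or for some depth \<open>T\<close> at least of the order of \<open>T\<^sup>2\<close> vertices lie within depth \<open>T\<close>,
  and a tent of height \<open>T\<close> over that many steps costs only a bounded amount of length.

  The resulting polygon meets every half-space within bounded distance.  Following it in a coset of
  the splitting and inserting the \<open>i\<close>-th component of \<open>x\<inverse> y\<close> inside the \<open>i\<close>-th half-space, where it is
  short, gives the box path.  The constant depends only on \<open>g\<close>, as there is at most one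
  perpendicular splitting.
\<close>

text \<open>The obstacle is that a path may run at great depth below a half-space, so that climbing
  into it and back costs more than any constant. Two things pay for this. The bookkeeping uses
  squared step lengths: as sqrt y <= (1 + y) / 2, a bounded gain of energy is a bounded gain of
  length, and the vertical squares missing from the horizontal energy are credit for detours. A
  slope of height T spread over T^2 steps changes the energy by about T^2 / T^2, which explains the
  quadratic count of vertices. The weights are exp (- depth / 2): every eigenvalue has real part at
  least 1, and giving up half of this rate absorbs the polynomial factors of Jordan blocks.

  On the Lie side everything is derived from charts. Curves are compared by left-translated
  velocities, and a curve of zero velocity is constant. This yields uniqueness of homomorphisms with
  given differential, which identifies the automorphisms that the definitions select by
  \<open>SOME\<close> with conjugation by the splitting.\<close>

section \<open>Derivatives within subsets of a subspace\<close>

text \<open>Sets on which a derivative within the set is determined in every direction of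
  \<open>V\<close>: a short segment along \<open>h\<close> starts at each point. The nonzero factor
  \<open>\<tau>\<close> may be negative, because at an end point of an interval only one of
  \<open>h\<close> and \<open>- h\<close> is available.\<close>

definition tangent_full :: "'e::euclidean_space set => 'e set => bool" where
 "tangent_full V S \<longleftrightarrow> subspace V &
   (\<forall>x\<in>S. \<forall>h\<in>V. \<exists>\<tau>. \<tau> ~= (0::real) & (\<exists>\<delta>>0. \<forall>\<epsilon>. 0 <= \<epsilon> & \<epsilon> < \<delta> --> x + (\<tau> * \<epsilon>) *\<^sub>R h : S))"

text \<open>Restricting to the segment gives a function of one real variable, so claims about
  \<open>f' h\<close> follow from uniqueness of vector derivatives at the end point of a half-open
  interval.\<close>

lemma tangent_full_ray_derivative:
 fixes f :: "'e::euclidean_space => 'f::real_normed_vector"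
 assumes "tangent_full V S" "x : S" "h : V"
 obtains \<tau> \<delta> :: real where "\<tau> ~= 0" "\<delta> > 0" "!!\<epsilon>. 0 <= \<epsilon> ==> \<epsilon> < \<delta> ==> x + (\<tau> * \<epsilon>) *\<^sub>R h : S"
  "!!f'. (f has_derivative f') (at x within S) ==>
    ((%\<epsilon>. f (x + (\<tau> * \<epsilon>) *\<^sub>R h)) has_vector_derivative \<tau> *\<^sub>R f' h) (at 0 within {0..<\<delta>})"
proof -
 obtain \<tau> \<delta> :: real where td: "\<tau> ~= 0" "\<delta> > 0" "!!\<epsilon>. 0 <= \<epsilon> & \<epsilon> < \<delta> ==> x + (\<tau> * \<epsilon>) *\<^sub>R h : S"
  using assms unfolding tangent_full_def by meson
 have "((%\<epsilon>. f (x + (\<tau> * \<epsilon>) *\<^sub>R h)) has_vector_derivative \<tau> *\<^sub>R f' h) (at 0 within {0..<\<delta>})"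
  if f': "(f has_derivative f') (at x within S)" for f'
 proof -
  have sub: "(%\<epsilon>. x + (\<tau> * \<epsilon>) *\<^sub>R h) ` {0..<\<delta>} <= S" using td by auto
  have 1: "((%\<epsilon>. x + (\<tau> * \<epsilon>) *\<^sub>R h) has_derivative (%\<epsilon>. (\<tau> * \<epsilon>) *\<^sub>R h)) (at 0 within {0..<\<delta>})"
   by (auto intro!: derivative_eq_intros)
  have 2: "(f has_derivative f') (at (x + (\<tau> * 0) *\<^sub>R h) within (%\<epsilon>. x + (\<tau> * \<epsilon>) *\<^sub>R h) ` {0..<\<delta>})"
   using has_derivative_subset[OF f' sub] by simp
  have "((%\<epsilon>. f (x + (\<tau> * \<epsilon>) *\<^sub>R h)) has_derivative (%\<epsilon>. f' ((\<tau> * \<epsilon>) *\<^sub>R h))) (at 0 within {0..<\<delta>})"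
   using has_derivative_in_compose[OF 1 2] .
  moreover have "f' ((\<tau> * \<epsilon>) *\<^sub>R h) = \<epsilon> *\<^sub>R (\<tau> *\<^sub>R f' h)" for \<epsilon>
   using linear_scale[OF has_derivative_linear[OF f'], of "\<tau> * \<epsilon>" h] by (simp add: mult.commute)
  ultimately show ?thesis unfolding has_vector_derivative_def by simp
 qed
 then show ?thesis using that td by blast
qed

lemma at_0_ray_neq_bot: "\<delta> > 0 ==> at (0::real) within {0..<\<delta>} ~= bot"
proof -
 assume "\<delta> > 0"
 have "at (0::real) within {0..<\<delta>} = at_right 0"
  using at_within_nhd[of "0::real" "{..<\<delta>}" "{0..<\<delta>}" "{0<..}"] \<open>\<delta> > 0\<close> by force
 then show ?thesis by simp
qed

lemma tangent_full_derivative_unique: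
 assumes "tangent_full V S" "x : S" "h : V"
  and "(f has_derivative f') (at x within S)" "(f has_derivative f'') (at x within S)"
 shows "f' h = f'' h"
proof -
 obtain \<tau> \<delta> :: real where "\<tau> ~= 0" "\<delta> > 0" and
  d: "!!f'. (f has_derivative f') (at x within S) ==>
    ((%\<epsilon>. f (x + (\<tau> * \<epsilon>) *\<^sub>R h)) has_vector_derivative \<tau> *\<^sub>R f' h) (at 0 within {0..<\<delta>})"
  using tangent_full_ray_derivative[OF assms(1-3), of f] by metis
 have "\<tau> *\<^sub>R f' h = \<tau> *\<^sub>R f'' h"
  using vector_derivative_unique_within[OF at_0_ray_neq_bot[OF \<open>\<delta> > 0\<close>] d[OF assms(4)] d[OF assms(5)]] .
 then show ?thesis using \<open>\<tau> ~= 0\<close> by simp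
qed

text \<open>The component of \<open>d\<close> orthogonal to \<open>V\<close> is the derivative of an
  identically vanishing function.\<close>

lemma has_vector_derivative_in_subspace:
 fixes V :: "'e::euclidean_space set"
 assumes V: "subspace V" and p: "!!r. r : T ==> p r : V" and t: "t : T" "at t within T ~= bot"
  and d: "(p has_vector_derivative d) (at t within T)"
 shows "d : V"
proof -
 obtain y z where yz: "y : span V" "!!w. w : span V ==> orthogonal z w" "d = y + z"
  using orthogonal_subspace_decomp_exists[of V d] by metis
 have "((%r. p r \<bullet> z) has_vector_derivative d \<bullet> z) (at t within T)"
  using d by (auto intro!: derivative_eq_intros simp: has_vector_derivative_def)
 moreover have "((%r. p r \<bullet> z) has_vector_derivative 0) (at t within T)"
 proof (rule has_vector_derivative_transform[OF t(1)])
  show "((%r. 0) has_vector_derivative 0) (at t within T)" by simp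
  show "!!r. r : T ==> p r \<bullet> z = 0" using yz(2) p by (metis orthogonal_def inner_commute span_base)
 qed
 ultimately have "d \<bullet> z = 0" using vector_derivative_unique_within[OF t(2)] by blast
 moreover have "y \<bullet> z = 0" using yz(1,2) by (metis orthogonal_def inner_commute)
 ultimately have "z = 0" using yz(3) by (simp add: inner_add_left)
 then show "d : V" using yz(1,3) V by (metis add.right_neutral span_eq_iff)
qed

lemma tangent_full_derivative_in_subspace:
 fixes f :: "'e::euclidean_space => 'f::euclidean_space"
 assumes "tangent_full V S" "x : S" "h : V" "(f has_derivative f') (at x within S)"
  and "subspace W" "!!y. y : S ==> f y : W"
 shows "f' h : W"
proof -
 obtain \<tau> \<delta> :: real where *: "\<tau> ~= 0" "\<delta> > 0" "!!\<epsilon>. 0 <= \<epsilon> ==> \<epsilon> < \<delta> ==> x + (\<tau> * \<epsilon>) *\<^sub>R h : S" and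
  d: "((%\<epsilon>. f (x + (\<tau> * \<epsilon>) *\<^sub>R h)) has_vector_derivative \<tau> *\<^sub>R f' h) (at 0 within {0..<\<delta>})"
  using tangent_full_ray_derivative[OF assms(1-3), of f] assms(4) by metis
 have "\<tau> *\<^sub>R f' h : W"
  by (rule has_vector_derivative_in_subspace[OF assms(5) _ _ at_0_ray_neq_bot d]) (use * assms(6) in auto)
 then have "inverse \<tau> *\<^sub>R (\<tau> *\<^sub>R f' h) : W" using assms(5) subspace_scale by blast
 then show ?thesis using * by simp
qed

lemma at_within_Int_nhd: "open O' ==> x : O' ==> at x within S Int O' = at x within S"
 by (rule at_within_nhd[of _ O']) auto

lemma tangent_full_Int_open:
 assumes "tangent_full V S" "open O'"
 shows "tangent_full V (S Int O')"
 unfolding tangent_full_def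
proof (intro conjI ballI)
 show "subspace V" using assms unfolding tangent_full_def by blast
 fix x h assume x: "x : S Int O'" and h: "h : V"
 then obtain \<tau> \<delta> :: real where td: "\<tau> ~= 0" "\<delta> > 0" "!!\<epsilon>. 0 <= \<epsilon> & \<epsilon> < \<delta> ==> x + (\<tau> * \<epsilon>) *\<^sub>R h : S"
  using assms(1) unfolding tangent_full_def by blast
 have "((%\<epsilon>. x + (\<tau> * \<epsilon>) *\<^sub>R h) \<longlongrightarrow> x + (\<tau> * 0) *\<^sub>R h) (at_right 0)"
  by (intro tendsto_intros)
 then have "\<forall>\<^sub>F \<epsilon> in at_right 0. x + (\<tau> * \<epsilon>) *\<^sub>R h : O'"
  using assms(2) x by (auto elim!: topological_tendstoD)
 then obtain \<delta>' where d': "\<delta>' > 0" "!!\<epsilon>. 0 < \<epsilon> ==> \<epsilon> < \<delta>' ==> x + (\<tau> * \<epsilon>) *\<^sub>R h : O'"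
  unfolding eventually_at_right_field by auto
 have "x + (\<tau> * \<epsilon>) *\<^sub>R h : S Int O'" if "0 <= \<epsilon>" "\<epsilon> < min \<delta> \<delta>'" for \<epsilon>
  using that d' td x by (cases "\<epsilon> = 0") auto
 then show "\<exists>\<tau>. \<tau> ~= 0 & (\<exists>\<delta>>0. \<forall>\<epsilon>. 0 <= \<epsilon> & \<epsilon> < \<delta> --> x + (\<tau> * \<epsilon>) *\<^sub>R h : S Int O')"
  using td d' by (intro exI[of _ \<tau>] conjI exI[of _ "min \<delta> \<delta>'"]) auto
qed

lemma tangent_full_openin_subspace:
 assumes V: "subspace V" and S: "openin (top_of_set V) S"
 shows "tangent_full V S"
proof -
 obtain O' where O: "open O'" "S = V Int O'" using S unfolding openin_open by blast
 have "tangent_full V V"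
  unfolding tangent_full_def using V
  by (intro conjI ballI exI[of _ "1::real"]) (auto intro!: subspace_add[OF V] subspace_scale[OF V] exI[of _ "1::real"])
 then show ?thesis using O tangent_full_Int_open by auto
qed

lemma tangent_full_interval:
 fixes a b :: real
 assumes "a < b" and S: "openin (top_of_set {a..b}) S"
 shows "tangent_full UNIV S"
proof -
 obtain O' where O: "open O'" "S = {a..b} Int O'" using S unfolding openin_open by blast
 have "tangent_full UNIV {a..b}"
  unfolding tangent_full_def
 proof (intro conjI ballI)
  fix x h assume x: "x : {a..b}"
  show "\<exists>\<tau>. \<tau> ~= 0 & (\<exists>\<delta>>0. \<forall>\<epsilon>. 0 <= \<epsilon> & \<epsilon> < \<delta> --> x + (\<tau> * \<epsilon>) *\<^sub>R h : {a..b})"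
  proof (cases "h = 0")
   case True then show ?thesis using x by (intro exI[of _ 1]) (auto intro: exI[of _ 1])
  next
   case False
   show ?thesis
   \<comment> \<open>\<open>\<tau> = 1/h\<close> makes the segment run to the right at unit speed;
     at the right end point the sign is reversed.\<close>
   proof (cases "x < b")
    case True
    then show ?thesis using x False by (intro exI[of _ "1/h"] conjI exI[of _ "b - x"]) auto
   next
    case *: False
    then show ?thesis using x False assms by (intro exI[of _ "-1/h"] conjI exI[of _ "b - a"]) auto
   qed
  qed
 qed auto
 then show ?thesis using O tangent_full_Int_open by auto
qed

section \<open>Differentiability of finite order\<close>

lemma Ck_on_cong:
 assumes "!!x. x : S ==> f x = g x" "Ck_on n V S f"
 shows "Ck_on n V S g"
 using assms
proof (cases n)
 case 0 then show ?thesis using assms continuous_on_cong[of S S f g] by auto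
next
 case (Suc m)
 then obtain f' where "\<forall>x\<in>S. (f has_derivative f' x) (at x within S)" "\<forall>h\<in>V. Ck_on m V S (%x. f' x h)"
  using assms by auto
 then have "\<forall>x\<in>S. (g has_derivative f' x) (at x within S)"
  using has_derivative_transform[of _ S g f] assms(1) by simp
 then show ?thesis unfolding Suc Ck_on.simps using \<open>\<forall>h\<in>V. Ck_on m V S (%x. f' x h)\<close> by blast
qed

lemma Ck_on_subset: "Ck_on n V S f ==> T <= S ==> Ck_on n V T f"
proof (induction n arbitrary: f)
 case 0 then show ?case using continuous_on_subset by auto
next
 case (Suc n)
 then obtain f' where "\<forall>x\<in>S. (f has_derivative f' x) (at x within S)" "\<forall>h\<in>V. Ck_on n V S (%x. f' x h)"
  by auto
 then show ?case using Suc by (auto intro!: exI[of _ f'] intro: has_derivative_subset)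
qed

lemma Ck_on_SucD: "Ck_on (Suc n) V S f ==> Ck_on n V S f"
proof (induction n arbitrary: f)
 case 0 then show ?case by (auto intro: has_derivative_continuous_on)
next
 case (Suc n)
 then obtain f' where "\<forall>x\<in>S. (f has_derivative f' x) (at x within S)" "\<forall>h\<in>V. Ck_on (Suc n) V S (%x. f' x h)"
  using Ck_on.simps(2) by metis
 then show ?case using Suc.IH by (auto simp del: Ck_on.simps(1) intro!: exI[of _ f'])
qed

lemma Ck_on_imp_continuous_on: "Ck_on n V S f ==> continuous_on S f"
proof (cases n)
 case (Suc m)
 moreover assume "Ck_on n V S f"
 ultimately obtain f' where "\<forall>x\<in>S. (f has_derivative f' x) (at x within S)" by auto
 then show ?thesis by (metis has_derivative_continuous_on)
qed simp

text \<open>\<open>Ck_on\<close> quantifies existentially over the derivative, and such choices do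
  not glue. Uniqueness of directional derivatives replaces them by the one canonical choice
  \<open>frechet_derivative\<close>.\<close>

lemma Ck_on_Suc_iff:
 assumes "tangent_full V S"
 shows "Ck_on (Suc n) V S f \<longleftrightarrow> (\<forall>x\<in>S. f differentiable (at x within S)) &
  (\<forall>h\<in>V. Ck_on n V S (%x. frechet_derivative f (at x within S) h))"
proof
 assume "Ck_on (Suc n) V S f"
 then obtain f' where f': "\<forall>x\<in>S. (f has_derivative f' x) (at x within S)" "\<forall>h\<in>V. Ck_on n V S (%x. f' x h)"
  by auto
 have d: "\<forall>x\<in>S. f differentiable (at x within S)" using f' unfolding differentiable_def by blast
 have "f' x h = frechet_derivative f (at x within S) h" if "x : S" "h : V" for x h
  using tangent_full_derivative_unique[OF assms that] f' d that frechet_derivative_works by metis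
 then show "(\<forall>x\<in>S. f differentiable (at x within S)) &
  (\<forall>h\<in>V. Ck_on n V S (%x. frechet_derivative f (at x within S) h))"
  using d f'(2) Ck_on_cong[of S "%x. f' x _" "%x. frechet_derivative f (at x within S) _" n V] by blast
next
 assume "(\<forall>x\<in>S. f differentiable (at x within S)) &
  (\<forall>h\<in>V. Ck_on n V S (%x. frechet_derivative f (at x within S) h))"
 then show "Ck_on (Suc n) V S f" unfolding Ck_on.simps
  by (intro exI[of _ "%x. frechet_derivative f (at x within S)"]) (simp add: frechet_derivative_works)
qed

text \<open>The canonical derivative at \<open>x\<close> within \<open>S\<close> is unchanged when
  \<open>S\<close> is cut down to an open neighbourhood of \<open>x\<close>, so differentiability
  passes from the pieces to the whole by induction on the order.\<close>

lemma Ck_on_local: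
 assumes "tangent_full V S" "!!x. x : S ==> \<exists>O'. open O' & x : O' & Ck_on n V (S Int O') f"
 shows "Ck_on n V S f"
 using assms(2)
proof (induction n arbitrary: f)
 case 0
 show ?case unfolding Ck_on.simps(1) continuous_on_eq_continuous_within
 proof
  fix x assume x: "x : S"
  then obtain O' where O: "open O'" "x : O'" "continuous_on (S Int O') f" using 0[OF x] by (metis Ck_on.simps(1))
  then have "continuous (at x within S Int O') f" using x by (simp add: continuous_on_eq_continuous_within)
  then show "continuous (at x within S) f"
   using O(1,2) by (simp add: at_within_Int_nhd)
 qed
next
 case (Suc n)
 have at_eq: "at x within S Int O' = at x within S" if "open O'" "x : O'" for x and O' :: "'a set"
  using that by (rule at_within_Int_nhd)
 have 1: "f differentiable (at x within S)" if x: "x : S" for x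
 proof -
  obtain O' where O: "open O'" "x : O'" "Ck_on (Suc n) V (S Int O') f" using Suc.prems x by blast
  then obtain f' where "(f has_derivative f') (at x within S Int O')" using x by auto
  then show ?thesis unfolding differentiable_def at_eq[OF O(1,2)] by blast
 qed
 have 2: "Ck_on n V S (%x. frechet_derivative f (at x within S) h)" if h: "h : V" for h
 proof (rule Suc.IH)
  fix x assume x: "x : S"
  obtain O' where O: "open O'" "x : O'" "Ck_on (Suc n) V (S Int O') f" using Suc.prems x by blast
  then have "Ck_on n V (S Int O') (%x. frechet_derivative f (at x within S Int O') h)"
   using Ck_on_Suc_iff[OF tangent_full_Int_open[OF assms(1) O(1)]] h by blast
  then have "Ck_on n V (S Int O') (%x. frechet_derivative f (at x within S) h)"
   by (rule Ck_on_cong[rotated]) (use at_eq O in auto)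
  then show "\<exists>O'. open O' & x : O' & Ck_on n V (S Int O') (%x. frechet_derivative f (at x within S) h)"
   using O by blast
 qed
 show ?case unfolding Ck_on_Suc_iff[OF assms(1)] using 1 2 by blast
qed

lemma Ck_on_const: "Ck_on n V S (%x. c)"
proof (induction n arbitrary: c)
 case (Suc n) then show ?case by (auto intro!: exI[of _ "%x h. 0"] derivative_eq_intros)
qed auto

lemma Ck_on_bounded_linear:
 assumes L: "bounded_linear L" shows "Ck_on n V S f ==> Ck_on n V S (%x. L (f x))"
proof (induction n arbitrary: f)
 case 0 then show ?case using bounded_linear.continuous_on[OF L] by auto
next
 case (Suc n)
 then obtain f' where "\<forall>x\<in>S. (f has_derivative f' x) (at x within S)" "\<forall>h\<in>V. Ck_on n V S (%x. f' x h)"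
  by auto
 then show ?case using Suc.IH by (auto intro!: exI[of _ "%x h. L (f' x h)"] bounded_linear.has_derivative[OF L])
qed

lemma Ck_on_linear: "bounded_linear L ==> Ck_on n V S L"
proof (cases n)
 case 0 assume "bounded_linear L" with 0 show ?thesis by (auto simp: linear_continuous_on)
next
 case (Suc m) assume "bounded_linear L" with Suc show ?thesis
  by (auto intro!: exI[of _ "%x. L"] Ck_on_const bounded_linear_imp_has_derivative)
qed

lemma Ck_on_add: "Ck_on n V S f ==> Ck_on n V S g ==> Ck_on n V S (%x. f x + g x)"
proof (induction n arbitrary: f g)
 case 0 then show ?case by (auto intro: continuous_on_add)
next
 case (Suc n)
 then obtain f' g' where "\<forall>x\<in>S. (f has_derivative f' x) (at x within S)" "\<forall>h\<in>V. Ck_on n V S (%x. f' x h)"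
  "\<forall>x\<in>S. (g has_derivative g' x) (at x within S)" "\<forall>h\<in>V. Ck_on n V S (%x. g' x h)"
  by auto
 then show ?case using Suc.IH by (auto intro!: exI[of _ "%x h. f' x h + g' x h"] has_derivative_add)
qed

lemma Ck_on_sum: "(!!i. i : I ==> Ck_on n V S (f i)) ==> Ck_on n V S (%x. \<Sum>i\<in>I. f i x)"
 by (induction I rule: infinite_finite_induct) (simp_all add: Ck_on_const Ck_on_add)

lemma Ck_on_scaleR: "Ck_on n V S f ==> Ck_on n V S g ==> Ck_on n V S (%x. f x *\<^sub>R g x)"
proof (induction n arbitrary: f g)
 case 0 then show ?case by (auto intro: continuous_on_scaleR)
next
 case (Suc n)
 obtain f' g' where *: "\<forall>x\<in>S. (f has_derivative f' x) (at x within S)" "\<forall>h\<in>V. Ck_on n V S (%x. f' x h)"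
  "\<forall>x\<in>S. (g has_derivative g' x) (at x within S)" "\<forall>h\<in>V. Ck_on n V S (%x. g' x h)"
  using Suc.prems by auto
 have "Ck_on n V S f" "Ck_on n V S g" using Suc.prems Ck_on_SucD by blast+
 with * show ?case using Suc.IH
  by (auto intro!: exI[of _ "%x h. f x *\<^sub>R g' x h + f' x h *\<^sub>R g x"] has_derivative_scaleR Ck_on_add)
qed

lemma orthonormal_expansion:
 fixes V :: "'e::euclidean_space set"
 assumes "subspace V"
 obtains B where "finite B" "B <= V" "!!x. x : V ==> (\<Sum>b\<in>B. (x \<bullet> b) *\<^sub>R b) = x"
proof -
 obtain B where B: "B <= V" "pairwise orthogonal B" "!!x. x : B ==> norm x = 1" "independent B" "span B = V"
  using orthonormal_basis_subspace[OF assms] by metis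
 then show ?thesis using that[of B] orthonormal_basis_expand[of B] independent_imp_finite by metis
qed

text \<open>The derivative of the composite evaluates \<open>g'\<close> in the direction
  \<open>f' x h\<close>, which varies with \<open>x\<close>, while \<open>Ck_on\<close> only
  controls fixed directions. Expanding \<open>f' x h\<close> in an orthonormal basis of
  \<open>W\<close> leaves finitely many fixed directions with differentiable coefficients.\<close>

lemma Ck_on_compose:
 fixes f :: "'e::euclidean_space => 'f::euclidean_space"
 assumes S: "tangent_full V S" and W: "subspace W" "!!x. x : S ==> f x : W" and T: "f ` S <= T"
 shows "Ck_on n V S f ==> Ck_on n W T g ==> Ck_on n V S (%x. g (f x))"
proof (induction n arbitrary: g)
 case 0 then show ?case using T continuous_on_compose2 by (metis Ck_on.simps(1))
next
 case (Suc n)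
 obtain f' g' where *: "\<forall>x\<in>S. (f has_derivative f' x) (at x within S)" "\<forall>h\<in>V. Ck_on n V S (%x. f' x h)"
  "\<forall>x\<in>T. (g has_derivative g' x) (at x within T)" "\<forall>h\<in>W. Ck_on n W T (%x. g' x h)"
  using Suc.prems by auto
 obtain B where B: "finite B" "B <= W" "!!x. x : W ==> (\<Sum>b\<in>B. (x \<bullet> b) *\<^sub>R b) = x"
  using orthonormal_expansion[OF W(1)] by blast
 have lin: "linear (g' (f x))" if "x : S" for x
  using *(3) T that by (blast intro: has_derivative_linear)
 have 1: "((%x. g (f x)) has_derivative (%h. g' (f x) (f' x h))) (at x within S)" if "x : S" for x
  using has_derivative_in_compose[of f "f' x" x S g "g' (f x)"] *(1,3) T that
  by (meson has_derivative_subset image_subset_iff)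
 have 2: "Ck_on n V S (%x. g' (f x) (f' x h))" if h: "h : V" for h
 proof -
  have "g' (f x) (f' x h) = (\<Sum>b\<in>B. (f' x h \<bullet> b) *\<^sub>R g' (f x) b)" if x: "x : S" for x
  proof -
   have "f' x h : W" using tangent_full_derivative_in_subspace[OF S x h _ W(1)] *(1) x W(2) by blast
   then have "g' (f x) (f' x h) = g' (f x) (\<Sum>b\<in>B. (f' x h \<bullet> b) *\<^sub>R b)" using B by simp
   then show ?thesis using lin[OF x] by (simp add: linear_sum linear_scale)
  qed
  moreover have "Ck_on n V S (%x. \<Sum>b\<in>B. (f' x h \<bullet> b) *\<^sub>R g' (f x) b)"
  proof (intro Ck_on_sum Ck_on_scaleR)
   fix b assume b: "b : B"
   show "Ck_on n V S (%x. f' x h \<bullet> b)"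
    using Ck_on_bounded_linear[OF bounded_linear_inner_left] *(2) h by blast
   show "Ck_on n V S (%x. g' (f x) b)"
    using Suc.IH[of "%y. g' y b"] Ck_on_SucD[OF Suc.prems(1)] *(4) b B by blast
  qed
  ultimately show ?thesis by (metis (no_types, lifting) Ck_on_cong)
 qed
 show ?case unfolding Ck_on.simps using 1 2 by (intro exI[of _ "%x h. g' (f x) (f' x h)"]) blast
qed

lemma Ck_on_Pair:
 fixes f :: "'e::euclidean_space => 'f::real_normed_vector" and g :: "'e => 'g::real_normed_vector"
 assumes "Ck_on n V S f" "Ck_on n V S g"
 shows "Ck_on n V S (%x. (f x, g x))"
proof -
 have "Ck_on n V S (%x. (f x, 0) + (0, g x))"
  by (intro Ck_on_add Ck_on_bounded_linear[OF _ assms(1), of "%u. (u, 0)"] Ck_on_bounded_linear[OF _ assms(2), of "%u. (0, u)"]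
    bounded_linear_Pair bounded_linear_ident bounded_linear_zero)
 then show ?thesis by simp
qed

lemma bounded_linear_axis: "bounded_linear (axis i :: 'e::euclidean_space => 'e ^ 'i::finite)"
 unfolding linear_conv_bounded_linear[symmetric] by (intro linearI) (auto simp: axis_def vec_eq_iff)

lemma Ck_on_vec:
 fixes f :: "'i::finite => 'e::euclidean_space => 'f::euclidean_space"
 assumes "!!i. Ck_on n V S (f i)"
 shows "Ck_on n V S (%x. \<chi> i. f i x)"
proof -
 have "Ck_on n V S (%x. \<Sum>i\<in>UNIV. axis i (f i x))"
  by (intro Ck_on_sum Ck_on_bounded_linear[OF bounded_linear_axis] assms)
 moreover have "(\<Sum>i\<in>UNIV. axis i (f i x)) = (\<chi> i. f i x)" for x
  by (simp add: vec_eq_iff axis_def sum_component if_distrib cong: if_cong)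
 ultimately show ?thesis by simp
qed

section \<open>Calculus of smooth maps\<close>

text \<open>The conditions on an atlas that a chain rule uses on the domain side. They are met by a
  compact interval with end points, whose one-chart atlas is not a \<open>smooth_atlas\<close>; the
  conditions on the codomain side are collected in \<open>target_atlas\<close>.\<close>

definition source_atlas :: "'a::topological_space set => 'e::euclidean_space set => ('a, 'e) chart set => bool" where
 "source_atlas M V A \<longleftrightarrow> (\<forall>U \<phi>. (U, \<phi>) : A --> U <= M & inj_on \<phi> U & continuous_on (\<phi> ` U) (inv_into U \<phi>) &
   (\<forall>W. openin (top_of_set M) W --> tangent_full V (\<phi> ` (U Int W))))"

definition target_atlas :: "'a::topological_space set => 'e::euclidean_space set => ('a, 'e) chart set => bool" where
 "target_atlas M V A \<longleftrightarrow> subspace V & (\<forall>x\<in>M. \<exists>U \<phi>. (U, \<phi>) : A & x : U) &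
   (\<forall>U \<phi>. (U, \<phi>) : A --> openin (top_of_set M) U & inj_on \<phi> U & \<phi> ` U <= V)"

lemma source_atlasD:
 assumes "source_atlas M V A" "(U, \<phi>) : A"
 shows "U <= M" "inj_on \<phi> U" "continuous_on (\<phi> ` U) (inv_into U \<phi>)"
  "!!W. openin (top_of_set M) W ==> tangent_full V (\<phi> ` (U Int W))"
 using assms(1)[unfolded source_atlas_def, rule_format, OF assms(2)] by simp_all

lemma target_atlasD:
 assumes "target_atlas M V A" "(U, \<phi>) : A"
 shows "openin (top_of_set M) U" "inj_on \<phi> U" "\<phi> ` U <= V" "subspace V" "U <= M"
proof -
 have *: "subspace V" "openin (top_of_set M) U & inj_on \<phi> U & \<phi> ` U <= V"
  using assms unfolding target_atlas_def by simp_all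
 then show "openin (top_of_set M) U" "inj_on \<phi> U" "\<phi> ` U <= V" "subspace V" "U <= M"
  using openin_imp_subset by blast+
qed

lemma target_atlas_cover:
 assumes "target_atlas M V A" "x : M" obtains U \<phi> where "(U, \<phi>) : A" "x : U"
proof -
 have "\<exists>U \<phi>. (U, \<phi>) : A & x : U" using assms unfolding target_atlas_def by simp
 then show ?thesis using that by blast
qed

lemma smooth_atlas_iff:
 "smooth_atlas M V A \<longleftrightarrow> subspace V & (\<Union>(U, \<phi>)\<in>A. U) = M &
  (\<forall>U \<phi>. (U, \<phi>) : A --> openin (top_of_set M) U & openin (top_of_set V) (\<phi> ` U) &
          homeomorphism U (\<phi> ` U) \<phi> (inv_into U \<phi>)) &
  (\<forall>U \<phi>. (U, \<phi>) : A --> (\<forall>W \<psi>. (W, \<psi>) : A --> smooth_on V (\<phi> ` (U Int W)) (\<psi> o inv_into U \<phi>)))"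
 by (simp only: smooth_atlas_def Ball_def split_paired_All prod.case)

lemma smooth_map_iff:
 "smooth_map M V A M' A' f \<longleftrightarrow> f ` M <= M' & continuous_on M f &
  (\<forall>U \<phi>. (U, \<phi>) : A --> (\<forall>W \<psi>. (W, \<psi>) : A' --> smooth_on V (\<phi> ` (U Int f -` W)) (\<psi> o f o inv_into U \<phi>)))"
 by (simp only: smooth_map_def Ball_def split_paired_All prod.case)

lemma smooth_atlasD:
 assumes "smooth_atlas M V A"
 shows "subspace V" "x : M ==> \<exists>U \<phi>. (U, \<phi>) : A & x : U"
  "(U, \<phi>) : A ==> openin (top_of_set M) U"
  "(U, \<phi>) : A ==> openin (top_of_set V) (\<phi> ` U)"
  "(U, \<phi>) : A ==> homeomorphism U (\<phi> ` U) \<phi> (inv_into U \<phi>)"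
  "(U, \<phi>) : A ==> (W, \<psi>) : A ==> smooth_on V (\<phi> ` (U Int W)) (\<psi> o inv_into U \<phi>)"
proof -
 note * = assms[unfolded smooth_atlas_iff]
 show "subspace V" using * by simp
 show "\<exists>U \<phi>. (U, \<phi>) : A & x : U" if "x : M"
 proof -
  have "x : (\<Union>(U, \<phi>)\<in>A. U)" using * that by simp
  then show ?thesis by auto
 qed
qed (use assms[unfolded smooth_atlas_iff] in simp_all)

lemma smooth_mapI:
 assumes "!!x. x : M ==> f x : M'" "continuous_on M f"
  "!!U \<phi> W \<psi> n. (U, \<phi>) : A ==> (W, \<psi>) : A' ==> Ck_on n V (\<phi> ` (U Int f -` W)) (\<psi> o f o inv_into U \<phi>)"
 shows "smooth_map M V A M' A' f"
 unfolding smooth_map_iff smooth_on_def using assms by (simp add: image_subset_iff)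

lemma smooth_mapD:
 assumes "smooth_map M V A M' A' f"
 shows "x : M ==> f x : M'" "f ` M <= M'" "continuous_on M f"
  "(U, \<phi>) : A ==> (W, \<psi>) : A' ==> Ck_on n V (\<phi> ` (U Int f -` W)) (\<psi> o f o inv_into U \<phi>)"
 using assms[unfolded smooth_map_iff smooth_on_def] by (simp_all add: image_subset_iff)

lemma homeomorphism_inj_on: "homeomorphism U W \<phi> \<psi> ==> inj_on \<phi> U"
 unfolding homeomorphism_def by (metis inj_on_inverseI)

lemma openin_chart_image:
 assumes hom: "homeomorphism U (\<phi> ` U) \<phi> \<psi>" and V: "openin (top_of_set V) (\<phi> ` U)"
  and W: "openin (top_of_set U) W"
 shows "openin (top_of_set V) (\<phi> ` W)"
 by (rule openin_trans[OF homeomorphism_imp_open_map[OF hom W] V])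

lemma smooth_atlas_source_atlas:
 fixes M :: "'a::{t2_space, second_countable_topology} set" and V :: "'e::euclidean_space set"
 assumes A: "smooth_atlas M V A" shows "source_atlas M V A"
 unfolding source_atlas_def
proof (intro allI impI conjI)
 fix U \<phi> assume U: "(U, \<phi>) : A"
 show "U <= M" using smooth_atlasD(3)[OF A U] openin_imp_subset by blast
 show "inj_on \<phi> U" using smooth_atlasD(5)[OF A U] by (rule homeomorphism_inj_on)
 show "continuous_on (\<phi> ` U) (inv_into U \<phi>)"
  using smooth_atlasD(5)[OF A U] unfolding homeomorphism_def by blast
 fix W assume W: "openin (top_of_set M) W"
 have "openin (top_of_set U) (U Int W)"
  using W \<open>U <= M\<close> by (metis openin_Int openin_subset_trans inf_le1 smooth_atlasD(3)[OF A U])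
 then show "tangent_full V (\<phi> ` (U Int W))"
  using tangent_full_openin_subspace[OF smooth_atlasD(1)[OF A] openin_chart_image[OF smooth_atlasD(5)[OF A U] smooth_atlasD(4)[OF A U]]] by blast
qed

lemma smooth_atlas_target_atlas:
 fixes M :: "'a::{t2_space, second_countable_topology} set" and V :: "'e::euclidean_space set"
 assumes A: "smooth_atlas M V A" shows "target_atlas M V A"
 unfolding target_atlas_def
proof (intro allI ballI impI conjI)
 show "subspace V" using smooth_atlasD(1)[OF A] .
 show "!!x. x : M ==> \<exists>U \<phi>. (U, \<phi>) : A & x : U" using smooth_atlasD(2)[OF A] .
 fix U \<phi> assume U: "(U, \<phi>) : A"
 show "openin (top_of_set M) U" using smooth_atlasD(3)[OF A U] .
 show "inj_on \<phi> U" using smooth_atlasD(5)[OF A U] by (rule homeomorphism_inj_on)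
 show "\<phi> ` U <= V" using smooth_atlasD(4)[OF A U] openin_imp_subset by blast
qed

lemma inv_into_id [simp]: "x : S ==> inv_into S id x = x"
 using inv_into_f_f[OF inj_on_id, of x S] by simp

lemma source_atlas_interval:
 assumes "a < b" shows "source_atlas {a..b::real} UNIV {({a..b}, id)}"
proof -
 have "continuous_on {a..b} (inv_into {a..b} id)"
  by (rule continuous_on_eq[OF continuous_on_id]) simp
 moreover have "tangent_full UNIV ({a..b} Int W)" if "openin (top_of_set {a..b}) W" for W
  using tangent_full_interval[OF assms that] openin_imp_subset[OF that] by (simp add: inf.absorb2)
 ultimately show ?thesis unfolding source_atlas_def by simp
qed

lemma vec_atlas_source: "source_atlas (UNIV :: 'v::euclidean_space set) UNIV {(UNIV, id)}"
proof -
 have "continuous_on UNIV (inv_into UNIV (id :: 'v => 'v))"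
  by (rule continuous_on_eq[OF continuous_on_id]) simp
 then show ?thesis unfolding source_atlas_def
  using tangent_full_openin_subspace[of "UNIV :: 'v set"] by simp
qed

lemma vec_atlas_target: "target_atlas (UNIV :: 'v::euclidean_space set) UNIV {(UNIV, id)}"
 unfolding target_atlas_def by simp

lemma target_atlas_prod:
 assumes A: "target_atlas M V A" "target_atlas M' V' A'"
 shows "target_atlas (M \<times> M') (V \<times> V') (prod_atlas A A')"
 unfolding target_atlas_def
proof (intro allI ballI impI conjI)
 show "subspace (V \<times> V')" using A unfolding target_atlas_def by (simp add: subspace_Times)
 fix x assume "x : M \<times> M'"
 then obtain U \<phi> U' \<phi>' where "(U, \<phi>) : A" "fst x : U" "(U', \<phi>') : A'" "snd x : U'"
  using target_atlas_cover[OF A(1)] target_atlas_cover[OF A(2)] by (metis mem_Times_iff)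
 then show "\<exists>U \<phi>. (U, \<phi>) : prod_atlas A A' & x : U"
  unfolding prod_atlas_def
  by (intro exI[of _ "U \<times> U'"] exI[of _ "%(x, y). (\<phi> x, \<phi>' y)"]) (auto simp: mem_Times_iff)
next
 fix U \<phi> assume "(U, \<phi>) : prod_atlas A A'"
 then obtain U1 \<phi>1 U2 \<phi>2 where *: "U = U1 \<times> U2" "\<phi> = (%(x, y). (\<phi>1 x, \<phi>2 y))" "(U1, \<phi>1) : A" "(U2, \<phi>2) : A'"
  unfolding prod_atlas_def by blast
 note 1 = target_atlasD[OF A(1) *(3)] and 2 = target_atlasD[OF A(2) *(4)]
 show "openin (top_of_set (M \<times> M')) U" unfolding * using 1(1) 2(1) by (rule openin_Times)
 show "inj_on \<phi> U" unfolding * using 1(2) 2(2) by (simp add: inj_on_def)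
 show "\<phi> ` U <= V \<times> V'" unfolding * using 1(3) 2(3) by auto
qed

lemma smooth_map_cong:
 assumes eq: "!!x. x : M ==> f x = g x" and A: "source_atlas M V A" and f: "smooth_map M V A M' A' f"
 shows "smooth_map M V A M' A' g"
proof (rule smooth_mapI)
 show "continuous_on M g" by (rule continuous_on_eq[OF smooth_mapD(3)[OF f] eq])
 show "g x : M'" if "x : M" for x using eq[OF that] smooth_mapD(1)[OF f that] by simp
 fix U \<phi> W \<psi> n assume U: "(U, \<phi>) : A" and W: "(W, \<psi>) : A'"
 have eq': "f x = g x" if "x : U" for x using eq source_atlasD(1)[OF A U] that by blast
 then have "U Int g -` W = U Int f -` W" by auto
 then have "Ck_on n V (\<phi> ` (U Int g -` W)) (\<psi> o f o inv_into U \<phi>)"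
  using smooth_mapD(4)[OF f U W] by simp
 then show "Ck_on n V (\<phi> ` (U Int g -` W)) (\<psi> o g o inv_into U \<phi>)"
  by (rule Ck_on_cong[rotated]) (auto simp: inv_into_f_f[OF source_atlasD(2)[OF A U]] eq')
qed

lemma source_atlas_vimage_open:
 fixes f :: "'a::topological_space => 'b::topological_space"
 assumes A: "source_atlas M V A" "(U, \<phi>) : A" and f: "continuous_on M f" "f ` M <= M'"
  and W: "openin (top_of_set M') W"
 obtains T where "open T" "!!x. x : U ==> \<phi> x : T \<longleftrightarrow> f x : W"
proof -
 note U = source_atlasD[OF A]
 obtain O' where O: "open O'" "W = M' Int O'" using W unfolding openin_open by blast
 have inv: "inv_into U \<phi> (\<phi> x) = x" if "x : U" for x using that U(2) by (simp add: inv_into_f_f)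
 have img: "inv_into U \<phi> ` (\<phi> ` U) <= M" using inv U(1) by auto
 have "continuous_on (\<phi> ` U) (f o inv_into U \<phi>)"
  by (rule continuous_on_compose[OF U(3) continuous_on_subset[OF f(1) img]])
 then obtain T where T: "open T" "T Int \<phi> ` U = (f o inv_into U \<phi>) -` O' Int \<phi> ` U"
  using O(1) unfolding continuous_on_open_invariant by metis
 have "\<phi> x : T \<longleftrightarrow> f x : W" if x: "x : U" for x
 proof -
  have "\<phi> x : T \<longleftrightarrow> \<phi> x : T Int \<phi> ` U" using x by blast
  also have "\<dots> \<longleftrightarrow> f x : O'" unfolding T(2) using x inv by simp
  also have "\<dots> \<longleftrightarrow> f x : W" unfolding O(2) using x U(1) f(2) by blast
  finally show ?thesis .
 qed
 then show ?thesis using that T by blast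
qed

lemma source_atlas_tangent_full:
 fixes f :: "'a::topological_space => 'b::topological_space"
 assumes A: "source_atlas M V A" "(U, \<phi>) : A" and f: "continuous_on M f" "f ` M <= M'"
  and W: "openin (top_of_set M') W"
 shows "tangent_full V (\<phi> ` (U Int f -` W))"
proof -
 have "openin (top_of_set M) (M Int f -` W)"
  using continuous_openin_preimage[OF f(1) _ W] f(2) by (simp add: image_subset_iff_funcset)
 moreover have "U Int f -` W = U Int (M Int f -` W)" using source_atlasD(1)[OF A] by blast
 ultimately show ?thesis using source_atlasD(4)[OF A] by simp
qed

text \<open>Around each point a chart of the middle manifold is chosen and the chain rule is applied
  on the open piece mapped into that chart; \<open>Ck_on_local\<close> assembles the pieces.\<close>

lemma smooth_map_compose:
 fixes f :: "'a::topological_space => 'b::topological_space" and g :: "'b => 'c::topological_space"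
 assumes src: "source_atlas M V A" and mid: "target_atlas M' V' A'" and tgt: "target_atlas M'' V'' A''"
  and f: "smooth_map M V A M' A' f" and g: "smooth_map M' V' A' M'' A'' g"
 shows "smooth_map M V A M'' A'' (%x. g (f x))"
proof (rule smooth_mapI)
 note fM = smooth_mapD(3,2)[OF f] and gM = smooth_mapD(3,2)[OF g]
 show con: "continuous_on M (%x. g (f x))" by (rule continuous_on_compose2[OF gM(1) fM])
 show "!!x. x : M ==> g (f x) : M''" using fM(2) gM(2) by blast
 then have img: "(%x. g (f x)) ` M <= M''" by blast
 fix U \<phi> W \<psi> n assume Ui: "(U, \<phi>) : A" and Wi: "(W, \<psi>) : A''"
 note U = source_atlasD[OF src Ui] and W = target_atlasD[OF tgt Wi]
 have inv: "inv_into U \<phi> (\<phi> x) = x" if "x : U" for x using that U(2) by (simp add: inv_into_f_f)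
 define S where "S = \<phi> ` (U Int (%x. g (f x)) -` W)"
 have S: "tangent_full V S"
  unfolding S_def by (rule source_atlas_tangent_full[OF src Ui con img W(1)])
 have "Ck_on n V S (\<psi> o (%x. g (f x)) o inv_into U \<phi>)"
 proof (rule Ck_on_local[OF S])
  fix y assume "y : S"
  then obtain x where x: "x : U" "g (f x) : W" "y = \<phi> x" unfolding S_def by blast
  then have "f x : M'" using U(1) fM(2) by blast
  then obtain U' \<phi>' where U': "(U', \<phi>') : A'" "f x : U'" using target_atlas_cover[OF mid] by metis
  note U'p = target_atlasD[OF mid U'(1)]
  have inv': "inv_into U' \<phi>' (\<phi>' x) = x" if "x : U'" for x using that U'p(2) by (simp add: inv_into_f_f)
  obtain T where T: "open T" "!!x. x : U ==> \<phi> x : T \<longleftrightarrow> f x : U'"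
   using source_atlas_vimage_open[OF src Ui fM U'p(1)] by metis
  have sub1: "S Int T <= \<phi> ` (U Int f -` U')" unfolding S_def using T(2) by blast
  have 1: "Ck_on n V (S Int T) (\<phi>' o f o inv_into U \<phi>)"
   by (rule Ck_on_subset[OF smooth_mapD(4)[OF f Ui U'(1)] sub1])
  have 2: "Ck_on n V' (\<phi>' ` (U' Int g -` W)) (\<psi> o g o inv_into U' \<phi>')"
   by (rule smooth_mapD(4)[OF g U'(1) Wi])
  have 3: "f (inv_into U \<phi> z) : U' & g (f (inv_into U \<phi> z)) : W" if "z : S Int T" for z
   using that T(2) inv unfolding S_def by auto
  have "Ck_on n V (S Int T) (%z. (\<psi> o g o inv_into U' \<phi>') ((\<phi>' o f o inv_into U \<phi>) z))"
   by (rule Ck_on_compose[OF tangent_full_Int_open[OF S T(1)] U'p(4) _ _ 1 2]) (use 3 U'p(3) in auto)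
  then have "Ck_on n V (S Int T) (\<psi> o (%x. g (f x)) o inv_into U \<phi>)"
   by (rule Ck_on_cong[rotated]) (simp add: 3 inv')
  moreover have "y : T" using T(2) x U'(2) by blast
  ultimately show "\<exists>O'. open O' & y : O' & Ck_on n V (S Int O') (\<psi> o (%x. g (f x)) o inv_into U \<phi>)"
   using T(1) by blast
 qed
 then show "Ck_on n V (\<phi> ` (U Int (%x. g (f x)) -` W)) (\<psi> o (%x. g (f x)) o inv_into U \<phi>)"
  unfolding S_def .
qed

lemma smooth_map_const:
 "c : M' ==> smooth_map M V A M' A' (%x. c)"
 by (rule smooth_mapI) (simp_all add: comp_def Ck_on_const)

lemma smooth_map_id:
 fixes M :: "'a::{t2_space, second_countable_topology} set"
 assumes "smooth_atlas M V A" shows "smooth_map M V A M A (%x. x)"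
 using smooth_atlasD(6)[OF assms] by (intro smooth_mapI) (simp_all add: comp_def smooth_on_def)

lemma smooth_map_Pair:
 fixes f :: "'a::topological_space => 'b::topological_space" and g :: "'a => 'c::topological_space"
 assumes f: "smooth_map M V A M' A' f" and g: "smooth_map M V A M'' A'' g"
 shows "smooth_map M V A (M' \<times> M'') (prod_atlas A' A'') (%x. (f x, g x))"
proof (rule smooth_mapI)
 show "continuous_on M (%x. (f x, g x))"
  by (rule continuous_on_Pair[OF smooth_mapD(3)[OF f] smooth_mapD(3)[OF g]])
 show "!!x. x : M ==> (f x, g x) : M' \<times> M''" using smooth_mapD(1)[OF f] smooth_mapD(1)[OF g] by simp
 fix U \<phi> W \<psi> n assume U: "(U, \<phi>) : A" and "(W, \<psi>) : prod_atlas A' A''"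
 then obtain U' \<phi>' U'' \<phi>'' where ab: "W = U' \<times> U''" "\<psi> = (%(x, y). (\<phi>' x, \<phi>'' y))"
  "(U', \<phi>') : A'" "(U'', \<phi>'') : A''" unfolding prod_atlas_def by blast
 have "Ck_on n V (\<phi> ` (U Int (%x. (f x, g x)) -` (U' \<times> U'')))
   (%x. ((\<phi>' o f o inv_into U \<phi>) x, (\<phi>'' o g o inv_into U \<phi>) x))"
  by (intro Ck_on_Pair Ck_on_subset[OF smooth_mapD(4)[OF f U ab(3)]] Ck_on_subset[OF smooth_mapD(4)[OF g U ab(4)]]) auto
 then show "Ck_on n V (\<phi> ` (U Int (%x. (f x, g x)) -` W)) (\<psi> o (%x. (f x, g x)) o inv_into U \<phi>)"
  unfolding ab by (simp add: comp_def)
qed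

lemma Ck_on_comp_inv_into_id:
 "S <= T ==> Ck_on n V S (f o inv_into T id) \<longleftrightarrow> Ck_on n V S f"
 by (rule iffI; erule Ck_on_cong[rotated]) (auto simp: subset_iff)

text \<open>Viewing a compact interval as a one-chart domain makes composition with smooth maps
  available for paths.\<close>

lemma smooth_path_on_iff:
 "smooth_path_on G {a..b} c \<longleftrightarrow> smooth_map {a..b} UNIV {({a..b}, id)} (carrier G) (atlas G) c"
 unfolding smooth_path_on_def smooth_map_def smooth_on_def by (simp add: Ck_on_comp_inv_into_id)

lemma smooth_on_interval_iff:
 "smooth_map {a..b::real} UNIV {({a..b}, id)} UNIV {(UNIV, id)} c \<longleftrightarrow> smooth_on UNIV {a..b} (c :: real => 'v::euclidean_space)"
 unfolding smooth_map_def smooth_on_def using Ck_on_imp_continuous_on[of _ UNIV "{a..b}" c]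
 by (auto simp add: Ck_on_comp_inv_into_id)

section \<open>Curves in Lie groups\<close>

text \<open>Continuity of \<open>b\<close> is a separate clause: \<open>coord G\<close> is
  unconstrained outside the chart domain, so a derivative of \<open>coord G (b r)\<close> alone
  would not keep \<open>b\<close> near the identity.\<close>

definition velocity_at ::
 "('a::topological_space, 'e::euclidean_space) lie_struct => (real => 'a) => real => real set => 'e => bool" where
 "velocity_at G b t J X \<longleftrightarrow> t : J & b t = \<one>\<^bsub>G\<^esub> & b ` J <= carrier G & continuous (at t within J) b &
   ((%r. coord G (b r)) has_vector_derivative X) (at t within J) & X : model G"

locale lie_grp =
 fixes G :: "('a::{t2_space, second_countable_topology}, 'e::euclidean_space) lie_struct" (structure)
 assumes lie: "lie_group G"
begin

sublocale group G using lie unfolding lie_group_def by simp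

lemma atlas_G: "smooth_atlas (carrier G) (model G) (atlas G)"
 using lie unfolding lie_group_def by simp

lemmas source_G = smooth_atlas_source_atlas[OF atlas_G]
lemmas target_G = smooth_atlas_target_atlas[OF atlas_G]

abbreviation "U \<equiv> fst (id_chart G)"
definition "cdom = coord G ` U"

lemma id_chart_in: "(U, coord G) : atlas G"
 using lie unfolding lie_group_def by simp

lemma one_in_U: "\<one> : U" and coord_one [simp]: "coord G \<one> = 0"
 using lie unfolding lie_group_def by simp_all

lemmas U_open = smooth_atlasD(3)[OF atlas_G id_chart_in]

lemma U_carrier: "x : U ==> x : carrier G"
 using source_atlasD(1)[OF source_G id_chart_in] by blast

lemma uncoord_coord [simp]: "x : U ==> uncoord G (coord G x) = x"
 using source_atlasD(2)[OF source_G id_chart_in] by (simp add: inv_into_f_f)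

lemma uncoord_in_U: "y : cdom ==> uncoord G y : U"
 unfolding cdom_def by (simp add: inv_into_into)

lemma coord_uncoord [simp]: "y : cdom ==> coord G (uncoord G y) = y"
 unfolding cdom_def by (simp add: f_inv_into_f)

lemma coord_in_dom: "x : U ==> coord G x : cdom"
 unfolding cdom_def by simp

lemma zero_in_dom: "0 : cdom"
 using coord_in_dom[OF one_in_U] by simp

lemma uncoord_zero [simp]: "uncoord G 0 = \<one>"
 using uncoord_coord[OF one_in_U] by simp

lemma dom_open: "openin (top_of_set (model G)) cdom"
 unfolding cdom_def by (rule smooth_atlasD(4)[OF atlas_G id_chart_in])

lemma subspace_model: "subspace (model G)"
 by (rule smooth_atlasD(1)[OF atlas_G])

lemma dom_model: "y : cdom ==> y : model G"
 using openin_imp_subset[OF dom_open] by blast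

lemma continuous_on_coord: "continuous_on U (coord G)"
 and continuous_on_uncoord: "continuous_on cdom (uncoord G)"
 using smooth_atlasD(5)[OF atlas_G id_chart_in] unfolding homeomorphism_def cdom_def by simp_all

lemma smooth_mult_map: "smooth_map (carrier G \<times> carrier G) (model G \<times> model G) (prod_atlas (atlas G) (atlas G))
     (carrier G) (atlas G) (%(x, y). x \<otimes> y)"
 and smooth_inv_map: "smooth_map (carrier G) (model G) (atlas G) (carrier G) (atlas G) (%x. inv x)"
 using lie unfolding lie_group_def by simp_all

lemma smooth_map_mult:
 assumes "source_atlas M W A" "smooth_map M W A (carrier G) (atlas G) f" "smooth_map M W A (carrier G) (atlas G) g"
 shows "smooth_map M W A (carrier G) (atlas G) (%x. f x \<otimes> g x)"
 using smooth_map_compose[OF assms(1) target_atlas_prod[OF target_G target_G] target_G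
   smooth_map_Pair[OF assms(2,3)] smooth_mult_map] by simp

lemma smooth_map_inv:
 assumes "source_atlas M W A" "smooth_map M W A (carrier G) (atlas G) f"
 shows "smooth_map M W A (carrier G) (atlas G) (%x. inv (f x))"
 using smooth_map_compose[OF assms(1) target_G target_G assms(2) smooth_inv_map] .

lemma continuous_on_mult:
 "continuous_on (carrier G \<times> carrier G) (%p. fst p \<otimes> snd p)"
 using smooth_mapD(3)[OF smooth_mult_map] by (simp add: case_prod_unfold)

lemma continuous_within_mult:
 fixes f g :: "real => 'a"
 assumes "continuous (at t within J) f" "continuous (at t within J) g" "f ` J <= carrier G" "g ` J <= carrier G" "t : J"
 shows "continuous (at t within J) (%r. f r \<otimes> g r)"
proof -
 have "continuous (at (f t, g t) within (%r. (f r, g r)) ` J) (%p. fst p \<otimes> snd p)"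
  by (rule continuous_within_subset[of _ "carrier G \<times> carrier G"])
    (use bspec[OF continuous_on_mult[unfolded continuous_on_eq_continuous_within], of "(f t, g t)"] assms(3-5) in auto)
 from continuous_within_compose2[OF continuous_Pair[OF assms(1,2)] this] show ?thesis by simp
qed

lemma continuous_within_compose_carrier:
 fixes f :: "real => 'a"
 assumes "continuous (at t within J) f" "f ` J <= carrier G" "t : J" "continuous_on (carrier G) h"
 shows "continuous (at t within J) (%r. h (f r))"
proof (rule continuous_within_compose2[OF assms(1)])
 show "continuous (at (f t) within f ` J) h"
  by (rule continuous_within_subset[OF _ assms(2)])
    (use assms in \<open>auto simp: continuous_on_eq_continuous_within\<close>)
qed

lemma curve_in_open:
 fixes f :: "real => 'a"
 assumes "continuous (at t within J) f" "f ` J <= carrier G" "t : J" "openin (top_of_set (carrier G)) W" "f t : W"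
 obtains O' where "open O'" "t : O'" "!!r. r : J ==> r : O' ==> f r : W"
proof -
 obtain T where T: "open T" "W = carrier G Int T" using assms(4) unfolding openin_open by blast
 then have "\<forall>\<^sub>F r in at t within J. f r : T"
  using assms(1,5) unfolding continuous_within by (auto elim: topological_tendstoD)
 then obtain O' where O: "open O'" "t : O'" "!!r. r : O' ==> r ~= t ==> r : J ==> f r : T"
  unfolding eventually_at_topological by blast
 have "f r : W" if "r : J" "r : O'" for r
  using O(3)[OF that(2) _ that(1)] assms(2,5) that T by (cases "r = t") auto
 then show ?thesis using that O by blast
qed

definition "mdom = {p : cdom \<times> cdom. uncoord G (fst p) \<otimes> uncoord G (snd p) : U}"

definition "mcoord p = coord G (uncoord G (fst p) \<otimes> uncoord G (snd p))"

lemma mdom_open: "openin (top_of_set (model G \<times> model G)) mdom"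
proof -
 have c: "continuous_on (cdom \<times> cdom) (%p. uncoord G (fst p) \<otimes> uncoord G (snd p))"
 proof (rule continuous_on_compose2[OF continuous_on_mult, of _ "%p. (uncoord G (fst p), uncoord G (snd p))", simplified])
  show "continuous_on (cdom \<times> cdom) (%p. (uncoord G (fst p), uncoord G (snd p)))"
   by (intro continuous_on_Pair continuous_on_compose2[OF continuous_on_uncoord] continuous_intros) auto
  show "(%p. (uncoord G (fst p), uncoord G (snd p))) ` (cdom \<times> cdom) <= carrier G \<times> carrier G"
   using uncoord_in_U U_carrier by auto
 qed
 have "openin (top_of_set (cdom \<times> cdom)) ((cdom \<times> cdom) Int (%p. uncoord G (fst p) \<otimes> uncoord G (snd p)) -` U)"
  by (rule continuous_openin_preimage[OF c _ U_open]) (use uncoord_in_U U_carrier in auto)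
 moreover have "(cdom \<times> cdom) Int (%p. uncoord G (fst p) \<otimes> uncoord G (snd p)) -` U = mdom"
  unfolding mdom_def by auto
 ultimately show ?thesis using openin_trans openin_Times[OF dom_open dom_open] by metis
qed

lemma mdom_tangent_full: "tangent_full (model G \<times> model G) mdom"
 by (rule tangent_full_openin_subspace[OF subspace_Times[OF subspace_model subspace_model] mdom_open])

lemma mcoord_smooth: "Ck_on n (model G \<times> model G) mdom mcoord"
proof -
 let ?f = "%(x, y). (coord G x, coord G y)" and ?m = "%(x, y). x \<otimes> y"
 have in_atlas: "(U \<times> U, ?f) : prod_atlas (atlas G) (atlas G)"
  unfolding prod_atlas_def using id_chart_in by blast
 have 1: "Ck_on n (model G \<times> model G) (?f ` ((U \<times> U) Int ?m -` U)) (coord G o ?m o inv_into (U \<times> U) ?f)"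
  by (rule smooth_mapD(4)[OF smooth_mult_map in_atlas id_chart_in])
 have inj: "inj_on ?f (U \<times> U)"
  using target_atlasD(2)[OF target_atlas_prod[OF target_G target_G] in_atlas] .
 have inv: "inv_into (U \<times> U) ?f (y, z) = (uncoord G y, uncoord G z)" if "y : cdom" "z : cdom" for y z
  using inv_into_f_f[OF inj, of "(uncoord G y, uncoord G z)"] that uncoord_in_U by simp
 have "mdom <= ?f ` ((U \<times> U) Int ?m -` U)"
 proof
  fix p assume p: "p : mdom"
  then have "p = ?f (uncoord G (fst p), uncoord G (snd p))" unfolding mdom_def by auto
  moreover have "(uncoord G (fst p), uncoord G (snd p)) : (U \<times> U) Int ?m -` U"
   using p uncoord_in_U unfolding mdom_def by auto
  ultimately show "p : ?f ` ((U \<times> U) Int ?m -` U)" by (rule image_eqI)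
 qed
 from Ck_on_subset[OF 1 this] show ?thesis
  by (rule Ck_on_cong[rotated]) (auto simp: mdom_def mcoord_def inv)
qed

lemma mdom_left: "y : cdom ==> (y, 0) : mdom" and mdom_right: "y : cdom ==> (0, y) : mdom"
 unfolding mdom_def using zero_in_dom uncoord_in_U U_carrier by auto

lemma mcoord_right: "y : cdom ==> mcoord (0, y) = y" and mcoord_left: "y : cdom ==> mcoord (y, 0) = y"
 unfolding mcoord_def using uncoord_in_U U_carrier by simp_all

definition "mderiv p = frechet_derivative mcoord (at p within mdom)"

lemma mderiv: "p : mdom ==> (mcoord has_derivative mderiv p) (at p within mdom)"
 and mderiv_Ck: "h : model G \<times> model G ==> Ck_on n (model G \<times> model G) mdom (%p. mderiv p h)"
 using mcoord_smooth[of "Suc n"] unfolding Ck_on_Suc_iff[OF mdom_tangent_full] mderiv_def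
 by (simp_all add: frechet_derivative_works del: mem_Sigma_iff split_paired_Ball_Sigma)

lemma mderiv_linear: "p : mdom ==> linear (mderiv p)"
 using mderiv has_derivative_linear by blast

text \<open>On each of the two axes \<open>mcoord\<close> is the identity map, and the derivative is
  linear.\<close>

lemma mderiv_zero:
 assumes "X : model G" "Y : model G" shows "mderiv (0, 0) (X, Y) = X + Y"
proof -
 have z: "(0, 0) : mdom" using mdom_left[OF zero_in_dom] .
 have dd: "tangent_full (model G) cdom" by (rule tangent_full_openin_subspace[OF subspace_model dom_open])
 have 1: "mderiv (0, 0) (X, 0) = X" if X: "X : model G" for X
 proof (rule tangent_full_derivative_unique[OF dd zero_in_dom X])
  have "((%y. mcoord (y, 0)) has_derivative (%h. mderiv (0, 0) (h, 0))) (at 0 within cdom)"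
   by (rule has_derivative_in_compose[of "%y. (y, 0)" "%h. (h, 0)"])
     (auto intro!: derivative_eq_intros has_derivative_subset[OF mderiv[OF z]] mdom_left)
  then show "((%y. y) has_derivative (%h. mderiv (0, 0) (h, 0))) (at 0 within cdom)"
   by (rule has_derivative_transform[OF zero_in_dom, rotated]) (simp add: mcoord_left)
  show "((%y. y) has_derivative (%h. h)) (at 0 within cdom)" by simp
 qed
 have 2: "mderiv (0, 0) (0, X) = X" if X: "X : model G" for X
 proof (rule tangent_full_derivative_unique[OF dd zero_in_dom X])
  have "((%y. mcoord (0, y)) has_derivative (%h. mderiv (0, 0) (0, h))) (at 0 within cdom)"
   by (rule has_derivative_in_compose[of "%y. (0, y)" "%h. (0, h)"])
     (auto intro!: derivative_eq_intros has_derivative_subset[OF mderiv[OF z]] mdom_right)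
  then show "((%y. y) has_derivative (%h. mderiv (0, 0) (0, h))) (at 0 within cdom)"
   by (rule has_derivative_transform[OF zero_in_dom, rotated]) (simp add: mcoord_right)
  show "((%y. y) has_derivative (%h. h)) (at 0 within cdom)" by simp
 qed
 have "mderiv (0, 0) (X, Y) = mderiv (0, 0) ((X, 0) + (0, Y))" by simp
 also have "\<dots> = mderiv (0, 0) (X, 0) + mderiv (0, 0) (0, Y)"
  by (rule linear_add[OF mderiv_linear[OF z]])
 finally show ?thesis using 1 2 assms by simp
qed

lemma curve_in_mdom:
 fixes f g :: "real => 'a"
 assumes "continuous (at t within J) f" "continuous (at t within J) g" "f ` J <= carrier G" "g ` J <= carrier G" "t : J"
  "f t : U" "g t : U" "f t \<otimes> g t : U"
 obtains O' where "open O'" "t : O'"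
  "!!r. r : J ==> r : O' ==> f r : U & g r : U & (coord G (f r), coord G (g r)) : mdom &
    coord G (f r \<otimes> g r) = mcoord (coord G (f r), coord G (g r))"
proof -
 obtain O1 where O1: "open O1" "t : O1" "!!r. r : J ==> r : O1 ==> f r : U"
  using curve_in_open[OF assms(1,3,5) U_open assms(6)] by metis
 obtain O2 where O2: "open O2" "t : O2" "!!r. r : J ==> r : O2 ==> g r : U"
  using curve_in_open[OF assms(2,4,5) U_open assms(7)] by metis
 have im: "(%r. f r \<otimes> g r) ` J <= carrier G" using assms(3,4) by blast
 obtain O3 where O3: "open O3" "t : O3" "!!r. r : J ==> r : O3 ==> f r \<otimes> g r : U"
  using curve_in_open[OF continuous_within_mult[OF assms(1-5)] im assms(5) U_open assms(8)] by metis
 show ?thesis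
  by (rule that[of "O1 Int O2 Int O3"]) (use O1 O2 O3 in \<open>auto simp: mdom_def mcoord_def coord_in_dom\<close>)
qed

text \<open>Chain rule through \<open>mcoord\<close>, whose derivative at the identity is
  addition.\<close>

lemma velocity_at_mult:
 assumes "velocity_at G f t J X" "velocity_at G g t J Y"
 shows "velocity_at G (%r. f r \<otimes> g r) t J (X + Y)"
proof -
 have f: "t : J" "f t = \<one>" "f ` J <= carrier G" "continuous (at t within J) f"
   "((%r. coord G (f r)) has_vector_derivative X) (at t within J)" "X : model G"
  and g: "g t = \<one>" "g ` J <= carrier G" "continuous (at t within J) g"
   "((%r. coord G (g r)) has_vector_derivative Y) (at t within J)" "Y : model G"
  using assms unfolding velocity_at_def by simp_all
 obtain O' where O: "open O'" "t : O'"
  "!!r. r : J ==> r : O' ==> (coord G (f r), coord G (g r)) : mdom"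
  "!!r. r : J ==> r : O' ==> coord G (f r \<otimes> g r) = mcoord (coord G (f r), coord G (g r))"
  using curve_in_mdom[OF f(4) g(3) f(3) g(2) f(1)] f(2) g(1) one_in_U one_closed l_one by metis
 have at: "at t within J Int O' = at t within J" using at_within_Int_nhd[OF O(1,2)] .
 have p: "((%r. (coord G (f r), coord G (g r))) has_vector_derivative (X, Y)) (at t within J Int O')"
  unfolding at using f(5) g(4) by (rule has_vector_derivative_Pair)
 have z: "(0, 0) : mdom" using mdom_left[OF zero_in_dom] .
 have "(mcoord has_derivative mderiv (0, 0)) (at (coord G (f t), coord G (g t)) within (%r. (coord G (f r), coord G (g r))) ` (J Int O'))"
  using has_derivative_subset[OF mderiv[OF z]] O(3) f(2) g(1) by (simp add: image_subset_iff)
 from vector_derivative_diff_chain_within[OF p this]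
 have "((%r. mcoord (coord G (f r), coord G (g r))) has_vector_derivative X + Y) (at t within J Int O')"
  using mderiv_zero[OF f(6) g(5)] by (simp add: comp_def)
 then have "((%r. coord G (f r \<otimes> g r)) has_vector_derivative X + Y) (at t within J Int O')"
  by (rule has_vector_derivative_transform[rotated 2]) (use O f(1) in auto)
 then show ?thesis unfolding velocity_at_def
  using f g continuous_within_mult[OF f(4) g(3) f(3) g(2) f(1)] subspace_add[OF subspace_model f(6) g(5)]
  by (auto simp: at)
qed

text \<open>These coordinate lines serve as test curves: they realise every vector of
  \<open>model G\<close> as a velocity, and they are the curves used in
  \<open>differential\<close>.\<close>

lemma velocity_at_uncoord:
 assumes X: "X : model G"
 obtains J where "open J" "(0::real) : J" "!!r. r : J ==> r *\<^sub>R X : cdom" "velocity_at G (%r. uncoord G (r *\<^sub>R X)) 0 J X"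
proof -
 obtain T where T: "open T" "cdom = model G Int T" using dom_open unfolding openin_open by blast
 have "0 : T" using T zero_in_dom by blast
 have "((%r. r *\<^sub>R X) \<longlongrightarrow> 0 *\<^sub>R X) (at 0)" by (intro tendsto_intros)
 then have "\<forall>\<^sub>F r in at 0. r *\<^sub>R X : T" using T(1) \<open>0 : T\<close> by (auto elim: topological_tendstoD)
 then obtain J where J: "open J" "(0::real) : J" "!!r. r : J ==> r ~= 0 ==> r *\<^sub>R X : T"
  unfolding eventually_at_topological by auto
 have d: "r *\<^sub>R X : cdom" if "r : J" for r
  using J(3)[OF that] \<open>0 : T\<close> T(2) subspace_scale[OF subspace_model X] zero_in_dom by (cases "r = 0") auto
 have "velocity_at G (%r. uncoord G (r *\<^sub>R X)) 0 J X"
  unfolding velocity_at_def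
 proof (intro conjI)
  show "continuous (at 0 within J) (%r. uncoord G (r *\<^sub>R X))"
  proof (rule continuous_within_compose2[where f="%r. r *\<^sub>R X"])
   show "continuous (at (0 *\<^sub>R X) within (%r. r *\<^sub>R X) ` J) (uncoord G)"
    by (rule continuous_within_subset[of _ cdom])
     (use continuous_on_uncoord zero_in_dom d in \<open>auto simp: continuous_on_eq_continuous_within\<close>)
  qed (intro continuous_intros)
  have "((%r. r *\<^sub>R X) has_vector_derivative X) (at 0 within J)"
   by (auto intro!: derivative_eq_intros simp: has_vector_derivative_def)
  then show "((%r. coord G (uncoord G (r *\<^sub>R X))) has_vector_derivative X) (at 0 within J)"
   by (rule has_vector_derivative_transform[rotated 2]) (use d J in auto)
  show "(%r. uncoord G (r *\<^sub>R X)) ` J <= carrier G" using d uncoord_in_U U_carrier by blast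
 qed (use J X in auto)
 then show ?thesis using that J d by blast
qed

end

text \<open>\<open>differential\<close> is defined along coordinate lines only. The chain rule in
  the charts shows that one linear map transports the velocity of every curve through the
  identity.\<close>

lemma velocity_at_map:
 fixes G :: "('a::{t2_space, second_countable_topology}, 'e::euclidean_space) lie_struct"
  and H :: "('b::{t2_space, second_countable_topology}, 'f::euclidean_space) lie_struct"
 assumes G: "lie_group G" and H: "lie_group H" and f: "smooth_map (carrier G) (model G) (atlas G) (carrier H) (atlas H) f"
  and one: "f \<one>\<^bsub>G\<^esub> = \<one>\<^bsub>H\<^esub>"
 obtains L where "bounded_linear L" "!!X. X : model G ==> L X = differential G H f X"
  "!!b t J X. velocity_at G b t J X ==> velocity_at H (%r. f (b r)) t J (L X)"
proof -
 interpret G: lie_grp G by unfold_locales fact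
 interpret H: lie_grp H by unfold_locales fact
 define S where "S = coord G ` (G.U Int f -` H.U)"
 have S: "tangent_full (model G) S"
  unfolding S_def by (rule source_atlas_tangent_full[OF G.source_G G.id_chart_in smooth_mapD(3,2)[OF f] H.U_open])
 have "\<one>\<^bsub>G\<^esub> : G.U Int f -` H.U" using one G.one_in_U H.one_in_U by simp
 then have z: "0 : S" unfolding S_def using G.coord_one by (metis image_eqI)
 have "Ck_on (Suc 0) (model G) S (coord H o f o uncoord G)"
  unfolding S_def by (rule smooth_mapD(4)[OF f G.id_chart_in H.id_chart_in])
 then obtain L where L: "(coord H o f o uncoord G has_derivative L) (at 0 within S)" using z by auto
 have LV: "L X : model H" if "X : model G" for X
 proof (rule tangent_full_derivative_in_subspace[OF S z that L H.subspace_model])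
  fix y assume "y : S"
  then show "(coord H o f o uncoord G) y : model H"
   unfolding S_def using H.coord_in_dom H.dom_model by auto
 qed
 have main: "velocity_at H (%r. f (b r)) t J (L X)" if v: "velocity_at G b t J X" for b t J X
 proof -
  have b: "t : J" "b t = \<one>\<^bsub>G\<^esub>" "b ` J <= carrier G" "continuous (at t within J) b"
   "((%r. coord G (b r)) has_vector_derivative X) (at t within J)" "X : model G"
   using v unfolding velocity_at_def by simp_all
  have fb: "continuous (at t within J) (%r. f (b r))"
   by (rule G.continuous_within_compose_carrier[OF b(4,3,1) smooth_mapD(3)[OF f]])
  have im: "(%r. f (b r)) ` J <= carrier H" using b(3) smooth_mapD(2)[OF f] by blast
  obtain O1 where O1: "open O1" "t : O1" "!!r. r : J ==> r : O1 ==> b r : G.U"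
   using G.curve_in_open[OF b(4,3,1) G.U_open] b(2) G.one_in_U by metis
  obtain O2 where O2: "open O2" "t : O2" "!!r. r : J ==> r : O2 ==> f (b r) : H.U"
   using H.curve_in_open[OF fb im b(1) H.U_open] b(2) one H.one_in_U by metis
  define T where "T = J Int (O1 Int O2)"
  have at: "at t within T = at t within J" unfolding T_def by (rule at_within_Int_nhd) (use O1 O2 in auto)
  have p: "((%r. coord G (b r)) has_vector_derivative X) (at t within T)" unfolding at by (rule b(5))
  have "(%r. coord G (b r)) ` T <= S" unfolding T_def S_def using O1(3) O2(3) by auto
  then have "(coord H o f o uncoord G has_derivative L) (at (coord G (b t)) within (%r. coord G (b r)) ` T)"
   using has_derivative_subset[OF L] b(2) by simp
  from vector_derivative_diff_chain_within[OF p this]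
  have "((%r. coord H (f (b r))) has_vector_derivative L X) (at t within T)"
   by (rule has_vector_derivative_transform[rotated 2]) (use O1 O2 b(1) in \<open>auto simp: T_def\<close>)
  then show ?thesis unfolding velocity_at_def using fb im b LV one by (simp add: at)
 qed
 have "differential G H f X = L X" if X: "X : model G" for X
 proof -
  obtain J where J: "open J" "(0::real) : J" "velocity_at G (%r. uncoord G (r *\<^sub>R X)) 0 J X"
   using G.velocity_at_uncoord[OF X] by metis
  from main[OF J(3)] have "((%r. coord H (f (uncoord G (r *\<^sub>R X)))) has_vector_derivative L X) (at 0)"
   unfolding velocity_at_def using J by (metis at_within_open)
  then show ?thesis unfolding differential_def by (rule vector_derivative_at)
 qed
 moreover have "bounded_linear L" using L has_derivative_bounded_linear by blast
 ultimately show ?thesis using that main by metis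
qed

lemma at_within_Icc_neq_bot:
 assumes "a < b" "t : {a..b::real}" shows "at t within {a..b} ~= bot"
proof -
 have "t islimpt {a..b}"
  by (rule connected_imp_perfect[OF _ assms(2)]) (use assms in auto)
 then show ?thesis by (simp add: trivial_limit_within)
qed

lemma velocity_at_unique:
 assumes "velocity_at G b t J X" "at t within J ~= bot"
 shows "vector_derivative (%r. coord G (b r)) (at t within J) = X"
 using assms vector_derivative_within unfolding velocity_at_def by blast

lemma velocity_at_nhd:
 assumes "velocity_at G b t J X" "at t within J' = at t within J" "t : J'" "b ` J' <= carrier G"
 shows "velocity_at G b t J' X"
 using assms unfolding velocity_at_def by simp

lemma velocity_at_cong:
 assumes "velocity_at G b t J X" "!!r. r : J ==> b' r = b r"
 shows "velocity_at G b' t J X"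
proof -
 have *: "t : J" "b t = \<one>\<^bsub>G\<^esub>" "b ` J <= carrier G" "continuous (at t within J) b"
   "((%r. coord G (b r)) has_vector_derivative X) (at t within J)" "X : model G"
  using assms(1) unfolding velocity_at_def by simp_all
 have "continuous (at t within J) b'"
  using *(4) assms(2)[OF *(1)] unfolding continuous_within
  by (auto intro!: Lim_transform_eventually[of b] simp: eventually_at_filter assms(2))
 moreover have "((%r. coord G (b' r)) has_vector_derivative X) (at t within J)"
  by (rule has_vector_derivative_transform[OF *(1) _ *(5)]) (simp add: assms(2))
 ultimately show ?thesis using * assms(2) unfolding velocity_at_def by auto
qed

lemma has_vector_derivative_of_has_derivative:
 fixes f :: "real => 'f::real_normed_vector"
 assumes "(f has_derivative f') F" shows "(f has_vector_derivative f' 1) F"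
proof -
 have "f' r = r *\<^sub>R f' 1" for r
  using linear_scale[OF has_derivative_linear[OF assms], of r 1] by simp
 then have "f' = (%r. r *\<^sub>R f' 1)" by (rule ext)
 from has_derivative_eq_rhs[OF assms this] show ?thesis unfolding has_vector_derivative_def .
qed

text \<open>The variant of \<open>left_velocity\<close> relative to an arbitrary time set, giving
  one-sided derivatives at the ends of a smooth piece of a path.\<close>

definition lv :: "('a, 'e::euclidean_space) lie_struct => real set => (real => 'a) => real => 'e" where
 "lv G J c t = vector_derivative (left_curve G c t) (at t within J)"

lemma lv_interior:
 assumes "0 <= a" "b <= 1" "a < t" "t < b"
 shows "lv G {a..b} c t = left_velocity G c t"
 unfolding left_velocity_def lv_def using assms by (simp add: at_within_Icc_at)

section \<open>Reparametrising and joining paths\<close>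

lemma Ck_on_affine:
 fixes f :: "real => 'f::real_normed_vector"
 assumes "!!x. x : S ==> k * x + l : T"
 shows "Ck_on n UNIV T f ==> Ck_on n UNIV S (%x. f (k * x + l))"
proof (induction n arbitrary: f)
 case 0
 then have f: "continuous_on T f" by simp
 have "continuous_on S (%x. f (k * x + l))"
  by (rule continuous_on_compose2[OF f]) (use assms in \<open>auto intro!: continuous_intros\<close>)
 then show ?case by simp
next
 case (Suc n)
 then obtain f' where f': "\<forall>x\<in>T. (f has_derivative f' x) (at x within T)" "\<forall>h. Ck_on n UNIV T (%x. f' x h)"
  by auto
 have "((%x. f (k * x + l)) has_derivative (%h. f' (k * x + l) (k * h))) (at x within S)" if x: "x : S" for x
 proof (rule has_derivative_in_compose[of "%x. k * x + l" "%h. k * h"])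
  show "((%x. k * x + l) has_derivative (%h. k * h)) (at x within S)" by (auto intro!: derivative_eq_intros)
  show "(f has_derivative f' (k * x + l)) (at (k * x + l) within (%x. k * x + l) ` S)"
   by (rule has_derivative_subset[of _ _ _ T]) (use f'(1) assms x in auto)
 qed
 moreover have "Ck_on n UNIV S (%x. f' (k * x + l) (k * h))" for h
  using Suc.IH[of "%y. f' y (k * h)"] f'(2) by blast
 ultimately show ?case unfolding Ck_on.simps
  by (intro exI[of _ "%x h. f' (k * x + l) (k * h)"]) blast
qed

lemma smooth_path_on_iff':
 "smooth_path_on G J c \<longleftrightarrow> c ` J <= carrier G & continuous_on J c &
  (\<forall>U \<phi>. (U, \<phi>) : atlas G --> smooth_on UNIV (J Int c -` U) (\<phi> o c))"
 by (simp only: smooth_path_on_def Ball_def split_paired_All prod.case)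

lemma smooth_path_onD:
 assumes "smooth_path_on G J c"
 shows "c ` J <= carrier G" "continuous_on J c" "(U, \<phi>) : atlas G ==> Ck_on n UNIV (J Int c -` U) (\<phi> o c)"
 using assms unfolding smooth_path_on_iff' smooth_on_def by simp_all

lemma smooth_path_onI:
 assumes "c ` J <= carrier G" "continuous_on J c" "!!U \<phi> n. (U, \<phi>) : atlas G ==> Ck_on n UNIV (J Int c -` U) (\<phi> o c)"
 shows "smooth_path_on G J c"
 using assms unfolding smooth_path_on_iff' smooth_on_def by simp

lemma smooth_path_on_subset:
 assumes "smooth_path_on G J c" "J' <= J" shows "smooth_path_on G J' c"
proof (rule smooth_path_onI)
 note c = smooth_path_onD[OF assms(1)]
 show "c ` J' <= carrier G" using c(1) assms(2) by blast
 show "continuous_on J' c" using c(2) assms(2) continuous_on_subset by blast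
 show "!!U \<phi> n. (U, \<phi>) : atlas G ==> Ck_on n UNIV (J' Int c -` U) (\<phi> o c)"
  by (rule Ck_on_subset[OF c(3)]) (use assms(2) in auto)
qed

lemma smooth_path_on_affine:
 assumes "smooth_path_on G J c" "!!x. x : J' ==> k * x + l : J" shows "smooth_path_on G J' (%t. c (k * t + l))"
proof (rule smooth_path_onI)
 note c = smooth_path_onD[OF assms(1)]
 show "(%t. c (k * t + l)) ` J' <= carrier G" using c(1) assms(2) by blast
 show "continuous_on J' (%t. c (k * t + l))"
  by (rule continuous_on_compose2[OF c(2)]) (use assms(2) in \<open>auto intro!: continuous_intros\<close>)
 fix U \<phi> n assume U: "(U, \<phi>) : atlas G"
 show "Ck_on n UNIV (J' Int (%t. c (k * t + l)) -` U) (\<phi> o (%t. c (k * t + l)))"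
  using Ck_on_affine[OF _ c(3)[OF U], of "J' Int (%t. c (k * t + l)) -` U" k l n] assms(2) by (simp add: comp_def)
qed

lemma smooth_path_on_cong:
 assumes "smooth_path_on G J c" "!!t. t : J ==> c' t = c t" shows "smooth_path_on G J c'"
proof (rule smooth_path_onI)
 note c = smooth_path_onD[OF assms(1)]
 show "c' ` J <= carrier G" using c(1) assms(2) by auto
 show "continuous_on J c'" by (rule continuous_on_eq[OF c(2)]) (simp add: assms(2))
 fix U \<phi> n assume U: "(U, \<phi>) : atlas G"
 have "J Int c' -` U = J Int c -` U" using assms(2) by auto
 then have "Ck_on n UNIV (J Int c' -` U) (\<phi> o c)" using c(3)[OF U] by simp
 then show "Ck_on n UNIV (J Int c' -` U) (\<phi> o c')"
  by (rule Ck_on_cong[rotated]) (simp add: assms(2))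
qed

lemma piecewise_smooth_pathD:
 assumes "piecewise_smooth_path G x y c"
 obtains F where "c 0 = x" "c 1 = y" "c ` {0..1} <= carrier G" "continuous_on {0..1} c" "finite F"
  "!!a b. 0 <= a ==> a < b ==> b <= 1 ==> {a<..<b} Int F = {} ==> smooth_path_on G {a..b} c"
 using assms unfolding piecewise_smooth_path_def by blast

lemma piecewise_smooth_path_reverse:
 assumes "piecewise_smooth_path G x y c" shows "piecewise_smooth_path G y x (%t. c (1 - t))"
proof -
 obtain F where c: "c 0 = x" "c 1 = y" "c ` {0..1} <= carrier G" "continuous_on {0..1} c" "finite F"
  "!!a b. 0 <= a ==> a < b ==> b <= 1 ==> {a<..<b} Int F = {} ==> smooth_path_on G {a..b} c"
  using piecewise_smooth_pathD[OF assms] by metis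
 have "smooth_path_on G {a..b} (%t. c (1 - t))"
  if ab: "0 <= a" "a < b" "b <= 1" "{a<..<b} Int (%t. 1 - t) ` F = {}" for a b
 proof -
  have "{1 - b<..<1 - a} Int F = {}"
  proof (rule ccontr)
   assume "{1 - b<..<1 - a} Int F ~= {}"
   then obtain f where "f : F" "1 - b < f" "f < 1 - a" by auto
   then have "1 - f : {a<..<b} Int (%t. 1 - t) ` F" by auto
   then show False using ab(4) by blast
  qed
  then have "smooth_path_on G {1-b..1-a} c" using c(6)[of "1-b" "1-a"] ab by auto
  from smooth_path_on_affine[OF this, of "{a..b}" "-1" 1] show ?thesis by simp
 qed
 moreover have "continuous_on {0..1} (%t. c (1 - t))"
  by (rule continuous_on_compose2[OF c(4)]) (auto intro!: continuous_intros)
 moreover have "(%t. c (1 - t)) ` {0..1} <= carrier G" using c(3) by auto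
 ultimately show ?thesis unfolding piecewise_smooth_path_def using c(1,2,5)
  by (intro conjI exI[of _ "(%t. 1 - t) ` F"]) simp_all
qed

lemma piecewise_smooth_path_join:
 assumes "piecewise_smooth_path G x y c" "piecewise_smooth_path G y z c'"
 shows "piecewise_smooth_path G x z (c +++ c')"
proof -
 obtain F where c: "c 0 = x" "c 1 = y" "c ` {0..1} <= carrier G" "continuous_on {0..1} c" "finite F"
  "!!a b. 0 <= a ==> a < b ==> b <= 1 ==> {a<..<b} Int F = {} ==> smooth_path_on G {a..b} c"
  using piecewise_smooth_pathD[OF assms(1)] by metis
 obtain F' where c': "c' 0 = y" "c' 1 = z" "c' ` {0..1} <= carrier G" "continuous_on {0..1} c'" "finite F'"
  "!!a b. 0 <= a ==> a < b ==> b <= 1 ==> {a<..<b} Int F' = {} ==> smooth_path_on G {a..b} c'"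
  using piecewise_smooth_pathD[OF assms(2)] by metis
 define E where "E = insert (1/2) ((%t. t/2) ` F Un (%t. (t+1)/2) ` F')"
 have sm: "smooth_path_on G {a..b} (c +++ c')" if ab: "0 <= a" "a < b" "b <= 1" "{a<..<b} Int E = {}" for a b
 proof -
  have "\<not> (a < 1/2 & 1/2 < b)" using ab(4) unfolding E_def by auto
  then consider "b <= 1/2" | "1/2 <= a" by linarith
  then show ?thesis
  proof cases
   case 1
   have "{2*a<..<2*b} Int F = {}"
   proof (rule ccontr)
    assume "{2*a<..<2*b} Int F ~= {}"
    then obtain f where "f : F" "2*a < f" "f < 2*b" by auto
    then have "f/2 : {a<..<b} Int E" unfolding E_def by auto
    then show False using ab(4) by blast
   qed
   then have "smooth_path_on G {2*a..2*b} c" using c(6)[of "2*a" "2*b"] ab 1 by auto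
   from smooth_path_on_affine[OF this, of "{a..b}" 2 0] have "smooth_path_on G {a..b} (%t. c (2 * t))" by simp
   then show ?thesis by (rule smooth_path_on_cong) (use 1 in \<open>auto simp: joinpaths_def\<close>)
  next
   case 2
   have "{2*a-1<..<2*b-1} Int F' = {}"
   proof (rule ccontr)
    assume "{2*a-1<..<2*b-1} Int F' ~= {}"
    then obtain f where "f : F'" "2*a-1 < f" "f < 2*b-1" by auto
    then have "(f+1)/2 : {a<..<b} Int E" unfolding E_def by (auto simp: field_simps)
    then show False using ab(4) by blast
   qed
   then have "smooth_path_on G {2*a-1..2*b-1} c'" using c'(6)[of "2*a-1" "2*b-1"] ab 2 by auto
   from smooth_path_on_affine[OF this, of "{a..b}" 2 "-1"] have "smooth_path_on G {a..b} (%t. c' (2 * t - 1))" by simp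
   then show ?thesis
   proof (rule smooth_path_on_cong)
    fix t assume "t : {a..b}"
    then have "1/2 <= t" using 2 by auto
    then show "(c +++ c') t = c' (2 * t - 1)"
    \<comment> \<open>At the junction \<open>+++\<close> still evaluates the first path; both values
      are the common end point.\<close>
    proof (cases "t = 1/2")
     case True
     then have "2 * t = 1" by simp
     then show ?thesis using c(2) c'(1) unfolding joinpaths_def by simp
    qed (auto simp: joinpaths_def)
   qed
  qed
 qed
 have "continuous_on {0..1} (c +++ c')"
  using path_join_imp[of c c'] c c' unfolding path_def pathfinish_def pathstart_def by simp
 moreover have "(c +++ c') ` {0..1} <= carrier G"
  using path_image_join_subset[of c c'] c(3) c'(3) unfolding path_image_def by auto
 moreover have "finite E" unfolding E_def using c(5) c'(5) by simp
 moreover have "(c +++ c') 0 = x" "(c +++ c') 1 = z" using c c' by (simp_all add: joinpaths_def)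
 ultimately show ?thesis using sm unfolding piecewise_smooth_path_def by (intro conjI exI[of _ E]) simp_all
qed

section \<open>Velocities of smooth paths: existence and continuity\<close>

context lie_grp begin

lemma smooth_path_mult:
 assumes "a < b" "smooth_path_on G {a..b} f" "smooth_path_on G {a..b} g"
 shows "smooth_path_on G {a..b} (%t. f t \<otimes> g t)"
 using smooth_map_mult[OF source_atlas_interval[OF assms(1)]] assms(2,3) unfolding smooth_path_on_iff by blast

lemma smooth_path_inv:
 assumes "a < b" "smooth_path_on G {a..b} f"
 shows "smooth_path_on G {a..b} (%t. inv (f t))"
 using smooth_map_inv[OF source_atlas_interval[OF assms(1)]] assms(2) unfolding smooth_path_on_iff by blast

lemma smooth_path_const: "x : carrier G ==> smooth_path_on G {a..b} (%t. x)"
 unfolding smooth_path_on_iff by (rule smooth_map_const)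

lemma smooth_conj:
 assumes "x : carrier G"
 shows "smooth_map (carrier G) (model G) (atlas G) (carrier G) (atlas G) (%y. x \<otimes> y \<otimes> inv x)"
 using assms by (intro smooth_map_mult[OF source_G] smooth_map_const smooth_map_id[OF atlas_G]) auto

text \<open>The product of \<open>b\<close> and its inverse is constant, so the velocity
  \<open>L X\<close> of the inverse satisfies \<open>X + L X = 0\<close>.\<close>

lemma velocity_at_inv:
 assumes v: "velocity_at G b t J X" and nb: "at t within J ~= bot"
 shows "velocity_at G (%r. inv (b r)) t J (- X)"
proof -
 obtain L where L: "bounded_linear L" "!!b t J X. velocity_at G b t J X ==> velocity_at G (%r. inv (b r)) t J (L X)"
  using velocity_at_map[OF lie lie smooth_inv_map] by (metis inv_one)
 from velocity_at_mult[OF v L(2)[OF v]]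
 have "velocity_at G (%r. b r \<otimes> inv (b r)) t J (X + L X)" .
 then have "velocity_at G (%r. \<one>) t J (X + L X)"
  by (rule velocity_at_cong) (use v in \<open>auto simp: velocity_at_def\<close>)
 then have "((%r. 0) has_vector_derivative X + L X) (at t within J)" unfolding velocity_at_def by simp
 then have "X + L X = 0" using vector_derivative_unique_within[OF nb] has_vector_derivative_const by blast
 then have "L X = - X" by (metis add.inverse_unique)
 then show ?thesis using L(2)[OF v] by simp
qed

lemma Ad_linear:
 assumes "x : carrier G"
 obtains L where "bounded_linear L" "!!X. X : model G ==> L X = Ad G x X"
  "!!b t J X. velocity_at G b t J X ==> velocity_at G (%r. x \<otimes> b r \<otimes> inv x) t J (L X)"
 using velocity_at_map[OF lie lie smooth_conj[OF assms]] assms unfolding Ad_def by (simp, metis)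

lemma left_translate_smooth:
 "x : carrier G ==> a < b ==> smooth_path_on G {a..b} c ==> smooth_path_on G {a..b} (%r. x \<otimes> c r)"
 by (rule smooth_path_mult[OF _ smooth_path_const])

lemma smooth_path_velocity:
 assumes ab: "a < b" and c: "smooth_path_on G {a..b} c" and t: "t : {a..b}"
 shows "velocity_at G (%r. inv (c t) \<otimes> c r) t {a..b} (lv G {a..b} c t)"
proof -
 define J where "J = {a..b}"
 define bb where "bb = (%r. inv (c t) \<otimes> c r)"
 have nb: "at t within J ~= bot" unfolding J_def by (rule at_within_Icc_neq_bot[OF ab t])
 have ct: "c t : carrier G" using smooth_path_onD(1)[OF c] t by blast
 then have "smooth_path_on G J bb"
  unfolding bb_def J_def by (intro left_translate_smooth ab c) simp
 note bb = smooth_path_onD[OF this]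
 have tJ: "t : J" using t unfolding J_def .
 have one: "bb t = \<one>" unfolding bb_def using ct by simp
 have cont: "continuous (at t within J) bb" using bb(2) tJ by (simp add: continuous_on_eq_continuous_within)
 obtain O' where O: "open O'" "t : O'" "!!r. r : J ==> r : O' ==> bb r : U"
  using curve_in_open[OF cont bb(1) tJ U_open] one one_in_U by metis
 have at: "at t within J Int O' = at t within J" using at_within_Int_nhd[OF O(1,2)] .
 have "Ck_on (Suc 0) UNIV (J Int O') (coord G o bb)"
  by (rule Ck_on_subset[OF bb(3)[OF id_chart_in]]) (use O in auto)
 then obtain f' where f': "((coord G o bb) has_derivative f') (at t within J Int O')" using tJ O(2) by auto
 then have d: "((coord G o bb) has_vector_derivative f' 1) (at t within J Int O')"
  by (rule has_vector_derivative_of_has_derivative)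
 have V: "f' 1 : model G"
  by (rule has_vector_derivative_in_subspace[OF subspace_model _ _ _ d])
    (use O tJ nb at cdom_def dom_model coord_in_dom in auto)
 have "velocity_at G bb t J (f' 1)"
  unfolding velocity_at_def using tJ one bb(1) cont d V by (simp add: at comp_def)
 moreover have "lv G J c t = f' 1"
  using velocity_at_unique[OF calculation nb] unfolding lv_def left_curve_def bb_def by simp
 ultimately show ?thesis unfolding bb_def J_def by simp
qed

text \<open>The chart in which \<open>lv\<close> is computed is centred at \<open>c t\<close> and
  moves with \<open>t\<close>. Near a fixed time \<open>t0\<close> everything is rewritten in the
  single chart around \<open>c t0\<close>: the left-translated curve is the product of
  \<open>inv (bb t)\<close> and \<open>bb r\<close>, so its derivative is that of
  \<open>mcoord\<close>, which depends continuously on the base point.\<close>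

lemma continuous_on_lv:
 assumes ab: "a < b" and c: "smooth_path_on G {a..b} c"
 shows "continuous_on {a..b} (lv G {a..b} c)"
 unfolding continuous_on_eq_continuous_within
proof
 fix t0 assume t0: "t0 : {a..b}"
 define J where "J = {a..b}"
 have t0J: "t0 : J" using t0 unfolding J_def .
 have cJ: "c r : carrier G" if "r : J" for r using smooth_path_onD(1)[OF c] that unfolding J_def by blast
 define bb where "bb = (%r. inv (c t0) \<otimes> c r)"
 have sb: "smooth_path_on G J bb"
  unfolding bb_def J_def by (intro left_translate_smooth ab c) (use cJ t0J in simp)
 have si: "smooth_path_on G J (%r. inv (bb r))"
  using smooth_path_inv[OF ab] sb unfolding J_def by blast
 note bb = smooth_path_onD[OF sb] and bi = smooth_path_onD[OF si]
 have bbJ: "bb r : carrier G" if "r : J" for r using bb(1) that by blast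
 have one: "bb t0 = \<one>" unfolding bb_def using cJ t0J by simp
 have cont: "continuous (at t within J) bb" "continuous (at t within J) (%r. inv (bb r))" if "t : J" for t
  using bb(2) bi(2) that by (simp_all add: continuous_on_eq_continuous_within)
 have one2: "inv (bb t0) : U" "bb t0 : U" "inv (bb t0) \<otimes> bb t0 : U" using one one_in_U by simp_all
 obtain O' where O: "open O'" "t0 : O'" "!!r. r : J ==> r : O' ==> inv (bb r) : U & bb r : U &
   (coord G (inv (bb r)), coord G (bb r)) : mdom"
  using curve_in_mdom[OF cont(2,1)[OF t0J] bi(1) bb(1) t0J one2] by metis
 define T where "T = J Int O'"
 have atT: "at t within T = at t within J" if "t : T" for t
  unfolding T_def by (rule at_within_Int_nhd) (use that O T_def in auto)
 define \<beta> where "\<beta> = coord G o bb"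
 define \<nu> where "\<nu> = coord G o (%r. inv (bb r))"
 have "Ck_on (Suc 0) UNIV T \<beta>"
  unfolding \<beta>_def by (rule Ck_on_subset[OF bb(3)[OF id_chart_in]]) (use O T_def in auto)
 then obtain f' where f': "!!t. t : T ==> (\<beta> has_derivative f' t) (at t within T)" "!!h. continuous_on T (%t. f' t h)" by auto
 define d where "d t = f' t 1" for t
 have d: "(\<beta> has_vector_derivative d t) (at t within T)" if "t : T" for t
  unfolding d_def by (rule has_vector_derivative_of_has_derivative[OF f'(1)[OF that]])
 have cd: "continuous_on T d" using f'(2) unfolding d_def .
 have nb: "at t within T ~= bot" if "t : T" for t
  unfolding atT[OF that] using at_within_Icc_neq_bot[OF ab] that unfolding J_def T_def by blast
 have dV: "d t : model G" if "t : T" for t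
  by (rule has_vector_derivative_in_subspace[OF subspace_model _ that nb[OF that] d[OF that]])
    (use O T_def \<beta>_def dom_model coord_in_dom in auto)
 have c\<beta>: "continuous_on T \<beta>"
  unfolding \<beta>_def by (rule continuous_on_compose[OF continuous_on_subset[OF bb(2)]])
   (use O T_def in \<open>auto intro: continuous_on_subset[OF continuous_on_coord]\<close>)
 have c\<nu>: "continuous_on T \<nu>"
  unfolding \<nu>_def by (rule continuous_on_compose[OF continuous_on_subset[OF bi(2)]])
   (use O T_def in \<open>auto intro: continuous_on_subset[OF continuous_on_coord]\<close>)
 have inm: "(\<nu> t, \<beta> t) : mdom" if "t : T" for t using O that unfolding T_def \<nu>_def \<beta>_def by simp
 \<comment> \<open>\<open>\<nu> t\<close> and \<open>\<beta> t\<close> are the coordinates of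
   \<open>inv (bb t)\<close> and \<open>bb t\<close>; only the second factor of the product varies
   with \<open>r\<close>.\<close>
 have key: "lv G J c t = mderiv (\<nu> t, \<beta> t) (0, d t)" if t: "t : T" for t
 proof -
  have tJ: "t : J" using t T_def by simp
  have bt: "inv (bb t) : U" "bb t : U" using O t unfolding T_def by simp_all
  have ic: "inv (bb t) : carrier G" using bbJ[OF tJ] by simp
  have im: "(%r. inv (bb t)) ` J <= carrier G" using ic by blast
  have one3: "inv (bb t) \<otimes> bb t : U" using bbJ[OF tJ] one_in_U by simp
  obtain O2 where O2: "open O2" "t : O2" "!!r. r : J ==> r : O2 ==> (coord G (inv (bb t)), coord G (bb r)) : mdom &
    coord G (inv (bb t) \<otimes> bb r) = mcoord (coord G (inv (bb t)), coord G (bb r))"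
   using curve_in_mdom[OF continuous_const cont(1)[OF tJ] im bb(1) tJ bt one3] by metis
  have at2: "at t within T Int O2 = at t within J" using at_within_Int_nhd[OF O2(1,2)] atT[OF t] by simp
  have "((%r. (\<nu> t, \<beta> r)) has_vector_derivative (0, d t)) (at t within T Int O2)"
   using d[OF t] unfolding at2 atT[OF t] by (intro has_vector_derivative_Pair) simp_all
  moreover have "(mcoord has_derivative mderiv (\<nu> t, \<beta> t)) (at (\<nu> t, \<beta> t) within (%r. (\<nu> t, \<beta> r)) ` (T Int O2))"
   by (rule has_derivative_subset[OF mderiv[OF inm[OF t]]]) (use O2(3) in \<open>auto simp: T_def \<nu>_def \<beta>_def\<close>)
  ultimately have "((mcoord o (%r. (\<nu> t, \<beta> r))) has_vector_derivative mderiv (\<nu> t, \<beta> t) (0, d t)) (at t within T Int O2)"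
   by (rule vector_derivative_diff_chain_within)
  then have "((%r. coord G (inv (c t) \<otimes> c r)) has_vector_derivative mderiv (\<nu> t, \<beta> t) (0, d t)) (at t within T Int O2)"
  proof (rule has_vector_derivative_transform[rotated 2])
   show "t : T Int O2" using t O2 by simp
   fix r assume r: "r : T Int O2"
   then have rJ: "r : J" unfolding T_def by simp
   have "inv (bb t) \<otimes> bb r = inv (c t) \<otimes> c r"
    unfolding bb_def using cJ[OF tJ] cJ[OF rJ] cJ[OF t0J] by (simp add: inv_mult_group m_assoc inv_solve_left)
     (metis (no_types, lifting) inv_closed l_one m_assoc m_closed r_inv)
   then show "coord G (inv (c t) \<otimes> c r) = (mcoord o (%r. (\<nu> t, \<beta> r))) r"
    using O2(3)[OF rJ] r unfolding \<nu>_def \<beta>_def by simp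
  qed
  then show ?thesis unfolding lv_def left_curve_def at2
   using vector_derivative_within[of t J] nb[OF t] atT[OF t] by metis
 qed
 obtain B where B: "finite B" "B <= model G" "!!x. x : model G ==> (\<Sum>e\<in>B. (x \<bullet> e) *\<^sub>R e) = x"
  using orthonormal_expansion[OF subspace_model] by metis
 \<comment> \<open>Continuity of \<open>mderiv\<close> is known for fixed directions only, hence the
   expansion of \<open>d t\<close> in a basis.\<close>
 have expand: "mderiv (\<nu> t, \<beta> t) (0, d t) = (\<Sum>e\<in>B. (d t \<bullet> e) *\<^sub>R mderiv (\<nu> t, \<beta> t) (0, e))" if t: "t : T" for t
 proof -
  have "(0, d t) = (\<Sum>e\<in>B. (d t \<bullet> e) *\<^sub>R (0 :: 'e, e))"
   using B(3)[OF dV[OF t]] by (simp add: sum_prod)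
  then have "mderiv (\<nu> t, \<beta> t) (0, d t) = mderiv (\<nu> t, \<beta> t) (\<Sum>e\<in>B. (d t \<bullet> e) *\<^sub>R (0 :: 'e, e))" by (rule arg_cong)
  then show ?thesis using mderiv_linear[OF inm[OF t]] by (simp add: linear_sum linear_scale del: scaleR_Pair)
 qed
 have "continuous_on T (%t. \<Sum>e\<in>B. (d t \<bullet> e) *\<^sub>R mderiv (\<nu> t, \<beta> t) (0, e))"
 proof (intro continuous_on_sum continuous_on_scaleR continuous_on_inner cd continuous_on_const)
  fix e assume e: "e : B"
  have "continuous_on mdom (%p. mderiv p (0, e))"
   using mderiv_Ck[of "(0, e)" 0] e B(2) subspace_0[OF subspace_model] by auto
  then show "continuous_on T (%t. mderiv (\<nu> t, \<beta> t) (0, e))"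
   by (rule continuous_on_compose2) (use inm c\<beta> c\<nu> in \<open>auto intro: continuous_on_Pair\<close>)
 qed
 then have "continuous_on T (lv G J c)"
  by (rule continuous_on_eq) (simp add: key expand)
 then have "continuous (at t0 within T) (lv G J c)"
  using O(2) t0J unfolding T_def by (simp add: continuous_on_eq_continuous_within)
 then show "continuous (at t0 within {a..b}) (lv G {a..b} c)"
  using atT[of t0] O(2) t0J unfolding J_def T_def by simp
qed

end

section \<open>Velocity bounds and uniqueness of paths\<close>

context lie_grp begin

text \<open>\<open>mderiv (y, 0) (0, X)\<close> is the left-invariant vector field with value
  \<open>X\<close> at the identity, read in the chart at \<open>y\<close>. It appears on
  differentiating the product of the fixed \<open>c t\<close> with the left-translated
  curve.\<close>

lemma velocity_at_chart:
 fixes c :: "real => 'a"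
 assumes v: "velocity_at G (%r. inv (c t) \<otimes> c r) t J X" and ct: "c ` J <= carrier G" "c t : U"
 shows "((%r. coord G (c r)) has_vector_derivative mderiv (coord G (c t), 0) (0, X)) (at t within J)"
proof -
 let ?b = "%r. inv (c t) \<otimes> c r"
 have b: "t : J" "?b t = \<one>" "?b ` J <= carrier G" "continuous (at t within J) ?b"
   "((%r. coord G (?b r)) has_vector_derivative X) (at t within J)" "X : model G"
  using v unfolding velocity_at_def by simp_all
 have cc: "c t : carrier G" using ct(1) b(1) by blast
 then have im: "(%r. c t) ` J <= carrier G" by blast
 have p: "c t \<otimes> ?b t : U" using b(2) ct cc by simp
 have b1: "?b t : U" unfolding b(2) by (rule one_in_U)
 obtain O' where O: "open O'" "t : O'" "!!r. r : J ==> r : O' ==> (coord G (c t), coord G (?b r)) : mdom &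
   coord G (c t \<otimes> ?b r) = mcoord (coord G (c t), coord G (?b r))"
  using curve_in_mdom[OF continuous_const b(4) im b(3,1) ct(2) b1 p] by metis
 have at: "at t within J Int O' = at t within J" using at_within_Int_nhd[OF O(1,2)] .
 have "((%r. (coord G (c t), coord G (?b r))) has_vector_derivative (0, X)) (at t within J Int O')"
  using b(5) unfolding at by (intro has_vector_derivative_Pair) simp_all
 moreover have "(mcoord has_derivative mderiv (coord G (c t), 0))
   (at (coord G (c t), coord G (?b t)) within (%r. (coord G (c t), coord G (?b r))) ` (J Int O'))"
  unfolding b(2) coord_one
  by (rule has_derivative_subset[OF mderiv[OF mdom_left[OF coord_in_dom[OF ct(2)]]]]) (use O(3) in auto)
 ultimately have "((mcoord o (%r. (coord G (c t), coord G (?b r)))) has_vector_derivative mderiv (coord G (c t), 0) (0, X)) (at t within J Int O')"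
  by (rule vector_derivative_diff_chain_within)
 then have "((%r. coord G (c r)) has_vector_derivative mderiv (coord G (c t), 0) (0, X)) (at t within J Int O')"
 proof (rule has_vector_derivative_transform[rotated 2])
  show "t : J Int O'" using O b by simp
  fix r assume r: "r : J Int O'"
  then have "c r : carrier G" using ct by blast
  then have "c t \<otimes> ?b r = c r" using cc by (simp add: m_assoc[symmetric])
  then show "coord G (c r) = (mcoord o (%r. (coord G (c t), coord G (?b r)))) r" using O(3)[of r] r by simp
 qed
 then show ?thesis unfolding at .
qed

text \<open>Continuity on a compact ball of the chart; a basis expansion makes the bound uniform in
  the direction \<open>X\<close>.\<close>

lemma chart_bound:
 obtains r0 C where "r0 > 0" "C > 0" "!!y. y : model G ==> norm y <= r0 ==> y : cdom"
  "!!y X. y : model G ==> norm y <= r0 ==> X : model G ==> norm (mderiv (y, 0) (0, X)) <= C * norm X"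
proof -
 obtain T where T: "open T" "cdom = model G Int T" using dom_open unfolding openin_open by blast
 have "0 : T" using T zero_in_dom by blast
 then obtain r0 where r0: "r0 > 0" "cball 0 r0 <= T" using T(1) open_contains_cball by blast
 have d: "y : cdom" if "y : model G" "norm y <= r0" for y using that r0 T by auto
 define K where "K = model G Int cball 0 r0"
 have K: "compact K" unfolding K_def by (intro closed_Int_compact closed_subspace subspace_model compact_cball)
 obtain B where B: "finite B" "B <= model G" "!!x. x : model G ==> (\<Sum>e\<in>B. (x \<bullet> e) *\<^sub>R e) = x"
  using orthonormal_expansion[OF subspace_model] by metis
 have "\<exists>M. \<forall>y\<in>K. norm (mderiv (y, 0) (0, e)) <= M" if e: "e : B" for e
 proof -
  have "continuous_on mdom (%p. mderiv p (0, e))"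
   using mderiv_Ck[of "(0, e)" 0] e B(2) subspace_0[OF subspace_model] by auto
  then have "continuous_on K (%y. mderiv (y, 0) (0, e))"
   by (rule continuous_on_compose2) (use d mdom_left in \<open>auto simp: K_def intro!: continuous_intros\<close>)
  then have "bounded ((%y. mderiv (y, 0) (0, e)) ` K)"
   using K compact_continuous_image compact_imp_bounded by blast
  then show ?thesis unfolding bounded_iff by auto
 qed
 then obtain M where M: "!!e y. e : B ==> y : K ==> norm (mderiv (y, 0) (0, e)) <= M e" by metis
 define C where "C = 1 + (\<Sum>e\<in>B. norm e * \<bar>M e\<bar>)"
 have C: "C > 0" unfolding C_def by (intro add_pos_nonneg sum_nonneg mult_nonneg_nonneg) auto
 have "norm (mderiv (y, 0) (0, X)) <= C * norm X" if y: "y : model G" "norm y <= r0" and X: "X : model G" for y X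
 proof -
  have yK: "y : K" using y unfolding K_def by simp
  have lin: "linear (mderiv (y, 0))" by (rule mderiv_linear[OF mdom_left[OF d[OF y]]])
  have "(0, X) = (\<Sum>e\<in>B. (X \<bullet> e) *\<^sub>R (0 :: 'e, e))" using B(3)[OF X] by (simp add: sum_prod)
  then have "mderiv (y, 0) (0, X) = mderiv (y, 0) (\<Sum>e\<in>B. (X \<bullet> e) *\<^sub>R (0 :: 'e, e))" by (rule arg_cong)
  then have "mderiv (y, 0) (0, X) = (\<Sum>e\<in>B. (X \<bullet> e) *\<^sub>R mderiv (y, 0) (0, e))"
   using lin by (simp add: linear_sum linear_scale del: scaleR_Pair)
  then have "norm (mderiv (y, 0) (0, X)) <= (\<Sum>e\<in>B. norm ((X \<bullet> e) *\<^sub>R mderiv (y, 0) (0, e)))" by (simp only: norm_sum)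
  also have "\<dots> <= (\<Sum>e\<in>B. norm X * (norm e * \<bar>M e\<bar>))"
  proof (rule sum_mono)
   fix e assume e: "e : B"
   have "\<bar>X \<bullet> e\<bar> * norm (mderiv (y, 0) (0, e)) <= (norm X * norm e) * \<bar>M e\<bar>"
    by (rule mult_mono) (use Cauchy_Schwarz_ineq2[of X e] M[OF e yK] in auto)
   then show "norm ((X \<bullet> e) *\<^sub>R mderiv (y, 0) (0, e)) <= norm X * (norm e * \<bar>M e\<bar>)" by (simp add: mult.assoc)
  qed
  also have "\<dots> = norm X * (\<Sum>e\<in>B. norm e * \<bar>M e\<bar>)" by (simp only: sum_distrib_left)
  also have "\<dots> <= C * norm X" unfolding C_def by (simp add: algebra_simps)
  finally show ?thesis .
 qed
 then show ?thesis using that[OF r0(1) C d] by blast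
qed

text \<open>The estimate under the provisional hypothesis that the path remains in the chart ball up
  to time \<open>s\<close>: the derivative of its coordinates is integrated.\<close>

lemma short_path_aux:
 fixes c :: "real => 'a"
 assumes C: "!!y X. y : model G ==> norm y <= r0 ==> X : model G ==> norm (mderiv (y, 0) (0, X)) <= C * norm X" "C > 0"
  and c: "continuous_on {0..1} c" "c ` {0..1} <= carrier G" "c 0 = \<one>" and F: "finite F"
  and v: "!!t. t : {0<..<1} - F ==> velocity_at G (%r. inv (c t) \<otimes> c r) t {0..1} (X t)"
  and I: "(%t. norm (X t)) integrable_on {0..1}"
  and s: "s : {0..1}" "!!t. t : {0..s} ==> c t : U & norm (coord G (c t)) <= r0"
 shows "norm (coord G (c s)) <= C * integral {0..1} (%t. norm (X t))"
proof -
 define d where "d t = (if t : {0<..<s} - F then mderiv (coord G (c t), 0) (0, X t) else 0)" for t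
 have XV: "X t : model G" if "t : {0<..<1} - F" for t using v[OF that] unfolding velocity_at_def by simp
 have "(d has_integral (coord G (c s) - coord G (c 0))) {0..s}"
 proof (rule fundamental_theorem_of_calculus_interior_strong[OF F])
  show "0 <= s" using s by simp
  fix t assume t: "t : {0<..<s} - F"
  then have t1: "t : {0<..<1} - F" "t : {0..s}" using s by auto
  have "((%r. coord G (c r)) has_vector_derivative mderiv (coord G (c t), 0) (0, X t)) (at t within {0..1})"
   by (rule velocity_at_chart[OF v[OF t1(1)] c(2)]) (use s(2)[OF t1(2)] in simp)
  moreover have "at t within {0..1} = at t" using t1 by (auto simp: at_within_Icc_at)
  ultimately show "((%r. coord G (c r)) has_vector_derivative d t) (at t)" using t unfolding d_def by simp
 next
  show "continuous_on {0..s} (%r. coord G (c r))"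
   by (rule continuous_on_compose2[OF continuous_on_coord]) (use s c(1) in \<open>auto intro: continuous_on_subset\<close>)
 qed
 then have di: "(d has_integral coord G (c s)) {0..s}" using c(3) by simp
 have I': "(%t. norm (X t)) integrable_on {0..s}" by (rule integrable_on_subinterval[OF I]) (use s in auto)
 have "norm (integral {0..s} d) <= integral {0..s} (%t. C * norm (X t))"
 proof (rule integral_norm_bound_integral)
  show "d integrable_on {0..s}" using di by blast
  show "(%t. C * norm (X t)) integrable_on {0..s}" using I' by (rule integrable_on_mult_right)
  fix t assume t: "t : {0..s}"
  show "norm (d t) <= C * norm (X t)"
  proof (cases "t : {0<..<s} - F")
   case True
   then have "X t : model G" using XV s by auto
   moreover have "coord G (c t) : model G" "norm (coord G (c t)) <= r0" using s(2)[OF t] coord_in_dom dom_model by auto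
   ultimately show ?thesis using C(1) True unfolding d_def by simp
  next
   case False then show ?thesis using C(2) unfolding d_def by auto
  qed
 qed
 also have "\<dots> = C * integral {0..s} (%t. norm (X t))" by simp
 also have "\<dots> <= C * integral {0..1} (%t. norm (X t))"
  by (rule mult_left_mono[OF integral_subset_le[OF _ I' I]]) (use s C in auto)
 finally show ?thesis using integral_unique[OF di] by simp
qed

text \<open>A first-exit argument removes the confinement hypothesis of
  \<open>short_path_aux\<close>: the bound obtained while the path is in the ball of radius
  \<open>r0\<close> is strictly less than \<open>r0\<close>, so the path cannot leave.\<close>

lemma short_path:
 obtains r0 C where "r0 > 0" "C > 0" "!!y. y : model G ==> norm y <= r0 ==> y : cdom"
 "!!c F X t. continuous_on {0..1::real} c ==> c ` {0..1} <= carrier G ==> c 0 = \<one> ==> finite F ==>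
  (!!t. t : {0<..<1} - F ==> velocity_at G (%r. inv (c t) \<otimes> c r) t {0..1} (X t)) ==>
  (%t. norm (X t)) integrable_on {0..1} ==> C * integral {0..1} (%t. norm (X t)) < r0 ==> t : {0..1} ==>
  c t : U & norm (coord G (c t)) <= C * integral {0..1} (%t. norm (X t))"
proof -
 obtain r0 C where r0: "r0 > 0" "C > 0" "!!y. y : model G ==> norm y <= r0 ==> y : cdom"
  "!!y X. y : model G ==> norm y <= r0 ==> X : model G ==> norm (mderiv (y, 0) (0, X)) <= C * norm X"
  using chart_bound by metis
 have "c t0 : U & norm (coord G (c t0)) <= C * integral {0..1} (%t. norm (X t))"
  if c: "continuous_on {0..1::real} c" "c ` {0..1} <= carrier G" "c 0 = \<one>" "finite F"
  and v: "!!t. t : {0<..<1} - F ==> velocity_at G (%r. inv (c t) \<otimes> c r) t {0..1} (X t)"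
  and I: "(%t. norm (X t)) integrable_on {0..1}" "C * integral {0..1} (%t. norm (X t)) < r0"
  and t0: "t0 : {0..1}" for c F X t0
 proof (rule ccontr)
  define R where "R = C * integral {0..1} (%t. norm (X t))"
  \<comment> \<open>\<open>K\<close> is compact, hence closed in the whole space and not merely in
    the chart domain; this makes the set \<open>A\<close> of times spent in \<open>K\<close>
    closed.\<close>
  define K where "K = uncoord G ` (model G Int cball 0 R)"
  define W where "W = U Int coord G -` ball 0 r0"
  have "0 <= R" unfolding R_def using r0(2) by (intro mult_nonneg_nonneg Henstock_Kurzweil_Integration.integral_nonneg I) auto
  have Kd: "model G Int cball 0 R <= cdom" using r0(3) I(2) unfolding R_def by auto
  have "compact K"
   unfolding K_def by (intro compact_continuous_image continuous_on_subset[OF continuous_on_uncoord Kd] closed_Int_compact closed_subspace subspace_model compact_cball)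
  then have Kc: "closed K" by (rule compact_imp_closed)
  have KU: "x : K \<longleftrightarrow> x : U & norm (coord G x) <= R" for x
  proof
   assume "x : K"
   then show "x : U & norm (coord G x) <= R" unfolding K_def using Kd uncoord_in_U by auto
  next
   assume "x : U & norm (coord G x) <= R"
   then show "x : K" unfolding K_def using dom_model coord_in_dom
    by (intro image_eqI[of _ _ "coord G x"]) auto
  qed
  have KW: "K <= W" using KU I(2) unfolding W_def R_def by auto
  have "openin (top_of_set U) W" unfolding W_def
   by (rule continuous_openin_preimage_gen[OF continuous_on_coord]) simp
  then have Wo: "openin (top_of_set (carrier G)) W" using openin_trans U_open by blast
  define A where "A = {0..1} Int c -` K"
  assume "\<not> (c t0 : U & norm (coord G (c t0)) <= C * integral {0..1} (%t. norm (X t)))"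
  then have t0A: "t0 ~: A" unfolding A_def using KU R_def by auto
  have Acl: "closed A" unfolding A_def by (rule continuous_closed_preimage[OF c(1) _ Kc]) simp
  \<comment> \<open>The supposed first exit time from \<open>K\<close>. It belongs to
    \<open>A\<close>, and some later time outside \<open>A\<close> is reached without leaving
    \<open>W\<close>, where the provisional estimate puts the path back into
    \<open>K\<close>.\<close>
  define T where "T = Inf ({0..1} - A)"
  have ne: "t0 : {0..1} - A" using t0 t0A by blast
  have bd: "bdd_below ({0..1} - A)" by (rule bdd_belowI[of _ 0]) auto
  have T01: "T : {0..1}" using cInf_lower[OF ne bd] ne cInf_greatest[of "{0..1} - A" 0] unfolding T_def by fastforce
  have below: "t : A" if "0 <= t" "t < T" for t
   using cInf_lower[OF _ bd, of t] that T01 unfolding T_def by force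
  have TA: "T : A"
  proof (cases "T = 0")
   case True
   then show ?thesis unfolding A_def using KU[of \<one>] one_in_U c(3) \<open>0 <= R\<close> by simp
  next
   case False
   then have "0 < T" using T01 by simp
   have "closure {0..<T} <= A" by (rule closure_minimal[OF _ Acl]) (use below in auto)
   then show ?thesis using closure_atLeastLessThan[OF \<open>0 < T\<close>] \<open>0 < T\<close> by auto
  qed
  have "c T : W" using TA KW unfolding A_def by blast
  then obtain O' where O: "open O'" "T : O'" "!!r. r : {0..1} ==> r : O' ==> c r : W"
   using curve_in_open[OF _ c(2) T01 Wo] c(1) T01 by (metis continuous_on_eq_continuous_within)
  then obtain \<delta> where \<delta>: "\<delta> > 0" "ball T \<delta> <= O'" using open_contains_ball by blast
  have "\<exists>s\<in>{0..1} - A. s < T + \<delta>"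
   using cInf_lessD[of "{0..1} - A" "T + \<delta>"] ne \<delta>(1) unfolding T_def by force
  then obtain s where s: "s : {0..1}" "s ~: A" "s < T + \<delta>" by blast
  have cW: "c t : W" if "t : {0..s}" for t
  proof (cases "t < T")
   case True then show ?thesis using below that KW unfolding A_def by auto
  next
   case False
   then have "t : ball T \<delta>" using that s(3) by (simp add: dist_real_def)
   then show ?thesis using O(3) \<delta>(2) that s(1) by auto
  qed
  have "norm (coord G (c s)) <= R"
   unfolding R_def by (rule short_path_aux[OF r0(4,2) c v I(1) s(1)]) (use cW in \<open>auto simp: W_def less_imp_le\<close>)
  moreover have "c s : U" using cW[of s] s(1) unfolding W_def by simp
  ultimately show False using s(1,2) KU unfolding A_def by blast
 qed
 then show ?thesis using that[OF r0(1-3)] by blast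
qed

text \<open>The quotient of \<open>c'\<close> by \<open>c\<close> has zero velocity: up to
  conjugation by \<open>c s\<close>, its velocity is \<open>X s - X s\<close>. A path with zero
  velocity stays at the identity by \<open>short_path\<close>.\<close>

lemma path_unique:
 assumes c: "continuous_on {0..1::real} c" "c ` {0..1} <= carrier G"
  and c': "continuous_on {0..1::real} c'" "c' ` {0..1} <= carrier G" "c 0 = c' 0" and F: "finite F"
  and v: "!!t. t : {0<..<1} - F ==> velocity_at G (%r. inv (c t) \<otimes> c r) t {0..1} (X t)"
  and v': "!!t. t : {0<..<1} - F ==> velocity_at G (%r. inv (c' t) \<otimes> c' r) t {0..1} (X t)"
  and t: "t : {0..1}"
 shows "c t = c' t"
proof -
 define f where "f r = c' r \<otimes> inv (c r)" for r
 have cc: "c r : carrier G" "c' r : carrier G" if "r : {0..1}" for r using c(2) c'(2) that by blast+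
 have fc: "f ` {0..1} <= carrier G" unfolding f_def using cc by auto
 have cf: "continuous_on {0..1} f"
  unfolding continuous_on_eq_continuous_within f_def
 proof
  fix s assume s: "s : {0..1::real}"
  have 1: "continuous (at s within {0..1}) c" "continuous (at s within {0..1}) c'"
   using c(1) c'(1) s by (simp_all add: continuous_on_eq_continuous_within)
  have 2: "continuous (at s within {0..1}) (%r. inv (c r))"
   by (rule continuous_within_compose_carrier[OF 1(1) c(2) s smooth_mapD(3)[OF smooth_inv_map]])
  show "continuous (at s within {0..1}) (%r. c' r \<otimes> inv (c r))"
   by (rule continuous_within_mult[OF 1(2) 2 c'(2) _ s]) (use cc in auto)
 qed
 have f0: "f 0 = \<one>" unfolding f_def using c'(3) cc[of 0] by simp
 have vf: "velocity_at G (%r. inv (f s) \<otimes> f r) s {0..1} 0" if s: "s : {0<..<1} - F" for s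
 proof -
  have s1: "s : {0..1}" using s by auto
  have nb: "at s within {0..1} ~= bot" by (rule at_within_Icc_neq_bot) (use s1 in auto)
  obtain L where L: "bounded_linear L"
   "!!b t J X. velocity_at G b t J X ==> velocity_at G (%r. c s \<otimes> b r \<otimes> inv (c s)) t J (L X)"
   using Ad_linear[OF cc(1)[OF s1]] by metis
  have "velocity_at G (%r. (inv (c' s) \<otimes> c' r) \<otimes> inv (inv (c s) \<otimes> c r)) s {0..1} (X s + (- X s))"
   by (rule velocity_at_mult[OF v'[OF s] velocity_at_inv[OF v[OF s] nb]])
  then have "velocity_at G (%r. c s \<otimes> ((inv (c' s) \<otimes> c' r) \<otimes> inv (inv (c s) \<otimes> c r)) \<otimes> inv (c s)) s {0..1} (L 0)"
   using L(2) by simp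
  then show ?thesis
   unfolding linear_0[OF bounded_linear.linear[OF L(1)]]
  proof (rule velocity_at_cong)
   fix r assume r: "r : {0..1::real}"
   note m = cc[OF r] cc[OF s1]
   have "inv (f s) = c s \<otimes> inv (c' s)" "inv (inv (c s) \<otimes> c r) = inv (c r) \<otimes> c s"
    unfolding f_def using m by (simp_all add: inv_mult_group)
   then show "inv (f s) \<otimes> f r = c s \<otimes> ((inv (c' s) \<otimes> c' r) \<otimes> inv (inv (c s) \<otimes> c r)) \<otimes> inv (c s)"
    unfolding f_def using m by (simp add: m_assoc)
  qed
 qed
 obtain r0 C where r0: "r0 > 0" "C > 0" and sp:
 "!!c F X t. continuous_on {0..1::real} c ==> c ` {0..1} <= carrier G ==> c 0 = \<one> ==> finite F ==>
  (!!t. t : {0<..<1} - F ==> velocity_at G (%r. inv (c t) \<otimes> c r) t {0..1} (X t)) ==>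
  (%t. norm (X t)) integrable_on {0..1} ==> C * integral {0..1} (%t. norm (X t)) < r0 ==> t : {0..1} ==>
  c t : U & norm (coord G (c t)) <= C * integral {0..1} (%t. norm (X t))"
  using short_path by metis
 have "f t : U & norm (coord G (f t)) <= C * integral {0..1} (%t. norm (0 :: 'e))"
  using sp[of f F "%_. 0" t] cf fc f0 F vf t r0 by (simp add: integrable_0)
 then have "f t = uncoord G 0" by (metis (mono_tags) norm_zero integral_0 mult_zero_right norm_le_zero_iff uncoord_coord)
 then have "c' t \<otimes> inv (c t) = \<one>" unfolding f_def by simp
 then show ?thesis using cc[OF t] by (metis inv_equality inv_inv inv_closed)
qed

lemma piecewise_smooth_path_velocity:
 assumes "piecewise_smooth_path G x y c"
 obtains F where "finite F" "!!t. t : {0<..<1} - F ==> velocity_at G (%r. inv (c t) \<otimes> c r) t {0..1} (left_velocity G c t)"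
proof -
 obtain F where c: "c 0 = x" "c 1 = y" "c ` {0..1} <= carrier G" "continuous_on {0..1} c" "finite F"
  "!!a b. 0 <= a ==> a < b ==> b <= 1 ==> {a<..<b} Int F = {} ==> smooth_path_on G {a..b} c"
  using piecewise_smooth_pathD[OF assms] by metis
 have "velocity_at G (%r. inv (c t) \<otimes> c r) t {0..1} (left_velocity G c t)" if t: "t : {0<..<1} - F" for t
 proof -
  have "open ({0<..<1} - F)" using c(5) by (intro open_Diff finite_imp_closed) auto
  then obtain e where e: "e > 0" "cball t e <= {0<..<1} - F" using t open_contains_cball by blast
  have eb: "{t - e..t + e} <= {0<..<1} - F" using e(2) by (simp add: cball_eq_atLeastAtMost)
  have "t - e : {t - e..t + e}" "t + e : {t - e..t + e}" using e(1) by auto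
  then have sub: "0 <= t - e" "t + e <= 1" using eb by fastforce+
  have "smooth_path_on G {t - e..t + e} c"
   by (rule c(6)) (use sub e(1) eb in \<open>auto simp: subset_iff\<close>)
  from smooth_path_velocity[OF _ this, of t]
  have "velocity_at G (%r. inv (c t) \<otimes> c r) t {t - e..t + e} (lv G {t-e..t+e} c t)" using e(1) by simp
  moreover have "lv G {t-e..t+e} c t = left_velocity G c t" by (rule lv_interior[OF sub]) (use e in auto)
  moreover have "at t within {t-e..t+e} = at t" "at t within {0..1} = at t" using e(1) t by (auto simp: at_within_Icc_at)
  moreover have "(%r. inv (c t) \<otimes> c r) ` {0..1} <= carrier G" using c(3) t by (auto simp: image_subset_iff)
  ultimately show ?thesis using velocity_at_nhd[of G _ t "{t - e..t + e}" _ "{0..1}"] t by auto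
 qed
 then show ?thesis using that c(5) by blast
qed

end

section \<open>Piecewise smooth connectedness, and homomorphisms with given differential\<close>

context lie_grp begin

lemma smooth_path_uncoord_line:
 assumes X: "!!t. t : {0..1} ==> t *\<^sub>R X : cdom" and XV: "X : model G"
 shows "smooth_path_on G {0..1} (%t. uncoord G (t *\<^sub>R X))"
proof (rule smooth_path_onI)
 show im: "(%t. uncoord G (t *\<^sub>R X)) ` {0..1} <= carrier G" using X uncoord_in_U U_carrier by blast
 show con: "continuous_on {0..1} (%t. uncoord G (t *\<^sub>R X))"
  by (rule continuous_on_compose2[OF continuous_on_uncoord]) (use X in \<open>auto intro!: continuous_intros\<close>)
 fix W \<psi> n assume W: "(W, \<psi>) : atlas G"
 let ?S = "{0..1} Int (%t. uncoord G (t *\<^sub>R X)) -` W"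
 have "openin (top_of_set {0..1}) ?S"
  by (rule continuous_openin_preimage[OF con _ smooth_atlasD(3)[OF atlas_G W]]) (use im in auto)
 then have S: "tangent_full UNIV ?S" by (rule tangent_full_interval[rotated]) simp
 have "Ck_on n UNIV ?S (%t. (\<psi> o uncoord G) (t *\<^sub>R X))"
 proof (rule Ck_on_compose[OF S subspace_model, where f = "%t. t *\<^sub>R X" and g = "\<psi> o uncoord G"])
  show "Ck_on n UNIV ?S (%t. t *\<^sub>R X)" by (rule Ck_on_linear) (rule bounded_linear_scaleR_left)
  show "Ck_on n (model G) (coord G ` (U Int W)) (\<psi> o uncoord G)"
   using smooth_atlasD(6)[OF atlas_G id_chart_in W] unfolding smooth_on_def by simp
  show "(%t. t *\<^sub>R X) ` ?S <= coord G ` (U Int W)"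
  proof
   fix y assume "y : (%t. t *\<^sub>R X) ` ?S"
   then obtain t where t: "y = t *\<^sub>R X" "t : {0..1}" "uncoord G (t *\<^sub>R X) : W" by blast
   then show "y : coord G ` (U Int W)" using X[OF t(2)] uncoord_in_U
    by (intro image_eqI[of _ _ "uncoord G y"]) auto
  qed
  show "!!t. t *\<^sub>R X : model G" using XV subspace_scale subspace_model by blast
 qed
 then show "Ck_on n UNIV ?S (\<psi> o (%t. uncoord G (t *\<^sub>R X)))" by (simp add: comp_def)
qed

lemma smooth_imp_piecewise_smooth_path:
 assumes "smooth_path_on G {0..1} c" shows "piecewise_smooth_path G (c 0) (c 1) c"
 unfolding piecewise_smooth_path_def
proof (intro conjI exI[of _ "{}"] allI impI)
 show "c ` {0..1} <= carrier G" "continuous_on {0..1} c" using smooth_path_onD[OF assms] by simp_all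
 fix a b :: real assume "0 <= a & a < b & b <= 1 & {a<..<b} Int {} = {}"
 then show "smooth_path_on G {a..b} c" using smooth_path_on_subset[OF assms] by auto
qed auto

text \<open>Being joined by a piecewise smooth path is an equivalence relation whose classes are
  open, since a translated coordinate ball around each point can be reached by line segments of the
  chart.\<close>

lemma piecewise_smooth_path_exists:
 assumes con: "connected (carrier G)" and x: "x : carrier G" and y: "y : carrier G"
 obtains c where "piecewise_smooth_path G x y c"
proof -
 obtain T where T: "open T" "cdom = model G Int T" using dom_open unfolding openin_open by blast
 have "0 : T" using T zero_in_dom by blast
 then obtain r0 where r0: "r0 > 0" "ball 0 r0 <= T" using T(1) open_contains_ball by blast
 define W0 where "W0 = U Int coord G -` ball 0 r0"
 have "openin (top_of_set U) W0" unfolding W0_def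
  by (rule continuous_openin_preimage_gen[OF continuous_on_coord]) simp
 then have W0: "openin (top_of_set (carrier G)) W0" using openin_trans U_open by blast
 have loc: "\<exists>c. piecewise_smooth_path G x y c" if x: "x : carrier G" and y: "y : carrier G" "inv x \<otimes> y : W0" for x y
 proof -
  define X where "X = coord G (inv x \<otimes> y)"
  have XV: "X : model G" unfolding X_def using y(2) coord_in_dom dom_model unfolding W0_def by blast
  have X: "t *\<^sub>R X : cdom" if t: "t : {0..1}" for t
  proof -
   have "norm (t *\<^sub>R X) <= norm X" using t by (simp add: mult_left_le_one_le)
   also have "\<dots> < r0" using y(2) unfolding W0_def X_def by simp
   finally show ?thesis using r0(2) T(2) subspace_scale[OF subspace_model XV] by auto
  qed
  have "smooth_path_on G {0..1} (%t. x \<otimes> uncoord G (t *\<^sub>R X))"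
   by (rule left_translate_smooth[OF x _ smooth_path_uncoord_line[OF X XV]]) simp
  from smooth_imp_piecewise_smooth_path[OF this]
  have "piecewise_smooth_path G (x \<otimes> \<one>) (x \<otimes> uncoord G X) (%t. x \<otimes> uncoord G (t *\<^sub>R X))" by simp
  moreover have "x \<otimes> uncoord G X = y"
   using y x unfolding X_def W0_def by (simp add: m_assoc[symmetric])
  ultimately show ?thesis using x by auto
 qed
 have "\<exists>c. piecewise_smooth_path G x y c"
 proof (rule connected_equivalence_relation[OF con x y, where R = "%x y. \<exists>c. piecewise_smooth_path G x y c"])
  show "\<exists>c. piecewise_smooth_path G y x c" if "\<exists>c. piecewise_smooth_path G x y c" for x y
   using that piecewise_smooth_path_reverse by blast
  show "\<exists>c. piecewise_smooth_path G x z c"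
   if "\<exists>c. piecewise_smooth_path G x y c" "\<exists>c. piecewise_smooth_path G y z c" for x y z
   using that piecewise_smooth_path_join by blast
  fix a assume a: "a : carrier G"
  have "continuous_on (carrier G) (%y. inv a \<otimes> y)"
   by (rule smooth_mapD(3)[OF smooth_map_mult[OF source_G smooth_map_const smooth_map_id[OF atlas_G]]]) (use a in simp)
  from continuous_openin_preimage[OF this _ W0]
  have "openin (top_of_set (carrier G)) (carrier G Int (%y. inv a \<otimes> y) -` W0)" using a by auto
  moreover have "a : carrier G Int (%y. inv a \<otimes> y) -` W0" using a one_in_U r0(1) unfolding W0_def by simp
  ultimately show "\<exists>T. openin (top_of_set (carrier G)) T & a : T & (\<forall>x\<in>T. \<exists>c. piecewise_smooth_path G a x c)"
   using loc[OF a] by blast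
 qed
 then show ?thesis using that by blast
qed

end

text \<open>Along a path from the identity to \<open>x\<close> the two image paths start together
  and have equal velocities, so \<open>path_unique\<close> applies.\<close>

lemma lie_hom_unique:
 fixes G :: "('a::{t2_space, second_countable_topology}, 'e::euclidean_space) lie_struct"
  and H :: "('b::{t2_space, second_countable_topology}, 'f::euclidean_space) lie_struct"
 assumes G: "lie_group G" and H: "lie_group H" and con: "connected (carrier G)"
  and f: "lie_hom G H f" and g: "lie_hom G H g"
  and eq: "!!X. X : model G ==> differential G H f X = differential G H g X"
  and x: "x : carrier G"
 shows "f x = g x"
proof -
 interpret G: lie_grp G by unfold_locales fact
 interpret H: lie_grp H by unfold_locales fact
 have hom: "group_hom G H f" "group_hom G H g"
  using f g unfolding lie_hom_def by (auto intro!: group_hom.intro G.is_group H.is_group simp: group_hom_axioms_def)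
 interpret f: group_hom G H f by (rule hom)
 interpret g: group_hom G H g by (rule hom)
 have sf: "smooth_map (carrier G) (model G) (atlas G) (carrier H) (atlas H) f"
  and sg: "smooth_map (carrier G) (model G) (atlas G) (carrier H) (atlas H) g"
  using f g unfolding lie_hom_def by simp_all
 obtain L where L: "!!X. X : model G ==> L X = differential G H f X"
  "!!b t J X. velocity_at G b t J X ==> velocity_at H (%r. f (b r)) t J (L X)"
  using velocity_at_map[OF G H sf] f.hom_one by metis
 obtain L' where L': "!!X. X : model G ==> L' X = differential G H g X"
  "!!b t J X. velocity_at G b t J X ==> velocity_at H (%r. g (b r)) t J (L' X)"
  using velocity_at_map[OF G H sg] g.hom_one by metis
 obtain c where c: "piecewise_smooth_path G \<one>\<^bsub>G\<^esub> x c"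
  using G.piecewise_smooth_path_exists[OF con _ x] by blast
 obtain F where F: "finite F" "!!t. t : {0<..<1} - F ==> velocity_at G (%r. inv\<^bsub>G\<^esub> (c t) \<otimes>\<^bsub>G\<^esub> c r) t {0..1} (left_velocity G c t)"
  using G.piecewise_smooth_path_velocity[OF c] by metis
 have cc: "c 0 = \<one>\<^bsub>G\<^esub>" "c 1 = x" "c ` {0..1} <= carrier G" "continuous_on {0..1} c"
  using piecewise_smooth_pathD[OF c] by metis+
 have fc: "f ` carrier G <= carrier H" "g ` carrier G <= carrier H" by auto
 have "(%t. f (c t)) 1 = (%t. g (c t)) 1"
 proof (rule H.path_unique[OF _ _ _ _ _ F(1), where X = "%t. L (left_velocity G c t)"])
  show "continuous_on {0..1} (%t. f (c t))" "continuous_on {0..1} (%t. g (c t))"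
   using continuous_on_compose2[OF smooth_mapD(3)[OF sf] cc(4,3)] continuous_on_compose2[OF smooth_mapD(3)[OF sg] cc(4,3)] by simp_all
  show "(%t. f (c t)) ` {0..1} <= carrier H" "(%t. g (c t)) ` {0..1} <= carrier H" using cc(3) fc by blast+
  show "f (c 0) = g (c 0)" unfolding cc(1) by simp
  fix t assume t: "t : {0<..<1} - F"
  then have ct: "c t : carrier G" using cc(3) by auto
  have "left_velocity G c t : model G" using F(2)[OF t] unfolding velocity_at_def by simp
  then have LL: "L' (left_velocity G c t) = L (left_velocity G c t)" using L(1) L'(1) eq by simp
  show "velocity_at H (%r. inv\<^bsub>H\<^esub> (f (c t)) \<otimes>\<^bsub>H\<^esub> f (c r)) t {0..1} (L (left_velocity G c t))"
   by (rule velocity_at_cong[OF L(2)[OF F(2)[OF t]]]) (use ct cc(3) in \<open>auto simp: image_subset_iff\<close>)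
  show "velocity_at H (%r. inv\<^bsub>H\<^esub> (g (c t)) \<otimes>\<^bsub>H\<^esub> g (c r)) t {0..1} (L (left_velocity G c t))"
   unfolding LL[symmetric]
   by (rule velocity_at_cong[OF L'(2)[OF F(2)[OF t]]]) (use ct cc(3) in \<open>auto simp: image_subset_iff\<close>)
 qed simp
 then show ?thesis using cc(2) by simp
qed

section \<open>The bracket\<close>

context lie_grp begin

lemma Ad_in_model: "x : carrier G ==> X : model G ==> Ad G x X : model G"
proof -
 assume x: "x : carrier G" and X: "X : model G"
 obtain L where L: "!!X. X : model G ==> L X = Ad G x X"
  "!!b t J X. velocity_at G b t J X ==> velocity_at G (%r. x \<otimes> b r \<otimes> inv x) t J (L X)"
  using Ad_linear[OF x] by metis
 obtain J where "velocity_at G (%r. uncoord G (r *\<^sub>R X)) 0 J X" using velocity_at_uncoord[OF X] by metis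
 from L(2)[OF this] L(1)[OF X] show ?thesis unfolding velocity_at_def by simp
qed

lemma Ad_velocity:
 assumes "x : carrier G" "velocity_at G b t J X"
 shows "velocity_at G (%r. x \<otimes> b r \<otimes> inv x) t J (Ad G x X)"
proof -
 obtain L where L: "!!X. X : model G ==> L X = Ad G x X"
  "!!b t J X. velocity_at G b t J X ==> velocity_at G (%r. x \<otimes> b r \<otimes> inv x) t J (L X)"
  using Ad_linear[OF assms(1)] by metis
 then show ?thesis using assms(2) unfolding velocity_at_def by metis
qed

text \<open>Conjugation by \<open>uncoord G y\<close> is a left followed by a right multiplication,
  so its differential is a composite of two partial derivatives of \<open>mcoord\<close>. Smooth
  dependence on \<open>y\<close> can be read off.\<close>

lemma Ad_chart:
 assumes y: "y : cdom" "inv (uncoord G y) : U" and Y: "Y : model G"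
 shows "Ad G (uncoord G y) Y = mderiv (y, coord G (inv (uncoord G y))) (mderiv (y, 0) (0, Y), 0)"
  "mderiv (y, 0) (0, Y) : model G"
proof -
 define u where "u = uncoord G y"
 have u: "u : U" "u : carrier G" "coord G u = y" unfolding u_def using y uncoord_in_U U_carrier by auto
 obtain J where J: "open J" "(0::real) : J" "!!r. r : J ==> r *\<^sub>R Y : cdom" "velocity_at G (%r. uncoord G (r *\<^sub>R Y)) 0 J Y"
  using velocity_at_uncoord[OF Y] by metis
 define g where "g = (%r. u \<otimes> uncoord G (r *\<^sub>R Y))"
 have bc: "uncoord G (r *\<^sub>R Y) : carrier G" if "r : J" for r using J(3)[OF that] uncoord_in_U U_carrier by blast
 then have gc: "g ` J <= carrier G" unfolding g_def using u by auto
 have g0: "g 0 = u" unfolding g_def using u by simp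
 have v: "velocity_at G (%r. inv (g 0) \<otimes> g r) 0 J Y"
 proof (rule velocity_at_cong[OF J(4)])
  fix r assume "r : J"
  from bc[OF this] show "inv (g 0) \<otimes> g r = uncoord G (r *\<^sub>R Y)"
   unfolding g0 g_def using u m_assoc[of "inv u" u "uncoord G (r *\<^sub>R Y)"] by simp
 qed
 have at: "at 0 within J = at 0" by (rule at_within_open[OF J(2,1)])
 have nb: "at 0 within J ~= bot" unfolding at by simp
 have dg: "((%r. coord G (g r)) has_vector_derivative mderiv (y, 0) (0, Y)) (at 0 within J)"
  using velocity_at_chart[OF v gc] u g0 by simp
 have cg: "continuous (at 0 within J) g"
 proof -
  have "continuous (at 0 within J) (%r. uncoord G (r *\<^sub>R Y))" using J(4) unfolding velocity_at_def by simp
  then show ?thesis unfolding g_def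
   by (rule continuous_within_mult[OF continuous_const _ _ _ J(2)]) (use u bc in auto)
 qed
 obtain O' where O: "open O'" "0 : O'" "!!r. r : J ==> r : O' ==> g r : U"
  using curve_in_open[OF cg gc J(2) U_open] g0 u by metis
 show Z: "mderiv (y, 0) (0, Y) : model G"
 proof (rule has_vector_derivative_in_subspace[OF subspace_model])
  show "((%r. coord G (g r)) has_vector_derivative mderiv (y, 0) (0, Y)) (at 0 within J Int O')"
   "at 0 within J Int O' ~= bot"
   using dg nb at_within_Int_nhd[OF O(1,2)] by simp_all
 qed (use O J coord_in_dom dom_model in auto)
 define w where "w = inv u"
 have w: "w : U" "w : carrier G" using y(2) u unfolding w_def u_def by simp_all
 have im: "(%r. w) ` J <= carrier G" using w by blast
 have p: "g 0 : U" "g 0 \<otimes> w : U" unfolding g0 w_def using u one_in_U by simp_all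
 obtain O2 where O2: "open O2" "0 : O2" "!!r. r : J ==> r : O2 ==> (coord G (g r), coord G w) : mdom &
    coord G (g r \<otimes> w) = mcoord (coord G (g r), coord G w)"
  using curve_in_mdom[OF cg continuous_const gc im J(2) p(1) w(1) p(2)] by metis
 have at2: "at 0 within J Int O2 = at 0 within J" using at_within_Int_nhd[OF O2(1,2)] .
 have inm: "(y, coord G w) : mdom" using O2(3)[OF J(2) O2(2)] g0 u by simp
 have "((%r. (coord G (g r), coord G w)) has_vector_derivative (mderiv (y, 0) (0, Y), 0)) (at 0 within J Int O2)"
  using dg unfolding at2 by (intro has_vector_derivative_Pair) simp_all
 moreover have "(mcoord has_derivative mderiv (y, coord G w)) (at (coord G (g 0), coord G w) within (%r. (coord G (g r), coord G w)) ` (J Int O2))"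
  unfolding g0 u(3) by (rule has_derivative_subset[OF mderiv[OF inm]]) (use O2(3) in auto)
 ultimately have "((mcoord o (%r. (coord G (g r), coord G w))) has_vector_derivative mderiv (y, coord G w) (mderiv (y, 0) (0, Y), 0)) (at 0 within J Int O2)"
  by (rule vector_derivative_diff_chain_within)
 then have 1: "((%r. coord G (g r \<otimes> w)) has_vector_derivative mderiv (y, coord G w) (mderiv (y, 0) (0, Y), 0)) (at 0 within J Int O2)"
  by (rule has_vector_derivative_transform[rotated 2]) (use O2 J in auto)
 have "velocity_at G (%r. u \<otimes> uncoord G (r *\<^sub>R Y) \<otimes> inv u) 0 J (Ad G u Y)"
  by (rule Ad_velocity[OF u(2) J(4)])
 then have 2: "((%r. coord G (g r \<otimes> w)) has_vector_derivative Ad G u Y) (at 0 within J)"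
  unfolding velocity_at_def g_def w_def by simp
 show "Ad G (uncoord G y) Y = mderiv (y, coord G (inv (uncoord G y))) (mderiv (y, 0) (0, Y), 0)"
  using vector_derivative_unique_within[OF nb 2 1[unfolded at2]] unfolding u_def w_def .
qed

text \<open>\<open>lie_bracket\<close> differentiates \<open>Ad\<close> along a coordinate line. A
  homomorphism maps this line to some other curve, so it must be known that the derivative depends
  only on the velocity of the curve.\<close>

lemma Ad_curve_derivative:
 assumes Y: "Y : model G"
 obtains \<xi> where "!!b J X. velocity_at G b 0 J X ==> ((%r. Ad G (b r) Y) has_vector_derivative \<xi> X) (at 0 within J)"
proof -
 define T0 where "T0 = coord G ` (U Int (%x. inv x) -` U)"
 have T0: "tangent_full (model G) T0"
  unfolding T0_def by (rule source_atlas_tangent_full[OF source_G id_chart_in smooth_mapD(3,2)[OF smooth_inv_map] U_open])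
 have T0d: "y : cdom" "inv (uncoord G y) : U" if "y : T0" for y using that coord_in_dom unfolding T0_def by auto
 have T0I: "coord G x : T0" if "x : U" "inv x : U" for x using that unfolding T0_def by auto
 have z: "0 : T0" using T0I[of \<one>] one_in_U by simp
 define \<nu> where "\<nu> = coord G o (%x. inv x) o uncoord G"
 have \<nu>: "Ck_on n (model G) T0 \<nu>" for n
  unfolding \<nu>_def T0_def by (rule smooth_mapD(4)[OF smooth_inv_map id_chart_in id_chart_in])
 have \<nu>V: "\<nu> y : model G" if "y : T0" for y unfolding \<nu>_def using T0d[OF that] coord_in_dom dom_model by simp
 have inm: "(y, \<nu> y) : mdom" if y: "y : T0" for y
  unfolding mdom_def \<nu>_def using T0d[OF y] coord_in_dom uncoord_in_U[OF T0d(1)[OF y]] U_carrier one_in_U by simp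
 obtain B where B: "finite B" "B <= model G" "!!x. x : model G ==> (\<Sum>e\<in>B. (x \<bullet> e) *\<^sub>R e) = x"
  using orthonormal_expansion[OF subspace_model] by metis
 note sub = subspace_Times[OF subspace_model subspace_model]
 have zV: "0 : model G" by (rule subspace_0[OF subspace_model])
 define Z where "Z y = mderiv (y, 0) (0, Y)" for y
 have idCk: "Ck_on 1 (model G) T0 (%y. y)" by (rule Ck_on_linear[OF bounded_linear_ident])
 have ZC: "Ck_on 1 (model G) T0 Z"
  unfolding Z_def
 proof (rule Ck_on_compose[OF T0 sub, where f = "%y. (y, 0)" and g = "%p. mderiv p (0, Y)"])
  show "Ck_on 1 (model G) T0 (%y. (y, 0 :: 'e))" by (rule Ck_on_Pair[OF idCk Ck_on_const])
  show "Ck_on 1 (model G \<times> model G) mdom (%p. mderiv p (0, Y))" by (rule mderiv_Ck) (use Y zV in simp)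
 qed (use T0d dom_model zV mdom_left in auto)
 have mC: "Ck_on 1 (model G) T0 (%y. mderiv (y, \<nu> y) (e, 0))" if e: "e : B" for e
 proof (rule Ck_on_compose[OF T0 sub, where f = "%y. (y, \<nu> y)" and g = "%p. mderiv p (e, 0)"])
  show "Ck_on 1 (model G) T0 (%y. (y, \<nu> y))" by (rule Ck_on_Pair[OF idCk \<nu>])
  show "Ck_on 1 (model G \<times> model G) mdom (%p. mderiv p (e, 0))" by (rule mderiv_Ck) (use e B zV in auto)
 qed (use T0d dom_model \<nu>V inm in auto)
 have "Ck_on 1 (model G) T0 (%y. \<Sum>e\<in>B. (Z y \<bullet> e) *\<^sub>R mderiv (y, \<nu> y) (e, 0))"
  by (intro Ck_on_sum Ck_on_scaleR mC Ck_on_bounded_linear[OF bounded_linear_inner_left ZC])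
 moreover have "(\<Sum>e\<in>B. (Z y \<bullet> e) *\<^sub>R mderiv (y, \<nu> y) (e, 0)) = Ad G (uncoord G y) Y" if y: "y : T0" for y
 proof -
  have "Z y : model G" unfolding Z_def using Ad_chart(2)[OF T0d[OF y] Y] .
  then have "(Z y, 0) = (\<Sum>e\<in>B. (Z y \<bullet> e) *\<^sub>R (e, 0 :: 'e))" using B(3) by (simp add: sum_prod)
  then have "mderiv (y, \<nu> y) (Z y, 0) = mderiv (y, \<nu> y) (\<Sum>e\<in>B. (Z y \<bullet> e) *\<^sub>R (e, 0 :: 'e))" by (rule arg_cong)
  also have "\<dots> = (\<Sum>e\<in>B. (Z y \<bullet> e) *\<^sub>R mderiv (y, \<nu> y) (e, 0))"
   using mderiv_linear[OF inm[OF y]] by (simp add: linear_sum linear_scale del: scaleR_Pair)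
  finally show ?thesis using Ad_chart(1)[OF T0d[OF y] Y] unfolding Z_def \<nu>_def by simp
 qed
 ultimately have "Ck_on (Suc 0) (model G) T0 (%y. Ad G (uncoord G y) Y)" using Ck_on_cong by (metis (no_types, lifting) One_nat_def)
 then obtain \<xi> where \<xi>: "((%y. Ad G (uncoord G y) Y) has_derivative \<xi>) (at 0 within T0)" using z by auto
 have "((%r. Ad G (b r) Y) has_vector_derivative \<xi> X) (at 0 within J)" if v: "velocity_at G b 0 J X" for b J X
 proof -
  have b: "0 : J" "b 0 = \<one>" "b ` J <= carrier G" "continuous (at 0 within J) b"
   "((%r. coord G (b r)) has_vector_derivative X) (at 0 within J)"
   using v unfolding velocity_at_def by simp_all
  have ci: "continuous (at 0 within J) (%r. inv (b r))"
   by (rule continuous_within_compose_carrier[OF b(4,3,1) smooth_mapD(3)[OF smooth_inv_map]])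
  obtain O1 where O1: "open O1" "0 : O1" "!!r. r : J ==> r : O1 ==> b r : U"
   using curve_in_open[OF b(4,3,1) U_open] b(2) one_in_U by metis
  have ib: "(%r. inv (b r)) ` J <= carrier G" "inv (b 0) : U" using b(2,3) one_in_U by auto
  obtain O2 where O2: "open O2" "0 : O2" "!!r. r : J ==> r : O2 ==> inv (b r) : U"
   using curve_in_open[OF ci ib(1) b(1) U_open ib(2)] by metis
  have at: "at 0 within J Int (O1 Int O2) = at 0 within J" by (rule at_within_Int_nhd) (use O1 O2 in auto)
  have "((%y. Ad G (uncoord G y) Y) has_derivative \<xi>) (at (coord G (b 0)) within (%r. coord G (b r)) ` (J Int (O1 Int O2)))"
   unfolding b(2) coord_one by (rule has_derivative_subset[OF \<xi>]) (use O1 O2 T0I in auto)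
  from vector_derivative_diff_chain_within[OF b(5)[folded at] this]
  have "((%r. Ad G (b r) Y) has_vector_derivative \<xi> X) (at 0 within J Int (O1 Int O2))"
   by (rule has_vector_derivative_transform[rotated 2]) (use O1 O2 b(1) in auto)
  then show ?thesis unfolding at .
 qed
 then show ?thesis using that by blast
qed

text \<open>Differentiate the identity \<open>L (Ad G a Y) = Ad G (f a) (L Y)\<close> along a curve
  \<open>a\<close> through the identity.\<close>

lemma lie_bracket_hom:
 assumes f: "f : hom G G" "smooth_map (carrier G) (model G) (atlas G) (carrier G) (atlas G) f"
  and L: "bounded_linear L" "!!b t J X. velocity_at G b t J X ==> velocity_at G (%r. f (b r)) t J (L X)"
  and X: "X : model G" and Y: "Y : model G"
 shows "L (lie_bracket G X Y) = lie_bracket G (L X) (L Y)"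
proof -
 interpret f: group_hom G G f using f(1) by (intro group_hom.intro is_group) (simp add: group_hom_axioms_def)
 have LV: "L X : model G" if X: "X : model G" for X
 proof -
  obtain J where "velocity_at G (%r. uncoord G (r *\<^sub>R X)) 0 J X" using velocity_at_uncoord[OF X] by metis
  from L(2)[OF this] show ?thesis unfolding velocity_at_def by simp
 qed
 have LAd: "L (Ad G a Y) = Ad G (f a) (L Y)" if a: "a : carrier G" for a
 proof -
  obtain J where J: "open J" "(0::real) : J" "velocity_at G (%r. uncoord G (r *\<^sub>R Y)) 0 J Y" using velocity_at_uncoord[OF Y] by metis
  have "velocity_at G (%r. f (a \<otimes> uncoord G (r *\<^sub>R Y) \<otimes> inv a)) 0 J (L (Ad G a Y))"
   by (rule L(2)[OF Ad_velocity[OF a J(3)]])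
  moreover have "velocity_at G (%r. f (a \<otimes> uncoord G (r *\<^sub>R Y) \<otimes> inv a)) 0 J (Ad G (f a) (L Y))"
   by (rule velocity_at_cong[OF Ad_velocity[OF _ L(2)[OF J(3)]]])
     (use a J(3) in \<open>auto simp: velocity_at_def image_subset_iff\<close>)
  moreover have "at 0 within J ~= bot" unfolding at_within_open[OF J(2,1)] by simp
  ultimately show ?thesis using velocity_at_unique by metis
 qed
 obtain J where J: "open J" "(0::real) : J" "velocity_at G (%r. uncoord G (r *\<^sub>R X)) 0 J X" using velocity_at_uncoord[OF X] by metis
 obtain J' where J': "open J'" "(0::real) : J'" "velocity_at G (%r. uncoord G (r *\<^sub>R L X)) 0 J' (L X)" using velocity_at_uncoord[OF LV[OF X]] by metis
 have at: "at 0 within J = at 0" "at 0 within J' = at 0" by (rule at_within_open[OF J(2,1)], rule at_within_open[OF J'(2,1)])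
 obtain \<xi> where \<xi>: "!!b J X. velocity_at G b 0 J X ==> ((%r. Ad G (b r) Y) has_vector_derivative \<xi> X) (at 0 within J)"
  using Ad_curve_derivative[OF Y] by metis
 obtain \<eta> where \<eta>: "!!b J X. velocity_at G b 0 J X ==> ((%r. Ad G (b r) (L Y)) has_vector_derivative \<eta> X) (at 0 within J)"
  using Ad_curve_derivative[OF LV[OF Y]] by metis
 have 1: "lie_bracket G X Y = \<xi> X" unfolding lie_bracket_def
  using \<xi>[OF J(3)] unfolding at by (rule vector_derivative_at)
 have 2: "lie_bracket G (L X) (L Y) = \<eta> (L X)" unfolding lie_bracket_def
  using \<eta>[OF J'(3)] unfolding at by (rule vector_derivative_at)
 have "((%r. L (Ad G (uncoord G (r *\<^sub>R X)) Y)) has_vector_derivative L (\<xi> X)) (at 0 within J)"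
  by (rule bounded_linear.has_vector_derivative[OF L(1) \<xi>[OF J(3)]])
 moreover have "((%r. L (Ad G (uncoord G (r *\<^sub>R X)) Y)) has_vector_derivative \<eta> (L X)) (at 0 within J)"
  using \<eta>[OF L(2)[OF J(3)]]
  by (rule has_vector_derivative_transform[rotated 2]) (use J LAd in \<open>auto simp: velocity_at_def image_subset_iff\<close>)
 ultimately have "L (\<xi> X) = \<eta> (L X)" unfolding at by (rule vector_derivative_unique_at)
 then show ?thesis using 1 2 by simp
qed

end

section \<open>The exponential of a linear map\<close>

lemma has_vector_derivative_reflect:
 assumes "(z has_vector_derivative d) (at (- s))" shows "((%s. z (- s)) has_vector_derivative - d) (at (s::real))"
proof -
 have "(uminus has_vector_derivative - 1) (at s)" using has_vector_derivative_minus[OF has_vector_derivative_id] by simp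
 from vector_diff_chain_at[OF this assms] show ?thesis by (simp add: comp_def)
qed

lemma has_vector_derivative_shift:
 assumes "(z has_vector_derivative d) (at (s + t))" shows "((%s. z (s + t)) has_vector_derivative d) (at (s::real))"
proof -
 have "((%s. s + t) has_vector_derivative 1) (at s)"
  using has_vector_derivative_add[OF has_vector_derivative_id has_vector_derivative_const] by simp
 from vector_diff_chain_at[OF this assms] show ?thesis by (simp add: comp_def)
qed

lemma lin_exp_sums:
 fixes D :: "'e::euclidean_space => 'e"
 assumes D: "linear D"
 shows "(%n. (t ^ n / fact n) *\<^sub>R (D ^^ n) X) sums lin_exp (%Y. t *\<^sub>R D Y) X"
proof -
 have pow: "((%Y. t *\<^sub>R D Y) ^^ n) X = t ^ n *\<^sub>R (D ^^ n) X" for n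
  by (induction n) (simp_all add: linear_scale[OF D])
 have tm: "((%Y. t *\<^sub>R D Y) ^^ n) X /\<^sub>R fact n = (t ^ n / fact n) *\<^sub>R (D ^^ n) X" for n
  unfolding pow by (simp add: divide_inverse_commute)
 obtain B where B: "B > 0" "!!x. norm (D x) <= B * norm x"
  using linear_bounded_pos[OF D] by blast
 have nb: "norm ((D ^^ n) X) <= B ^ n * norm X" for n
 proof (induction n)
  case (Suc n)
  have "norm ((D ^^ Suc n) X) <= B * norm ((D ^^ n) X)" using B(2) by simp
  also have "\<dots> <= B * (B ^ n * norm X)" using Suc B(1) by simp
  finally show ?case by (simp add: mult.assoc)
 qed simp
 have "summable (%n. (t ^ n / fact n) *\<^sub>R (D ^^ n) X)"
 proof (rule summable_comparison_test)
  show "summable (%n. inverse (fact n) * (\<bar>t\<bar> * B) ^ n * norm X)"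
   by (rule summable_mult2[OF summable_exp])
  have "norm ((t ^ n / fact n) *\<^sub>R (D ^^ n) X) <= inverse (fact n) * (\<bar>t\<bar> * B) ^ n * norm X" for n
  proof -
   have "norm ((t ^ n / fact n) *\<^sub>R (D ^^ n) X) = (\<bar>t\<bar> ^ n / fact n) * norm ((D ^^ n) X)"
    by (simp add: power_abs)
   also have "\<dots> <= (\<bar>t\<bar> ^ n / fact n) * (B ^ n * norm X)" by (rule mult_left_mono[OF nb]) simp
   finally show ?thesis by (simp add: power_mult_distrib divide_inverse_commute mult.assoc)
  qed
  then show "\<exists>N. \<forall>n\<ge>N. norm ((t ^ n / fact n) *\<^sub>R (D ^^ n) X) <= inverse (fact n) * (\<bar>t\<bar> * B) ^ n * norm X" by blast
 qed
 then show ?thesis unfolding lin_exp_def tm by (rule summable_sums)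
qed

lemma lin_exp_0 [simp]:
 fixes D :: "'e::euclidean_space => 'e"
 assumes D: "linear D" shows "lin_exp (%Y. 0 *\<^sub>R D Y) X = X"
proof -
 have "(%n. (0 ^ n / fact n) *\<^sub>R (D ^^ n) X) = (%n. if n = 0 then (0 ^ n / fact n) *\<^sub>R (D ^^ n) X else 0)"
  by (auto simp: fun_eq_iff)
 then have "(%n. (0 ^ n / fact n) *\<^sub>R (D ^^ n) X) sums X"
  using sums_single[of 0 "%n. (0 ^ n / fact n) *\<^sub>R (D ^^ n) X"] by simp
 then show ?thesis using lin_exp_sums[OF D, of 0 X] sums_unique2 by blast
qed

lemma lin_exp_bounded_linear_image:
 fixes D :: "'e::euclidean_space => 'e"
 assumes D: "linear D" and L: "bounded_linear L"
 shows "(%n. (t ^ n / fact n) *\<^sub>R L ((D ^^ n) X)) sums L (lin_exp (%Y. t *\<^sub>R D Y) X)"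
 using bounded_linear.sums[OF L lin_exp_sums[OF D]] by (simp add: linear_scale[OF bounded_linear.linear[OF L]])

lemma funpow_linear: "linear D ==> linear (D ^^ n)" for D :: "'e::real_vector => 'e"
proof (induction n)
 case 0 then show ?case by (simp add: linear_id id_def[symmetric])
next
 case (Suc n) then show ?case using linear_compose[of "D ^^ n" D] by (simp add: comp_def)
qed

lemma lin_exp_linear:
 fixes D :: "'e::euclidean_space => 'e"
 assumes D: "linear D" shows "linear (lin_exp (%Y. t *\<^sub>R D Y))"
proof (rule linearI)
 fix X Z :: 'e and c :: real
 have "(%n. (t ^ n / fact n) *\<^sub>R (D ^^ n) (X + Z)) sums (lin_exp (%Y. t *\<^sub>R D Y) X + lin_exp (%Y. t *\<^sub>R D Y) Z)"
  using sums_add[OF lin_exp_sums[OF D] lin_exp_sums[OF D]]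
  by (simp add: linear_add[OF funpow_linear[OF D]] scaleR_add_right)
 then show "lin_exp (%Y. t *\<^sub>R D Y) (X + Z) = lin_exp (%Y. t *\<^sub>R D Y) X + lin_exp (%Y. t *\<^sub>R D Y) Z"
  using lin_exp_sums[OF D] sums_unique2 by blast
 have "(%n. (t ^ n / fact n) *\<^sub>R (D ^^ n) (c *\<^sub>R X)) sums (c *\<^sub>R lin_exp (%Y. t *\<^sub>R D Y) X)"
  using sums_scaleR_right[OF lin_exp_sums[OF D], of c]
  by (simp add: linear_scale[OF funpow_linear[OF D]] mult.commute)
 then show "lin_exp (%Y. t *\<^sub>R D Y) (c *\<^sub>R X) = c *\<^sub>R lin_exp (%Y. t *\<^sub>R D Y) X"
  using lin_exp_sums[OF D] sums_unique2 by blast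
qed

lemma lin_exp_commute:
 fixes D :: "'e::euclidean_space => 'e"
 assumes D: "linear D" shows "(D ^^ k) (lin_exp (%Y. t *\<^sub>R D Y) X) = lin_exp (%Y. t *\<^sub>R D Y) ((D ^^ k) X)"
proof -
 have L: "bounded_linear (D ^^ k)" using funpow_linear[OF D] linear_conv_bounded_linear by blast
 have eq: "(%n. (t ^ n / fact n) *\<^sub>R (D ^^ k) ((D ^^ n) X)) = (%n. (t ^ n / fact n) *\<^sub>R (D ^^ n) ((D ^^ k) X))"
  using funpow_add[of k _ D] funpow_add[of _ k D] by (simp add: fun_eq_iff add.commute)
 show ?thesis
  using lin_exp_bounded_linear_image[OF D L, of t X] unfolding eq by (rule sums_unique2[OF _ lin_exp_sums[OF D]])
qed

lemma lin_exp_in_subspace: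
 fixes D :: "'e::euclidean_space => 'e"
 assumes D: "linear D" "D ` V <= V" and V: "subspace V" and X: "X : V"
 shows "lin_exp (%Y. t *\<^sub>R D Y) X : V"
proof -
 have "(D ^^ n) X : V" for n by (induction n) (use X D(2) in auto)
 then have "(\<Sum>n<m. (t ^ n / fact n) *\<^sub>R (D ^^ n) X) : V" for m
  by (intro subspace_sum[OF V] subspace_scale[OF V])
 then show ?thesis
  by (rule closed_sequentially[OF closed_subspace[OF V] _ lin_exp_sums[OF D(1), of t X, unfolded sums_def]])
qed

text \<open>In each coordinate the exponential is a power series in \<open>t\<close>, which is
  differentiated termwise.\<close>

lemma lin_exp_derivative:
 fixes D :: "'e::euclidean_space => 'e"
 assumes D: "linear D"
 shows "((%t. lin_exp (%Y. t *\<^sub>R D Y) X) has_vector_derivative lin_exp (%Y. t *\<^sub>R D Y) (D X)) (at t)"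
proof -
 have comp: "((%t. lin_exp (%Y. t *\<^sub>R D Y) X \<bullet> b) has_derivative (%h. h *\<^sub>R lin_exp (%Y. t *\<^sub>R D Y) (D X) \<bullet> b)) (at t)" for b
 proof -
  define c where "c n = ((D ^^ n) X \<bullet> b) / fact n" for n
  have s: "(%n. c n * s ^ n) sums (lin_exp (%Y. s *\<^sub>R D Y) X \<bullet> b)" for s
   using lin_exp_bounded_linear_image[OF D bounded_linear_inner_left, of s X b] unfolding c_def by (simp add: mult.commute)
  have "diffs c n * t ^ n = (t ^ n / fact n) *\<^sub>R ((D ^^ n) (D X) \<bullet> b)" for n
   unfolding c_def diffs_def by (simp add: funpow_swap1 field_simps del: of_nat_Suc)
  then have d: "(%n. diffs c n * t ^ n) sums (lin_exp (%Y. t *\<^sub>R D Y) (D X) \<bullet> b)"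
   using lin_exp_bounded_linear_image[OF D bounded_linear_inner_left, of t "D X" b] by simp
  have "((%s. \<Sum>n. c n * s ^ n) has_field_derivative (\<Sum>n. diffs c n * t ^ n)) (at t)"
   by (rule termdiffs_strong_converges_everywhere) (use s in \<open>auto simp: sums_iff\<close>)
  then have "((%s. lin_exp (%Y. s *\<^sub>R D Y) X \<bullet> b) has_field_derivative (lin_exp (%Y. t *\<^sub>R D Y) (D X) \<bullet> b)) (at t)"
   using s d by (simp add: sums_iff)
  then show ?thesis unfolding has_field_derivative_def by (simp add: mult.commute[of "lin_exp _ _ \<bullet> _"] mult_commute_abs)
 qed
 show ?thesis unfolding has_vector_derivative_def
  using has_derivative_componentwise_within[of "%t. lin_exp (%Y. t *\<^sub>R D Y) X" _ t UNIV] comp by blast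
qed

text \<open>Uniqueness for the linear differential equation: the squared norm, damped by a large exponential, cannot grow.\<close>

lemma linear_ode_zero_forward:
 fixes z :: "real => 'e::euclidean_space"
 assumes D: "linear D" and z: "!!t. (z has_vector_derivative D (z t)) (at t)" "z 0 = 0" and t: "t >= 0"
 shows "z t = 0"
proof -
 obtain B where B: "B > 0" "!!x. norm (D x) <= B * norm x"
  using linear_bounded_pos[OF D] by blast
 define f where "f s = (z s \<bullet> z s) * exp (- (2 * B * s))" for s
 have "(f has_real_derivative ((2 * (z s \<bullet> D (z s)) - 2 * B * (z s \<bullet> z s)) * exp (- (2 * B * s)))) (at s)" for s
 proof -
  have "((%s. z s \<bullet> z s) has_real_derivative 2 * (z s \<bullet> D (z s))) (at s)"
   using has_derivative_inner[OF z(1)[of s, unfolded has_vector_derivative_def] z(1)[of s, unfolded has_vector_derivative_def]]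
   unfolding has_field_derivative_def by (rule has_derivative_eq_rhs) (auto simp: inner_commute)
  moreover have "((%s. exp (- (2 * B * s))) has_real_derivative - 2 * B * exp (- (2 * B * s))) (at s)"
   by (auto intro!: derivative_eq_intros)
  ultimately have "(f has_real_derivative 2 * (z s \<bullet> D (z s)) * exp (- (2 * B * s)) + - 2 * B * exp (- (2 * B * s)) * (z s \<bullet> z s)) (at s)"
   unfolding f_def by (rule DERIV_mult)
  then show ?thesis by (simp add: algebra_simps)
 qed
 moreover have "(2 * (z s \<bullet> D (z s)) - 2 * B * (z s \<bullet> z s)) * exp (- (2 * B * s)) <= 0" for s
 proof -
  have "z s \<bullet> D (z s) <= norm (z s) * norm (D (z s))" by (rule norm_cauchy_schwarz)
  also have "\<dots> <= norm (z s) * (B * norm (z s))" using B(2) by (intro mult_left_mono) auto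
  also have "\<dots> = B * (z s \<bullet> z s)" by (simp add: dot_square_norm power2_eq_square)
  finally show ?thesis by (simp add: mult_le_0_iff)
 qed
 ultimately have "f t <= f 0" using t by (intro DERIV_nonpos_imp_nonincreasing[of 0 t f]) blast+
 then have "(z t \<bullet> z t) * exp (- (2 * B * t)) <= 0" unfolding f_def using z(2) by simp
 then have "z t \<bullet> z t <= 0" by (simp add: mult_le_0_iff)
 then show ?thesis using inner_ge_zero[of "z t"] inner_eq_zero_iff by (metis antisym)
qed

lemma linear_ode_zero:
 fixes z :: "real => 'e::euclidean_space"
 assumes D: "linear D" and z: "!!t. (z has_vector_derivative D (z t)) (at t)" "z 0 = 0"
 shows "z t = 0"
proof (cases "t >= 0")
 case True then show ?thesis using linear_ode_zero_forward[OF assms] by blast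
next
 case False
 have "((%s. z (- s)) has_vector_derivative - D (z (- s))) (at s)" for s
  by (rule has_vector_derivative_reflect[OF z(1)])
 from linear_ode_zero_forward[OF linear_compose_neg[OF D] this, of "- t"] show ?thesis using z(2) False by simp
qed

text \<open>Both sides solve the same linear equation in \<open>s\<close> and agree at
  \<open>s = 0\<close>.\<close>

lemma lin_exp_add:
 fixes D :: "'e::euclidean_space => 'e"
 assumes D: "linear D"
 shows "lin_exp (%Y. s *\<^sub>R D Y) (lin_exp (%Y. t *\<^sub>R D Y) X) = lin_exp (%Y. (s + t) *\<^sub>R D Y) X"
proof -
 define z where "z s = lin_exp (%Y. (s + t) *\<^sub>R D Y) X - lin_exp (%Y. s *\<^sub>R D Y) (lin_exp (%Y. t *\<^sub>R D Y) X)" for s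
 have com: "lin_exp (%Y. s *\<^sub>R D Y) (D Z) = D (lin_exp (%Y. s *\<^sub>R D Y) Z)" for s Z
  using lin_exp_commute[OF D, of 1] by simp
 have "((%s. lin_exp (%Y. (s + t) *\<^sub>R D Y) X) has_vector_derivative lin_exp (%Y. (s + t) *\<^sub>R D Y) (D X)) (at s)" for s
  by (rule has_vector_derivative_shift[OF lin_exp_derivative[OF D]])
 then have "(z has_vector_derivative D (z s)) (at s)" for s
  unfolding z_def using has_vector_derivative_diff[OF _ lin_exp_derivative[OF D]] by (simp add: com linear_diff[OF D])
 moreover have "z 0 = 0" unfolding z_def lin_exp_0[OF D] by simp
 ultimately have "z s = 0" using linear_ode_zero[OF D] by blast
 then show ?thesis unfolding z_def by simp
qed

lemma lin_exp_conjugate: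
 fixes D :: "'e::euclidean_space => 'e"
 assumes D: "linear D" "D ` V <= V" and A: "linear A" and B: "B ` V <= V" "!!Y. Y : V ==> B (A Y) = Y" "!!Y. Y : V ==> A (B Y) = Y"
  and AB: "linear (%Y. A (D (B Y)))" and X: "X : V"
 shows "lin_exp (%Y. t *\<^sub>R A (D (B Y))) X = A (lin_exp (%Y. t *\<^sub>R D Y) (B X))"
proof -
 have "(D ^^ n) (B X) : V" for n by (induction n) (use X D(2) B(1) in auto)
 then have "((%Y. A (D (B Y))) ^^ n) X = A ((D ^^ n) (B X))" for n
  by (induction n) (simp_all add: B X)
 then have "(%n. (t ^ n / fact n) *\<^sub>R A ((D ^^ n) (B X))) sums lin_exp (%Y. t *\<^sub>R A (D (B Y))) X"
  using lin_exp_sums[OF AB, of t X] by simp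
 moreover have "bounded_linear A" using A linear_conv_bounded_linear by blast
 ultimately show ?thesis using lin_exp_bounded_linear_image[OF D(1), of A t "B X"] sums_unique2 by blast
qed

subsection \<open>Decay\<close>

text \<open>The linear functional on polynomials that sends the \<open>k\<close>-th power of the
  variable to \<open>f k\<close>. For \<open>f k = (D ^^ k) X \<bullet> b\<close> its value at
  \<open>q\<close> is the coordinate of \<open>q(D) X\<close> along \<open>b\<close>.\<close>

definition poly_pair :: "(nat => complex) => complex poly => complex" where
 "poly_pair f q = (\<Sum>k\<le>degree q. coeff q k * f k)"

lemma poly_pair_eq: "degree q <= n ==> poly_pair f q = (\<Sum>k\<le>n. coeff q k * f k)"
 unfolding poly_pair_def by (rule sum.mono_neutral_left) (auto simp: coeff_eq_0)

text \<open>Multiplying a polynomial by the variable shifts the sequence it is paired with.\<close>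

lemma poly_pair_linear_factor:
 "poly_pair f ([:-z, 1:] * q) = poly_pair (%k. f (Suc k)) q - z * poly_pair f q"
proof -
 have c: "coeff ([:-z, 1:] * q) k = (case k of 0 => 0 | Suc j => coeff q j) - z * coeff q k" for k
  by (simp add: coeff_pCons mult_pCons_left split: nat.split)
 have d: "degree ([:-z, 1:] * q) <= Suc (degree q)"
  using degree_mult_le[of "[:-z, 1:]" q] by simp
 have "poly_pair f ([:-z, 1:] * q) = (\<Sum>k\<le>Suc (degree q). (case k of 0 => 0 | Suc j => coeff q j) * f k) - z * (\<Sum>k\<le>Suc (degree q). coeff q k * f k)"
  unfolding poly_pair_eq[OF d] c left_diff_distrib sum_subtractf sum_distrib_left mult.assoc ..
 also have "(\<Sum>k\<le>Suc (degree q). (case k of 0 => 0 | Suc j => coeff q j) * f k) = (\<Sum>k\<le>degree q. coeff q k * f (Suc k))"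
  unfolding sum.atMost_Suc_shift by simp
 also have "(\<Sum>k\<le>Suc (degree q). coeff q k * f k) = poly_pair f q"
  by (rule poly_pair_eq[symmetric]) simp
 finally show ?thesis unfolding poly_pair_def[of "%k. f (Suc k)"] .
qed

text \<open>Removing one root at a time turns a homogeneous equation into first-order inhomogeneous ones.\<close>

lemma poly_pair_decay:
 fixes y :: "nat => real => complex"
 assumes y: "!!k t. (y k has_vector_derivative - y (Suc k) t) (at t)"
 shows "p ~= 0 ==> (!!z. poly p z = 0 ==> Re z >= 1) ==> (!!t. poly_pair (%k. y k t) (p * q) = 0) ==>
  \<exists>C. \<forall>t\<ge>0. norm (poly_pair (%k. y k t) q) <= C * exp (- t / 2)"
proof (induction "degree p" arbitrary: p q)
 case 0
 then obtain c where c: "p = [:c:]" "c ~= 0" by (metis degree_eq_zeroE pCons_0_0)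
 have "poly_pair f (p * q) = c * poly_pair f q" for f
  unfolding c poly_pair_def using c(2) by (simp add: sum_distrib_left mult.assoc)
 then show ?case using 0 c by (intro exI[of _ 0]) auto
next
 case (Suc n)
 then obtain z where z: "poly p z = 0" using fundamental_theorem_of_algebra[of p] by (metis constant_degree nat.distinct(1))
 then obtain p' where p': "p = [:-z, 1:] * p'" using poly_eq_0_iff_dvd by (metis dvdE)
 have "degree p' = n" using Suc.hyps(2) Suc.prems(1) unfolding p' by (subst (asm) degree_mult_eq) auto
 moreover have "p' ~= 0" using Suc.prems(1) p' by auto
 moreover have "!!z. poly p' z = 0 ==> Re z >= 1" using Suc.prems(2) unfolding p' by simp
 \<comment> \<open>The factor of the root moves from \<open>p\<close> to the cofactor, so the
   induction hypothesis bounds the inhomogeneity \<open>r\<close> of the first-order equation for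
   \<open>u\<close>.\<close>
 moreover have "!!t. poly_pair (%k. y k t) (p' * ([:-z, 1:] * q)) = 0" using Suc.prems(3) unfolding p' by (metis mult.assoc mult.commute)
 ultimately obtain C where C: "!!t. t >= 0 ==> norm (poly_pair (%k. y k t) ([:-z, 1:] * q)) <= C * exp (- t / 2)"
  using Suc.hyps(1) by blast
 define \<rho> where "\<rho> = Re z"
 have \<rho>: "\<rho> >= 1" unfolding \<rho>_def using Suc.prems(2)[OF z] .
 define u where "u t = poly_pair (%k. y k t) q" for t
 define r where "r t = poly_pair (%k. y k t) ([:-z, 1:] * q)" for t
 have du: "(u has_vector_derivative - (r t + z * u t)) (at t)" for t
 proof -
  have "(u has_vector_derivative (\<Sum>k\<le>degree q. coeff q k * (- y (Suc k) t))) (at t)"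
   unfolding u_def poly_pair_def by (intro has_vector_derivative_sum has_vector_derivative_mult_right y)
  moreover have "(\<Sum>k\<le>degree q. coeff q k * (- y (Suc k) t)) = - (r t + z * u t)"
   unfolding r_def u_def poly_pair_linear_factor by (simp add: poly_pair_def sum_negf)
  ultimately show ?thesis by simp
 qed
 \<comment> \<open>Integrating factor for the equation \<open>du\<close>.\<close>
 define w where "w t = exp (of_real t * z) * u t" for t
 have dw: "(w has_vector_derivative - (exp (of_real t * z) * r t)) (at t)" for t
 proof -
  have "((%t. exp (of_real t * z)) has_vector_derivative exp (of_real t * z) * z) (at t)"
   using exp_scaleR_has_vector_derivative_right[of z t UNIV] by (simp add: scaleR_conv_of_real)
  from has_vector_derivative_mult[OF this du[of t]] show ?thesis unfolding w_def
   by (simp add: algebra_simps)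
 qed
 have C0: "C >= 0" using order_trans[OF norm_ge_zero C[of 0]] by simp
 have "norm (u t) <= (norm (u 0) + 2 * C) * exp (- t / 2)" if t: "t >= 0" for t
 proof -
  have ne: "norm (exp (of_real s * z)) = exp (\<rho> * s)" for s unfolding \<rho>_def by (simp add: norm_exp_eq_Re mult.commute)
  have i1: "((%s. - (exp (of_real s * z) * r s)) has_integral (w t - w 0)) {0..t}"
   by (rule fundamental_theorem_of_calculus[OF t], rule has_vector_derivative_at_within[OF dw])
  \<comment> \<open>Since \<open>\<rho>\<close> exceeds the target rate 1/2 by at least 1/2, the
    integral of the inhomogeneity is at most \<open>2 * C * exp ((\<rho> - 1/2) * t)\<close>. The
    fixed gap between the rates keeps polynomial factors from accumulating at repeated
    roots.\<close>
  have "((%s. C / (\<rho> - 1/2) * exp ((\<rho> - 1/2) * s)) has_vector_derivative C * exp ((\<rho> - 1/2) * s)) (at s within {0..t})" for s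
   using \<rho> by (auto intro!: derivative_eq_intros simp: has_real_derivative_iff_has_vector_derivative[symmetric])
  then have i2: "((%s. C * exp ((\<rho> - 1/2) * s)) has_integral (C / (\<rho> - 1/2) * exp ((\<rho> - 1/2) * t) - C / (\<rho> - 1/2) * exp ((\<rho> - 1/2) * 0))) {0..t}"
   by (intro fundamental_theorem_of_calculus[OF t])
  have "norm (integral {0..t} (%s. - (exp (of_real s * z) * r s))) <= integral {0..t} (%s. C * exp ((\<rho> - 1/2) * s))"
  proof (rule integral_norm_bound_integral)
   show "(%s. - (exp (of_real s * z) * r s)) integrable_on {0..t}" using i1 by (rule has_integral_integrable)
   show "(%s. C * exp ((\<rho> - 1/2) * s)) integrable_on {0..t}" using i2 by (rule has_integral_integrable)
   fix s assume s: "s : {0..t}"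
   have "norm (- (exp (of_real s * z) * r s)) = exp (\<rho> * s) * norm (r s)" by (simp add: norm_mult ne del: norm_exp_eq_Re)
   also have "\<dots> <= exp (\<rho> * s) * (C * exp (- s / 2))" unfolding r_def using C s by (intro mult_left_mono) auto
   also have "\<dots> = C * exp ((\<rho> - 1/2) * s)" by (simp add: exp_add[symmetric] algebra_simps)
   finally show "norm (- (exp (of_real s * z) * r s)) <= C * exp ((\<rho> - 1/2) * s)" .
  qed
  also have "\<dots> = C / (\<rho> - 1/2) * (exp ((\<rho> - 1/2) * t) - 1)" using integral_unique[OF i2] by (simp add: algebra_simps)
  also have "\<dots> <= (2 * C) * exp ((\<rho> - 1/2) * t)"
  proof (rule mult_mono)
   show "C / (\<rho> - 1/2) <= 2 * C" using \<rho> C0 mult_right_mono[of 1 "2 * (\<rho> - 1/2)" C] by (simp add: field_simps)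
  qed (use C0 \<rho> t in auto)
  finally have "norm (w t - w 0) <= (2 * C) * exp ((\<rho> - 1/2) * t)" unfolding integral_unique[OF i1] .
  then have "norm (w t) <= norm (w 0) + (2 * C) * exp ((\<rho> - 1/2) * t)" using norm_triangle_sub[of "w t" "w 0"] by linarith
  also have "norm (w 0) <= norm (u 0) * exp ((\<rho> - 1/2) * t)" using \<rho> t unfolding w_def
   by (simp add: mult_le_cancel_left1)
  finally have "norm (w t) <= (norm (u 0) + 2 * C) * exp ((\<rho> - 1/2) * t)" by (simp add: algebra_simps)
  moreover have "norm (w t) = exp (\<rho> * t) * norm (u t)" unfolding w_def by (simp add: norm_mult ne del: norm_exp_eq_Re)
  ultimately have "exp (- (\<rho> * t)) * (exp (\<rho> * t) * norm (u t)) <= exp (- (\<rho> * t)) * ((norm (u 0) + 2 * C) * exp ((\<rho> - 1/2) * t))" by simp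
  moreover have "exp (- (\<rho> * t)) * (exp (\<rho> * t) * norm (u t)) = norm (u t)" by (simp add: exp_minus)
  moreover have "exp (- (\<rho> * t)) * ((norm (u 0) + 2 * C) * exp ((\<rho> - 1/2) * t)) = (norm (u 0) + 2 * C) * exp (- t / 2)"
   by (simp add: mult.left_commute exp_add[symmetric] algebra_simps)
  ultimately show ?thesis by simp
 qed
 then show ?case unfolding u_def by blast
qed

text \<open>There is one vector more than the dimension. The case of a repeated value is separate
  because linear dependence is stated for sets, where repetitions disappear.\<close>

lemma powers_linear_relation:
 fixes f :: "nat => 'e::euclidean_space"
 obtains c k0 where "c k0 ~= (0::real)" "k0 <= DIM('e)" "(\<Sum>k\<le>DIM('e). c k *\<^sub>R f k) = 0"
proof (cases "inj_on f {..DIM('e)}")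
 case True
 then have "card (f ` {..DIM('e)}) > DIM('e)" by (simp add: card_image)
 then have "dependent (f ` {..DIM('e)})" by (intro dependent_biggerset) auto
 then obtain u v where u: "v : f ` {..DIM('e)}" "u v ~= 0" "(\<Sum>v\<in>f ` {..DIM('e)}. u v *\<^sub>R v) = 0"
  using dependent_finite[of "f ` {..DIM('e)}"] by auto
 then obtain k0 where "k0 <= DIM('e)" "v = f k0" by auto
 moreover have "(\<Sum>k\<le>DIM('e). u (f k) *\<^sub>R f k) = 0" using u(3) sum.reindex[OF True, of "%v. u v *\<^sub>R v"] by simp
 ultimately show ?thesis using that[of "%k. u (f k)" k0] u by blast
next
 case False
 then obtain j k where jk: "j <= DIM('e)" "k <= DIM('e)" "j ~= k" "f j = f k" unfolding inj_on_def by auto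
 define c :: "nat => real" where "c i = (if i = j then 1 else if i = k then -1 else 0)" for i
 have "(\<Sum>i\<le>DIM('e). c i *\<^sub>R f i) = (\<Sum>i\<le>DIM('e). (if i = j then f j else 0) - (if i = k then f k else 0))"
  by (rule sum.cong) (use jk in \<open>auto simp: c_def\<close>)
 also have "\<dots> = f j - f k" using jk by (simp add: sum_subtractf)
 finally show ?thesis using that[of c j] jk unfolding c_def by auto
qed

text \<open>The minimal polynomial \<open>p\<close> of \<open>X\<close> with respect to
  \<open>D\<close> has eigenvalues of \<open>D\<close> on \<open>V\<close> as its roots, and the
  coordinates of \<open>E t\<close> satisfy the corresponding homogeneous equation in
  \<open>t\<close>, to which \<open>poly_pair_decay\<close> applies.\<close>

lemma lin_exp_decay_vector:
 fixes D :: "'e::euclidean_space => 'e"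
 assumes D: "linear D" "D ` V <= V" and V: "subspace V"
  and ev: "!!z. eigenvalue_on V D z ==> Re z >= 1" and X: "X : V"
 shows "\<exists>C. \<forall>t\<ge>0. norm (lin_exp (%Y. (- t) *\<^sub>R D Y) X) <= C * exp (- t / 2)"
proof -
 define f where "f b Z k = complex_of_real ((D ^^ k) Z \<bullet> b)" for b Z k
 define ann where "ann Z q \<longleftrightarrow> (\<forall>b. poly_pair (f b Z) q = 0)" for Z q
 \<comment> \<open>\<open>vr\<close> and \<open>vi\<close> are the real and imaginary parts of
   \<open>q(D) Z\<close>.\<close>
 define vr where "vr Z q = (\<Sum>k\<le>degree q. Re (coeff q k) *\<^sub>R (D ^^ k) Z)" for Z q
 define vi where "vi Z q = (\<Sum>k\<le>degree q. Im (coeff q k) *\<^sub>R (D ^^ k) Z)" for Z q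
 have pp: "poly_pair (f b Z) q = Complex (vr Z q \<bullet> b) (vi Z q \<bullet> b)" for b Z q
  unfolding poly_pair_def f_def vr_def vi_def by (simp add: complex_eq_iff inner_sum_left)
 have pps: "poly_pair (%k. f b Z (Suc k)) q = Complex (D (vr Z q) \<bullet> b) (D (vi Z q) \<bullet> b)" for b Z q
  unfolding poly_pair_def f_def vr_def vi_def by (simp add: complex_eq_iff inner_sum_left linear_sum[OF D(1)] linear_scale[OF D(1)])
 have ann_iff: "ann Z q \<longleftrightarrow> vr Z q = 0 & vi Z q = 0" for Z q
  unfolding ann_def pp by (auto simp: complex_eq_iff) (metis inner_eq_zero_iff)+
 have Vn: "(D ^^ n) X : V" for n by (induction n) (use X D(2) in auto)
 have vV: "vr X q : V" "vi X q : V" for q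
  unfolding vr_def vi_def by (intro subspace_sum[OF V] subspace_scale[OF V] Vn)+
 have "\<exists>p. p ~= 0 & ann X p"
 proof -
  obtain c k0 where c: "c k0 ~= (0::real)" "k0 <= DIM('e)" "(\<Sum>k\<le>DIM('e). c k *\<^sub>R (D ^^ k) X) = 0"
   using powers_linear_relation[of "%k. (D ^^ k) X"] by blast
  define p where "p = (\<Sum>k\<le>DIM('e). monom (complex_of_real (c k)) k)"
  have co: "coeff p k = (if k <= DIM('e) then of_real (c k) else 0)" for k
   unfolding p_def by (simp add: coeff_sum coeff_monom)
  have dg: "degree p <= DIM('e)" by (rule degree_le) (simp add: co)
  have "p ~= 0" using co[of k0] c by auto
  moreover have "poly_pair (f b X) p = 0" for b
  proof -
   have "poly_pair (f b X) p = of_real ((\<Sum>k\<le>DIM('e). c k *\<^sub>R (D ^^ k) X) \<bullet> b)"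
    unfolding poly_pair_eq[OF dg] f_def by (simp add: co inner_sum_left)
   then show ?thesis using c by simp
  qed
  ultimately show ?thesis unfolding ann_def by blast
 qed
 \<comment> \<open>Minimality of the degree makes every root an eigenvalue: if \<open>p\<close> is
   \<open>[:-z, 1:] * q\<close>, then \<open>q(D) X\<close> is nonzero and is an eigenvector for
   \<open>z\<close> in the complexification.\<close>
 then obtain p where p: "p ~= 0" "ann X p" and pmin: "!!q. q ~= 0 ==> ann X q ==> degree p <= degree q"
  using ex_has_least_nat[of "%p. p ~= 0 & ann X p" _ degree] by blast
 have roots: "Re z >= 1" if z: "poly p z = 0" for z
 proof (rule ev)
  obtain q where q: "p = [:-z, 1:] * q" using z poly_eq_0_iff_dvd by (metis dvdE)
  have q0: "q ~= 0" using p(1) q by auto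
  have "degree p = Suc (degree q)" unfolding q using q0 by (subst degree_mult_eq) auto
  then have "\<not> ann X q" using pmin[OF q0] by auto
  then have nz: "vr X q ~= 0 \<or> vi X q ~= 0" unfolding ann_iff by blast
  have e: "Complex (D (vr X q) \<bullet> b) (D (vi X q) \<bullet> b) = z * Complex (vr X q \<bullet> b) (vi X q \<bullet> b)" for b
   using p(2) unfolding ann_def q poly_pair_linear_factor pp pps by simp
  have "D (vr X q) \<bullet> b = (Re z *\<^sub>R vr X q - Im z *\<^sub>R vi X q) \<bullet> b"
   "D (vi X q) \<bullet> b = (Im z *\<^sub>R vr X q + Re z *\<^sub>R vi X q) \<bullet> b" for b
   using e[of b] by (simp_all add: complex_eq_iff inner_diff_left inner_add_left)
  then have "D (vr X q) = Re z *\<^sub>R vr X q - Im z *\<^sub>R vi X q" "D (vi X q) = Im z *\<^sub>R vr X q + Re z *\<^sub>R vi X q"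
   using euclidean_eq_iff by blast+
  then show "eigenvalue_on V D z" unfolding eigenvalue_on_def using vV nz by blast
 qed
 define E where "E t = lin_exp (%Y. (- t) *\<^sub>R D Y) X" for t
 have dE: "((%t. (D ^^ k) (E t)) has_vector_derivative - (D ^^ Suc k) (E t)) (at t)" for k t
 proof -
  have "((%t. lin_exp (%Y. (- t) *\<^sub>R D Y) ((D ^^ k) X)) has_vector_derivative - lin_exp (%Y. (- t) *\<^sub>R D Y) (D ((D ^^ k) X))) (at t)"
   by (rule has_vector_derivative_reflect[OF lin_exp_derivative[OF D(1)]])
  then show ?thesis unfolding E_def lin_exp_commute[OF D(1)] by simp
 qed
 have comp: "\<exists>C. \<forall>t\<ge>0. \<bar>E t \<bullet> b\<bar> <= C * exp (- t / 2)" for b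
 proof -
  have "((%t. f b (E t) k) has_vector_derivative - f b (E t) (Suc k)) (at t)" for k t
  proof -
   have "((%t. (D ^^ k) (E t) \<bullet> b) has_vector_derivative - ((D ^^ Suc k) (E t)) \<bullet> b) (at t)"
    using bounded_linear.has_vector_derivative[OF bounded_linear_inner_left dE] .
   from bounded_linear.has_vector_derivative[OF bounded_linear_of_real this] show ?thesis unfolding f_def by simp
  qed
  moreover have "ann (E t) p" for t
  proof -
   note lin = lin_exp_linear[OF D(1), of "- t"]
   have "vr (E t) p = lin_exp (%Y. (- t) *\<^sub>R D Y) (vr X p)" "vi (E t) p = lin_exp (%Y. (- t) *\<^sub>R D Y) (vi X p)"
    unfolding vr_def vi_def E_def lin_exp_commute[OF D(1)] by (simp_all only: linear_sum[OF lin] linear_scale[OF lin])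
   then show ?thesis using p(2) linear_0[OF lin] unfolding ann_iff by simp
  qed
  \<comment> \<open>With cofactor \<open>1\<close> the pairing is the coordinate of
    \<open>E t\<close> itself.\<close>
  ultimately have "\<exists>C. \<forall>t\<ge>0. norm (poly_pair (%k. f b (E t) k) 1) <= C * exp (- t / 2)"
   using poly_pair_decay[of "%k t. f b (E t) k" p 1] p(1) roots unfolding ann_def by simp
  then show ?thesis unfolding poly_pair_def f_def by simp
 qed
 then obtain C where C: "!!b t. t >= 0 ==> \<bar>E t \<bullet> b\<bar> <= C b * exp (- t / 2)" by metis
 have "norm (E t) <= (\<Sum>b\<in>Basis. C b) * exp (- t / 2)" if "t >= 0" for t
  using order_trans[OF norm_le_l1 sum_mono[OF C[OF that]]] by (simp add: sum_distrib_right)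
 then show ?thesis unfolding E_def by blast
qed

text \<open>An orthonormal basis makes the constant of \<open>lin_exp_decay_vector\<close> uniform
  in \<open>X\<close>.\<close>

lemma lin_exp_decay:
 fixes D :: "'e::euclidean_space => 'e"
 assumes D: "linear D" "D ` V <= V" and V: "subspace V"
  and ev: "!!z. eigenvalue_on V D z ==> Re z >= 1"
 obtains C where "C > 0" "!!t X. t >= 0 ==> X : V ==> norm (lin_exp (%Y. (- t) *\<^sub>R D Y) X) <= C * exp (- t / 2) * norm X"
proof -
 obtain B where B: "B <= V" "pairwise orthogonal B" "!!x. x : B ==> norm x = 1" "independent B" "span B = V"
  using orthonormal_basis_subspace[OF V] by metis
 have fB: "finite B" using B(4) independent_imp_finite by blast
 have "\<exists>C. \<forall>t\<ge>0. norm (lin_exp (%Y. (- t) *\<^sub>R D Y) e) <= C * exp (- t / 2)" if "e : B" for e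
  using lin_exp_decay_vector[OF D V ev] B(1) that by blast
 then obtain C where C: "!!e t. e : B ==> t >= 0 ==> norm (lin_exp (%Y. (- t) *\<^sub>R D Y) e) <= C e * exp (- t / 2)" by metis
 have C0: "C e >= 0" if "e : B" for e
  using order_trans[OF norm_ge_zero C[OF that, of 0]] by simp
 have "norm (lin_exp (%Y. (- t) *\<^sub>R D Y) X) <= (1 + (\<Sum>e\<in>B. C e)) * exp (- t / 2) * norm X" if t: "t >= 0" and X: "X : V" for t X
 proof -
  note lin = lin_exp_linear[OF D(1), of "- t"]
  have "X = (\<Sum>e\<in>B. (X \<bullet> e) *\<^sub>R e)" using orthonormal_basis_expand[OF B(2,3) _ fB] X B(5) by simp
  then have "lin_exp (%Y. (- t) *\<^sub>R D Y) X = lin_exp (%Y. (- t) *\<^sub>R D Y) (\<Sum>e\<in>B. (X \<bullet> e) *\<^sub>R e)" by (rule arg_cong)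
  also have "\<dots> = (\<Sum>e\<in>B. (X \<bullet> e) *\<^sub>R lin_exp (%Y. (- t) *\<^sub>R D Y) e)" by (simp only: linear_sum[OF lin] linear_scale[OF lin])
  also have "norm \<dots> <= (\<Sum>e\<in>B. norm X * (C e * exp (- t / 2)))"
  proof (rule order_trans[OF norm_sum], rule sum_mono)
   fix e assume e: "e : B"
   have "\<bar>X \<bullet> e\<bar> <= norm X" using Cauchy_Schwarz_ineq2[of X e] B(3)[OF e] by simp
   then show "norm ((X \<bullet> e) *\<^sub>R lin_exp (%Y. (- t) *\<^sub>R D Y) e) <= norm X * (C e * exp (- t / 2))"
    unfolding norm_scaleR by (intro mult_mono C[OF e t]) auto
  qed
  also have "\<dots> = (\<Sum>e\<in>B. C e) * (exp (- t / 2) * norm X)" by (simp add: sum_distrib_right sum_distrib_left algebra_simps)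
  also have "\<dots> <= (1 + (\<Sum>e\<in>B. C e)) * (exp (- t / 2) * norm X)" by (intro mult_right_mono) auto
  finally show ?thesis by (simp only: mult.assoc)
 qed
 moreover have "1 + (\<Sum>e\<in>B. C e) > 0" using C0 by (intro add_pos_nonneg sum_nonneg) auto
 ultimately show ?thesis using that by blast
qed

section \<open>Detours of polygonal paths\<close>

text \<open>Pigeonhole: the at most \<open>n\<close> points of \<open>P\<close> sort
  \<open>A\<close> into \<open>n + 1\<close> classes by the number of points of \<open>P\<close> up
  to \<open>j\<close>, and one class has at least \<open>2 * W + 1\<close> elements. Its extremes
  are \<open>p\<close> and \<open>q\<close>, and \<open>m\<close> is its first element from
  \<open>p + W\<close> on. A modification strictly between \<open>p\<close> and \<open>q\<close>
  does not touch \<open>P\<close>.\<close>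

lemma gap_subset:
 fixes A P :: "nat set"
 assumes A: "finite A" and P: "finite P" "card P <= n" and c: "card A >= (n + 1) * (2 * W + 1)"
 obtains p m q where "p : A" "m : A" "q : A" "p + W <= m" "m + W <= q" "P Int {p<..<q} = {}"
proof -
 define r where "r j = card {x : P. x <= j}" for j
 have r: "r j <= n" for j
  unfolding r_def using P card_mono[OF P(1), of "{x : P. x <= j}"] by auto
 have "\<exists>y\<in>{..n}. 2 * W + 1 <= card {j : A. r j = y}"
 proof (rule ccontr)
  assume "\<not> ?thesis"
  then have lt: "card {j : A. r j = y} <= 2 * W" if "y <= n" for y using that by force
  have "card A = (\<Sum>y\<le>n. card {j : A. r j = y})"
  proof -
   have "A = (\<Union>y\<in>{..n}. {j : A. r j = y})" using r by auto
   then have "card A = card (\<Union>y\<in>{..n}. {j : A. r j = y})" by simp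
   also have "\<dots> = (\<Sum>y\<le>n. card {j : A. r j = y})" by (rule card_UN_disjoint) (use A in auto)
   finally show ?thesis .
  qed
  also have "\<dots> <= (\<Sum>y\<le>n. 2 * W)" by (rule sum_mono) (use lt in auto)
  finally show False using c by simp
 qed
 then obtain y where y: "2 * W + 1 <= card {j : A. r j = y}" by blast
 define F where "F = {j : A. r j = y}"
 have yF: "2 * W + 1 <= card F" using y unfolding F_def .
 then have ne: "F ~= {}" by auto
 have fF: "finite F" using A unfolding F_def by simp
 note F = fF ne
 define p where "p = Min F"
 define q where "q = Max F"
 have pq: "p : F" "q : F" "!!j. j : F ==> p <= j" "!!j. j : F ==> j <= q" unfolding p_def q_def using F by auto
 \<comment> \<open>At most \<open>W\<close> elements of the class lie before \<open>p + W\<close>;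
   the other \<open>W + 1\<close> or more leave distance \<open>W\<close> between \<open>m\<close>
   and \<open>q\<close>.\<close>
 define F' where "F' = {j : F. p + W <= j}"
 have "F <= F' Un {p..<p+W}" unfolding F'_def using pq(3) by auto
 then have "card F <= card (F' Un {p..<p+W})" using F F'_def by (intro card_mono) auto
 also have "\<dots> <= card F' + W" using card_Un_le[of F' "{p..<p+W}"] by simp
 finally have c': "card F' >= W + 1" using y unfolding F_def by simp
 have "F' ~= {}" using c' by auto
 moreover have "finite F'" using F unfolding F'_def by simp
 ultimately have F': "finite F'" "F' ~= {}" by simp_all
 define m where "m = Min F'"
 have m: "m : F'" "!!j. j : F' ==> m <= j" unfolding m_def using F' by auto
 have "F' <= {m..q}" using m(2) pq(4) unfolding F'_def by auto
 then have "card F' <= card {m..q}" by (intro card_mono) auto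
 then have "m + W <= q" using c' by simp
 moreover have "P Int {p<..<q} = {}"
 proof (rule ccontr)
  assume "P Int {p<..<q} ~= {}"
  then obtain x where x: "x : P" "p < x" "x < q" by auto
  have "{z : P. z <= p} <= {z : P. z <= q}" "x : {z : P. z <= q}" "x ~: {z : P. z <= p}" using x by auto
  then have "{z : P. z <= p} \<subset> {z : P. z <= q}" by blast
  then have "r p < r q" unfolding r_def using P(1) by (intro psubset_card_mono) auto
  then show False using pq(1,2) unfolding F_def by simp
 qed
 ultimately show ?thesis using that[of p m q] pq(1,2) m(1) unfolding F_def F'_def by auto
qed

lemma sum_telescope_affine:
 fixes a :: "nat => real"
 assumes "m <= n"
 shows "(\<Sum>j\<in>{m..<n}. k * (a (Suc j) - a j) + z) = k * (a n - a m) + (real n - real m) * z"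
proof -
 have "(\<Sum>j\<in>{m..<n}. k * (a (Suc j) - a j) + z) = k * (\<Sum>j\<in>{m..<n}. a (Suc j) - a j) + (\<Sum>j\<in>{m..<n}. z)"
  by (simp only: sum.distrib sum_distrib_left)
 then show ?thesis using assms by (simp add: sum_Suc_diff' of_nat_diff)
qed

text \<open>The part of the argument that takes place in the projection. \<open>B\<close> is the
  inner product there, and \<open>e i\<close> is the \<open>B\<close>-gradient of the root
  \<open>\<alpha> i\<close>, the direction of cheapest ascent. The depth of a vertex for
  \<open>i\<close> is the amount by which \<open>\<alpha> i\<close> falls short of the level
  \<open>h\<close>.\<close>

locale detour =
 fixes B :: "'v::real_vector => 'v => real" and \<alpha> :: "'i::finite => 'v => real" and e :: "'i => 'v"
 assumes B_sym: "B u v = B v u" and B_add: "B (u + v) z = B u z + B v z" and B_scale: "B (r *\<^sub>R u) z = r * B u z"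
  and B_nonneg: "B u u >= 0"
  and grad: "B u (e i) = \<alpha> i u" and \<alpha>_e: "\<alpha> i (e i) > 0"
begin

lemma \<alpha>_add: "\<alpha> i (u + v) = \<alpha> i u + \<alpha> i v" and \<alpha>_scale: "\<alpha> i (r *\<^sub>R u) = r * \<alpha> i u"
 unfolding grad[symmetric] by (rule B_add, rule B_scale)

lemma \<alpha>_diff: "\<alpha> i (u - v) = \<alpha> i u - \<alpha> i v"
 using \<alpha>_add[of i "u - v" v] by simp

lemma B_expand: "B (u + r *\<^sub>R e i) (u + r *\<^sub>R e i) = B u u + 2 * r * \<alpha> i u + r\<^sup>2 * \<alpha> i (e i)"
proof -
 have "B (u + r *\<^sub>R e i) (u + r *\<^sub>R e i) = B u (u + r *\<^sub>R e i) + r * B (e i) (u + r *\<^sub>R e i)"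
  by (simp only: B_add B_scale)
 also have "B u (u + r *\<^sub>R e i) = B u u + r * \<alpha> i u"
  using B_sym[of u "u + r *\<^sub>R e i"] B_add[of u "r *\<^sub>R e i" u] B_scale[of r "e i" u] B_sym[of "e i" u] grad[of u i] by simp
 also have "B (e i) (u + r *\<^sub>R e i) = \<alpha> i u + r * \<alpha> i (e i)"
  using B_sym[of "e i" "u + r *\<^sub>R e i"] B_add[of u "r *\<^sub>R e i" "e i"] B_scale[of r "e i" "e i"] grad[of u i] grad[of "e i" i] by simp
 finally show ?thesis by (simp add: power2_eq_square algebra_simps)
qed

text \<open>Squared lengths are used because a push along \<open>e i\<close> changes them by a term
  linear in the increments of \<open>\<alpha> i\<close>, which telescopes, and by a constant
  multiple of the squared slope (\<open>B_expand\<close>).\<close>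

definition energy :: "nat => (nat => 'v) => real" where
 "energy L w = (\<Sum>j<L. B (w (Suc j) - w j) (w (Suc j) - w j))"

text \<open>The vertices are pushed along \<open>e i\<close> by a tent function that is zero at
  \<open>p\<close> and \<open>q\<close> and \<open>\<eta>\<close> at \<open>m\<close>. On each flank
  the slope is constant, so the first-order change of energy telescopes; the depth bounds at
  \<open>p\<close>, \<open>m\<close>, \<open>q\<close> control it by \<open>T\<close>, and flanks of
  width at least \<open>W\<close> give the factor \<open>1 / W\<close>.\<close>

lemma tent:
 assumes pmq: "p + W <= m" "m + W <= q" "q <= L" "W >= 1"
  and near: "\<alpha> i (w p) >= h - T" "\<alpha> i (w m) >= h - T" "\<alpha> i (w q) >= h - T" and T: "T >= 0"
 obtains w' where "!!j. j <= p \<or> q <= j ==> w' j = w j" "\<alpha> i (w' m) >= h"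
  "!!j. \<exists>r. 0 <= r & r <= T / \<alpha> i (e i) & w' j = w j + r *\<^sub>R e i"
  "energy L w' <= energy L w + 6 * T\<^sup>2 / (\<alpha> i (e i) * W)"
proof (cases "\<alpha> i (w m) >= h")
 case True
 show ?thesis
  by (rule that[of w]) (use True \<alpha>_e[of i] T pmq in \<open>auto intro!: exI[of _ 0]\<close>)
next
 case False
 define c where "c = \<alpha> i (e i)"
 have c: "c > 0" unfolding c_def by (rule \<alpha>_e)
 \<comment> \<open>The push along \<open>e i\<close> that lifts vertex \<open>m\<close> exactly to
   the level \<open>h\<close>.\<close>
 define \<eta> where "\<eta> = (h - \<alpha> i (w m)) / c"
 have \<eta>: "0 < \<eta>" "\<eta> <= T / c" unfolding \<eta>_def using False c near(2) by (auto simp: divide_right_mono)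
 define d1 where "d1 = real m - real p"
 define d2 where "d2 = real q - real m"
 have d: "d1 >= W" "d2 >= W" "W > 0" "d1 > 0" "d2 > 0" unfolding d1_def d2_def using pmq by auto
 define f where "f j = (if j <= p then 0 else if j <= m then \<eta> * (real j - real p) / d1
   else if j <= q then \<eta> * (real q - real j) / d2 else 0)" for j
 define g where "g j = (if p <= j & j < m then \<eta> / d1 else if m <= j & j < q then - (\<eta> / d2) else 0)" for j
 have fg: "f (Suc j) - f j = g j" for j
 proof -
  consider "j < p" | "p <= j" "j < m" | "m <= j" "j < q" | "q <= j" by linarith
  then show ?thesis
  proof cases
   case 1 then show ?thesis unfolding f_def g_def using pmq by auto
  next
   case 2 then show ?thesis unfolding f_def g_def using d pmq by (auto simp: field_simps)
  next
   case 3
   have "f j = \<eta> * (real q - real j) / d2"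
   proof (cases "j = m")
    case True then show ?thesis unfolding f_def using d pmq by (auto simp: d1_def d2_def)
   next
    case False then show ?thesis unfolding f_def using 3 pmq by auto
   qed
   then show ?thesis unfolding f_def g_def using d pmq 3 by (auto simp: field_simps)
  next
   case 4 then show ?thesis unfolding f_def g_def using d pmq by auto
  qed
 qed
 define w' where "w' j = w j + f j *\<^sub>R e i" for j
 have f0: "0 <= f j & f j <= \<eta>" for j
 proof -
  have "(real j - real p) / d1 <= 1" if "j <= m" using that d unfolding d1_def by (simp add: field_simps)
  moreover have "(real q - real j) / d2 <= 1" if "m < j" using that d unfolding d2_def by (simp add: field_simps)
  ultimately show ?thesis unfolding f_def using \<eta> d pmq
   by (auto simp: mult_left_le times_divide_eq_right[symmetric] simp del: times_divide_eq_right)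
 qed
 have "f m = \<eta>" unfolding f_def using d pmq by (auto simp: d1_def)
 then have "\<alpha> i (w' m) = h" unfolding w'_def \<alpha>_add \<alpha>_scale \<eta>_def using c c_def by simp
 moreover have "w' j = w j" if "j <= p \<or> q <= j" for j
  using that pmq unfolding w'_def f_def by auto
 moreover have "\<exists>r. 0 <= r & r <= T / \<alpha> i (e i) & w' j = w j + r *\<^sub>R e i" for j
  unfolding w'_def using f0[of j] \<eta>(2) c_def by (intro exI[of _ "f j"]) auto
 moreover have "energy L w' <= energy L w + 6 * T\<^sup>2 / (\<alpha> i (e i) * W)"
 proof -
  define a where "a j = \<alpha> i (w j)" for j
  have diff: "w' (Suc j) - w' j = (w (Suc j) - w j) + g j *\<^sub>R e i" for j
   unfolding w'_def fg[symmetric] by (simp add: algebra_simps)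
  have "energy L w' = energy L w + (\<Sum>j<L. 2 * g j * (a (Suc j) - a j) + (g j)\<^sup>2 * c)"
   unfolding energy_def diff B_expand \<alpha>_diff a_def c_def by (simp add: sum.distrib add.assoc)
  also have "(\<Sum>j<L. 2 * g j * (a (Suc j) - a j) + (g j)\<^sup>2 * c) = (\<Sum>j\<in>{p..<m} Un {m..<q}. 2 * g j * (a (Suc j) - a j) + (g j)\<^sup>2 * c)"
   by (rule sum.mono_neutral_right) (use pmq in \<open>auto simp: g_def\<close>)
  also have "\<dots> = (\<Sum>j\<in>{p..<m}. 2 * g j * (a (Suc j) - a j) + (g j)\<^sup>2 * c) + (\<Sum>j\<in>{m..<q}. 2 * g j * (a (Suc j) - a j) + (g j)\<^sup>2 * c)"
   by (rule sum.union_disjoint) auto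
  also have "(\<Sum>j\<in>{p..<m}. 2 * g j * (a (Suc j) - a j) + (g j)\<^sup>2 * c) = (\<Sum>j\<in>{p..<m}. 2 * (\<eta>/d1) * (a (Suc j) - a j) + (\<eta>/d1)\<^sup>2 * c)"
   by (rule sum.cong) (auto simp: g_def)
  also have "\<dots> = 2 * (\<eta>/d1) * (a m - a p) + d1 * ((\<eta>/d1)\<^sup>2 * c)"
   unfolding d1_def by (rule sum_telescope_affine) (use pmq in simp)
  also have "(\<Sum>j\<in>{m..<q}. 2 * g j * (a (Suc j) - a j) + (g j)\<^sup>2 * c) = (\<Sum>j\<in>{m..<q}. 2 * (- (\<eta>/d2)) * (a (Suc j) - a j) + (\<eta>/d2)\<^sup>2 * c)"
   by (rule sum.cong) (auto simp: g_def)
  also have "\<dots> = 2 * (- (\<eta>/d2)) * (a q - a m) + d2 * ((\<eta>/d2)\<^sup>2 * c)"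
   unfolding d2_def by (rule sum_telescope_affine) (use pmq in simp)
  finally have E: "energy L w' = energy L w + (2 * (\<eta>/d1) * (a m - a p) + d1 * ((\<eta>/d1)\<^sup>2 * c) + (2 * (- (\<eta>/d2)) * (a q - a m) + d2 * ((\<eta>/d2)\<^sup>2 * c)))" by simp
  have am: "a m <= h" using False unfolding a_def by simp
  \<comment> \<open>\<open>x\<close> is the rise of the old polygon from the foot of a flank to
    \<open>m\<close>. It is at most \<open>T\<close>, since \<open>m\<close> is not above
    \<open>h\<close> and the foot is at most \<open>T\<close> below.\<close>
  have half: "2 * (\<eta>/d') * x + d' * ((\<eta>/d')\<^sup>2 * c) <= 3 * T\<^sup>2 / (c * W)" if x: "x <= T" and d': "d' >= W" for x d' :: real
  proof -
   have d'0: "d' > 0" using d' d(3) by linarith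
   have \<eta>c: "\<eta> * c <= T" using \<eta>(2) c by (simp add: field_simps)
   have "2 * (\<eta>/d') * x + d' * ((\<eta>/d')\<^sup>2 * c) = (\<eta> / d') * (2 * x + \<eta> * c)"
    using d'0 by (simp add: power2_eq_square field_simps)
   also have "\<dots> <= (\<eta> / d') * (3 * T)"
    using x \<eta>c \<eta>(1) d'0 by (intro mult_left_mono) auto
   also have "\<dots> <= ((T / c) / W) * (3 * T)"
    using \<eta> d' d(3) T c by (intro mult_right_mono frac_le) auto
   finally show ?thesis by (simp add: power2_eq_square field_simps)
  qed
  have "2 * (\<eta>/d1) * (a m - a p) + d1 * ((\<eta>/d1)\<^sup>2 * c) <= 3 * T\<^sup>2 / (c * W)"
   by (rule half[of "a m - a p" d1]) (use am near(1) d in \<open>auto simp: a_def\<close>)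
  moreover have "2 * (\<eta>/d2) * (a m - a q) + d2 * ((\<eta>/d2)\<^sup>2 * c) <= 3 * T\<^sup>2 / (c * W)"
   by (rule half[of "a m - a q" d2]) (use am near(3) d in \<open>auto simp: a_def\<close>)
  moreover have "2 * (- (\<eta>/d2)) * (a q - a m) = 2 * (\<eta>/d2) * (a m - a q)"
   by (metis minus_diff_eq mult_minus_left mult_minus_right)
  ultimately show ?thesis using E unfolding c_def[symmetric] by simp
 qed
 ultimately show ?thesis using that[of w'] by simp
qed

text \<open>
 The indices in \<open>xs\<close> are treated in the order of increasing depth \<open>T i\<close>, so that the earlier tents,
 whose heights are at most proportional to the current depth, do not spoil the later ones.  The
 indices in \<open>P\<close> are left in place.
\<close>

definition tents :: "nat => real => real => bool" where
 "tents k Kd Ke \<longleftrightarrow> (\<forall>xs P L w h (T :: 'i => nat). length xs = k --> distinct xs --> sorted (map T xs) -->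
   (\<forall>i\<in>set xs. 1 <= T i & card {j. j < L & \<alpha> i (w j) >= h i - real (T i)} >= (CARD('i) + 1) * (2 * (T i)\<^sup>2 + 1)) -->
   finite P --> card P + k <= CARD('i) -->
   (\<exists>w' J. (\<forall>j. j : P \<or> j = 0 \<or> j >= L --> w' j = w j) &
    (\<forall>i\<in>set xs. J i <= L & \<alpha> i (w' (J i)) >= h i) &
    energy L w' <= energy L w + Ke &
    (xs ~= [] --> (\<forall>i j. \<bar>\<alpha> i (w' j) - \<alpha> i (w j)\<bar> <= Kd * T (last xs))) & (xs = [] --> w' = w)))"

text \<open>In the induction step the last index \<open>i\<close> has the largest depth. The earlier
  tents moved each root by at most \<open>Kd * T i\<close>, so the vertices counted for
  \<open>i\<close> are still within depth \<open>(1 + Kd) * T i\<close>; \<open>gap_subset\<close>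
  finds a place for the new tent away from \<open>P\<close> and from the summits of the earlier
  tents.\<close>

lemma iterated_tents: "\<exists>Kd Ke. Kd >= 0 & Ke >= 0 & tents k Kd Ke"
proof (induction k)
 case 0
 show ?case unfolding tents_def by (intro exI[of _ 0] conjI) auto
next
 case (Suc k)
 then obtain Kd Ke where K: "Kd >= 0" "Ke >= 0" and IH: "tents k Kd Ke" by blast
 define cm where "cm = Min (range (%i. \<alpha> i (e i)))"
 have cm: "cm > 0" "!!i. cm <= \<alpha> i (e i)" unfolding cm_def using \<alpha>_e by auto
 define M where "M = Max (range (%(i, k). \<bar>\<alpha> i (e k)\<bar>))"
 have M: "\<bar>\<alpha> i (e k)\<bar> <= M" for i k unfolding M_def by (rule Max_ge) (auto intro: rev_image_eqI[of "(i, k)"])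
 have M0: "M >= 0" using M[of undefined undefined] by linarith
 define Kd' where "Kd' = Kd + (1 + Kd) / cm * M"
 define Ke' where "Ke' = Ke + 6 * (1 + Kd)\<^sup>2 / cm"
 have main: "\<exists>w' J. (\<forall>j. j : P \<or> j = 0 \<or> j >= L --> w' j = w j) &
    (\<forall>i\<in>set xs. J i <= L & \<alpha> i (w' (J i)) >= h i) &
    energy L w' <= energy L w + Ke' &
    (xs ~= [] --> (\<forall>i j. \<bar>\<alpha> i (w' j) - \<alpha> i (w j)\<bar> <= Kd' * T (last xs))) & (xs = [] --> w' = w)"
  if xs: "length xs = Suc k" "distinct xs" "sorted (map T xs)"
   "\<forall>i\<in>set xs. 1 <= (T i :: nat) & card {j. j < L & \<alpha> i (w j) >= h i - real (T i)} >= (CARD('i) + 1) * (2 * (T i)\<^sup>2 + 1)"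
   and P: "finite P" "card P + Suc k <= CARD('i)" for xs P L w h T
 proof -
  obtain ys i where ys: "xs = ys @ [i]" using xs(1) by (metis length_Suc_conv_rev)
  have len: "length ys = k" and ds: "distinct ys" "i ~: set ys" and so: "sorted (map T ys)" "!!y. y : set ys ==> T y <= T i"
   using xs unfolding ys by (auto simp: sorted_append)
  have "\<exists>w' J. (\<forall>j. j : P \<or> j = 0 \<or> j >= L --> w' j = w j) &
    (\<forall>i\<in>set ys. J i <= L & \<alpha> i (w' (J i)) >= h i) &
    energy L w' <= energy L w + Ke &
    (ys ~= [] --> (\<forall>i j. \<bar>\<alpha> i (w' j) - \<alpha> i (w j)\<bar> <= Kd * T (last ys))) & (ys = [] --> w' = w)"
   by (rule IH[unfolded tents_def, rule_format, OF len ds(1) so(1) _ P(1)]) (use xs(4) P(2) ys in auto)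
  then obtain w1 J1 where w1: "!!j. j : P \<or> j = 0 \<or> j >= L ==> w1 j = w j"
    "!!i. i : set ys ==> J1 i <= L & \<alpha> i (w1 (J1 i)) >= h i"
    "energy L w1 <= energy L w + Ke"
    "ys ~= [] ==> (\<forall>i j. \<bar>\<alpha> i (w1 j) - \<alpha> i (w j)\<bar> <= Kd * T (last ys))" "ys = [] ==> w1 = w" by blast
  have disp: "\<bar>\<alpha> l (w1 j) - \<alpha> l (w j)\<bar> <= Kd * T i" for l j
  proof (cases "ys = []")
   case True then show ?thesis using w1(5) K by simp
  next
   case False
   have "\<bar>\<alpha> l (w1 j) - \<alpha> l (w j)\<bar> <= Kd * T (last ys)" using w1(4)[OF False] by blast
   also have "\<dots> <= Kd * T i" using so(2)[of "last ys"] False K by (intro mult_left_mono) auto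
   finally show ?thesis .
  qed
  define A where "A = {j. j < L & \<alpha> i (w j) >= h i - real (T i)}"
  have A: "card A >= (CARD('i) + 1) * (2 * (T i)\<^sup>2 + 1)" and Ti: "T i >= 1" using xs(4) unfolding ys A_def by auto
  \<comment> \<open>The positions that must not move, \<open>P\<close> and the summits
    \<open>J1\<close>, number at most \<open>CARD('i)\<close>, as \<open>gap_subset\<close>
    requires.\<close>
  have "card (P Un J1 ` set ys) <= card P + card (J1 ` set ys)" by (rule card_Un_le)
  also have "\<dots> <= card P + k" using card_image_le[of "set ys" J1] len card_length[of ys] by auto
  finally have cP: "card (P Un J1 ` set ys) <= CARD('i)" using P(2) by simp
  have fA: "finite A" "finite (P Un J1 ` set ys)" unfolding A_def using P(1) by auto
  note fP = fA(2) and fA = fA(1)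
  obtain p m q where pmq: "p : A" "m : A" "q : A" "p + (T i)\<^sup>2 <= m" "m + (T i)\<^sup>2 <= q" "(P Un J1 ` set ys) Int {p<..<q} = {}"
   using gap_subset[OF fA fP cP A] by metis
  define T' where "T' = (1 + Kd) * real (T i)"
  have near: "\<alpha> i (w1 j) >= h i - T'" if "j : A" for j
   using that disp[of i j] unfolding A_def T'_def by (auto simp: algebra_simps abs_le_iff)
  have T'0: "T' >= 0" "(T i)\<^sup>2 >= 1" unfolding T'_def using K Ti by auto
  have qL: "q <= L" using pmq(3) unfolding A_def by simp
  obtain w2 where w2: "!!j. j <= p \<or> q <= j ==> w2 j = w1 j" "\<alpha> i (w2 m) >= h i"
   "!!j. \<exists>r. 0 <= r & r <= T' / \<alpha> i (e i) & w2 j = w1 j + r *\<^sub>R e i"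
   "energy L w2 <= energy L w1 + 6 * T'\<^sup>2 / (\<alpha> i (e i) * real ((T i)\<^sup>2))"
   using tent[OF pmq(4,5) qL T'0(2) near[OF pmq(1)] near[OF pmq(2)] near[OF pmq(3)] T'0(1)] by metis
  \<comment> \<open>Width \<open>(T i)\<^sup>2\<close> against a height proportional to
    \<open>T i\<close>: the depth cancels and the cost is a constant.\<close>
  have en: "6 * T'\<^sup>2 / (\<alpha> i (e i) * real ((T i)\<^sup>2)) <= 6 * (1 + Kd)\<^sup>2 / cm"
  proof -
   have "6 * T'\<^sup>2 / (\<alpha> i (e i) * real ((T i)\<^sup>2)) = 6 * (1 + Kd)\<^sup>2 / \<alpha> i (e i)"
    unfolding T'_def using Ti by (simp add: power_mult_distrib)
   also have "\<dots> <= 6 * (1 + Kd)\<^sup>2 / cm" using cm by (intro divide_left_mono mult_pos_pos \<alpha>_e) auto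
   finally show ?thesis .
  qed
  have keep: "w2 j = w1 j" if "j : P Un J1 ` set ys" for j
   using pmq(6) that by (intro w2(1)) (auto simp: disjoint_iff not_less)
  define J where "J = J1(i := m)"
  show ?thesis
  proof (intro exI[of _ w2] exI[of _ J] conjI allI ballI impI)
   fix j assume j: "j : P \<or> j = 0 \<or> j >= L"
   then have "w2 j = w1 j" using keep w2(1) qL by auto
   then show "w2 j = w j" using w1(1)[OF j] by simp
  next
   fix l assume "l : set xs"
   then show "J l <= L" unfolding J_def using w1(2) pmq(2) ys A_def by auto
  next
   fix l assume "l : set xs"
   then show "h l <= \<alpha> l (w2 (J l))" unfolding J_def using w1(2) w2(2) ys ds(2) keep by auto
  next
   show "energy L w2 <= energy L w + Ke'" unfolding Ke'_def using w2(4) w1(3) en by linarith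
  next
   fix l j
   obtain r where r: "0 <= r" "r <= T' / \<alpha> i (e i)" "w2 j = w1 j + r *\<^sub>R e i" using w2(3) by blast
   have "\<bar>r * \<alpha> l (e i)\<bar> <= (T' / cm) * M"
   proof -
    have "T' / \<alpha> i (e i) <= T' / cm" using cm T'0 by (intro divide_left_mono mult_pos_pos \<alpha>_e) auto
    then show ?thesis unfolding abs_mult using r M M0 T'0 cm by (intro mult_mono) auto
   qed
   then have "\<bar>\<alpha> l (w2 j) - \<alpha> l (w j)\<bar> <= Kd * T i + (T' / cm) * M"
    using disp[of l j] unfolding r(3) \<alpha>_add \<alpha>_scale by linarith
   then show "\<bar>\<alpha> l (w2 j) - \<alpha> l (w j)\<bar> <= Kd' * T (last xs)"
    unfolding Kd'_def T'_def ys by (simp add: algebra_simps)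
  qed (use ys in auto)
 qed
 have "tents (Suc k) Kd' Ke'"
  unfolding tents_def by (intro allI impI, rule main) assumption+
 moreover have "Kd' >= 0" "Ke' >= 0" unfolding Kd'_def Ke'_def using K cm M0 by auto
 ultimately show ?case by blast
qed

lemma summable_quadratic_exp:
 assumes "\<kappa> > 0" shows "summable (%T::nat. exp (- \<kappa> * real T) * (2 * (real T)\<^sup>2 + 1))"
proof (rule summable_comparison_test)
 \<comment> \<open>From \<open>y\<^sup>2 / 2 <= exp y\<close> with
   \<open>y = \<kappa> * T / 2\<close>: half of the exponential decay absorbs the quadratic
   factor.\<close>
 define c where "c = 16 / \<kappa>\<^sup>2 + 1"
 have "summable (%T. exp (- \<kappa> / 2) ^ T)" using assms by (intro summable_geometric) simp
 then show "summable (%T. c * exp (- \<kappa> / 2) ^ T)" by (rule summable_mult)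
 have "norm (exp (- \<kappa> * real T) * (2 * (real T)\<^sup>2 + 1)) <= c * exp (- \<kappa> / 2) ^ T" for T
 proof -
  define y where "y = \<kappa> * real T / 2"
  have y: "y >= 0" unfolding y_def using assms by simp
  have e: "1 + y + y\<^sup>2 / 2 <= exp y" by (rule exp_lower_Taylor_quadratic[OF y])
  have "(real T)\<^sup>2 = 8 / \<kappa>\<^sup>2 * (y\<^sup>2 / 2)" unfolding y_def using assms by (simp add: power2_eq_square field_simps)
  also have "\<dots> <= 8 / \<kappa>\<^sup>2 * exp y" using e y by (intro mult_left_mono) auto
  finally have "(real T)\<^sup>2 <= 8 / \<kappa>\<^sup>2 * exp y" .
  moreover have "c * exp y = 2 * (8 / \<kappa>\<^sup>2 * exp y) + exp y" unfolding c_def by (simp add: algebra_simps)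
  moreover have "1 <= exp y" using y by simp
  ultimately have "2 * (real T)\<^sup>2 + 1 <= c * exp y" by linarith
  then have "exp (- \<kappa> * real T) * (2 * (real T)\<^sup>2 + 1) <= exp (- \<kappa> * real T) * (c * exp y)" by simp
  also have "\<dots> = c * exp (- \<kappa> / 2) ^ T" unfolding y_def
   by (simp add: exp_of_nat_mult[symmetric] mult.left_commute exp_add[symmetric] field_simps)
  finally show ?thesis by simp
 qed
 then show "\<exists>N. \<forall>T\<ge>N. norm (exp (- \<kappa> * real T) * (2 * (real T)\<^sup>2 + 1)) <= c * exp (- \<kappa> / 2) ^ T" by blast
qed

text \<open>If few vertices come close to the level \<open>h\<close>, the weights are square
  summable with an extra factor \<open>exp (- \<kappa> * \<tau>)\<close>, where
  \<open>\<tau>\<close> is the least depth. By Cauchy-Schwarz the squares of \<open>x\<close> then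
  sum to at least a multiple of \<open>exp (\<kappa> * \<tau>)\<close>, which dominates the cost
  \<open>b * \<tau>\<close> of a detour from the highest vertex.\<close>

lemma few_visits:
 assumes \<kappa>: "\<kappa> > 0" and b: "b >= 0" and m: "m > 0" and C: "C > 0"
 shows "\<exists>K0\<ge>0. \<forall>(L :: nat) a x h. (\<forall>T\<ge>1. card {j. j < L & a j >= h - real T} < n * (2 * T\<^sup>2 + 1)) -->
  (\<forall>j<L. a j < h) --> 1 <= (\<Sum>j<L. C * exp (- \<kappa> * (h - a j)) * x j) -->
  (\<exists>J<L. b * (h - a J) <= m * (\<Sum>j<L. (x j)\<^sup>2) + K0)"
proof -
 define s where "s T = real n * (exp (- \<kappa> * real T) * (2 * (real T)\<^sup>2 + 1))" for T :: nat
 have sum_s: "summable s" unfolding s_def by (rule summable_mult[OF summable_quadratic_exp[OF \<kappa>]])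
 have s0: "s T >= 0" for T unfolding s_def by simp
 define S where "S = suminf s + 1"
 have S: "S > 0" unfolding S_def using suminf_nonneg[OF sum_s s0] by linarith
 define Q where "Q = C\<^sup>2 * (exp (2 * \<kappa>) * S)"
 have Q: "Q > 0" unfolding Q_def using C S by simp
 \<comment> \<open>Chosen so that \<open>(\<kappa> * \<tau>)\<^sup>2 / 2 <= Q * X\<close> becomes
   \<open>A * \<tau>\<^sup>2 <= m * X\<close>; completing the square then produces the constant
   \<open>b\<^sup>2 / (4 * A)\<close>.\<close>
 define A where "A = m * \<kappa>\<^sup>2 / (2 * Q)"
 have A: "A > 0" unfolding A_def using m \<kappa> Q by simp
 have main: "\<exists>J<L. b * (h - a J) <= m * (\<Sum>j<L. (x j)\<^sup>2) + b\<^sup>2 / (4 * A)"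
  if few: "!!T. T >= 1 ==> card {j. j < L & a j >= h - real T} < n * (2 * T\<^sup>2 + 1)"
   and below: "!!j. j < L ==> a j < h" and one: "1 <= (\<Sum>j<L. C * exp (- \<kappa> * (h - a j)) * x j)" for L :: nat and a x h
 proof -
  have L0: "L > 0" using one by (cases L) auto
  then have ne: "a ` {..<L} ~= {}" by auto
  then have "Max (a ` {..<L}) : a ` {..<L}" by (intro Max_in) auto
  then obtain J where J: "J < L" "Max (a ` {..<L}) = a J" by auto
  have Jmax: "a j <= a J" if "j < L" for j using Max_ge[of "a ` {..<L}" "a j"] that J(2) by auto
  define \<tau> where "\<tau> = h - a J"
  have \<tau>: "\<tau> > 0" unfolding \<tau>_def using below[OF J(1)] by simp
  define t where "t j = nat \<lceil>h - a j\<rceil>" for j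
  have t: "real (t j) >= h - a j" "real (t j) <= h - a j + 1" "t j >= 1" if "j < L" for j
   using below[OF that] unfolding t_def by linarith+
  define X where "X = (\<Sum>j<L. (x j)\<^sup>2)"
  have "(\<Sum>j<L. exp (- \<kappa> * real (t j))) = (\<Sum>T\<in>t ` {..<L}. \<Sum>j\<in>{j : {..<L}. t j = T}. exp (- \<kappa> * real (t j)))"
   by (rule sum.group[symmetric]) auto
  also have "\<dots> <= (\<Sum>T\<in>t ` {..<L}. s T)"
  proof (rule sum_mono)
   fix T assume "T : t ` {..<L}"
   then have T1: "T >= 1" using t(3) by auto
   have sub: "{j : {..<L}. t j = T} <= {j. j < L & a j >= h - real T}" using t(1) by force
   then have "card {j : {..<L}. t j = T} <= n * (2 * T\<^sup>2 + 1)"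
    using le_trans[OF card_mono[OF _ sub] less_imp_le[OF few[OF T1]]] by simp
   then have "real (card {j : {..<L}. t j = T}) <= real (n * (2 * T\<^sup>2 + 1))" by (rule of_nat_mono)
   then have "real (card {j : {..<L}. t j = T}) * exp (- \<kappa> * real T) <= real (n * (2 * T\<^sup>2 + 1)) * exp (- \<kappa> * real T)"
    by (rule mult_right_mono) simp
   also have "\<dots> = s T" unfolding s_def by (simp add: algebra_simps)
   finally show "(\<Sum>j\<in>{j : {..<L}. t j = T}. exp (- \<kappa> * real (t j))) <= s T" by simp
  qed
  also have "\<dots> <= suminf s" by (rule sum_le_suminf[OF sum_s]) (use s0 in auto)
  finally have sumt: "(\<Sum>j<L. exp (- \<kappa> * real (t j))) <= S" unfolding S_def by simp
  \<comment> \<open>One of the two exponential factors is bounded through the least depth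
    \<open>\<tau>\<close>, the other through the rounded depth \<open>t j\<close>, over which the
    counts of vertices are summable. The factor \<open>exp (2 * \<kappa>)\<close> covers the
    rounding.\<close>
  have "(\<Sum>j<L. (exp (- \<kappa> * (h - a j)))\<^sup>2) <= (\<Sum>j<L. (exp (2 * \<kappa>) * exp (- \<kappa> * \<tau>)) * exp (- \<kappa> * real (t j)))"
  proof (rule sum_mono)
   fix j assume "j : {..<L}"
   then have j: "j < L" by simp
   have "\<kappa> * real (t j) <= \<kappa> * (h - a j + 1)" "\<kappa> * \<tau> <= \<kappa> * (h - a j)"
    using t(2)[OF j] Jmax[OF j] \<kappa> unfolding \<tau>_def by (auto intro!: mult_left_mono)
   then have "2 * (- \<kappa> * (h - a j)) <= 2 * \<kappa> + - \<kappa> * \<tau> + - \<kappa> * real (t j)" using \<kappa> by (simp add: algebra_simps)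
   then show "(exp (- \<kappa> * (h - a j)))\<^sup>2 <= (exp (2 * \<kappa>) * exp (- \<kappa> * \<tau>)) * exp (- \<kappa> * real (t j))"
    unfolding exp_double[symmetric] exp_add[symmetric] by simp
  qed
  also have "\<dots> = (exp (2 * \<kappa>) * exp (- \<kappa> * \<tau>)) * (\<Sum>j<L. exp (- \<kappa> * real (t j)))" by (simp only: sum_distrib_left)
  also have "\<dots> <= (exp (2 * \<kappa>) * exp (- \<kappa> * \<tau>)) * S" using sumt by (intro mult_left_mono) auto
  finally have Z: "(\<Sum>j<L. (exp (- \<kappa> * (h - a j)))\<^sup>2) <= exp (2 * \<kappa>) * exp (- \<kappa> * \<tau>) * S" .
  have "1 <= (\<Sum>j<L. C * exp (- \<kappa> * (h - a j)) * x j)\<^sup>2" using one by (simp add: one_le_power)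
  also have "(\<Sum>j<L. C * exp (- \<kappa> * (h - a j)) * x j) = C * (\<Sum>j<L. exp (- \<kappa> * (h - a j)) * x j)"
   by (simp only: sum_distrib_left mult.assoc)
  also have "\<dots>\<^sup>2 = C\<^sup>2 * (\<Sum>j<L. exp (- \<kappa> * (h - a j)) * x j)\<^sup>2" by (simp add: power_mult_distrib)
  also have "\<dots> <= C\<^sup>2 * ((\<Sum>j<L. (exp (- \<kappa> * (h - a j)))\<^sup>2) * X)"
   unfolding X_def by (intro mult_left_mono Cauchy_Schwarz_ineq_sum) simp
  also have "\<dots> <= C\<^sup>2 * ((exp (2 * \<kappa>) * exp (- \<kappa> * \<tau>) * S) * X)"
   by (intro mult_left_mono mult_right_mono Z) (auto simp: X_def intro: sum_nonneg)
  finally have "1 <= Q * X * exp (- \<kappa> * \<tau>)" unfolding Q_def by (simp add: algebra_simps)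
  then have "1 * exp (\<kappa> * \<tau>) <= Q * X * exp (- \<kappa> * \<tau>) * exp (\<kappa> * \<tau>)" by (intro mult_right_mono) auto
  moreover have "exp (- \<kappa> * \<tau>) * exp (\<kappa> * \<tau>) = 1" by (simp add: exp_add[symmetric])
  ultimately have "exp (\<kappa> * \<tau>) <= Q * X" by (simp only: mult.assoc mult_1_right mult_1_left)
  moreover have "(\<kappa> * \<tau>)\<^sup>2 / 2 <= exp (\<kappa> * \<tau>)"
   using exp_lower_Taylor_quadratic[of "\<kappa> * \<tau>"] \<kappa> \<tau> mult_pos_pos[OF \<kappa> \<tau>] by linarith
  ultimately have "(\<kappa> * \<tau>)\<^sup>2 / 2 <= Q * X" by linarith
  then have "A * \<tau>\<^sup>2 <= m * X"
   using Q m mult_left_mono[of "(\<kappa> * \<tau>)\<^sup>2 / 2" "Q * X" "m / Q"] unfolding A_def by (simp add: power_mult_distrib field_simps)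
  moreover have "b * \<tau> <= A * \<tau>\<^sup>2 + b\<^sup>2 / (4 * A)"
  proof -
   have "0 <= A * (\<tau> - b / (2 * A))\<^sup>2" using A by simp
   also have "\<dots> = A * \<tau>\<^sup>2 - b * \<tau> + b\<^sup>2 / (4 * A)" using A by (simp add: power2_eq_square field_simps)
   finally show ?thesis by linarith
  qed
  ultimately show ?thesis using J(1) unfolding \<tau>_def X_def by (intro exI[of _ J]) linarith
 qed
 have "b\<^sup>2 / (4 * A) >= 0" using A by simp
 then show ?thesis by (intro exI[of _ "b\<^sup>2 / (4 * A)"] conjI allI impI main) auto
qed

text \<open>Each index is of one of two kinds. If at some depth the polygon has \<open>many\<close>
  vertices, a tent is cheap. Otherwise a loop along \<open>e i\<close> from some vertex is
  affordable, either because a vertex is within \<open>C2\<close> of the level or because the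
  squares of \<open>x\<close> pay for it.\<close>

lemma visiting_polygon:
 assumes \<kappa>: "\<kappa> > 0" and C: "C > 0" and C2: "C2 >= 0"
 obtains K where "!!L w x h. (!!j. j < L ==> B (w (Suc j) - w j) (w (Suc j) - w j) + (x j)\<^sup>2 <= 1) ==>
   (!!i. (\<exists>j\<le>L. \<alpha> i (w j) >= h i - C2) \<or> 1 <= (\<Sum>j<L. C * exp (- \<kappa> * (h i - \<alpha> i (w j))) * x j)) ==>
   \<exists>w' J u. w' 0 = w 0 & w' L = w L & (\<forall>i. J i <= L & \<alpha> i (u i) >= h i) &
    (\<Sum>j<L. sqrt (B (w' (Suc j) - w' j) (w' (Suc j) - w' j))) +
    2 * (\<Sum>i\<in>UNIV. sqrt (B (u i - w' (J i)) (u i - w' (J i)))) <= real L + K"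
proof -
 define n where "n = CARD('i)"
 have n: "n > 0" unfolding n_def by simp
 \<comment> \<open>Length of the way up and back along \<open>e i\<close>, per unit of
   \<open>\<alpha> i\<close>.\<close>
 define b where "b i = 2 / sqrt (\<alpha> i (e i))" for i
 have b: "b i > 0" for i unfolding b_def using \<alpha>_e by simp
 \<comment> \<open>All loops together may use half of \<open>X\<close>, which is exactly what the
   missing vertical squares save when energy is converted to length.\<close>
 define m where "m = 1 / (2 * real n)"
 have m: "m > 0" unfolding m_def using n by simp
 define ok where "ok i K0 \<longleftrightarrow> (\<forall>(L :: nat) a x h. (\<forall>T\<ge>1. card {j. j < L & a j >= h - real T} < (n + 1) * (2 * T\<^sup>2 + 1)) -->
  (\<forall>j<L. a j < h) --> 1 <= (\<Sum>j<L. C * exp (- \<kappa> * (h - a j)) * x j) -->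
  (\<exists>J<L. b i * (h - a J) <= m * (\<Sum>j<L. (x j)\<^sup>2) + K0))" for i K0
 have "\<exists>K0\<ge>0. ok i K0" for i
  unfolding ok_def using few_visits[OF \<kappa> less_imp_le[OF b[of i]] m C, of "n + 1"] .
 then obtain K0 where K0: "!!i. K0 i >= 0" and ok: "!!i. ok i (K0 i)" by metis
 note few = ok[unfolded ok_def, rule_format]
 have "\<forall>k. \<exists>Ke. Ke >= 0 & (\<exists>Kd. tents k Kd Ke)" using iterated_tents by blast
 then obtain Ke where Ke: "!!k. Ke k >= 0" "!!k. \<exists>Kd. tents k Kd (Ke k)" by metis
 define K where "K = (\<Sum>k\<le>n. Ke k) + (\<Sum>i\<in>UNIV. b i * C2 + K0 i)"
 show ?thesis
 proof (rule that[of K])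
  fix L w x h
  assume step: "!!j. j < L ==> B (w (Suc j) - w j) (w (Suc j) - w j) + (x j)\<^sup>2 <= 1"
   and vis: "!!i. (\<exists>j\<le>L. \<alpha> i (w j) >= h i - C2) \<or> 1 <= (\<Sum>j<L. C * exp (- \<kappa> * (h i - \<alpha> i (w j))) * x j)"
  define X where "X = (\<Sum>j<L. (x j)\<^sup>2)"
  have X0: "X >= 0" unfolding X_def by (simp add: sum_nonneg)
  define many where "many i T \<longleftrightarrow> T >= 1 & (n + 1) * (2 * T\<^sup>2 + 1) <= card {j. j < L & \<alpha> i (w j) >= h i - real T}" for i and T :: nat
  define I where "I = {i. \<exists>T. many i T}"
  define T where "T i = (SOME T. many i T)" for i
  have T: "many i (T i)" if "i : I" for i using that unfolding I_def T_def by (auto intro: someI_ex)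
  have loops: "\<exists>J\<le>L. b i * max 0 (h i - \<alpha> i (w J)) <= m * X + b i * C2 + K0 i" if i: "i ~: I" for i
  proof (cases "\<exists>j\<le>L. \<alpha> i (w j) >= h i - C2")
   case True
   then obtain j where j: "j <= L" "h i - \<alpha> i (w j) <= C2" by force
   then have "b i * max 0 (h i - \<alpha> i (w j)) <= b i * C2" using C2 b[of i] by (intro mult_left_mono) auto
   then show ?thesis using j(1) X0 K0[of i] m by (intro exI[of _ j]) (auto simp: add_increasing add_increasing2)
  next
   case False
   have "\<forall>j<L. \<alpha> i (w j) < h i"
   proof (intro allI impI)
    fix j assume "j < L"
    then have "\<not> \<alpha> i (w j) >= h i - C2" using False less_imp_le by blast
    then show "\<alpha> i (w j) < h i" using C2 by linarith
   qed
   moreover have "\<forall>T\<ge>1. card {j. j < L & \<alpha> i (w j) >= h i - real T} < (n + 1) * (2 * T\<^sup>2 + 1)"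
   proof (intro allI impI)
    fix S :: nat assume "S >= 1"
    moreover have "\<not> many i S" using i unfolding I_def by blast
    ultimately show "card {j. j < L & \<alpha> i (w j) >= h i - real S} < (n + 1) * (2 * S\<^sup>2 + 1)"
     unfolding many_def by linarith
   qed
   moreover have "1 <= (\<Sum>j<L. C * exp (- \<kappa> * (h i - \<alpha> i (w j))) * x j)" using vis[of i] False by blast
   ultimately obtain J where J: "J < L" "b i * (h i - \<alpha> i (w J)) <= m * X + K0 i"
    using few[of L "h i" "%j. \<alpha> i (w j)" x i] unfolding X_def by blast
   have "0 <= b i * C2" using b[of i] C2 by simp
   then show ?thesis using J \<open>\<forall>j<L. \<alpha> i (w j) < h i\<close> by (intro exI[of _ J]) (auto simp: max_def)
  qed
  then obtain J0 where J0: "!!i. i ~: I ==> J0 i <= L & b i * max 0 (h i - \<alpha> i (w (J0 i))) <= m * X + b i * C2 + K0 i" by metis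
  define xs where "xs = sort_key T (SOME l. set l = I & distinct l)"
  have "\<exists>l. set l = I & distinct l" using finite_distinct_list[of I] by auto
  then have "set (SOME l. set l = I & distinct l) = I & distinct (SOME l. set l = I & distinct l)" by (rule someI_ex)
  then have xs: "set xs = I" "distinct xs" "sorted (map T xs)" unfolding xs_def by auto
  \<comment> \<open>The vertices from which loops start; the tents must leave them in place.\<close>
  define P where "P = J0 ` (- I)"
  have lxs: "length xs = card I" using xs distinct_card by metis
  have "card P + length xs <= card (- I) + card I" unfolding P_def lxs by (intro add_mono card_image_le) auto
  also have "\<dots> = CARD('i)" by (metis card_Un_disjoint Compl_disjoint2 Compl_partition2 finite)
  finally have cP: "card P + length xs <= CARD('i)" .
  obtain Kd where "tents (length xs) Kd (Ke (length xs))" using Ke(2) by blast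
  note tn = this[unfolded tents_def, THEN spec[where x = xs], THEN spec[where x = P], THEN spec[where x = L],
    THEN spec[where x = w], THEN spec[where x = h], THEN spec[where x = T]]
  have pr: "\<forall>i\<in>set xs. 1 <= T i & card {j. j < L & \<alpha> i (w j) >= h i - real (T i)} >= (CARD('i) + 1) * (2 * (T i)\<^sup>2 + 1)"
   using T unfolding many_def xs(1) n_def by blast
  have fP: "finite P" unfolding P_def by simp
  note tn[THEN mp, OF refl, THEN mp, OF xs(2), THEN mp, OF xs(3), THEN mp, OF pr, THEN mp, OF fP, THEN mp, OF cP]
  then obtain w' J1 where w': "!!j. j : P \<or> j = 0 \<or> j >= L ==> w' j = w j"
    "!!i. i : I ==> J1 i <= L & \<alpha> i (w' (J1 i)) >= h i" "energy L w' <= energy L w + Ke (length xs)"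
   unfolding xs(1) by blast
  define J where "J i = (if i : I then J1 i else J0 i)" for i
  define r where "r i = (if i : I then 0 else max 0 (h i - \<alpha> i (w (J0 i))) / \<alpha> i (e i))" for i
  define u where "u i = w' (J i) + r i *\<^sub>R e i" for i
  have r0: "r i >= 0" for i unfolding r_def using \<alpha>_e[of i] by auto
  have JL: "J i <= L" for i unfolding J_def using w'(2) J0 by simp
  have u: "\<alpha> i (u i) >= h i" for i
  proof (cases "i : I")
   case True then show ?thesis unfolding u_def J_def r_def using w'(2) by simp
  next
   case False
   then have "w' (J0 i) = w (J0 i)" using w'(1) unfolding P_def by simp
   then show ?thesis using False \<alpha>_e[of i] unfolding u_def J_def r_def by (simp add: \<alpha>_add \<alpha>_scale)
  qed
  have B_loop: "2 * sqrt (B (u i - w' (J i)) (u i - w' (J i))) <= (if i : I then 0 else m * X) + (b i * C2 + K0 i)" for i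
  proof -
   have "B (r i *\<^sub>R e i) (r i *\<^sub>R e i) = (r i)\<^sup>2 * \<alpha> i (e i)"
    unfolding B_scale using B_sym[of "e i" "r i *\<^sub>R e i"] B_scale[of "r i" "e i" "e i"] grad[of "e i" i] by (simp add: power2_eq_square)
   then have "2 * sqrt (B (u i - w' (J i)) (u i - w' (J i))) = 2 * (r i * sqrt (\<alpha> i (e i)))"
    unfolding u_def using r0 by (simp add: real_sqrt_mult)
   also have "\<dots> = (if i : I then 0 else b i * max 0 (h i - \<alpha> i (w (J0 i))))"
    unfolding r_def b_def using \<alpha>_e[of i] by (simp add: field_simps)
   also have "\<dots> <= (if i : I then 0 else m * X) + (b i * C2 + K0 i)"
    using J0[of i] b[of i] C2 K0[of i] by (auto simp: less_imp_le)
   finally show ?thesis .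
  qed
  have "(\<Sum>i\<in>UNIV. 2 * sqrt (B (u i - w' (J i)) (u i - w' (J i)))) <= (\<Sum>i\<in>UNIV. m * X + (b i * C2 + K0 i))"
   by (rule sum_mono, rule order_trans[OF B_loop]) (use m X0 in auto)
  also have "\<dots> = X / 2 + (\<Sum>i\<in>UNIV. b i * C2 + K0 i)"
   unfolding sum.distrib m_def using n by (simp add: n_def)
  finally have loop_len: "2 * (\<Sum>i\<in>UNIV. sqrt (B (u i - w' (J i)) (u i - w' (J i)))) <= X / 2 + (\<Sum>i\<in>UNIV. b i * C2 + K0 i)"
   by (simp only: sum_distrib_left)
  \<comment> \<open>With energy at most \<open>L - X + Ke\<close> this bounds the length by
    \<open>L - X / 2 + Ke / 2\<close>.\<close>
  have am: "sqrt y <= (1 + y) / 2" if "y >= 0" for y :: real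
   using arith_geo_mean_sqrt[of 1 y] that by simp
  have "(\<Sum>j<L. sqrt (B (w' (Suc j) - w' j) (w' (Suc j) - w' j))) <= (\<Sum>j<L. (1 + B (w' (Suc j) - w' j) (w' (Suc j) - w' j)) / 2)"
   by (intro sum_mono am B_nonneg)
  also have "\<dots> = (real L + energy L w') / 2" unfolding energy_def by (simp add: sum.distrib sum_divide_distrib[symmetric] add_divide_distrib)
  also have "energy L w' <= energy L w + Ke (length xs)" by (rule w'(3))
  also have "energy L w <= (\<Sum>j<L. 1 - (x j)\<^sup>2)" unfolding energy_def by (rule sum_mono) (use step in force)
  also have "\<dots> = real L - X" unfolding X_def by (simp add: sum_subtractf)
  finally have len: "(\<Sum>j<L. sqrt (B (w' (Suc j) - w' j) (w' (Suc j) - w' j))) <= (real L + (real L - X + Ke (length xs))) / 2" by simp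
  have "card I <= n" unfolding n_def by (rule card_mono) auto
  then have "Ke (length xs) <= (\<Sum>k\<le>n. Ke k)" unfolding lxs using Ke(1) by (intro member_le_sum) auto
  note lKe = this
  have arith: "p + q <= l + (M + S)" if "p <= (l + (l - X + k)) / 2" "q <= X / 2 + S" "k <= M" "0 <= k" for p q l k M S :: real
   using that by (simp add: field_simps)
  have "(\<Sum>j<L. sqrt (B (w' (Suc j) - w' j) (w' (Suc j) - w' j))) +
    2 * (\<Sum>i\<in>UNIV. sqrt (B (u i - w' (J i)) (u i - w' (J i)))) <= real L + K"
   unfolding K_def by (rule arith[OF len loop_len lKe Ke(1)])
  then show "\<exists>w' J u. w' 0 = w 0 & w' L = w L & (\<forall>i. J i <= L & \<alpha> i (u i) >= h i) &
    (\<Sum>j<L. sqrt (B (w' (Suc j) - w' j) (w' (Suc j) - w' j))) +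
    2 * (\<Sum>i\<in>UNIV. sqrt (B (u i - w' (J i)) (u i - w' (J i)))) <= real L + K"
   using w'(1) JL u by (intro exI[of _ w'] exI[of _ J] exI[of _ u]) auto
 qed
qed

end

section \<open>Differentials of composites, and auxiliary facts on paths\<close>

lemma differential_velocity:
 fixes G :: "('a::{t2_space, second_countable_topology}, 'e::euclidean_space) lie_struct"
  and H :: "('b::{t2_space, second_countable_topology}, 'f::euclidean_space) lie_struct"
 assumes G: "lie_group G" and H: "lie_group H" and f: "smooth_map (carrier G) (model G) (atlas G) (carrier H) (atlas H) f"
  and one: "f \<one>\<^bsub>G\<^esub> = \<one>\<^bsub>H\<^esub>" and v: "velocity_at G b t J X"
 shows "velocity_at H (%r. f (b r)) t J (differential G H f X)"
proof -
 obtain L where L: "!!X. X : model G ==> L X = differential G H f X"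
  "!!b t J X. velocity_at G b t J X ==> velocity_at H (%r. f (b r)) t J (L X)"
  using velocity_at_map[OF G H f one] by metis
 then show ?thesis using v unfolding velocity_at_def by metis
qed

lemma differential_compose:
 fixes G :: "('a::{t2_space, second_countable_topology}, 'e::euclidean_space) lie_struct"
  and H :: "('b::{t2_space, second_countable_topology}, 'f::euclidean_space) lie_struct"
  and K :: "('c::{t2_space, second_countable_topology}, 'g::euclidean_space) lie_struct"
 assumes G: "lie_group G" and H: "lie_group H" and K: "lie_group K"
  and f: "smooth_map (carrier G) (model G) (atlas G) (carrier H) (atlas H) f" "f \<one>\<^bsub>G\<^esub> = \<one>\<^bsub>H\<^esub>"
  and g: "smooth_map (carrier H) (model H) (atlas H) (carrier K) (atlas K) g" "g \<one>\<^bsub>H\<^esub> = \<one>\<^bsub>K\<^esub>"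
  and X: "X : model G"
 shows "differential G K (%x. g (f x)) X = differential H K g (differential G H f X)"
proof -
 interpret G: lie_grp G by unfold_locales fact
 interpret H: lie_grp H by unfold_locales fact
 interpret K: lie_grp K by unfold_locales fact
 have gf: "smooth_map (carrier G) (model G) (atlas G) (carrier K) (atlas K) (%x. g (f x))"
  by (rule smooth_map_compose[OF G.source_G H.target_G K.target_G f(1) g(1)])
 obtain J where J: "open J" "(0::real) : J" "velocity_at G (%r. uncoord G (r *\<^sub>R X)) 0 J X"
  using G.velocity_at_uncoord[OF X] by metis
 have 1: "velocity_at K (%r. g (f (uncoord G (r *\<^sub>R X)))) 0 J (differential H K g (differential G H f X))"
  by (rule differential_velocity[OF H K g differential_velocity[OF G H f J(3)]])
 have 2: "velocity_at K (%r. g (f (uncoord G (r *\<^sub>R X)))) 0 J (differential G K (%x. g (f x)) X)"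
  by (rule differential_velocity[OF G K gf _ J(3)]) (simp add: f(2) g(2))
 have "at 0 within J ~= bot" unfolding at_within_open[OF J(2,1)] by simp
 then show ?thesis using velocity_at_unique[OF 1] velocity_at_unique[OF 2] by simp
qed

lemma lin_exp_continuous_on:
 fixes D :: "'e::euclidean_space => 'e"
 assumes D: "linear D" and a: "continuous_on S a" and X: "continuous_on S X"
 shows "continuous_on S (%t. lin_exp (%Y. a t *\<^sub>R D Y) (X t))"
proof -
 have c: "continuous_on UNIV (%s. lin_exp (%Y. s *\<^sub>R D Y) b)" for b
  using lin_exp_derivative[OF D] has_vector_derivative_continuous by (intro continuous_at_imp_continuous_on ballI) blast
 have "lin_exp (%Y. a t *\<^sub>R D Y) (X t) = (\<Sum>b\<in>Basis. (X t \<bullet> b) *\<^sub>R lin_exp (%Y. a t *\<^sub>R D Y) b)" for t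
 proof -
  note lin = lin_exp_linear[OF D, of "a t"]
  have "lin_exp (%Y. a t *\<^sub>R D Y) (X t) = lin_exp (%Y. a t *\<^sub>R D Y) (\<Sum>b\<in>Basis. (X t \<bullet> b) *\<^sub>R b)"
   by (simp only: euclidean_representation)
  then show ?thesis by (simp only: linear_sum[OF lin] linear_scale[OF lin])
 qed
 moreover have "continuous_on S (%t. \<Sum>b\<in>Basis. (X t \<bullet> b) *\<^sub>R lin_exp (%Y. a t *\<^sub>R D Y) b)"
  by (intro continuous_intros X continuous_on_compose2[OF c a]) auto
 ultimately show ?thesis by simp
qed

lemma smooth_on_real_derivative:
 fixes v :: "real => 'v::euclidean_space"
 assumes "smooth_on UNIV {a..b} v"
 obtains V where "continuous_on {a..b} V" "!!t. t : {a..b} ==> (v has_vector_derivative V t) (at t within {a..b})"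
proof -
 have "Ck_on (Suc 0) UNIV {a..b} v" using assms unfolding smooth_on_def by blast
 then obtain f' where f': "\<forall>t\<in>{a..b}. (v has_derivative f' t) (at t within {a..b})" "\<forall>h. continuous_on {a..b} (%t. f' t h)" by auto
 show ?thesis
 proof (rule that[of "%t. f' t 1"])
  show "continuous_on {a..b} (%t. f' t 1)" using f'(2) by blast
  show "(v has_vector_derivative f' t 1) (at t within {a..b})" if "t : {a..b}" for t
   using f'(1) that has_vector_derivative_of_has_derivative by blast
 qed
qed

text \<open>Two constant loops are freely homotopic, and the track of their base point is a
  path.\<close>

lemma simply_connected_connected:
 fixes S :: "'a::topological_space set"
 assumes "simply_connected S" shows "connected S"
proof (rule path_connected_imp_connected, unfold path_connected_component, intro ballI)
 fix a b assume ab: "a : S" "b : S"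
 have "homotopic_loops S (%_. a) (%_. b)"
  by (rule assms[unfolded simply_connected_def, rule_format])
   (use ab in \<open>auto simp: path_def pathstart_def pathfinish_def path_image_def\<close>)
 from homotopic_loops_imp_path_component_value[OF this, of 0] show "path_component S a b" by simp
qed

section \<open>The semidirect product\<close>

lemma sum_axis: "(\<Sum>i\<in>UNIV. axis i (y i)) = (\<chi> i. y i)"
 by (simp add: vec_eq_iff axis_def sum_component if_distrib cong: if_cong)

locale sol_group =
 fixes N :: "'i::finite => ('a::{t2_space, second_countable_topology}, 'e::euclidean_space) lie_struct"
  and \<alpha> :: "'i => real ^ 'k => real"
  and D :: "'i => 'e => 'e"
  and act :: "'i => real ^ 'k => 'a => 'a"
 assumes sol: "higher_rank_sol_type N \<alpha> D act"
begin

abbreviation "G \<equiv> semidirect N act"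
abbreviation G_mult (infixl "\<cdot>" 70) where "x \<cdot> y \<equiv> x \<otimes>\<^bsub>G\<^esub> y"
abbreviation "E i t \<equiv> lin_exp (%Y. t *\<^sub>R D i Y)"

lemmas sol_conj = sol[unfolded higher_rank_sol_type_def, THEN conjunct2]
lemmas sol_facts = sol_conj[THEN conjunct1] sol_conj[THEN conjunct2, THEN conjunct1]
 sol_conj[THEN conjunct2, THEN conjunct2, THEN conjunct1] sol_conj[THEN conjunct2, THEN conjunct2, THEN conjunct2]

lemma lie_N: "lie_group (N i)" using sol_facts(1) by simp
lemma connected_N: "connected (carrier (N i))" by (rule simply_connected_connected) (use sol_facts(1) in simp)
lemma derivation_D: "lie_derivation (N i) (D i)" using sol_facts(2) by simp
lemma linear_D: "linear (D i)" and D_model: "D i ` model (N i) <= model (N i)"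
 using derivation_D[of i] unfolding lie_derivation_def by simp_all
lemma eigenvalue_D: "eigenvalue_on (model (N i)) (D i) z ==> Re z >= 1" using sol_facts(2) by simp
lemma linear_\<alpha>: "linear (\<alpha> i)" and \<alpha>_nonzero: "\<exists>v. \<alpha> i v ~= 0" using sol_facts(3) by simp_all
lemma act_automorphism: "lie_automorphism (N i) (act i v)"
 and act_differential: "X : model (N i) ==> differential (N i) (N i) (act i v) X = E i (\<alpha> i v) X"
 using sol_facts(4) by simp_all

lemma lie_grp_N [intro]: "lie_grp (N i)"
 using lie_N by unfold_locales

lemma group_N: "group (N i)"
 using lie_N unfolding lie_group_def by blast

lemma subspace_N: "subspace (model (N i))"
 by (rule lie_grp.subspace_model[OF lie_grp_N])

lemmas \<alpha>_add = linear_add[OF linear_\<alpha>] and \<alpha>_neg = linear_neg[OF linear_\<alpha>] and \<alpha>_zero = linear_0[OF linear_\<alpha>]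
 and \<alpha>_scale = linear_scale[OF linear_\<alpha>] and \<alpha>_diff = linear_diff[OF linear_\<alpha>]

lemma act_lie_hom: "lie_hom (N i) (N i) (act i v)"
 using act_automorphism unfolding lie_automorphism_def by blast

lemma act_smooth: "smooth_map (carrier (N i)) (model (N i)) (atlas (N i)) (carrier (N i)) (atlas (N i)) (act i v)"
 using act_lie_hom unfolding lie_hom_def by blast

lemma act_group_hom: "group_hom (N i) (N i) (act i v)"
 using act_lie_hom[of i v] group_N[of i] unfolding lie_hom_def by (simp add: group_hom_def group_hom_axioms_def)

lemmas act_closed [simp] = group_hom.hom_closed[OF act_group_hom]
 and act_one [simp] = group_hom.hom_one[OF act_group_hom]
 and act_mult = group_hom.hom_mult[OF act_group_hom]
 and act_inv = group_hom.hom_inv[OF act_group_hom]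

lemma act_velocity:
 assumes "velocity_at (N i) b t J X"
 shows "velocity_at (N i) (%r. act i v (b r)) t J (E i (\<alpha> i v) X)"
proof -
 have "X : model (N i)" using assms unfolding velocity_at_def by simp
 then show ?thesis
  using differential_velocity[OF lie_N lie_N act_smooth act_one assms, of v] act_differential by simp
qed

lemma E_model: "X : model (N i) ==> E i t X : model (N i)"
 by (rule lin_exp_in_subspace[OF linear_D D_model subspace_N])

text \<open>Only the differentials of the single maps \<open>act i v\<close> are prescribed. The
  composite of \<open>act i v\<close> and \<open>act i w\<close> has the differential of
  \<open>act i (v + w)\<close>, and on a connected group this determines a homomorphism.\<close>

lemma act_add:
 assumes x: "x : carrier (N i)"
 shows "act i (v + w) x = act i v (act i w x)"
proof (rule lie_hom_unique[OF lie_N lie_N connected_N act_lie_hom _ _ x])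
 have "(%x. act i v (act i w x)) : hom (N i) (N i)"
  by (rule homI) (simp_all add: act_mult)
 moreover have "smooth_map (carrier (N i)) (model (N i)) (atlas (N i)) (carrier (N i)) (atlas (N i)) (%x. act i v (act i w x))"
  using smooth_map_compose[OF lie_grp.source_G[OF lie_grp_N] lie_grp.target_G[OF lie_grp_N] lie_grp.target_G[OF lie_grp_N] act_smooth act_smooth] .
 ultimately show "lie_hom (N i) (N i) (%x. act i v (act i w x))" unfolding lie_hom_def by blast
 fix X assume X: "X : model (N i)"
 have "differential (N i) (N i) (%x. act i v (act i w x)) X = E i (\<alpha> i v) (E i (\<alpha> i w) X)"
  using differential_compose[OF lie_N lie_N lie_N act_smooth act_one act_smooth act_one X] X
  by (simp add: act_differential E_model)
 then show "differential (N i) (N i) (act i (v + w)) X = differential (N i) (N i) (%x. act i v (act i w x)) X"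
  using X by (simp add: act_differential lin_exp_add[OF linear_D] \<alpha>_add)
qed

text \<open>\<open>act i 0\<close> is idempotent by additivity, and it is injective.\<close>

lemma act_zero:
 assumes x: "x : carrier (N i)" shows "act i 0 x = x"
proof -
 have "act i 0 (act i 0 x) = act i 0 x" using act_add[OF x, of 0 0] by simp
 moreover have "inj_on (act i 0) (carrier (N i))"
  using act_automorphism unfolding lie_automorphism_def bij_betw_def by blast
 ultimately show ?thesis using x by (simp add: inj_on_def)
qed

lemma G_sel:
 "carrier G = {h. \<forall>i. h i : carrier (N i)} \<times> UNIV"
 "x \<cdot> y = (%i. fst x i \<otimes>\<^bsub>N i\<^esub> act i (snd x) (fst y i), snd x + snd y)"
 "\<one>\<^bsub>G\<^esub> = (%i. \<one>\<^bsub>N i\<^esub>, 0)"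
 "model G = {X. \<forall>i. X $ i : model (N i)} \<times> UNIV"
 "coord G x = (\<chi> i. coord (N i) (fst x i), snd x)"
 "atlas G = prod_atlas {pi_chart C | C. \<forall>i. C i : atlas (N i)} {(UNIV, id)}"
 unfolding semidirect_def pi_chart_def by (simp_all add: case_prod_unfold)

lemma group_G: "group G"
proof (rule groupI)
 fix x y z assume x: "x : carrier G" and y: "y : carrier G" and z: "z : carrier G"
 have c: "fst x i : carrier (N i)" "fst y i : carrier (N i)" "fst z i : carrier (N i)" for i
  using x y z unfolding G_sel by auto
 show "x \<cdot> y : carrier G" unfolding G_sel using c group.is_monoid[OF group_N] by (auto intro: monoid.m_closed)
 show "x \<cdot> y \<cdot> z = x \<cdot> (y \<cdot> z)"
  unfolding G_sel using c group.is_monoid[OF group_N]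
  by (auto simp: fun_eq_iff act_add act_mult monoid.m_assoc)
next
 show "\<one>\<^bsub>G\<^esub> : carrier G" unfolding G_sel using group.is_monoid[OF group_N] by (auto intro: monoid.one_closed)
next
 fix x assume x: "x : carrier G"
 then have c: "fst x i : carrier (N i)" for i unfolding G_sel by auto
 show "\<one>\<^bsub>G\<^esub> \<cdot> x = x" unfolding G_sel using c group.is_monoid[OF group_N]
  by (auto simp: act_zero monoid.l_one prod_eq_iff fun_eq_iff)
 show "\<exists>y\<in>carrier G. y \<cdot> x = \<one>\<^bsub>G\<^esub>"
 proof (rule bexI[of _ "(%i. act i (- snd x) (inv\<^bsub>N i\<^esub> (fst x i)), - snd x)"])
  show "(%i. act i (- snd x) (inv\<^bsub>N i\<^esub> (fst x i)), - snd x) \<cdot> x = \<one>\<^bsub>G\<^esub>"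
   unfolding G_sel using c group.inv_closed[OF group_N] group.l_inv[OF group_N]
   by (simp add: fun_eq_iff act_mult[symmetric])
  show "(%i. act i (- snd x) (inv\<^bsub>N i\<^esub> (fst x i)), - snd x) : carrier G"
   unfolding G_sel using c group.inv_closed[OF group_N] by simp
 qed
qed

lemma inv_G:
 assumes x: "x : carrier G"
 shows "inv\<^bsub>G\<^esub> x = (%i. act i (- snd x) (inv\<^bsub>N i\<^esub> (fst x i)), - snd x)"
proof (rule group.inv_equality[OF group_G _ x])
 have c: "fst x i : carrier (N i)" for i using x unfolding G_sel by auto
 show "(%i. act i (- snd x) (inv\<^bsub>N i\<^esub> (fst x i)), - snd x) \<cdot> x = \<one>\<^bsub>G\<^esub>"
   unfolding G_sel using c group.inv_closed[OF group_N] group.l_inv[OF group_N]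
   by (simp add: fun_eq_iff act_mult[symmetric])
 show "(%i. act i (- snd x) (inv\<^bsub>N i\<^esub> (fst x i)), - snd x) : carrier G"
   unfolding G_sel using c group.inv_closed[OF group_N] by simp
qed

lemma inv_mult_G:
 assumes x: "x : carrier G" and y: "y : carrier G"
 shows "inv\<^bsub>G\<^esub> x \<cdot> y = (%i. act i (- snd x) (inv\<^bsub>N i\<^esub> (fst x i) \<otimes>\<^bsub>N i\<^esub> fst y i), snd y - snd x)"
proof -
 have c: "fst x i : carrier (N i)" "fst y i : carrier (N i)" for i using x y unfolding G_sel by auto
 then show ?thesis unfolding inv_G[OF x] G_sel using group.inv_closed[OF group_N]
  by (simp add: act_mult)
qed

text \<open>Smoothness into the semidirect product is tested factor by factor, so that the calculus
  of the Lie groups \<open>N i\<close> and of R^k carries over.\<close>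

lemma smooth_map_G_iff:
 fixes f :: "'b::topological_space => ('i => 'a) \<times> (real ^ 'k)"
 assumes src: "source_atlas M W A"
 shows "smooth_map M W A (carrier G) (atlas G) f \<longleftrightarrow>
  (\<forall>i. smooth_map M W A (carrier (N i)) (atlas (N i)) (%x. fst (f x) i)) &
  smooth_map M W A UNIV {(UNIV, id)} (%x. snd (f x))" (is "?l \<longleftrightarrow> ?r1 & ?r2")
proof
 assume f: ?l
 have atl: "\<exists>C. C : atlas (N j)" for j using lie_N[of j] unfolding lie_group_def by blast
 have cf: "continuous_on M (%x. fst (f x) i)" for i
  by (rule continuous_on_product_then_coordinatewise[OF continuous_on_fst[OF smooth_mapD(3)[OF f]]])
 have fM: "fst (f x) i : carrier (N i)" if "x : M" for x i using smooth_mapD(1)[OF f that] unfolding G_sel by auto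
 have cs: "continuous_on M (%x. snd (f x))" using smooth_mapD(3)[OF f] by (rule continuous_on_snd)
 have chart: "(fst (pi_chart C) \<times> UNIV, %(h, v). (snd (pi_chart C) h, id v)) : atlas G" if "!!i. C i : atlas (N i)" for C
 proof -
  have "pi_chart C : {pi_chart C | C. \<forall>i. C i : atlas (N i)}" using that by blast
  then have *: "(fst (pi_chart C), snd (pi_chart C)) : {pi_chart C | C. \<forall>i. C i : atlas (N i)}" by simp
  show ?thesis unfolding G_sel(6) prod_atlas_def
   by (rule CollectI, rule exI[of _ "fst (pi_chart C)"], rule exI[of _ "snd (pi_chart C)"], rule exI[of _ UNIV], rule exI[of _ id])
    (use * in simp)
 qed
 have cover: "\<exists>C. C : atlas (N j) & y : fst C" if y: "y : carrier (N j)" for j y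
 proof -
  obtain U' \<phi>' where "(U', \<phi>') : atlas (N j)" "y : U'" using target_atlas_cover[OF lie_grp.target_G[OF lie_grp_N] y] by blast
  then show ?thesis by (intro exI[of _ "(U', \<phi>')"]) simp
 qed
 have img: "(%x. fst (f x) j) ` M <= carrier (N j)" for j using fM by blast
 have opens: "\<exists>T. open T & (\<forall>z\<in>U. \<phi> z : T \<longleftrightarrow> fst (f z) j : fst C)" if U: "(U, \<phi>) : A" and C: "C : atlas (N j)" for U \<phi> C j
 proof -
  have C': "(fst C, snd C) : atlas (N j)" using C by simp
  obtain T where "open T" "!!x. x : U ==> \<phi> x : T \<longleftrightarrow> fst (f x) j : fst C"
   using source_atlas_vimage_open[OF src U cf img target_atlasD(1)[OF lie_grp.target_G[OF lie_grp_N] C']] by blast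
  then show ?thesis by blast
 qed
 \<comment> \<open>A product chart fixes charts of all factors at once; it can be used near a point
   as soon as each factor chart contains the corresponding component.\<close>
 have local: "\<exists>T'. open T' & \<phi> x : T' & Ck_on n W (\<phi> ` U Int T') ((%(h, v). (snd (pi_chart C) h, id v)) o f o inv_into U \<phi>)"
  if U: "(U, \<phi>) : A" and x: "x : U" and C: "!!j. C j : atlas (N j)" "!!j. fst (f x) j : fst (C j)" for U \<phi> x C n
 proof -
  have "\<exists>T. open T & (\<forall>z\<in>U. \<phi> z : T \<longleftrightarrow> fst (f z) j : fst (C j))" for j
   by (rule opens[OF U C(1)])
  then obtain T where T: "!!j. open (T j)" "!!j z. z : U ==> \<phi> z : T j \<longleftrightarrow> fst (f z) j : fst (C j)" by metis
  define T' where "T' = (\<Inter>j. T j)"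
  have T': "open T'" unfolding T'_def by (intro open_INT) (auto simp: T(1))
  have x': "\<phi> x : T'" unfolding T'_def using T(2)[OF x] C(2) by blast
  have "Ck_on n W (\<phi> ` U Int T') ((%(h, v). (snd (pi_chart C) h, id v)) o f o inv_into U \<phi>)"
  proof (rule Ck_on_subset[OF smooth_mapD(4)[OF f U chart[OF C(1)]]])
   show "\<phi> ` U Int T' <= \<phi> ` (U Int f -` (fst (pi_chart C) \<times> UNIV))"
   proof
    fix u assume u: "u : \<phi> ` U Int T'"
    then obtain z where z: "z : U" "u = \<phi> z" by blast
    then have "fst (f z) j : fst (C j)" for j using T(2)[OF z(1)] u unfolding T'_def by blast
    then have "z : U Int f -` (fst (pi_chart C) \<times> UNIV)" using z unfolding pi_chart_def by (auto simp: mem_Times_iff)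
    then show "u : \<phi> ` (U Int f -` (fst (pi_chart C) \<times> UNIV))" using z by blast
   qed
  qed
  then show ?thesis using T' x' by blast
 qed
 show "?r1 & ?r2"
 proof (intro conjI allI)
  fix i
  show "smooth_map M W A (carrier (N i)) (atlas (N i)) (%x. fst (f x) i)"
  proof (rule smooth_mapI[OF fM cf])
   fix U \<phi> U' \<psi> n assume U: "(U, \<phi>) : A" and U': "(U', \<psi>) : atlas (N i)"
   note Us = source_atlasD[OF src U]
   have inv: "inv_into U \<phi> (\<phi> x) = x" if "x : U" for x using that Us(2) by (simp add: inv_into_f_f)
   have U'o: "openin (top_of_set (carrier (N i))) U'"
    using target_atlasD(1)[OF lie_grp.target_G[OF lie_grp_N] U'] .
   have S: "tangent_full W (\<phi> ` (U Int (%x. fst (f x) i) -` U'))" (is "tangent_full W ?S")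
    by (rule source_atlas_tangent_full[OF src U cf img U'o])
   show "Ck_on n W ?S (\<psi> o (%x. fst (f x) i) o inv_into U \<phi>)"
   proof (rule Ck_on_local[OF S])
    fix y assume "y : ?S"
    then obtain x where x: "x : U" "fst (f x) i : U'" "y = \<phi> x" by blast
    then have xM: "x : M" using Us(1) by blast
    \<comment> \<open>The prescribed chart in factor \<open>i\<close>, and any chart around the
      component of \<open>f x\<close> in the others.\<close>
    have "\<exists>C. C : atlas (N j) & fst (f x) j : fst C & (j = i --> C = (U', \<psi>))" for j
    proof (cases "j = i")
     case True then show ?thesis using U' x by (intro exI[of _ "(U', \<psi>)"]) auto
    next
     case False
     then show ?thesis using cover[OF fM[OF xM]] by blast
    qed
    then obtain C where C: "!!j. C j : atlas (N j)" "!!j. fst (f x) j : fst (C j)" "C i = (U', \<psi>)" by metis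
    obtain T' where T': "open T'" "\<phi> x : T'" "Ck_on n W (\<phi> ` U Int T') ((%(h, v). (snd (pi_chart C) h, id v)) o f o inv_into U \<phi>)"
     using local[OF U x(1) C(1,2)] by blast
    have "Ck_on n W (?S Int T') ((%(h, v). (snd (pi_chart C) h, id v)) o f o inv_into U \<phi>)"
     by (rule Ck_on_subset[OF T'(3)]) auto
    from Ck_on_bounded_linear[OF bounded_linear_compose[OF bounded_linear_vec_nth bounded_linear_fst] this, of i]
    have "Ck_on n W (?S Int T') (%z. fst (((%(h, v). (snd (pi_chart C) h, id v)) o f o inv_into U \<phi>) z) $ i)"
     by (simp only: comp_def)
    then have "Ck_on n W (?S Int T') (\<psi> o (%x. fst (f x) i) o inv_into U \<phi>)"
     using C(3) by (simp add: pi_chart_def comp_def case_prod_unfold)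
    then show "\<exists>O'. open O' & y : O' & Ck_on n W (?S Int O') (\<psi> o (%x. fst (f x) i) o inv_into U \<phi>)"
     using T'(1,2) x(3) by blast
   qed
  qed
 next
  show ?r2
  proof (rule smooth_mapI[OF _ cs])
   fix U \<phi> and U' :: "(real ^ 'k) set" and \<psi> :: "real ^ 'k => real ^ 'k" and n assume U: "(U, \<phi>) : A" and U': "(U', \<psi>) : {(UNIV, id)}"
   note Us = source_atlasD[OF src U]
   have "U' = UNIV" "U Int M = U" using U' Us(1) by auto
   then have eqS: "\<phi> ` (U Int (%x. snd (f x)) -` U') = \<phi> ` (U Int M)" by simp
   have S: "tangent_full W (\<phi> ` (U Int M))" by (rule Us(4)) simp
   show "Ck_on n W (\<phi> ` (U Int (%x. snd (f x)) -` U')) (\<psi> o (%x. snd (f x)) o inv_into U \<phi>)"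
    unfolding eqS
   proof (rule Ck_on_local[OF S])
    fix y assume "y : \<phi> ` (U Int M)"
    then obtain x where x: "x : U" "x : M" "y = \<phi> x" by blast
    have "\<exists>C. C : atlas (N j) & fst (f x) j : fst C" for j
     by (rule cover[OF fM[OF x(2)]])
    then obtain C where C: "!!j. C j : atlas (N j)" "!!j. fst (f x) j : fst (C j)" by metis
    obtain T' where T': "open T'" "\<phi> x : T'" "Ck_on n W (\<phi> ` U Int T') ((%(h, v). (snd (pi_chart C) h, id v)) o f o inv_into U \<phi>)"
     using local[OF U x(1) C(1,2)] by blast
    have "Ck_on n W (\<phi> ` (U Int M) Int T') ((%(h, v). (snd (pi_chart C) h, id v)) o f o inv_into U \<phi>)"
     by (rule Ck_on_subset[OF T'(3)]) auto
    from Ck_on_bounded_linear[OF bounded_linear_snd this]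
    have "Ck_on n W (\<phi> ` (U Int M) Int T') (\<psi> o (%x. snd (f x)) o inv_into U \<phi>)"
     using U' by (simp add: comp_def case_prod_unfold)
    then show "\<exists>O'. open O' & y : O' & Ck_on n W (\<phi> ` (U Int M) Int O') (\<psi> o (%x. snd (f x)) o inv_into U \<phi>)"
     using T'(1,2) x(3) by blast
   qed
  qed simp
 qed
next
 assume r: "?r1 & ?r2"
 then have r1: "!!i. smooth_map M W A (carrier (N i)) (atlas (N i)) (%x. fst (f x) i)" and r2: ?r2 by blast+
 show ?l
 proof (rule smooth_mapI)
  show "f x : carrier G" if "x : M" for x using smooth_mapD(1)[OF r1 that] unfolding G_sel by (simp add: mem_Times_iff)
  have "continuous_on M (%x. fst (f x))"
   by (rule continuous_on_coordinatewise_then_product) (rule smooth_mapD(3)[OF r1])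
  from continuous_on_Pair[OF this smooth_mapD(3)[OF r2]] show "continuous_on M f" by simp
  fix U \<phi> U' \<psi> n assume U: "(U, \<phi>) : A" and U': "(U', \<psi>) : atlas G"
  have "(U', \<psi>) : prod_atlas {pi_chart C | C. \<forall>i. C i : atlas (N i)} {(UNIV, id)}" using U' unfolding G_sel(6) .
  then obtain U1 \<phi>1 and W1 :: "(real ^ 'k) set" and \<psi>1 where *: "U' = U1 \<times> W1" "\<psi> = (%(x, y). (\<phi>1 x, \<psi>1 y))"
   "(U1, \<phi>1) : {pi_chart C | C. \<forall>i. C i : atlas (N i)}" "(W1, \<psi>1) : {(UNIV, id)}" unfolding prod_atlas_def by blast
  then obtain C where C0: "(U1, \<phi>1) = pi_chart C" "!!i. C i : atlas (N i)" by blast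
  have "U1 = fst (pi_chart C)" "\<phi>1 = snd (pi_chart C)" "W1 = UNIV" "\<psi>1 = id" using *(4) by (simp_all add: C0(1)[symmetric])
  with * C0 have C: "!!i. C i : atlas (N i)" "U' = fst (pi_chart C) \<times> UNIV" "\<psi> = (%(h, v). (snd (pi_chart C) h, id v))" by simp_all
  let ?S = "\<phi> ` (U Int f -` U')"
  have "Ck_on n W ?S (%z. ((\<chi> i. (snd (C i) o (%x. fst (f x) i) o inv_into U \<phi>) z), (id o (%x. snd (f x)) o inv_into U \<phi>) z))"
  proof (intro Ck_on_Pair Ck_on_vec)
   fix i
   have "(fst (C i), snd (C i)) : atlas (N i)" using C(1) by simp
   from smooth_mapD(4)[OF r1 U this] show "Ck_on n W ?S (snd (C i) o (%x. fst (f x) i) o inv_into U \<phi>)"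
    by (rule Ck_on_subset) (auto simp: C(2) pi_chart_def)
  next
   have "(UNIV, id) : {(UNIV, id :: real ^ 'k => real ^ 'k)}" by simp
   from smooth_mapD(4)[OF r2 U this] show "Ck_on n W ?S (id o (%x. snd (f x)) o inv_into U \<phi>)"
    by (rule Ck_on_subset) auto
  qed
  then show "Ck_on n W ?S (\<psi> o f o inv_into U \<phi>)"
   unfolding C(3) by (simp add: comp_def pi_chart_def case_prod_unfold)
 qed
qed

lemma smooth_path_G_iff:
 assumes "a < b"
 shows "smooth_path_on G {a..b} \<gamma> \<longleftrightarrow> (\<forall>i. smooth_path_on (N i) {a..b} (%t. fst (\<gamma> t) i)) & smooth_on UNIV {a..b} (%t. snd (\<gamma> t))"
 unfolding smooth_path_on_iff smooth_map_G_iff[OF source_atlas_interval[OF assms]] smooth_on_interval_iff ..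

text \<open>Translation by the inverse of an element with projection \<open>v\<close> applies
  \<open>act i (- v)\<close> to the factors, whence \<open>E i (- \<alpha> i v)\<close> on their
  velocities.\<close>

lemma left_curve_G_derivative:
 assumes t: "t : J" and c: "\<gamma> ` J <= carrier G"
  and X: "!!i. velocity_at (N i) (%r. inv\<^bsub>N i\<^esub> (fst (\<gamma> t) i) \<otimes>\<^bsub>N i\<^esub> fst (\<gamma> r) i) t J (X i)"
  and V: "((%r. snd (\<gamma> r)) has_vector_derivative V) (at t within J)"
 shows "(left_curve G \<gamma> t has_vector_derivative ((\<chi> i. E i (- \<alpha> i (snd (\<gamma> t))) (X i)), V)) (at t within J)"
proof -
 have 1: "((%r. coord (N i) (act i (- snd (\<gamma> t)) (inv\<^bsub>N i\<^esub> (fst (\<gamma> t) i) \<otimes>\<^bsub>N i\<^esub> fst (\<gamma> r) i))) has_vector_derivative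
   E i (- \<alpha> i (snd (\<gamma> t))) (X i)) (at t within J)" for i
  using act_velocity[OF X[of i], of "- snd (\<gamma> t)"] unfolding velocity_at_def by (simp add: \<alpha>_neg)
 have 2: "((%r. snd (\<gamma> r) - snd (\<gamma> t)) has_vector_derivative V) (at t within J)"
  using has_vector_derivative_diff[OF V has_vector_derivative_const] by simp
 have 3: "((%r. (\<Sum>i\<in>UNIV. axis i (coord (N i) (act i (- snd (\<gamma> t)) (inv\<^bsub>N i\<^esub> (fst (\<gamma> t) i) \<otimes>\<^bsub>N i\<^esub> fst (\<gamma> r) i)))))
   has_vector_derivative (\<Sum>i\<in>UNIV. axis i (E i (- \<alpha> i (snd (\<gamma> t))) (X i)))) (at t within J)"
  by (intro has_vector_derivative_sum bounded_linear.has_vector_derivative[OF bounded_linear_axis 1])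
 show ?thesis
 proof (rule has_vector_derivative_transform[OF t _ has_vector_derivative_Pair[OF 3[unfolded sum_axis] 2]])
  fix r assume "r : J"
  then show "left_curve G \<gamma> t r = ((\<chi> i. coord (N i) (act i (- snd (\<gamma> t)) (inv\<^bsub>N i\<^esub> (fst (\<gamma> t) i) \<otimes>\<^bsub>N i\<^esub> fst (\<gamma> r) i))), snd (\<gamma> r) - snd (\<gamma> t))"
   unfolding left_curve_def using c t by (subst inv_mult_G) (auto simp: G_sel)
 qed
qed

end

section \<open>Piecewise continuous functions\<close>

text \<open>Values at the break points are left free, as \<open>left_velocity\<close> carries no
  information there; continuity is demanded of an extension of \<open>f\<close> from each open piece
  to its closure.\<close>

definition pw_continuous :: "(real => 'b::topological_space) => bool" where
 "pw_continuous f \<longleftrightarrow> (\<exists>F. finite F & (\<forall>a b. 0 <= a & a < b & b <= 1 & {a<..<b} Int F = {} -->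
   (\<exists>k. continuous_on {a..b} k & (\<forall>t\<in>{a<..<b}. f t = k t))))"

lemma pw_continuousE:
 assumes "pw_continuous f"
 obtains F k where "finite F"
  "!!a b. 0 <= a ==> a < b ==> b <= 1 ==> {a<..<b} Int F = {} ==> continuous_on {a..b} (k a b)"
  "!!a b t. 0 <= a ==> a < b ==> b <= 1 ==> {a<..<b} Int F = {} ==> t : {a<..<b} ==> f t = k a b t"
proof -
 obtain F where F: "finite F" "\<forall>a b. 0 <= a & a < b & b <= 1 & {a<..<b} Int F = {} -->
   (\<exists>k. continuous_on {a..b} k & (\<forall>t\<in>{a<..<b}. f t = k t))"
  using assms unfolding pw_continuous_def by (elim exE conjE)
 define k where "k a b = (SOME k. continuous_on {a..b} k & (\<forall>t\<in>{a<..<b}. f t = k t))" for a b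
 have "continuous_on {a..b} (k a b) & (\<forall>t\<in>{a<..<b}. f t = k a b t)"
  if "0 <= a" "a < b" "b <= 1" "{a<..<b} Int F = {}" for a b
  unfolding k_def by (rule someI_ex[OF F(2)[rule_format]]) (use that in auto)
 then show ?thesis using that[of F k] F(1) by simp
qed

lemma pw_continuous_imp_integrable:
 fixes f :: "real => 'b::euclidean_space"
 assumes "pw_continuous f" shows "f integrable_on {0..1}"
proof -
 obtain F l where F: "finite F"
  "!!a b. 0 <= a ==> a < b ==> b <= 1 ==> {a<..<b} Int F = {} ==> continuous_on {a..b} (l a b)"
  "!!a b t. 0 <= a ==> a < b ==> b <= 1 ==> {a<..<b} Int F = {} ==> t : {a<..<b} ==> f t = l a b t"
  using pw_continuousE[OF assms] by metis
 have "f integrable_on {p..q}" if "0 <= p" "p < q" "q <= 1" for p q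
  using that
 proof (induction "card (F Int {p<..<q})" arbitrary: p q rule: less_induct)
  case less
  show ?case
  proof (cases "F Int {p<..<q} = {}")
   case True
   then have "{p<..<q} Int F = {}" by blast
   define k where "k = l p q"
   have k1: "continuous_on {p..q} k" unfolding k_def by (rule F(2)) (use less.prems True in auto)
   have k2: "f t = k t" if "t : {p<..<q}" for t unfolding k_def by (rule F(3)) (use less.prems True that in auto)
   have "k integrable_on cbox p q" using k1 integrable_continuous[of p q k] by simp
   then have "f integrable_on cbox p q" by (rule integrable_spike_interior[rotated]) (use k2 in auto)
   then show ?thesis by simp
  next
   case False
   then obtain c where c: "c : F" "p < c" "c < q" by auto
   have "F Int {p<..<c} \<subset> F Int {p<..<q}" "F Int {c<..<q} \<subset> F Int {p<..<q}" using c by auto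
   then have "card (F Int {p<..<c}) < card (F Int {p<..<q})" "card (F Int {c<..<q}) < card (F Int {p<..<q})"
    using F(1) by (auto intro: psubset_card_mono)
   then have "f integrable_on {p..c}" "f integrable_on {c..q}" using less c by auto
   then show ?thesis using Henstock_Kurzweil_Integration.integrable_combine[where a = p and c = c and b = q and f = f] c by auto
  qed
 qed
 then show ?thesis by simp
qed

lemma pw_continuous_Pair:
 assumes "pw_continuous f" "pw_continuous g"
 shows "pw_continuous (%t. (f t, g t))"
proof -
 obtain F k where F: "finite F"
  "!!a b. 0 <= a ==> a < b ==> b <= 1 ==> {a<..<b} Int F = {} ==> continuous_on {a..b} (k a b)"
  "!!a b t. 0 <= a ==> a < b ==> b <= 1 ==> {a<..<b} Int F = {} ==> t : {a<..<b} ==> f t = k a b t"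
  using pw_continuousE[OF assms(1)] by metis
 obtain H l where H: "finite H"
  "!!a b. 0 <= a ==> a < b ==> b <= 1 ==> {a<..<b} Int H = {} ==> continuous_on {a..b} (l a b)"
  "!!a b t. 0 <= a ==> a < b ==> b <= 1 ==> {a<..<b} Int H = {} ==> t : {a<..<b} ==> g t = l a b t"
  using pw_continuousE[OF assms(2)] by metis
 show ?thesis unfolding pw_continuous_def
 proof (intro exI[of _ "F Un H"] conjI allI impI)
  show "finite (F Un H)" using F(1) H(1) by simp
  fix a b :: real assume ab: "0 <= a & a < b & b <= 1 & {a<..<b} Int (F Un H) = {}"
  then have e: "0 <= a" "a < b" "b <= 1" "{a<..<b} Int F = {}" "{a<..<b} Int H = {}" by blast+
  show "\<exists>k. continuous_on {a..b} k & (\<forall>t\<in>{a<..<b}. (f t, g t) = k t)"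
   by (rule exI[of _ "%t. (k a b t, l a b t)"])
    (use F(2,3)[OF e(1-4)] H(2,3)[OF e(1-3,5)] in \<open>simp add: continuous_on_Pair\<close>)
 qed
qed

lemma pw_continuous_compose:
 assumes "pw_continuous f" "continuous_on UNIV \<phi>"
 shows "pw_continuous (%t. \<phi> (f t))"
proof -
 obtain F k where F: "finite F"
  "!!a b. 0 <= a ==> a < b ==> b <= 1 ==> {a<..<b} Int F = {} ==> continuous_on {a..b} (k a b)"
  "!!a b t. 0 <= a ==> a < b ==> b <= 1 ==> {a<..<b} Int F = {} ==> t : {a<..<b} ==> f t = k a b t"
  using pw_continuousE[OF assms(1)] by metis
 show ?thesis unfolding pw_continuous_def
 proof (intro exI[of _ F] conjI allI impI F(1))
  fix a b :: real assume "0 <= a & a < b & b <= 1 & {a<..<b} Int F = {}"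
  then have e: "0 <= a" "a < b" "b <= 1" "{a<..<b} Int F = {}" by blast+
  have "continuous_on {a..b} (%t. \<phi> (k a b t))" by (rule continuous_on_compose2[OF assms(2) F(2)[OF e]]) simp
  then show "\<exists>l. continuous_on {a..b} l & (\<forall>t\<in>{a<..<b}. \<phi> (f t) = l t)"
   by (intro exI[of _ "%t. \<phi> (k a b t)"]) (simp add: F(3)[OF e])
 qed
qed

lemma continuous_imp_pw_continuous:
 assumes "continuous_on {0..1} f" shows "pw_continuous f"
 unfolding pw_continuous_def
proof (intro exI[of _ "{}"] conjI allI impI)
 fix a b :: real assume "0 <= a & a < b & b <= 1 & {a<..<b} Int {} = {}"
 then have "continuous_on {a..b} f" using continuous_on_subset[OF assms] by auto
 then show "\<exists>k. continuous_on {a..b} k & (\<forall>t\<in>{a<..<b}. f t = k t)" by blast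
qed simp

lemma (in lie_grp) pw_continuous_left_velocity:
 assumes "piecewise_smooth_path G x y c" shows "pw_continuous (left_velocity G c)"
proof -
 obtain F where F: "finite F" "!!a b. 0 <= a ==> a < b ==> b <= 1 ==> {a<..<b} Int F = {} ==> smooth_path_on G {a..b} c"
  using piecewise_smooth_pathD[OF assms] by metis
 show ?thesis unfolding pw_continuous_def
 proof (intro exI[of _ F] conjI allI impI F(1))
  fix a b :: real assume ab: "0 <= a & a < b & b <= 1 & {a<..<b} Int F = {}"
  then have "continuous_on {a..b} (lv G {a..b} c)" by (intro continuous_on_lv F(2)) auto
  moreover have "\<forall>t\<in>{a<..<b}. left_velocity G c t = lv G {a..b} c t" using ab by (simp add: lv_interior)
  ultimately show "\<exists>k. continuous_on {a..b} k & (\<forall>t\<in>{a<..<b}. left_velocity G c t = k t)" by blast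
 qed
qed

section \<open>The additive group\<close>

lemma vector_group_sel:
 "carrier vector_group = UNIV" "x \<otimes>\<^bsub>vector_group\<^esub> y = x + y" "\<one>\<^bsub>vector_group\<^esub> = 0"
 "model vector_group = UNIV" "atlas vector_group = {(UNIV, id)}" "id_chart vector_group = (UNIV, id)"
 unfolding vector_group_def by simp_all

lemma group_vector_group: "group (vector_group :: ('v::euclidean_space, 'v) lie_struct)"
 by (rule groupI) (auto simp: vector_group_sel intro: exI[of _ "- x" for x])

lemma inv_vector_group: "inv\<^bsub>vector_group\<^esub> (x :: 'v::euclidean_space) = - x"
 by (rule group.inv_equality[OF group_vector_group]) (simp_all add: vector_group_sel)

lemma lie_vector_group: "lie_group (vector_group :: ('v::euclidean_space, 'v) lie_struct)"
proof -
 have cid: "continuous_on UNIV (inv_into UNIV (id :: 'v => 'v))" by (rule continuous_on_eq[OF continuous_on_id]) simp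
 have inv: "inv_into UNIV (id :: 'v => 'v) = id" by (rule ext) simp
 have at: "smooth_atlas (UNIV :: 'v set) UNIV {(UNIV, id)}"
  unfolding smooth_atlas_iff smooth_on_def
  by (auto simp: inv homeomorphism_def intro: Ck_on_linear bounded_linear_ident[unfolded id_def[symmetric]] continuous_on_id' simp flip: id_def)
 have f: "(%(x, y). (id x, id y)) = (id :: 'v \<times> 'v => 'v \<times> 'v)" by auto
 have inv2: "inv_into (UNIV \<times> UNIV) (id :: 'v \<times> 'v => 'v \<times> 'v) = id" by (rule ext) simp
 have pr: "prod_atlas {(UNIV, id)} {(UNIV, id)} = {(UNIV \<times> UNIV, id :: 'v \<times> 'v => 'v \<times> 'v)}"
  unfolding prod_atlas_def f[symmetric] by blast
 have add: "bounded_linear (%(x, y). x + y :: 'v)"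
  using bounded_linear_add[OF bounded_linear_fst bounded_linear_snd] by (simp add: case_prod_unfold)
 have "smooth_map (UNIV \<times> UNIV) (UNIV \<times> UNIV) (prod_atlas {(UNIV, id)} {(UNIV, id)}) UNIV {(UNIV, id)} (%(x, y). x + y :: 'v)"
 proof (rule smooth_mapI)
  show "continuous_on (UNIV \<times> UNIV) (%(x, y). x + y :: 'v)" using add by (simp add: linear_continuous_on)
  fix U :: "('v \<times> 'v) set" and \<phi> :: "'v \<times> 'v => 'v \<times> 'v" and W :: "'v set" and \<psi> :: "'v => 'v" and n
  assume "(U, \<phi>) : prod_atlas {(UNIV, id)} {(UNIV, id)}" "(W, \<psi>) : {(UNIV, id)}"
  then have *: "U = UNIV \<times> UNIV" "\<phi> = id" "W = UNIV" "\<psi> = id" unfolding pr by simp_all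
  show "Ck_on n (UNIV \<times> UNIV) (\<phi> ` (U Int (%(x, y). x + y) -` W)) (\<psi> o (%(x, y). x + y) o inv_into U \<phi>)"
   unfolding * inv2 using Ck_on_linear[OF add] by simp
 qed simp
 moreover have "smooth_map UNIV UNIV {(UNIV, id)} UNIV {(UNIV, id)} (%x. - x :: 'v)"
 proof (rule smooth_mapI)
  fix U :: "'v set" and \<phi> :: "'v => 'v" and W :: "'v set" and \<psi> :: "'v => 'v" and n assume "(U, \<phi>) : {(UNIV, id :: 'v => 'v)}" "(W, \<psi>) : {(UNIV, id :: 'v => 'v)}"
  then have *: "U = UNIV" "\<phi> = id" "W = UNIV" "\<psi> = id" by simp_all
  show "Ck_on n UNIV (\<phi> ` (U Int uminus -` W)) (\<psi> o uminus o inv_into U \<phi>)"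
   unfolding * inv using Ck_on_linear[OF bounded_linear_minus[OF bounded_linear_ident]] by simp
 qed (auto intro: continuous_intros)
 moreover have "m_inv vector_group = (uminus :: 'v => 'v)" by (rule ext) (rule inv_vector_group)
 ultimately show ?thesis unfolding lie_group_def vector_group_sel
  using at group_vector_group by (simp add: vector_group_sel)
qed

lemma velocity_at_vector_group:
 "t : J ==> (v has_vector_derivative V) (at t within J) ==> velocity_at vector_group (%r. v r - v t) t J V"
 unfolding velocity_at_def vector_group_sel
 using has_vector_derivative_diff[OF _ has_vector_derivative_const, of v V _ "v t"] has_vector_derivative_continuous[of "%r. v r - v t" V t J] by simp

section \<open>Splittings\<close>

locale sol_splitting = sol_group N \<alpha> D act
 for N :: "'i::finite => ('a::{t2_space, second_countable_topology}, 'e::euclidean_space) lie_struct"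
  and \<alpha> :: "'i => real ^ 'k => real" and D act +
 fixes s :: "real ^ 'k => ('i => 'a) \<times> (real ^ 'k)"
 assumes s_hom: "lie_hom vector_group (semidirect N act) s" and snd_s [simp]: "snd (s v) = v"
begin

text \<open>The \<open>N i\<close>-component of the splitting, a cocycle for \<open>act i\<close> by
  \<open>\<sigma>_add\<close>.\<close>

definition "\<sigma> i v = fst (s v) i"
definition "d\<sigma> i = differential vector_group (N i) (\<sigma> i)"

lemma s_closed: "s v : carrier G"
 and s_add: "s (v + w) = s v \<cdot> s w"
 using s_hom unfolding lie_hom_def hom_def by (auto simp: vector_group_sel)

lemma \<sigma>_closed [simp]: "\<sigma> i v : carrier (N i)"
 using s_closed[of v] unfolding \<sigma>_def G_sel(1) by auto

lemma \<sigma>_add: "\<sigma> i (v + w) = \<sigma> i v \<otimes>\<^bsub>N i\<^esub> act i v (\<sigma> i w)"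
 unfolding \<sigma>_def s_add G_sel(2) by simp

lemma \<sigma>_smooth: "smooth_map (carrier vector_group) (model vector_group) (atlas vector_group) (carrier (N i)) (atlas (N i)) (\<sigma> i)"
proof -
 have "smooth_map UNIV UNIV {(UNIV, id)} (carrier G) (atlas G) s"
  using s_hom unfolding lie_hom_def vector_group_sel by blast
 then show ?thesis unfolding vector_group_sel smooth_map_G_iff[OF vec_atlas_source] \<sigma>_def by blast
qed

lemma \<sigma>_zero [simp]: "\<sigma> i 0 = \<one>\<^bsub>N i\<^esub>"
proof -
 have "\<sigma> i 0 = \<sigma> i 0 \<otimes>\<^bsub>N i\<^esub> \<sigma> i 0" using \<sigma>_add[of i 0 0] by (simp add: act_zero)
 then show ?thesis using group.l_cancel_one'[OF group_N] by (metis \<sigma>_closed)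
qed

lemma \<sigma>_one: "\<sigma> i \<one>\<^bsub>vector_group\<^esub> = \<one>\<^bsub>N i\<^esub>"
 by (simp add: vector_group_sel)

lemma \<sigma>_velocity:
 assumes "t : J" "(v has_vector_derivative V) (at t within J)"
 shows "velocity_at (N i) (%r. \<sigma> i (v r - v t)) t J (d\<sigma> i V)"
 unfolding d\<sigma>_def
 by (rule differential_velocity[OF lie_vector_group lie_N \<sigma>_smooth \<sigma>_one velocity_at_vector_group[OF assms]])

lemma d\<sigma>_linear: "bounded_linear (d\<sigma> i)"
proof -
 obtain L where L: "bounded_linear L" "!!X. X : model vector_group ==> L X = d\<sigma> i X"
  using velocity_at_map[OF lie_vector_group lie_N[of i] \<sigma>_smooth[of i] \<sigma>_one[of i]] unfolding d\<sigma>_def by metis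
 then have "L = d\<sigma> i" by (auto simp: vector_group_sel)
 then show ?thesis using L(1) by simp
qed

lemma d\<sigma>_model: "d\<sigma> i V : model (N i)"
proof -
 have "velocity_at (N i) (%r. \<sigma> i (r *\<^sub>R V - 0 *\<^sub>R V)) 0 UNIV (d\<sigma> i V)"
  by (rule \<sigma>_velocity) (auto intro!: derivative_eq_intros simp: has_vector_derivative_def)
 then show ?thesis unfolding velocity_at_def by simp
qed

lemma differential_s: "differential vector_group G s v = (\<chi> i. d\<sigma> i v, v)"
proof -
 have v: "velocity_at (N i) (%r. \<sigma> i (r *\<^sub>R v - 0 *\<^sub>R v)) 0 UNIV (d\<sigma> i v)" for i
  by (rule \<sigma>_velocity) (auto intro!: derivative_eq_intros simp: has_vector_derivative_def)
 have 1: "((%r. coord (N i) (\<sigma> i (r *\<^sub>R v))) has_vector_derivative d\<sigma> i v) (at 0)" for i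
  using v[of i] unfolding velocity_at_def by simp
 have 2: "((%r. r *\<^sub>R v) has_vector_derivative v) (at (0::real))"
  by (auto intro!: derivative_eq_intros simp: has_vector_derivative_def)
 have "((%r. \<Sum>i\<in>UNIV. axis i (coord (N i) (\<sigma> i (r *\<^sub>R v)))) has_vector_derivative (\<Sum>i\<in>UNIV. axis i (d\<sigma> i v))) (at 0)"
  by (intro has_vector_derivative_sum bounded_linear.has_vector_derivative[OF bounded_linear_axis 1])
 from vector_derivative_at[OF has_vector_derivative_Pair[OF this 2]]
 show ?thesis unfolding differential_def by (simp add: sum_axis G_sel(5) \<sigma>_def vector_group_sel)
qed

text \<open>By the cocycle identity the left-translated curve is \<open>act i (v t)\<close> applied
  to \<open>\<sigma> i (v r - v t)\<close>, which passes through the identity.\<close>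

lemma \<sigma>_path_velocity:
 assumes t: "t : J" and v: "(v has_vector_derivative V) (at t within J)"
 shows "velocity_at (N i) (%r. inv\<^bsub>N i\<^esub> (\<sigma> i (v t)) \<otimes>\<^bsub>N i\<^esub> \<sigma> i (v r)) t J (E i (\<alpha> i (v t)) (d\<sigma> i V))"
proof (rule velocity_at_cong[OF act_velocity[OF \<sigma>_velocity[OF assms]]])
 fix r
 interpret Ni: group "N i" by (rule group_N)
 have "\<sigma> i (v r) = \<sigma> i (v t) \<otimes>\<^bsub>N i\<^esub> act i (v t) (\<sigma> i (v r - v t))" using \<sigma>_add[of i "v t" "v r - v t"] by simp
 then show "inv\<^bsub>N i\<^esub> (\<sigma> i (v t)) \<otimes>\<^bsub>N i\<^esub> \<sigma> i (v r) = act i (v t) (\<sigma> i (v r - v t))"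
  by (simp add: Ni.m_assoc[symmetric])
qed

lemma \<sigma>_smooth_path:
 assumes "a < b" "smooth_on UNIV {a..b} v"
 shows "smooth_path_on (N i) {a..b} (%t. \<sigma> i (v t))"
proof -
 have v: "smooth_map {a..b} UNIV {({a..b}, id)} UNIV {(UNIV, id)} v" using assms(2) unfolding smooth_on_interval_iff .
 show ?thesis unfolding smooth_path_on_iff
  by (rule smooth_map_compose[OF source_atlas_interval[OF assms(1)] vec_atlas_target lie_grp.target_G[OF lie_grp_N] v \<sigma>_smooth[unfolded vector_group_sel]])
qed

end

section \<open>Contraction by the action, and the splitting as a coboundary\<close>

context sol_group begin

lemma decay:
 obtains C where "C > 0" "!!t X. t >= 0 ==> X : model (N i) ==> norm (E i (- t) X) <= C * exp (- t / 2) * norm X"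
proof -
 show ?thesis
  by (rule lin_exp_decay[OF linear_D[of i] D_model[of i] subspace_N[of i] eigenvalue_D[of i]])
   (use that in blast)+
qed

text \<open>Applying \<open>act i (- n v1)\<close> to a path applies \<open>E i (- n)\<close> to its
  velocities, which decays; \<open>short_path\<close> then places the end point in the identity
  chart.\<close>

lemma contraction:
 assumes v1: "\<alpha> i v1 = 1"
 obtains r0 C where "r0 > 0" "C > 0" "!!y. y : model (N i) ==> norm y <= r0 ==> y : lie_grp.cdom (N i)"
  "!!u c (n :: nat). piecewise_smooth_path (N i) \<one>\<^bsub>N i\<^esub> u c ==> C * exp (- real n / 2) * integral {0..1} (%t. norm (left_velocity (N i) c t)) < r0 ==>
   act i (- real n *\<^sub>R v1) u : lie_grp.U (N i) &
   norm (coord (N i) (act i (- real n *\<^sub>R v1) u)) <= C * exp (- real n / 2) * integral {0..1} (%t. norm (left_velocity (N i) c t))"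
proof -
 interpret Ni: lie_grp "N i" ..
 obtain C1 where C1: "C1 > 0" "!!t X. t >= 0 ==> X : model (N i) ==> norm (E i (- t) X) <= C1 * exp (- t / 2) * norm X"
  using decay by metis
 obtain r0 C0 where r0: "r0 > 0" "C0 > 0" "!!y. y : model (N i) ==> norm y <= r0 ==> y : Ni.cdom" and
 sp: "!!c F X t. continuous_on {0..1::real} c ==> c ` {0..1} <= carrier (N i) ==> c 0 = \<one>\<^bsub>N i\<^esub> ==> finite F ==>
  (!!t. t : {0<..<1} - F ==> velocity_at (N i) (%r. inv\<^bsub>N i\<^esub> (c t) \<otimes>\<^bsub>N i\<^esub> c r) t {0..1} (X t)) ==>
  (%t. norm (X t)) integrable_on {0..1} ==> C0 * integral {0..1} (%t. norm (X t)) < r0 ==> t : {0..1} ==>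
  c t : Ni.U & norm (coord (N i) (c t)) <= C0 * integral {0..1} (%t. norm (X t))"
  using Ni.short_path by blast
 have "act i (- real n *\<^sub>R v1) u : Ni.U &
   norm (coord (N i) (act i (- real n *\<^sub>R v1) u)) <= (C0 * C1) * exp (- real n / 2) * integral {0..1} (%t. norm (left_velocity (N i) c t))"
  if c: "piecewise_smooth_path (N i) \<one>\<^bsub>N i\<^esub> u c"
  and small: "(C0 * C1) * exp (- real n / 2) * integral {0..1} (%t. norm (left_velocity (N i) c t)) < r0" for u c and n :: nat
 proof -
  let ?a = "act i (- real n *\<^sub>R v1)" and ?X = "left_velocity (N i) c"
  obtain F where F: "finite F" "!!t. t : {0<..<1} - F ==> velocity_at (N i) (%r. inv\<^bsub>N i\<^esub> (c t) \<otimes>\<^bsub>N i\<^esub> c r) t {0..1} (?X t)"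
   using Ni.piecewise_smooth_path_velocity[OF c] by metis
  have cc: "c 0 = \<one>\<^bsub>N i\<^esub>" "c 1 = u" "c ` {0..1} <= carrier (N i)" "continuous_on {0..1} c"
   using piecewise_smooth_pathD[OF c] by metis+
  define Y where "Y t = (if t : {0<..<1} - F then E i (- real n) (?X t) else 0)" for t
  have pc: "pw_continuous ?X" by (rule Ni.pw_continuous_left_velocity[OF c])
  have iX: "(%t. norm (?X t)) integrable_on {0..1}"
   by (rule pw_continuous_imp_integrable[OF pw_continuous_compose[OF pc]]) (intro continuous_intros)
  have iE: "(%t. norm (E i (- real n) (?X t))) integrable_on {0..1}"
   by (rule pw_continuous_imp_integrable[OF pw_continuous_compose[OF pc]])
    (intro continuous_intros linear_continuous_on linear_conv_bounded_linear[THEN iffD1] lin_exp_linear linear_D)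
  have iY: "(%t. norm (Y t)) integrable_on {0..1}"
   by (rule integrable_spike_finite[OF _ _ iE, of "F Un {0, 1}"]) (use F(1) in \<open>auto simp: Y_def\<close>)
  have "integral {0..1} (%t. norm (Y t)) <= integral {0..1} (%t. (C1 * exp (- real n / 2)) * norm (?X t))"
  proof (rule integral_le[OF iY])
   show "(%t. (C1 * exp (- real n / 2)) * norm (?X t)) integrable_on {0..1}" using iX by (rule integrable_on_mult_right)
   fix t :: real
   show "norm (Y t) <= (C1 * exp (- real n / 2)) * norm (?X t)"
   proof (cases "t : {0<..<1} - F")
    case True
    then have "?X t : model (N i)" using F(2) unfolding velocity_at_def by blast
    then show ?thesis using True C1(2)[of "real n"] unfolding Y_def by simp
   next
    case False then show ?thesis using C1(1) unfolding Y_def by auto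
   qed
  qed
  then have b: "C0 * integral {0..1} (%t. norm (Y t)) <= (C0 * C1) * exp (- real n / 2) * integral {0..1} (%t. norm (?X t))"
   using r0(2) by (simp add: mult.assoc)
  have "?a (c 1) : Ni.U & norm (coord (N i) (?a (c 1))) <= C0 * integral {0..1} (%t. norm (Y t))"
  proof (rule sp[where c = "%t. ?a (c t)" and F = F])
   show "continuous_on {0..1} (%t. ?a (c t))" by (rule continuous_on_compose2[OF smooth_mapD(3)[OF act_smooth] cc(4,3)])
   show "(%t. ?a (c t)) ` {0..1} <= carrier (N i)" using cc(3) by auto
   show "?a (c 0) = \<one>\<^bsub>N i\<^esub>" unfolding cc(1) by simp
   fix t assume t: "t : {0<..<1} - F"
   then have ct: "c t : carrier (N i)" using cc(3) by auto
   have "Y t = E i (\<alpha> i (- real n *\<^sub>R v1)) (?X t)" unfolding Y_def \<alpha>_scale v1 using t by simp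
   then show "velocity_at (N i) (%r. inv\<^bsub>N i\<^esub> (?a (c t)) \<otimes>\<^bsub>N i\<^esub> ?a (c r)) t {0..1} (Y t)"
    using velocity_at_cong[OF act_velocity[OF F(2)[OF t]], of "%r. inv\<^bsub>N i\<^esub> (?a (c t)) \<otimes>\<^bsub>N i\<^esub> ?a (c r)"] ct cc(3)
    by (auto simp: act_mult act_inv[symmetric] image_subset_iff)
  qed (use F(1) iY b small in auto)
  then show ?thesis using b cc(2) by auto
 qed
 then show ?thesis using that[of r0 "C0 * C1"] r0 C1(1) by auto
qed

end

lemma (in group) mult_inv_cancel:
 assumes "x : carrier G" "y : carrier G"
 shows "x \<otimes> (inv x \<otimes> y) = y" "inv x \<otimes> (x \<otimes> y) = y"
 using assms by (simp_all add: m_assoc[symmetric])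

lemma (in lie_grp) Ad_inverse:
 assumes x: "x : carrier G" and Y: "Y : model G"
 shows "Ad G x (Ad G (inv x) Y) = Y"
proof -
 obtain J where J: "open J" "(0::real) : J" "velocity_at G (%r. uncoord G (r *\<^sub>R Y)) 0 J Y"
  using velocity_at_uncoord[OF Y] by metis
 have im: "uncoord G (r *\<^sub>R Y) : carrier G" if "r : J" for r using J(3) that unfolding velocity_at_def by blast
 have "velocity_at G (%r. x \<otimes> (inv x \<otimes> uncoord G (r *\<^sub>R Y) \<otimes> inv (inv x)) \<otimes> inv x) 0 J (Ad G x (Ad G (inv x) Y))"
  by (rule Ad_velocity[OF x Ad_velocity[OF inv_closed[OF x] J(3)]])
 then have "velocity_at G (%r. uncoord G (r *\<^sub>R Y)) 0 J (Ad G x (Ad G (inv x) Y))"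
  by (rule velocity_at_cong) (simp add: x im m_assoc mult_inv_cancel)
 moreover have "at 0 within J ~= bot" unfolding at_within_open[OF J(2,1)] by simp
 ultimately show ?thesis using velocity_at_unique J(3) by metis
qed

lemma (in lie_grp) tendsto_mult_carrier:
 assumes "(f \<longlongrightarrow> a) F" "(g \<longlongrightarrow> b) F" "a : carrier G" "b : carrier G" "!!n. f n : carrier G" "!!n. g n : carrier G"
 shows "((%n. f n \<otimes> g n) \<longlongrightarrow> a \<otimes> b) F"
 using continuous_on_tendsto_compose[OF continuous_on_mult tendsto_Pair[OF assms(1,2)]] assms(3-6) by simp

context sol_splitting begin

lemma \<sigma>_line_path:
 "piecewise_smooth_path (N i) \<one>\<^bsub>N i\<^esub> (\<sigma> i w) (%t. \<sigma> i (t *\<^sub>R w))"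
 "t : {0..1} ==> left_velocity (N i) (%t. \<sigma> i (t *\<^sub>R w)) t = E i (t * \<alpha> i w) (d\<sigma> i w)"
proof -
 interpret Ni: lie_grp "N i" ..
 have "smooth_on UNIV {0..1} (%t::real. t *\<^sub>R w)"
  unfolding smooth_on_def using Ck_on_linear[OF bounded_linear_scaleR_left] by blast
 from Ni.smooth_imp_piecewise_smooth_path[OF \<sigma>_smooth_path[OF _ this]]
 show "piecewise_smooth_path (N i) \<one>\<^bsub>N i\<^esub> (\<sigma> i w) (%t. \<sigma> i (t *\<^sub>R w))" by simp
 assume t: "t : {0..1}"
 have "((%t::real. t *\<^sub>R w) has_vector_derivative w) (at t within {0..1})"
  by (auto intro!: derivative_eq_intros simp: has_vector_derivative_def)
 from velocity_at_unique[OF \<sigma>_path_velocity[OF t this]] at_within_Icc_neq_bot[of 0 1 t] t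
 show "left_velocity (N i) (%t. \<sigma> i (t *\<^sub>R w)) t = E i (t * \<alpha> i w) (d\<sigma> i w)"
  unfolding left_velocity_def left_curve_def[abs_def] by (simp add: \<alpha>_scale)
qed

text \<open>
 The cocycle \<open>\<sigma> i\<close> is a coboundary, because the action contracts: \<open>c\<close> is the limit of \<open>\<sigma> i (- n v)\<close>,
 where \<open>\<alpha> i v = 1\<close>.
\<close>

lemma splitting_conjugate: "\<exists>c\<in>carrier (N i). \<forall>w. \<sigma> i w = c \<otimes>\<^bsub>N i\<^esub> inv\<^bsub>N i\<^esub> (act i w c)"
proof -
 interpret Ni: lie_grp "N i" ..
 obtain v0 where "\<alpha> i v0 ~= 0" using \<alpha>_nonzero by blast
 define v1 where "v1 = (1 / \<alpha> i v0) *\<^sub>R v0"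
 have v1: "\<alpha> i v1 = 1" unfolding v1_def \<alpha>_scale using \<open>\<alpha> i v0 ~= 0\<close> by simp
 obtain C1 where C1: "C1 > 0" "!!t X. t >= 0 ==> X : model (N i) ==> norm (E i (- t) X) <= C1 * exp (- t / 2) * norm X"
  using decay by metis
 obtain r0 C where rC: "r0 > 0" "C > 0" "!!y. y : model (N i) ==> norm y <= r0 ==> y : Ni.cdom" and
  con: "!!u c n. piecewise_smooth_path (N i) \<one>\<^bsub>N i\<^esub> u c ==> C * exp (- real n / 2) * integral {0..1} (%t. norm (left_velocity (N i) c t)) < r0 ==>
   act i (- real n *\<^sub>R v1) u : Ni.U &
   norm (coord (N i) (act i (- real n *\<^sub>R v1) u)) <= C * exp (- real n / 2) * integral {0..1} (%t. norm (left_velocity (N i) c t))"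
  using contraction[OF v1] by blast
 define x where "x n = \<sigma> i (- real n *\<^sub>R v1)" for n :: nat
 have xc: "x n : carrier (N i)" for n unfolding x_def by simp
 have x_add: "x (n + m) = x n \<otimes>\<^bsub>N i\<^esub> act i (- real n *\<^sub>R v1) (x m)" for n m
  unfolding x_def using \<sigma>_add[of i "- real n *\<^sub>R v1" "- real m *\<^sub>R v1"] by (simp add: scaleR_add_left algebra_simps)
 have lim0: "(%n. A * exp (- real n / 2)) \<longlonglongrightarrow> 0" for A
 proof -
  have "(%n. A * exp (- 1 / 2) ^ n) \<longlonglongrightarrow> A * 0" by (intro tendsto_intros LIMSEQ_realpow_zero) auto
  moreover have "exp (- 1 / 2) ^ n = exp (- real n / 2)" for n by (simp add: exp_of_nat_mult[symmetric])
  ultimately show ?thesis by simp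
 qed
 define M where "M = 2 * C1 * norm (d\<sigma> i v1)"
 \<comment> \<open>The line to \<open>x m\<close> yields a velocity integral bounded for all
   \<open>m\<close> at once: the norm is at most a constant times
   \<open>m * exp (- t * m / 2)\<close>, whose integral over the unit interval is at most 2.\<close>
 have M: "integral {0..1} (%t. norm (left_velocity (N i) (%t. \<sigma> i (t *\<^sub>R (- real m *\<^sub>R v1))) t)) <= M" (is "integral _ ?f <= _") for m
 proof -
  let ?w = "- real m *\<^sub>R v1"
  have fi: "?f integrable_on {0..1}"
   by (rule pw_continuous_imp_integrable[OF pw_continuous_compose[OF Ni.pw_continuous_left_velocity[OF \<sigma>_line_path(1)]]])
    (intro continuous_intros)
  have d: "((%t. - 2 * C1 * norm (d\<sigma> i v1) * exp (- (t * real m) / 2)) has_vector_derivative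
    (C1 * norm (d\<sigma> i v1) * real m * exp (- (t * real m) / 2))) (at t within {0..1})" for t
   unfolding has_real_derivative_iff_has_vector_derivative[symmetric]
   by (auto intro!: derivative_eq_intros simp: field_simps)
  have hi: "((%t. C1 * norm (d\<sigma> i v1) * real m * exp (- (t * real m) / 2)) has_integral
    (- 2 * C1 * norm (d\<sigma> i v1) * exp (- (1 * real m) / 2) - (- 2 * C1 * norm (d\<sigma> i v1) * exp (- (0 * real m) / 2)))) {0..1}"
   by (rule fundamental_theorem_of_calculus[OF _ d]) simp
  have "integral {0..1} ?f <= - 2 * C1 * norm (d\<sigma> i v1) * exp (- (1 * real m) / 2) - (- 2 * C1 * norm (d\<sigma> i v1) * exp (- (0 * real m) / 2))"
  proof (rule has_integral_le[OF integrable_integral[OF fi] hi])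
   fix t :: real assume t: "t : {0..1}"
   have lin: "d\<sigma> i ?w = (- real m) *\<^sub>R d\<sigma> i v1" using linear_scale[OF bounded_linear.linear[OF d\<sigma>_linear[of i]], of "- real m" v1] by simp
   have "?f t = norm (E i (- (t * real m)) (d\<sigma> i ?w))" unfolding \<sigma>_line_path(2)[OF t] by (simp add: \<alpha>_neg \<alpha>_scale v1)
   also have "\<dots> <= C1 * exp (- (t * real m) / 2) * norm (d\<sigma> i ?w)" by (rule C1(2)) (use t d\<sigma>_model in auto)
   also have "\<dots> = C1 * norm (d\<sigma> i v1) * real m * exp (- (t * real m) / 2)" unfolding lin by simp
   finally show "?f t <= C1 * norm (d\<sigma> i v1) * real m * exp (- (t * real m) / 2)" .
  qed
  also have "\<dots> <= M" unfolding M_def using C1(1) by simp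
  finally show ?thesis .
 qed
 have M0: "M >= 0" unfolding M_def using C1(1) by simp
 \<comment> \<open>After contracting by \<open>n0\<close> further steps all \<open>x m\<close> lie
   in one compact coordinate ball, so a subsequence converges there.\<close>
 obtain n0 where n0: "C * M * exp (- real n0 / 2) < r0"
  using order_tendstoD(2)[OF lim0[of "C * M"] rC(1)] unfolding eventually_sequentially by blast
 define r1 where "r1 = C * exp (- real n0 / 2) * M"
 have r1: "r1 < r0" "0 <= r1" unfolding r1_def using n0 rC(2) M0 by (simp_all add: mult_ac)
 define z where "z m = act i (- real n0 *\<^sub>R v1) (x m)" for m
 have z: "z m : Ni.U & norm (coord (N i) (z m)) <= r1" for m
 proof -
  have le: "C * exp (- real n0 / 2) * integral {0..1} (%t. norm (left_velocity (N i) (%t. \<sigma> i (t *\<^sub>R (- real m *\<^sub>R v1))) t)) <= r1"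
   unfolding r1_def using M[of m] rC(2) by (intro mult_left_mono) auto
  then show ?thesis using con[OF \<sigma>_line_path(1)[of i "- real m *\<^sub>R v1"], of n0] r1 unfolding z_def x_def by (meson le_less_trans order_trans)
 qed
 have "compact (model (N i) Int cball 0 r1)"
  by (rule closed_Int_compact[OF closed_subspace[OF Ni.subspace_model] compact_cball])
 moreover have "coord (N i) (z m) : model (N i) Int cball 0 r1" for m
  using z[of m] Ni.dom_model[OF Ni.coord_in_dom] by (simp add: dist_norm)
 ultimately obtain y \<rho> where y: "y : model (N i) Int cball 0 r1" "strict_mono \<rho>" "((%m. coord (N i) (z m)) o \<rho>) \<longlonglongrightarrow> y"
  using seq_compactE[OF compact_imp_seq_compact, of "model (N i) Int cball 0 r1" "%m. coord (N i) (z m)"] by metis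
 have yd: "y : Ni.cdom" using y(1) r1 by (intro rC(3)) (auto simp: dist_norm)
 have cunc: "continuous_on Ni.cdom (uncoord (N i))"
  by (rule Ni.continuous_on_uncoord)
 have "(%k. uncoord (N i) (coord (N i) (z (\<rho> k)))) \<longlonglongrightarrow> uncoord (N i) y"
  by (rule continuous_on_tendsto_compose[OF cunc y(3)[unfolded comp_def] yd]) (use z Ni.coord_in_dom in auto)
 then have zl: "(%k. z (\<rho> k)) \<longlonglongrightarrow> uncoord (N i) y" using z by simp
 have uc: "uncoord (N i) y : carrier (N i)" using Ni.uncoord_in_U[OF yd] Ni.U_carrier by blast
 define c where "c = x n0 \<otimes>\<^bsub>N i\<^esub> uncoord (N i) y"
 have cc: "c : carrier (N i)" unfolding c_def using xc uc by simp
 have zc: "z m : carrier (N i)" for m unfolding z_def using xc by simp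
 have xl: "(%k. x (n0 + \<rho> k)) \<longlonglongrightarrow> c"
  unfolding x_add c_def z_def[symmetric] using xc uc zc by (intro Ni.tendsto_mult_carrier tendsto_const zl)
 have "\<sigma> i w = c \<otimes>\<^bsub>N i\<^esub> inv\<^bsub>N i\<^esub> (act i w c)" for w
 proof -
  define I where "I = integral {0..1} (%t. norm (left_velocity (N i) (%t. \<sigma> i (t *\<^sub>R w)) t))"
  have ev: "\<forall>\<^sub>F n in sequentially. C * I * exp (- real n / 2) < r0" by (rule order_tendstoD(2)[OF lim0 rC(1)])
  define e where "e n = act i (- real n *\<^sub>R v1) (\<sigma> i w)" for n :: nat
  have ec: "e n : carrier (N i)" for n unfolding e_def by simp
  have eb: "\<forall>\<^sub>F n in sequentially. e n : Ni.U & norm (coord (N i) (e n)) <= C * I * exp (- real n / 2)"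
   using ev
  proof eventually_elim
   case (elim n)
   then show ?case using con[OF \<sigma>_line_path(1)[of i w], of n] unfolding e_def I_def[symmetric] by (simp add: mult_ac)
  qed
  have "(%n. coord (N i) (e n)) \<longlonglongrightarrow> 0"
   by (rule Lim_null_comparison[OF _ lim0[of "C * I"]]) (use eb in \<open>auto elim: eventually_mono\<close>)
  moreover have "\<forall>\<^sub>F n in sequentially. coord (N i) (e n) : Ni.cdom"
   using eb by eventually_elim (simp add: Ni.coord_in_dom)
  ultimately have "(%n. uncoord (N i) (coord (N i) (e n))) \<longlonglongrightarrow> \<one>\<^bsub>N i\<^esub>"
   using continuous_on_tendsto_compose[OF cunc _ Ni.zero_in_dom] by simp
  then have el: "e \<longlonglongrightarrow> \<one>\<^bsub>N i\<^esub>"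
   by (rule Lim_transform_eventually) (use eb in \<open>auto elim!: eventually_mono\<close>)
  have "strict_mono (%k. n0 + \<rho> k)" using y(2) by (simp add: strict_mono_def)
  from LIMSEQ_subseq_LIMSEQ[OF el this] have el': "(%k. e (n0 + \<rho> k)) \<longlonglongrightarrow> \<one>\<^bsub>N i\<^esub>" by (simp add: comp_def)
  \<comment> \<open>The cocycle identity, expanded in both orders for \<open>- n v1\<close> and
    \<open>w\<close>. Since \<open>e n\<close> tends to the identity, the limit along the
    subsequence reads \<open>c = \<sigma> i w \<otimes> act i w c\<close>.\<close>
  have eq: "x n \<otimes>\<^bsub>N i\<^esub> e n = \<sigma> i w \<otimes>\<^bsub>N i\<^esub> act i w (x n)" for n
   unfolding e_def x_def \<sigma>_add[symmetric] by (simp add: add.commute)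
  have "(%k. x (n0 + \<rho> k) \<otimes>\<^bsub>N i\<^esub> e (n0 + \<rho> k)) \<longlonglongrightarrow> c \<otimes>\<^bsub>N i\<^esub> \<one>\<^bsub>N i\<^esub>"
   using cc xc ec by (intro Ni.tendsto_mult_carrier xl el') auto
  moreover have "(%k. act i w (x (n0 + \<rho> k))) \<longlonglongrightarrow> act i w c"
   by (rule continuous_on_tendsto_compose[OF smooth_mapD(3)[OF act_smooth] xl cc]) (use xc in auto)
  then have "(%k. \<sigma> i w \<otimes>\<^bsub>N i\<^esub> act i w (x (n0 + \<rho> k))) \<longlonglongrightarrow> \<sigma> i w \<otimes>\<^bsub>N i\<^esub> act i w c"
   using cc xc by (intro Ni.tendsto_mult_carrier tendsto_const) auto
  ultimately have "c \<otimes>\<^bsub>N i\<^esub> \<one>\<^bsub>N i\<^esub> = \<sigma> i w \<otimes>\<^bsub>N i\<^esub> act i w c" unfolding eq by (rule LIMSEQ_unique)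
  then have "c = \<sigma> i w \<otimes>\<^bsub>N i\<^esub> act i w c" using cc by simp
  then show ?thesis using Ni.inv_solve_right[OF \<sigma>_closed cc, of "act i w c"] cc by simp
 qed
 then show ?thesis using cc by blast
qed

definition "conj_elt i = (SOME c. c : carrier (N i) & (\<forall>w. \<sigma> i w = c \<otimes>\<^bsub>N i\<^esub> inv\<^bsub>N i\<^esub> (act i w c)))"

lemma conj_elt: "conj_elt i : carrier (N i)" "\<sigma> i w = conj_elt i \<otimes>\<^bsub>N i\<^esub> inv\<^bsub>N i\<^esub> (act i w (conj_elt i))"
proof -
 have "conj_elt i : carrier (N i) & (\<forall>w. \<sigma> i w = conj_elt i \<otimes>\<^bsub>N i\<^esub> inv\<^bsub>N i\<^esub> (act i w (conj_elt i)))"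
  unfolding conj_elt_def by (rule someI_ex) (use splitting_conjugate[of i] in \<open>simp only: Bex_def\<close>)
 then show "conj_elt i : carrier (N i)" "\<sigma> i w = conj_elt i \<otimes>\<^bsub>N i\<^esub> inv\<^bsub>N i\<^esub> (act i w (conj_elt i))" by blast+
qed

section \<open>Conjugation by the splitting\<close>

text \<open>Conjugation by \<open>s v\<close>, restricted to \<open>N i\<close>;
  \<open>conj_G\<close> makes this precise.\<close>

definition "\<psi> i v x = \<sigma> i v \<otimes>\<^bsub>N i\<^esub> act i v x \<otimes>\<^bsub>N i\<^esub> inv\<^bsub>N i\<^esub> (\<sigma> i v)"
text \<open>The differential of \<open>\<psi> i v\<close>, in the form given by the coboundary:
  \<open>act i v\<close> conjugated by an element that does not depend on \<open>v\<close>. This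
  form yields the decay.\<close>

definition "d\<psi> i v X = Ad (N i) (conj_elt i) (E i (\<alpha> i v) (Ad (N i) (inv\<^bsub>N i\<^esub> (conj_elt i)) X))"

lemma \<psi>_eq:
 assumes x: "x : carrier (N i)"
 shows "\<psi> i v x = conj_elt i \<otimes>\<^bsub>N i\<^esub> act i v (inv\<^bsub>N i\<^esub> (conj_elt i) \<otimes>\<^bsub>N i\<^esub> x \<otimes>\<^bsub>N i\<^esub> conj_elt i) \<otimes>\<^bsub>N i\<^esub> inv\<^bsub>N i\<^esub> (conj_elt i)"
proof -
 interpret Ni: lie_grp "N i" ..
 note c = conj_elt(1)[of i]
 show ?thesis unfolding \<psi>_def conj_elt(2)[of i v] using c x by (simp add: act_mult act_inv Ni.inv_mult_group Ni.m_assoc Ni.mult_inv_cancel)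
qed

lemma \<psi>_closed [simp]: "x : carrier (N i) ==> \<psi> i v x : carrier (N i)"
proof -
 interpret Ni: lie_grp "N i" ..
 show "x : carrier (N i) ==> \<psi> i v x : carrier (N i)" unfolding \<psi>_def by simp
qed

lemma \<psi>_mult: "x : carrier (N i) ==> y : carrier (N i) ==> \<psi> i v (x \<otimes>\<^bsub>N i\<^esub> y) = \<psi> i v x \<otimes>\<^bsub>N i\<^esub> \<psi> i v y"
proof -
 interpret Ni: lie_grp "N i" ..
 assume "x : carrier (N i)" "y : carrier (N i)"
 then show ?thesis unfolding \<psi>_def by (simp add: act_mult Ni.m_assoc Ni.mult_inv_cancel)
qed

lemma \<psi>_add:
 assumes x: "x : carrier (N i)" shows "\<psi> i v (\<psi> i w x) = \<psi> i (v + w) x"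
proof -
 interpret Ni: lie_grp "N i" ..
 show ?thesis unfolding \<psi>_def \<sigma>_add act_add[OF x] using x by (simp add: act_mult act_inv Ni.inv_mult_group Ni.m_assoc Ni.mult_inv_cancel)
qed

lemma \<psi>_zero: "x : carrier (N i) ==> \<psi> i 0 x = x"
proof -
 interpret Ni: lie_grp "N i" ..
 show "x : carrier (N i) ==> \<psi> i 0 x = x" unfolding \<psi>_def by (simp add: act_zero)
qed

lemma \<psi>_one [simp]: "\<psi> i v \<one>\<^bsub>N i\<^esub> = \<one>\<^bsub>N i\<^esub>"
proof -
 interpret Ni: lie_grp "N i" ..
 show ?thesis unfolding \<psi>_def by simp
qed

lemma \<psi>_smooth: "smooth_map (carrier (N i)) (model (N i)) (atlas (N i)) (carrier (N i)) (atlas (N i)) (\<psi> i v)"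
proof -
 interpret Ni: lie_grp "N i" ..
 have "smooth_map (carrier (N i)) (model (N i)) (atlas (N i)) (carrier (N i)) (atlas (N i)) (%x. \<sigma> i v \<otimes>\<^bsub>N i\<^esub> act i v x \<otimes>\<^bsub>N i\<^esub> inv\<^bsub>N i\<^esub> (\<sigma> i v))"
  by (rule smooth_map_compose[OF Ni.source_G Ni.target_G Ni.target_G act_smooth Ni.smooth_conj]) simp
 then show ?thesis unfolding \<psi>_def[abs_def] .
qed

lemma \<psi>_velocity:
 assumes "velocity_at (N i) b t J X"
 shows "velocity_at (N i) (%r. \<psi> i v (b r)) t J (d\<psi> i v X)"
proof -
 interpret Ni: lie_grp "N i" ..
 note c = conj_elt(1)[of i]
 have b: "b r : carrier (N i)" if "r : J" for r using assms that unfolding velocity_at_def by blast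
 show ?thesis unfolding d\<psi>_def
  by (rule velocity_at_cong[OF Ni.Ad_velocity[OF c act_velocity[OF Ni.Ad_velocity[OF Ni.inv_closed[OF c] assms]]]])
   (simp add: \<psi>_eq b c)
qed

lemma \<psi>_lie_hom: "lie_hom (N i) (N i) (\<psi> i v)"
 unfolding lie_hom_def hom_def using \<psi>_smooth \<psi>_mult by auto

lemma \<psi>_automorphism: "lie_automorphism (N i) (\<psi> i v)"
proof -
 interpret Ni: lie_grp "N i" ..
 have inv1: "\<psi> i (- v) (\<psi> i v x) = x" "\<psi> i v (\<psi> i (- v) x) = x" if "x : carrier (N i)" for x
  using that by (simp_all add: \<psi>_add \<psi>_zero)
 have bij: "bij_betw (\<psi> i v) (carrier (N i)) (carrier (N i))"
  by (rule bij_betw_byWitness[where f' = "\<psi> i (- v)"]) (use inv1 in auto)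
 have eq: "\<psi> i (- v) x = inv_into (carrier (N i)) (\<psi> i v) x" if "x : carrier (N i)" for x
  using inv_into_f_eq[OF bij_betw_imp_inj_on[OF bij], of "\<psi> i (- v) x" x] that inv1 by simp
 have "lie_hom (N i) (N i) (inv_into (carrier (N i)) (\<psi> i v))"
  unfolding lie_hom_def
 proof
  show "smooth_map (carrier (N i)) (model (N i)) (atlas (N i)) (carrier (N i)) (atlas (N i)) (inv_into (carrier (N i)) (\<psi> i v))"
   by (rule smooth_map_cong[OF eq Ni.source_G \<psi>_smooth])
  show "inv_into (carrier (N i)) (\<psi> i v) : hom (N i) (N i)"
   by (rule homI) (simp_all add: eq[symmetric] \<psi>_mult)
 qed
 then show ?thesis unfolding lie_automorphism_def using \<psi>_lie_hom bij by blast
qed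

lemma \<psi>_differential:
 assumes X: "X : model (N i)" shows "differential (N i) (N i) (\<psi> i v) X = d\<psi> i v X"
proof -
 interpret Ni: lie_grp "N i" ..
 obtain J where J: "open J" "(0::real) : J" "velocity_at (N i) (%r. uncoord (N i) (r *\<^sub>R X)) 0 J X"
  using Ni.velocity_at_uncoord[OF X] by metis
 have "at 0 within J ~= bot" unfolding at_within_open[OF J(2,1)] by simp
 then show ?thesis
  using velocity_at_unique[OF \<psi>_velocity[OF J(3)]] velocity_at_unique[OF differential_velocity[OF lie_N lie_N \<psi>_smooth \<psi>_one J(3)]]
  by metis
qed

end

context sol_splitting begin

text \<open>The derivation is \<open>D i\<close> conjugated by \<open>Ad\<close> of
  \<open>conj_elt i\<close>; \<open>Ad\<close> preserves brackets by \<open>lie_bracket_hom\<close>.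
  It is the witness for the choice made in \<open>splitting_derivation\<close>.\<close>

lemma conj_derivation:
 "\<exists>D'. lie_derivation (N i) D' & (\<forall>v. \<forall>X\<in>model (N i). lin_exp (%Y. \<alpha> i v *\<^sub>R D' Y) X = d\<psi> i v X)"
proof -
 interpret Ni: lie_grp "N i" ..
 define c where "c = conj_elt i"
 have c: "c : carrier (N i)" "inv\<^bsub>N i\<^esub> c : carrier (N i)" unfolding c_def using conj_elt(1) by simp_all
 obtain A where A: "bounded_linear A" "!!X. X : model (N i) ==> A X = Ad (N i) c X"
  "!!b t J X. velocity_at (N i) b t J X ==> velocity_at (N i) (%r. c \<otimes>\<^bsub>N i\<^esub> b r \<otimes>\<^bsub>N i\<^esub> inv\<^bsub>N i\<^esub> c) t J (A X)"
  using Ni.Ad_linear[OF c(1)] by metis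
 obtain B where B: "bounded_linear B" "!!X. X : model (N i) ==> B X = Ad (N i) (inv\<^bsub>N i\<^esub> c) X"
  "!!b t J X. velocity_at (N i) b t J X ==> velocity_at (N i) (%r. inv\<^bsub>N i\<^esub> c \<otimes>\<^bsub>N i\<^esub> b r \<otimes>\<^bsub>N i\<^esub> inv\<^bsub>N i\<^esub> (inv\<^bsub>N i\<^esub> c)) t J (B X)"
  using Ni.Ad_linear[OF c(2)] by metis
 have Am: "A X : model (N i)" and Bm: "B X : model (N i)" if "X : model (N i)" for X
  using A(2)[OF that] B(2)[OF that] Ni.Ad_in_model c that by auto
 have AB: "A (B X) = X" and BA: "B (A X) = X" if "X : model (N i)" for X
  using Ni.Ad_inverse[OF c(1) that] Ni.Ad_inverse[OF c(2) that] A(2) B(2) Am Bm that c by simp_all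
 have Dm: "D i X : model (N i)" if "X : model (N i)" for X using D_model[of i] that by blast
 have lin: "linear (%Y. A (D i (B Y)))"
  using linear_compose[OF linear_compose[OF bounded_linear.linear[OF B(1)] linear_D] bounded_linear.linear[OF A(1)]] by (simp add: comp_def)
 have hom: "(%x. a \<otimes>\<^bsub>N i\<^esub> x \<otimes>\<^bsub>N i\<^esub> inv\<^bsub>N i\<^esub> a) : hom (N i) (N i)" if "a : carrier (N i)" for a
  by (rule homI) (use that in \<open>simp_all add: Ni.m_assoc Ni.mult_inv_cancel\<close>)
 have brA: "A (lie_bracket (N i) X Y) = lie_bracket (N i) (A X) (A Y)" if "X : model (N i)" "Y : model (N i)" for X Y
  by (rule Ni.lie_bracket_hom[OF hom[OF c(1)] Ni.smooth_conj[OF c(1)] A(1)]) (use A(3) that in simp_all)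
 have brB: "B (lie_bracket (N i) X Y) = lie_bracket (N i) (B X) (B Y)" if "X : model (N i)" "Y : model (N i)" for X Y
  by (rule Ni.lie_bracket_hom[OF hom[OF c(2)] Ni.smooth_conj[OF c(2)] B(1)]) (use B(3) that in blast)+
 have der: "A (D i (B (lie_bracket (N i) X Y))) = lie_bracket (N i) (A (D i (B X))) Y + lie_bracket (N i) X (A (D i (B Y)))"
  if X: "X : model (N i)" and Y: "Y : model (N i)" for X Y
 proof -
  have "D i (lie_bracket (N i) (B X) (B Y)) = lie_bracket (N i) (D i (B X)) (B Y) + lie_bracket (N i) (B X) (D i (B Y))"
   using derivation_D[of i] Bm[OF X] Bm[OF Y] unfolding lie_derivation_def by simp
  then show ?thesis
   using brB[OF X Y] brA[OF Dm[OF Bm[OF X]] Bm[OF Y]] brA[OF Bm[OF X] Dm[OF Bm[OF Y]]]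
   by (simp add: AB X Y linear_add[OF bounded_linear.linear[OF A(1)]])
 qed
 have "lie_derivation (N i) (%Y. A (D i (B Y)))"
  unfolding lie_derivation_def using lin der Am Bm Dm by auto
 moreover have "lin_exp (%Y. \<alpha> i v *\<^sub>R A (D i (B Y))) X = d\<psi> i v X" if X: "X : model (N i)" for v X
 proof -
  have "lin_exp (%Y. \<alpha> i v *\<^sub>R A (D i (B Y))) X = A (E i (\<alpha> i v) (B X))"
   by (rule lin_exp_conjugate[OF linear_D D_model bounded_linear.linear[OF A(1)] _ BA AB lin X]) (use Bm in auto)
  then show ?thesis unfolding d\<psi>_def c_def[symmetric] using A(2) B(2) Bm E_model X by simp
 qed
 ultimately show ?thesis by blast
qed

text \<open>The conjugating element is independent of \<open>v\<close>, so it contributes only a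
  constant factor to the decay of \<open>E i\<close>.\<close>

lemma d\<psi>_decay:
 obtains C where "C > 0" "!!v X. \<alpha> i v <= 0 ==> X : model (N i) ==> norm (d\<psi> i v X) <= C * exp (\<alpha> i v / 2) * norm X"
proof -
 interpret Ni: lie_grp "N i" ..
 define c where "c = conj_elt i"
 have c: "c : carrier (N i)" "inv\<^bsub>N i\<^esub> c : carrier (N i)" unfolding c_def using conj_elt(1) by simp_all
 obtain A where A: "bounded_linear A" "!!X. X : model (N i) ==> A X = Ad (N i) c X"
  using Ni.Ad_linear[OF c(1)] by metis
 obtain B where B: "bounded_linear B" "!!X. X : model (N i) ==> B X = Ad (N i) (inv\<^bsub>N i\<^esub> c) X"
  using Ni.Ad_linear[OF c(2)] by metis
 obtain a where a: "a > 0" "!!X. norm (A X) <= norm X * a" using bounded_linear.pos_bounded[OF A(1)] by blast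
 obtain b where b: "b > 0" "!!X. norm (B X) <= norm X * b" using bounded_linear.pos_bounded[OF B(1)] by blast
 obtain C where C: "C > 0" "!!t X. t >= 0 ==> X : model (N i) ==> norm (E i (- t) X) <= C * exp (- t / 2) * norm X"
  using decay by metis
 have "norm (d\<psi> i v X) <= (a * C * b) * exp (\<alpha> i v / 2) * norm X" if v: "\<alpha> i v <= 0" and X: "X : model (N i)" for v X
 proof -
  have BX: "B X : model (N i)" using B(2)[OF X] Ni.Ad_in_model[OF c(2) X] by simp
  have "d\<psi> i v X = A (E i (\<alpha> i v) (B X))"
   unfolding d\<psi>_def c_def[symmetric] B(2)[OF X, symmetric] using A(2)[OF E_model[OF BX]] by simp
  then have "norm (d\<psi> i v X) <= norm (E i (\<alpha> i v) (B X)) * a" using a(2) by simp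
  also have "norm (E i (\<alpha> i v) (B X)) <= C * exp (\<alpha> i v / 2) * norm (B X)" using C(2)[of "- \<alpha> i v", OF _ BX] v by simp
  also have "C * exp (\<alpha> i v / 2) * norm (B X) <= C * exp (\<alpha> i v / 2) * (norm X * b)" using b(2) C(1) by (intro mult_left_mono) auto
  finally show ?thesis using a(1) by (simp add: mult_ac)
 qed
 then show ?thesis using that[of "a * C * b"] a(1) b(1) C(1) by simp
qed

lemma d\<psi>_model: "X : model (N i) ==> d\<psi> i v X : model (N i)"
proof -
 interpret Ni: lie_grp "N i" ..
 show "X : model (N i) ==> d\<psi> i v X : model (N i)"
  unfolding d\<psi>_def using conj_elt(1)[of i] by (intro Ni.Ad_in_model E_model) auto
qed

lemma conj_G:
 assumes h: "!!i. h i : carrier (N i)"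
 shows "s v \<cdot> (h, 0) \<cdot> inv\<^bsub>G\<^esub> (s v) = (%i. \<psi> i v (h i), 0)"
proof -
 have "act i v (act i (- v) (inv\<^bsub>N i\<^esub> (\<sigma> i v))) = inv\<^bsub>N i\<^esub> (\<sigma> i v)" for i
  using act_add[of "inv\<^bsub>N i\<^esub> (\<sigma> i v)" i v "- v"] act_zero group.inv_closed[OF group_N \<sigma>_closed] by simp
 then show ?thesis unfolding inv_G[OF s_closed] G_sel \<psi>_def by (simp add: \<sigma>_def)
qed

lemma uncoord_G:
 assumes "!!j. y $ j : lie_grp.cdom (N j)"
 shows "uncoord G (y, v) = (%j. uncoord (N j) (y $ j), v)"
proof (rule inv_into_f_eq)
 have ch: "fst (id_chart G) = {h. \<forall>i. h i : fst (id_chart (N i))} \<times> UNIV"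
  unfolding semidirect_def pi_chart_def by simp
 show "inj_on (coord G) (fst (id_chart G))"
 proof (rule inj_onI)
  fix p q assume p: "p : fst (id_chart G)" and q: "q : fst (id_chart G)" and eq: "coord G p = coord G q"
  have "fst p i = fst q i" for i
  proof -
   have "coord (N i) (fst p i) = coord (N i) (fst q i)" using eq unfolding G_sel by (simp add: vec_eq_iff)
   moreover have "fst p i : fst (id_chart (N i))" "fst q i : fst (id_chart (N i))" using p q unfolding ch by auto
   ultimately show ?thesis using lie_grp.uncoord_coord[OF lie_grp_N] by metis
  qed
  moreover have "snd p = snd q" using eq unfolding G_sel by simp
  ultimately show "p = q" by (simp add: prod_eq_iff fun_eq_iff)
 qed
 show "(%j. uncoord (N j) (y $ j), v) : fst (id_chart G)"
  unfolding ch using lie_grp.uncoord_in_U[OF lie_grp_N assms] by simp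
 show "coord G (%j. uncoord (N j) (y $ j), v) = (y, v)"
  unfolding G_sel using lie_grp.coord_uncoord[OF lie_grp_N assms] by (simp add: vec_eq_iff)
qed

lemma Ad_s:
 assumes X: "X : model (N i)"
 shows "Ad G (s v) (axis i X, 0) = (axis i (d\<psi> i v X), 0)"
proof -
 interpret Ni: lie_grp "N i" ..
 obtain J where J: "open J" "(0::real) : J" "!!r. r : J ==> r *\<^sub>R X : Ni.cdom" "velocity_at (N i) (%r. uncoord (N i) (r *\<^sub>R X)) 0 J X"
  using Ni.velocity_at_uncoord[OF X] by metis
 have "((%r. coord (N i) (\<psi> i v (uncoord (N i) (r *\<^sub>R X)))) has_vector_derivative d\<psi> i v X) (at 0)"
  using \<psi>_velocity[OF J(4)] unfolding velocity_at_def at_within_open[OF J(2,1)] by blast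
 from has_vector_derivative_Pair[OF bounded_linear.has_vector_derivative[OF bounded_linear_axis this] has_vector_derivative_const]
 have 1: "((%r. (axis i (coord (N i) (\<psi> i v (uncoord (N i) (r *\<^sub>R X)))), 0 :: real ^ 'k)) has_vector_derivative (axis i (d\<psi> i v X), 0)) (at 0)" .
 have "((%r. coord G (s v \<cdot> uncoord G (r *\<^sub>R (axis i X, 0)) \<cdot> inv\<^bsub>G\<^esub> (s v))) has_vector_derivative (axis i (d\<psi> i v X), 0)) (at 0)"
 proof (rule has_vector_derivative_transform_within_open[OF 1 J(1,2)])
  fix r assume r: "r : J"
  have ax: "r *\<^sub>R (axis i X, 0 :: real ^ 'k) = (axis i (r *\<^sub>R X), 0)" by (simp add: vec_eq_iff axis_def)
  have dom: "axis i (r *\<^sub>R X) $ j : lie_grp.cdom (N j)" for j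
   using J(3)[OF r] lie_grp.zero_in_dom[OF lie_grp_N, of j] by (simp add: axis_def)
  have car: "uncoord (N j) (axis i (r *\<^sub>R X) $ j) : carrier (N j)" for j
   using lie_grp.U_carrier[OF lie_grp_N] lie_grp.uncoord_in_U[OF lie_grp_N dom] by blast
  show "(axis i (coord (N i) (\<psi> i v (uncoord (N i) (r *\<^sub>R X)))), 0) = coord G (s v \<cdot> uncoord G (r *\<^sub>R (axis i X, 0)) \<cdot> inv\<^bsub>G\<^esub> (s v))"
   unfolding ax uncoord_G[OF dom] conj_G[OF car] G_sel(5)
   by (simp add: vec_eq_iff axis_def lie_grp.uncoord_zero[OF lie_grp_N] lie_grp.coord_one[OF lie_grp_N])
 qed
 from vector_derivative_at[OF this] show ?thesis unfolding Ad_def differential_def .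
qed

text \<open>\<open>splitting_derivation\<close> is chosen by \<open>SOME\<close>;
  \<open>conj_derivation\<close> and \<open>Ad_s\<close> provide a candidate, so the choice has its
  defining property.\<close>

lemma splitting_derivation_exp:
 assumes X: "X : model (N i)"
 shows "lin_exp (%Y. \<alpha> i v *\<^sub>R splitting_derivation N \<alpha> act s i Y) X = d\<psi> i v X"
proof -
 let ?P = "%D'. lie_derivation (N i) D' & (\<forall>v. \<forall>X\<in>model (N i). Ad G (s v) (axis i X, 0) = (axis i (lin_exp (%Y. \<alpha> i v *\<^sub>R D' Y) X), 0))"
 obtain D' where D': "lie_derivation (N i) D'" "\<forall>v. \<forall>X\<in>model (N i). lin_exp (%Y. \<alpha> i v *\<^sub>R D' Y) X = d\<psi> i v X"
  using conj_derivation[of i] by (elim exE conjE)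
 then have "?P D'" using Ad_s by simp
 then have "?P (splitting_derivation N \<alpha> act s i)" unfolding splitting_derivation_def by (rule someI[of ?P])
 then have "Ad G (s v) (axis i X, 0) = (axis i (lin_exp (%Y. \<alpha> i v *\<^sub>R splitting_derivation N \<alpha> act s i Y) X), 0)" using X by simp
 then show ?thesis unfolding Ad_s[OF X] by (simp add: vec_eq_iff axis_def split: if_splits)
qed

text \<open>\<open>\<psi> i v\<close> has the differential that \<open>automorphism_of\<close> asks
  for, and on a connected group this determines the automorphism. So half-space levels can be
  computed with \<open>\<psi>\<close>.\<close>

lemma automorphism_of_splitting:
 assumes v: "\<alpha> i v = - H" and x: "x : carrier (N i)"
 shows "automorphism_of (N i) (lin_exp (%Y. - H *\<^sub>R splitting_derivation N \<alpha> act s i Y)) x = \<psi> i v x"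
proof -
 let ?A = "lin_exp (%Y. - H *\<^sub>R splitting_derivation N \<alpha> act s i Y)"
 have A: "?A X = d\<psi> i v X" if "X : model (N i)" for X using splitting_derivation_exp[OF that, of v] unfolding v .
 let ?P = "%f. lie_automorphism (N i) f & (\<forall>X\<in>model (N i). differential (N i) (N i) f X = ?A X)"
 have "?P (\<psi> i v)" using \<psi>_automorphism \<psi>_differential A by simp
 then have P: "?P (automorphism_of (N i) ?A)" unfolding automorphism_of_def by (rule someI[of ?P])
 show ?thesis
 proof (rule lie_hom_unique[OF lie_N lie_N connected_N _ \<psi>_lie_hom _ x])
  show "lie_hom (N i) (N i) (automorphism_of (N i) ?A)" using P unfolding lie_automorphism_def by blast
  show "differential (N i) (N i) (automorphism_of (N i) ?A) X = differential (N i) (N i) (\<psi> i v) X" if "X : model (N i)" for X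
   using P A[OF that] \<psi>_differential[OF that] that by simp
 qed
qed

end

section \<open>Linear algebra of the metric\<close>

text \<open>\<open>g\<close> is constrained on \<open>V\<close> only. Composing it with the
  orthogonal projection onto \<open>V\<close> gives a form \<open>ge\<close> on the whole space,
  whose norm is continuous in arbitrary vectors; the lower bound \<open>m\<close> comes from
  compactness of the unit sphere of \<open>V\<close>.\<close>

lemma inner_product_extension:
 fixes V :: "'e::euclidean_space set"
 assumes V: "subspace V" and g: "inner_product_on V g"
 obtains ge m where "!!X Y. X : V ==> Y : V ==> ge X Y = g X Y" "!!X Y. ge X Y = ge Y X"
  "!!X Y Z. ge (X + Y) Z = ge X Z + ge Y Z" "!!r X Z. ge (r *\<^sub>R X) Z = r * ge X Z" "!!X. ge X X >= 0"
  "continuous_on UNIV (%X. ge X X)" "m > 0" "!!X. X : V ==> m * (norm X)\<^sup>2 <= ge X X"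
proof -
 obtain B where B: "finite B" "B <= V" "!!x. x : V ==> (\<Sum>b\<in>B. (x \<bullet> b) *\<^sub>R b) = x"
  using orthonormal_expansion[OF V] by metis
 note gs = g[unfolded inner_product_on_def, THEN conjunct1, rule_format]
  and gl = g[unfolded inner_product_on_def, THEN conjunct2, THEN conjunct1, rule_format]
  and gp = g[unfolded inner_product_on_def, THEN conjunct2, THEN conjunct2, rule_format]
 have V0: "0 : V" using subspace_0[OF V] .
 have g0: "g 0 Z = 0" if "Z : V" for Z using gl[OF V0 V0 that, of 1] by simp
 have gsc: "g (r *\<^sub>R X) Z = r * g X Z" if "X : V" "Z : V" for r X Z using gl[OF that(1) V0 that(2), of r] g0[OF that(2)] by simp
 have gsum: "g (\<Sum>b\<in>A. c b *\<^sub>R b) Z = (\<Sum>b\<in>A. c b * g b Z)" if "A <= B" "Z : V" for A c Z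
  using finite_subset[OF that(1) B(1)] that
 proof (induction A rule: finite_induct)
  case empty then show ?case using g0 by simp
 next
  case (insert b A)
  then have "b : V" "(\<Sum>b\<in>A. c b *\<^sub>R b) : V" using B(2) by (auto intro!: subspace_sum[OF V] subspace_scale[OF V])
  then show ?case using insert gl[of b "\<Sum>b\<in>A. c b *\<^sub>R b" Z "c b"] by simp
 qed
 define p where "p X = (\<Sum>b\<in>B. (X \<bullet> b) *\<^sub>R b)" for X :: 'e
 have pV: "p X : V" for X unfolding p_def using B(2) by (intro subspace_sum[OF V] subspace_scale[OF V]) auto
 have pid: "X : V ==> p X = X" for X unfolding p_def by (rule B(3))
 have padd: "p (X + Y) = p X + p Y" and psc: "p (r *\<^sub>R X) = r *\<^sub>R p X" for X Y r
  unfolding p_def by (simp_all add: inner_add_left scaleR_add_left sum.distrib scaleR_sum_right)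
 define ge where "ge X Y = g (p X) (p Y)" for X Y
 have nn: "ge X X >= 0" for X
  unfolding ge_def using gp[OF pV, of X] g0[OF V0] by (cases "p X = 0") auto
 have expand: "ge X X = (\<Sum>b\<in>B. \<Sum>b'\<in>B. (X \<bullet> b) * ((X \<bullet> b') * g b' b))" for X
 proof -
  have "g (p X) (p X) = (\<Sum>b\<in>B. (X \<bullet> b) * g b (p X))" using gsum[of B "p X" "%b. X \<bullet> b"] pV unfolding p_def by simp
  also have "\<dots> = (\<Sum>b\<in>B. (X \<bullet> b) * (\<Sum>b'\<in>B. (X \<bullet> b') * g b' b))"
  proof (rule sum.cong[OF refl])
   fix b assume "b : B"
   then have b: "b : V" using B(2) by blast
   show "(X \<bullet> b) * g b (p X) = (X \<bullet> b) * (\<Sum>b'\<in>B. (X \<bullet> b') * g b' b)"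
    using gsum[of B b "%b. X \<bullet> b"] gs[OF b pV] b unfolding p_def by simp
  qed
  finally show ?thesis unfolding ge_def by (simp add: sum_distrib_left)
 qed
 have cont: "continuous_on UNIV (%X. ge X X)" unfolding expand by (intro continuous_intros)
 have "\<exists>m>0. \<forall>X\<in>V Int sphere 0 1. m <= ge X X"
 proof (cases "V Int sphere 0 1 = {}")
  case True then show ?thesis by (intro exI[of _ 1]) auto
 next
  case False
  have "compact (V Int sphere 0 1)" by (rule closed_Int_compact[OF closed_subspace[OF V] compact_sphere])
  from continuous_attains_inf[OF this False continuous_on_subset[OF cont subset_UNIV]]
  obtain X where X: "X : V Int sphere 0 1" "\<forall>Y\<in>V Int sphere 0 1. ge X X <= ge Y Y" by blast
  have "X : V" "X ~= 0" using X(1) by auto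
  then have "ge X X > 0" unfolding ge_def using gp[of X] pid[of X] by auto
  then show ?thesis using X(2) by blast
 qed
 then obtain m where m: "m > 0" "!!X. X : V ==> norm X = 1 ==> m <= ge X X" by auto
 have sc: "ge (r *\<^sub>R X) Z = r * ge X Z" for r X Z unfolding ge_def psc using gsc pV by simp
 have sym: "ge X Y = ge Y X" for X Y unfolding ge_def using gs pV by simp
 have low: "m * (norm X)\<^sup>2 <= ge X X" if X: "X : V" for X
 proof (cases "X = 0")
  case True then show ?thesis using nn[of 0] by simp
 next
  case False
  have "m <= ge (X /\<^sub>R norm X) (X /\<^sub>R norm X)" by (rule m(2)) (use False X subspace_scale[OF V] in auto)
  also have "\<dots> = ge X X / (norm X)\<^sup>2"
   using sc[of "inverse (norm X)" X] sc[of "inverse (norm X)" X X] sym[of X "X /\<^sub>R norm X"] by (simp add: power2_eq_square divide_inverse)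
  finally show ?thesis using False by (simp add: field_simps)
 qed
 show ?thesis
 proof (rule that[of ge m])
  show "ge X Y = g X Y" if "X : V" "Y : V" for X Y unfolding ge_def using pid that by simp
  show "ge (X + Y) Z = ge X Z + ge Y Z" for X Y Z unfolding ge_def padd using gl[OF pV pV pV, of 1 X Y Z] by simp
 qed (use sym sc nn cont m low in auto)
qed

lemma cauchy_schwarz_form:
 fixes Q :: "'v::real_vector => 'v => real"
 assumes sym: "!!u v. Q u v = Q v u" and add: "!!u v w. Q (u + v) w = Q u w + Q v w" and sc: "!!r u w. Q (r *\<^sub>R u) w = r * Q u w"
  and nn: "!!u. Q u u >= 0"
 shows "\<bar>Q u v\<bar> <= sqrt (Q u u) * sqrt (Q v v)"
proof -
 have "0 <= Q (u + r *\<^sub>R v) (u + r *\<^sub>R v)" for r by (rule nn)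
 also have "Q (u + r *\<^sub>R v) (u + r *\<^sub>R v) = Q v v * r\<^sup>2 + (2 * Q u v) * r + Q u u" for r
  using sym[of u "u + r *\<^sub>R v"] sym[of v "u + r *\<^sub>R v"] sym[of v u] by (simp add: add sc power2_eq_square algebra_simps)
 finally have 1: "0 <= Q v v * r\<^sup>2 + (2 * Q u v) * r + Q u u" for r .
 have "(Q u v)\<^sup>2 <= Q u u * Q v v"
 proof (cases "Q v v = 0")
  case True
  have "Q u v = 0"
  proof (rule ccontr)
   assume "Q u v ~= 0"
   then show False using 1[of "- (Q u u + 1) / (2 * Q u v)"] True by simp
  qed
  then show ?thesis using True by simp
 next
  case False
  then have "Q v v > 0" using nn[of v] by simp
  then show ?thesis using 1[of "- Q u v / Q v v"] by (simp add: power2_eq_square field_simps)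
 qed
 then have "sqrt ((Q u v)\<^sup>2) <= sqrt (Q u u * Q v v)" by (rule real_sqrt_le_mono)
 then show ?thesis by (simp add: real_sqrt_mult)
qed

text \<open>The Riesz representation of \<open>\<alpha>\<close> for the inner product
  \<open>Q\<close>.\<close>

lemma gradient_exists:
 fixes Q :: "'v::euclidean_space => 'v => real" and \<alpha> :: "'v => real"
 assumes sym: "!!u v. Q u v = Q v u" and add: "!!u v w. Q (u + v) w = Q u w + Q v w" and sc: "!!r u w. Q (r *\<^sub>R u) w = r * Q u w"
  and pos: "!!u. u ~= 0 ==> Q u u > 0" and \<alpha>: "linear \<alpha>" "\<exists>v. \<alpha> v ~= 0"
 obtains e where "!!u. Q u e = \<alpha> u" "\<alpha> e > 0"
proof -
 have linQ: "linear (%u. Q u w)" for w by (rule linearI) (simp_all add: add sc)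
 define T where "T v = (\<Sum>b\<in>Basis. Q v b *\<^sub>R b)" for v :: 'v
 have T: "linear T" by (rule linearI) (simp_all add: T_def add sc scaleR_add_left sum.distrib scaleR_sum_right)
 have Tb: "T v \<bullet> b = Q v b" if "b : Basis" for v b
  unfolding T_def using that by (simp add: inner_sum_left inner_Basis if_distrib cong: if_cong)
 have expand: "f u = (\<Sum>b\<in>Basis. (u \<bullet> b) * f b)" if "linear f" for f :: "'v => real" and u
 proof -
  have "f u = f (\<Sum>b\<in>Basis. (u \<bullet> b) *\<^sub>R b)" by (simp only: euclidean_representation)
  then show ?thesis by (simp only: linear_sum[OF that] linear_scale[OF that] real_scaleR_def)
 qed
 have "inj T" unfolding linear_injective_0[OF T]
 proof (intro allI impI)
  fix v assume "T v = 0"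
  then have "Q b v = 0" if "b : Basis" for b using Tb[OF that, of v] sym by simp
  then have "Q v v = 0" using expand[OF linQ, of v v] by simp
  then show "v = 0" using pos[of v] by fastforce
 qed
 then have "surj T" using linear_injective_imp_surjective[OF T] by blast
 then obtain e where e: "T e = (\<Sum>b\<in>Basis. \<alpha> b *\<^sub>R b)" by (metis surjD)
 have Qe: "Q b e = \<alpha> b" if "b : Basis" for b
  using Tb[OF that, of e] sym[of b e] that unfolding e by (simp add: inner_sum_left inner_Basis if_distrib cong: if_cong)
 have grad: "Q u e = \<alpha> u" for u using expand[OF linQ, of u e] expand[OF \<alpha>(1), of u] Qe by simp
 have "e ~= 0" using \<alpha>(2) grad linear_0[OF linQ, of 0] sc[of 0 0] sym by (metis mult_zero_left scale_zero_left)
 then show ?thesis using that grad pos[of e] by metis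
qed

lemma (in group) inv_translate_mult:
 assumes "z : carrier G" "x : carrier G" "y : carrier G"
 shows "inv (z \<otimes> x) \<otimes> (z \<otimes> y) = inv x \<otimes> y"
 using assms by (simp add: inv_mult_group m_assoc mult_inv_cancel)

section \<open>Uniqueness of splittings, and paths in components\<close>

context sol_group begin

text \<open>Along the line \<open>t v\<close> the velocity of \<open>\<sigma> i\<close> is
  \<open>E i (t * \<alpha> i v) (d\<sigma> i v)\<close>, so two splittings with the same
  \<open>d\<sigma>\<close> agree by \<open>path_unique\<close>.\<close>

lemma splitting_unique:
 assumes s: "sol_splitting N \<alpha> D act s" and s': "sol_splitting N \<alpha> D act s'"
  and eq: "!!i v. sol_splitting.d\<sigma> N s i v = sol_splitting.d\<sigma> N s' i v"
 shows "s = s'"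
proof
 fix v
 interpret s: sol_splitting N \<alpha> D act s by (rule s)
 interpret s': sol_splitting N \<alpha> D act s' by (rule s')
 have "s.\<sigma> i v = s'.\<sigma> i v" for i
 proof -
  interpret Ni: lie_grp "N i" ..
  note p = piecewise_smooth_pathD[OF s.\<sigma>_line_path(1)[of i v]] and p' = piecewise_smooth_pathD[OF s'.\<sigma>_line_path(1)[of i v]]
  obtain F where F: "finite F" "!!t. t : {0<..<1} - F ==> velocity_at (N i) (%r. inv\<^bsub>N i\<^esub> (s.\<sigma> i (t *\<^sub>R v)) \<otimes>\<^bsub>N i\<^esub> s.\<sigma> i (r *\<^sub>R v)) t {0..1} (left_velocity (N i) (%r. s.\<sigma> i (r *\<^sub>R v)) t)"
   using Ni.piecewise_smooth_path_velocity[OF s.\<sigma>_line_path(1)] by metis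
  obtain F' where F': "finite F'" "!!t. t : {0<..<1} - F' ==> velocity_at (N i) (%r. inv\<^bsub>N i\<^esub> (s'.\<sigma> i (t *\<^sub>R v)) \<otimes>\<^bsub>N i\<^esub> s'.\<sigma> i (r *\<^sub>R v)) t {0..1} (left_velocity (N i) (%r. s'.\<sigma> i (r *\<^sub>R v)) t)"
   using Ni.piecewise_smooth_path_velocity[OF s'.\<sigma>_line_path(1)] by metis
  have "s.\<sigma> i (1 *\<^sub>R v) = s'.\<sigma> i (1 *\<^sub>R v)"
  proof (rule Ni.path_unique[where F = "F Un F'" and X = "%t. E i (t * \<alpha> i v) (s.d\<sigma> i v)"])
   show "continuous_on {0..1} (%t. s.\<sigma> i (t *\<^sub>R v))" "continuous_on {0..1} (%t. s'.\<sigma> i (t *\<^sub>R v))" using p p' by metis+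
   fix t assume t: "t : {0<..<1} - (F Un F')"
   then have t1: "t : {0..1}" by simp
   show "velocity_at (N i) (%r. inv\<^bsub>N i\<^esub> (s.\<sigma> i (t *\<^sub>R v)) \<otimes>\<^bsub>N i\<^esub> s.\<sigma> i (r *\<^sub>R v)) t {0..1} (E i (t * \<alpha> i v) (s.d\<sigma> i v))"
    using F(2)[of t] t unfolding s.\<sigma>_line_path(2)[OF t1] by blast
   show "velocity_at (N i) (%r. inv\<^bsub>N i\<^esub> (s'.\<sigma> i (t *\<^sub>R v)) \<otimes>\<^bsub>N i\<^esub> s'.\<sigma> i (r *\<^sub>R v)) t {0..1} (E i (t * \<alpha> i v) (s.d\<sigma> i v))"
    using F'(2)[of t] t unfolding s'.\<sigma>_line_path(2)[OF t1] eq by blast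
  qed (use F F' in auto)
  then show ?thesis by simp
 qed
 then show "s v = s' v" by (simp add: prod_eq_iff fun_eq_iff s.\<sigma>_def s'.\<sigma>_def)
qed

end

lemma pw_continuous_sum:
 fixes f :: "'i => real => 'b::real_normed_vector"
 assumes "finite S" "!!i. i : S ==> pw_continuous (f i)"
 shows "pw_continuous (%t. \<Sum>i\<in>S. f i t)"
 using assms
proof (induction S rule: finite_induct)
 case empty
 have "continuous_on {0..1::real} (%t. 0 :: 'b)" by (rule continuous_on_const)
 from continuous_imp_pw_continuous[OF this] show ?case by simp
next
 case (insert i S)
 have "continuous_on UNIV (%p :: 'b \<times> 'b. fst p + snd p)" by (intro continuous_intros)
 from pw_continuous_compose[OF pw_continuous_Pair[OF insert(4)[of i] insert(3)] this] insert show ?case by simp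
qed

lemma pw_continuous_cong:
 assumes f: "pw_continuous f" and F0: "finite F0" and eq: "!!t. t : {0<..<1} - F0 ==> g t = f t"
 shows "pw_continuous g"
proof -
 obtain F k where F: "finite F"
  "!!a b. 0 <= a ==> a < b ==> b <= 1 ==> {a<..<b} Int F = {} ==> continuous_on {a..b} (k a b)"
  "!!a b t. 0 <= a ==> a < b ==> b <= 1 ==> {a<..<b} Int F = {} ==> t : {a<..<b} ==> f t = k a b t"
  using pw_continuousE[OF f] by metis
 show ?thesis unfolding pw_continuous_def
 proof (intro exI[of _ "F Un F0"] conjI allI impI)
  fix a b :: real assume "0 <= a & a < b & b <= 1 & {a<..<b} Int (F Un F0) = {}"
  then have e: "0 <= a" "a < b" "b <= 1" "{a<..<b} Int F = {}" "{a<..<b} Int F0 = {}" by blast+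
  have "g t = k a b t" if "t : {a<..<b}" for t
   using eq[of t] F(3)[OF e(1-4) that] e that by fastforce
  then show "\<exists>l. continuous_on {a..b} l & (\<forall>t\<in>{a<..<b}. g t = l t)" using F(2)[OF e(1-4)] by blast
 qed (use F(1) F0 in simp)
qed

lemma piecewise_interval:
 assumes "finite F" "t : {0<..<1::real} - F"
 obtains a b where "0 <= a" "a < t" "t < b" "b <= 1" "{a<..<b} Int F = {}"
proof -
 have "open ({0<..<1} - F)" using assms(1) by (intro open_Diff finite_imp_closed) auto
 then obtain r where r: "r > 0" "!!x. dist x t < r ==> x : {0<..<1} - F" using assms(2) unfolding open_dist by blast
 have *: "x : {0<..<1} - F" if "x : {t - r<..<t + r}" for x using r(2)[of x] that by (simp add: dist_real_def abs_diff_less_iff)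
 show ?thesis
 proof (rule that[of "t - r / 2" "t + r / 2"])
  show "0 <= t - r / 2" "t + r / 2 <= 1" using *[of "t - r / 2"] *[of "t + r / 2"] r(1) by auto
  have "x ~: F" if "x : {t - r / 2<..<t + r / 2}" for x using *[of x] that r(1) by simp
  then show "{t - r / 2<..<t + r / 2} Int F = {}" by blast
 qed (use r in auto)
qed

context sol_group begin

text \<open>One common set of break points serves all components, and their velocities are expressed
  through the left velocity in the whole group.\<close>

lemma piecewise_smooth_path_G:
 assumes \<gamma>: "piecewise_smooth_path G x y \<gamma>"
 obtains F where "finite F"
  "!!a b i. 0 <= a ==> a < b ==> b <= 1 ==> {a<..<b} Int F = {} ==> smooth_path_on (N i) {a..b} (%t. fst (\<gamma> t) i)"
  "!!a b. 0 <= a ==> a < b ==> b <= 1 ==> {a<..<b} Int F = {} ==> smooth_on UNIV {a..b} (%t. snd (\<gamma> t))"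
  "continuous_on {0..1} (%t. snd (\<gamma> t))" "!!i. continuous_on {0..1} (%t. fst (\<gamma> t) i)"
  "!!t. t : {0<..<1} - F ==> ((%r. snd (\<gamma> r)) has_vector_derivative snd (left_velocity G \<gamma> t)) (at t)"
  "!!t i. t : {0<..<1} - F ==> velocity_at (N i) (%r. act i (- snd (\<gamma> t)) (inv\<^bsub>N i\<^esub> (fst (\<gamma> t) i) \<otimes>\<^bsub>N i\<^esub> fst (\<gamma> r) i)) t {0..1} (fst (left_velocity G \<gamma> t) $ i)"
  "!!t. t : {0<..<1} - F ==> left_velocity G \<gamma> t : model G" "pw_continuous (left_velocity G \<gamma>)"
proof -
 obtain F where c: "\<gamma> 0 = x" "\<gamma> 1 = y" "\<gamma> ` {0..1} <= carrier G" "continuous_on {0..1} \<gamma>" "finite F"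
  "!!a b. 0 <= a ==> a < b ==> b <= 1 ==> {a<..<b} Int F = {} ==> smooth_path_on G {a..b} \<gamma>"
  using piecewise_smooth_pathD[OF \<gamma>] by metis
 have sN: "smooth_path_on (N i) {a..b} (%t. fst (\<gamma> t) i)" and sV: "smooth_on UNIV {a..b} (%t. snd (\<gamma> t))"
  if "0 <= a" "a < b" "b <= 1" "{a<..<b} Int F = {}" for a b i
  using c(6)[OF that] unfolding smooth_path_G_iff[OF that(2)] by blast+
 have cs: "continuous_on {0..1} (%t. snd (\<gamma> t))" using c(4) by (rule continuous_on_snd)
 have cN: "continuous_on {0..1} (%t. fst (\<gamma> t) i)" for i
  by (rule continuous_on_product_then_coordinatewise[OF continuous_on_fst[OF c(4)]])
 have im: "fst (\<gamma> t) i : carrier (N i)" if "t : {0..1}" for t i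
 proof -
  have "\<gamma> t : carrier G" using c(3) that by blast
  then show ?thesis unfolding G_sel by auto
 qed
 have pN: "piecewise_smooth_path (N i) (fst x i) (fst y i) (%t. fst (\<gamma> t) i)" for i
  unfolding piecewise_smooth_path_def
  by (intro conjI exI[of _ F]) (use c sN cN im in auto)
 have vN: "velocity_at (N i) (%r. inv\<^bsub>N i\<^esub> (fst (\<gamma> t) i) \<otimes>\<^bsub>N i\<^esub> fst (\<gamma> r) i) t {0..1} (left_velocity (N i) (%t. fst (\<gamma> t) i) t)"
  if t: "t : {0<..<1} - F" for t i
 proof -
  interpret Ni: lie_grp "N i" ..
  obtain a b where ab: "0 <= a" "a < t" "t < b" "b <= 1" "{a<..<b} Int F = {}" using piecewise_interval[OF c(5) t] by metis
  have ab': "a < b" using ab by simp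
  have tt: "t : {a..b}" using ab by simp
  note v = Ni.smooth_path_velocity[OF ab' sN[OF ab(1) ab' ab(4,5)] tt]
  have "at t within {0..1} = at t within {a..b}" using ab t by (simp add: at_within_Icc_at)
  then show ?thesis unfolding lv_interior[OF ab(1,4,2,3), symmetric]
   by (rule velocity_at_nhd[OF v]) (use t im in auto)
 qed
 define V where "V t = vector_derivative (%r. snd (\<gamma> r)) (at t)" for t
 have dV: "((%r. snd (\<gamma> r)) has_vector_derivative V t) (at t)" if t: "t : {0<..<1} - F" for t
 proof -
  obtain a b where ab: "0 <= a" "a < t" "t < b" "b <= 1" "{a<..<b} Int F = {}" using piecewise_interval[OF c(5) t] by metis
  have ab': "a < b" using ab by simp
  obtain W where "((%r. snd (\<gamma> r)) has_vector_derivative W t) (at t within {a..b})"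
   using smooth_on_real_derivative[OF sV[OF ab(1) ab' ab(4,5)]] ab(2,3) by (metis atLeastAtMost_iff less_imp_le)
  then have "((%r. snd (\<gamma> r)) has_vector_derivative W t) (at t)" using ab by (simp add: at_within_Icc_at)
  then show ?thesis unfolding V_def using vector_derivative_at by force
 qed
 have pcV: "pw_continuous V" unfolding pw_continuous_def
 proof (intro exI[of _ F] conjI allI impI c(5))
  fix a b :: real assume "0 <= a & a < b & b <= 1 & {a<..<b} Int F = {}"
  then have ab: "0 <= a" "a < b" "b <= 1" "{a<..<b} Int F = {}" by blast+
  obtain W where W: "continuous_on {a..b} W" "!!t. t : {a..b} ==> ((%r. snd (\<gamma> r)) has_vector_derivative W t) (at t within {a..b})"
   using smooth_on_real_derivative[OF sV[OF ab]] by metis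
  have "V t = W t" if "t : {a<..<b}" for t
   using W(2)[of t] that vector_derivative_at unfolding V_def by (force simp: at_within_Icc_at)
  then show "\<exists>k. continuous_on {a..b} k & (\<forall>t\<in>{a<..<b}. V t = k t)" using W(1) by blast
 qed
 define X where "X t = (\<chi> i. E i (- \<alpha> i (snd (\<gamma> t))) (left_velocity (N i) (%t. fst (\<gamma> t) i) t))" for t
 have lv: "left_velocity G \<gamma> t = (X t, V t)" if t: "t : {0<..<1} - F" for t
 proof -
  have at: "at t within {0..1} = at t" using t by (simp add: at_within_Icc_at)
  have "(left_curve G \<gamma> t has_vector_derivative (X t, V t)) (at t within {0..1})"
   unfolding X_def by (rule left_curve_G_derivative[OF _ c(3) vN[OF t]]) (use t dV[OF t] at in auto)
  then show ?thesis unfolding left_velocity_def at by (rule vector_derivative_at)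
 qed
 have Xc: "pw_continuous X"
 proof -
  have 1: "pw_continuous (%t. axis i (E i (- \<alpha> i (snd (\<gamma> t))) (left_velocity (N i) (%t. fst (\<gamma> t) i) t)))" for i
  proof -
   have "continuous_on UNIV (%p. axis i (E i (- \<alpha> i (fst p)) (snd p)) :: 'e ^ 'i)"
    by (rule continuous_on_compose2[OF linear_continuous_on[OF bounded_linear_axis] lin_exp_continuous_on[OF linear_D], of UNIV])
     (auto intro!: continuous_intros continuous_on_compose2[OF linear_continuous_on[OF linear_conv_bounded_linear[THEN iffD1, OF linear_\<alpha>]], of UNIV])
   from pw_continuous_compose[OF pw_continuous_Pair[OF continuous_imp_pw_continuous[OF cs]
     lie_grp.pw_continuous_left_velocity[OF lie_grp_N pN[of i]]] this]
   show ?thesis by simp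
  qed
   have "pw_continuous (%t. \<Sum>i\<in>UNIV. axis i (E i (- \<alpha> i (snd (\<gamma> t))) (left_velocity (N i) (%t. fst (\<gamma> t) i) t)))"
   by (rule pw_continuous_sum[OF _ 1]) simp
  then show ?thesis unfolding sum_axis X_def[abs_def] .
 qed
 show ?thesis
 proof (rule that[of F])
  fix t i assume t: "t : {0<..<1} - F"
  show "((%r. snd (\<gamma> r)) has_vector_derivative snd (left_velocity G \<gamma> t)) (at t)" using dV[OF t] lv[OF t] by simp
  show v: "velocity_at (N i) (%r. act i (- snd (\<gamma> t)) (inv\<^bsub>N i\<^esub> (fst (\<gamma> t) i) \<otimes>\<^bsub>N i\<^esub> fst (\<gamma> r) i)) t {0..1} (fst (left_velocity G \<gamma> t) $ i)" for i
   using act_velocity[OF vN[OF t], of i "- snd (\<gamma> t)"] unfolding lv[OF t] X_def \<alpha>_neg by simp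
  show "left_velocity G \<gamma> t : model G" unfolding G_sel(4) using v unfolding velocity_at_def by (auto simp: mem_Times_iff)
 qed (use c(5) sN sV cs cN pw_continuous_cong[OF pw_continuous_Pair[OF Xc pcV] c(5) lv] in auto)
qed

end

context sol_splitting begin

text \<open>The curve is the \<open>N i\<close>-component of the path in the decomposition given by
  the splitting, conjugated by \<open>s u\<close>. Its velocity is the vertical part of the velocity
  of the path, transformed by \<open>d\<psi>\<close> at \<open>u + snd (\<gamma> t)\<close>; this is
  where depth becomes an exponential weight.\<close>

lemma \<psi>_path:
 assumes \<gamma>: "piecewise_smooth_path G \<one>\<^bsub>G\<^esub> z \<gamma>"
 obtains F where "finite F"
  "piecewise_smooth_path (N i) \<one>\<^bsub>N i\<^esub> (\<psi> i u (fst z i \<otimes>\<^bsub>N i\<^esub> inv\<^bsub>N i\<^esub> (\<sigma> i (snd z))))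
   (%t. \<psi> i u (fst (\<gamma> t) i \<otimes>\<^bsub>N i\<^esub> inv\<^bsub>N i\<^esub> (\<sigma> i (snd (\<gamma> t)))))"
  "!!t. t : {0<..<1} - F ==> left_velocity (N i) (%t. \<psi> i u (fst (\<gamma> t) i \<otimes>\<^bsub>N i\<^esub> inv\<^bsub>N i\<^esub> (\<sigma> i (snd (\<gamma> t))))) t =
   d\<psi> i (u + snd (\<gamma> t)) (fst (left_velocity G \<gamma> t) $ i - d\<sigma> i (snd (left_velocity G \<gamma> t)))"
proof -
 interpret Ni: lie_grp "N i" ..
 obtain F where F: "finite F"
  "!!a b i. 0 <= a ==> a < b ==> b <= 1 ==> {a<..<b} Int F = {} ==> smooth_path_on (N i) {a..b} (%t. fst (\<gamma> t) i)"
  "!!a b. 0 <= a ==> a < b ==> b <= 1 ==> {a<..<b} Int F = {} ==> smooth_on UNIV {a..b} (%t. snd (\<gamma> t))"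
  "continuous_on {0..1} (%t. snd (\<gamma> t))" "!!i. continuous_on {0..1} (%t. fst (\<gamma> t) i)"
  "!!t. t : {0<..<1} - F ==> ((%r. snd (\<gamma> r)) has_vector_derivative snd (left_velocity G \<gamma> t)) (at t)"
  "!!t i. t : {0<..<1} - F ==> velocity_at (N i) (%r. act i (- snd (\<gamma> t)) (inv\<^bsub>N i\<^esub> (fst (\<gamma> t) i) \<otimes>\<^bsub>N i\<^esub> fst (\<gamma> r) i)) t {0..1} (fst (left_velocity G \<gamma> t) $ i)"
  by (rule piecewise_smooth_path_G[OF \<gamma>], rule that, assumption+)
 have c: "\<gamma> 0 = \<one>\<^bsub>G\<^esub>" "\<gamma> 1 = z" "\<gamma> ` {0..1} <= carrier G"
  using piecewise_smooth_pathD[OF \<gamma>] by metis+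
 have im: "fst (\<gamma> t) i : carrier (N i)" if "t : {0..1}" for t
 proof -
  have "\<gamma> t : carrier G" using c(3) that by blast
  then show ?thesis unfolding G_sel by auto
 qed
 define p where "p t = snd (\<gamma> t)" for t
 define n where "n t = fst (\<gamma> t) i" for t
 have c\<sigma>: "continuous_on UNIV (\<sigma> i)" using smooth_mapD(3)[OF \<sigma>_smooth[of i]] by (simp add: vector_group_sel)
 have nc: "n t : carrier (N i)" if "t : {0..1}" for t unfolding n_def by (rule im[OF that])
 define \<mu> where "\<mu> t = \<psi> i u (n t \<otimes>\<^bsub>N i\<^esub> inv\<^bsub>N i\<^esub> (\<sigma> i (p t)))" for t
 have smooth: "smooth_path_on (N i) {a..b} \<mu>"
  if "0 <= a" "a < b" "b <= 1" "{a<..<b} Int F = {}" for a b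
 proof -
  have "smooth_path_on (N i) {a..b} (%t. n t \<otimes>\<^bsub>N i\<^esub> inv\<^bsub>N i\<^esub> (\<sigma> i (p t)))"
   unfolding n_def p_def
   by (rule Ni.smooth_path_mult[OF that(2) F(2)[OF that] Ni.smooth_path_inv[OF that(2) \<sigma>_smooth_path[OF that(2) F(3)[OF that]]]])
  then show ?thesis unfolding smooth_path_on_iff \<mu>_def
   using smooth_map_compose[OF source_atlas_interval[OF that(2)] Ni.target_G Ni.target_G _ \<psi>_smooth] by blast
 qed
 have cont: "continuous_on {0..1} \<mu>"
 proof -
  have c1: "continuous_on {0..1} (%t. \<sigma> i (p t))" unfolding p_def by (rule continuous_on_compose2[OF c\<sigma> F(4)]) simp
  have c2: "continuous_on {0..1} (%t. inv\<^bsub>N i\<^esub> (\<sigma> i (p t)))"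
   by (rule continuous_on_compose2[OF smooth_mapD(3)[OF Ni.smooth_inv_map] c1]) auto
  have c3: "continuous_on {0..1} (%t. n t \<otimes>\<^bsub>N i\<^esub> inv\<^bsub>N i\<^esub> (\<sigma> i (p t)))"
   using continuous_on_compose2[OF Ni.continuous_on_mult continuous_on_Pair[OF F(5)[of i] c2]] nc unfolding n_def by (simp add: image_subset_iff)
  show ?thesis unfolding \<mu>_def by (rule continuous_on_compose2[OF smooth_mapD(3)[OF \<psi>_smooth] c3]) (use nc in auto)
 qed
 have \<mu>c: "\<mu> t : carrier (N i)" if "t : {0..1}" for t unfolding \<mu>_def using nc[OF that] by simp
 have ends: "\<mu> 0 = \<one>\<^bsub>N i\<^esub>" "\<mu> 1 = \<psi> i u (fst z i \<otimes>\<^bsub>N i\<^esub> inv\<^bsub>N i\<^esub> (\<sigma> i (snd z)))"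
  unfolding \<mu>_def n_def p_def c G_sel(3) by simp_all
 have path: "piecewise_smooth_path (N i) \<one>\<^bsub>N i\<^esub> (\<psi> i u (fst z i \<otimes>\<^bsub>N i\<^esub> inv\<^bsub>N i\<^esub> (\<sigma> i (snd z)))) \<mu>"
  unfolding piecewise_smooth_path_def
  by (intro conjI exI[of _ F]) (use F(1) smooth cont \<mu>c ends in auto)
 have vel: "left_velocity (N i) \<mu> t = d\<psi> i (u + snd (\<gamma> t)) (fst (left_velocity G \<gamma> t) $ i - d\<sigma> i (snd (left_velocity G \<gamma> t)))"
  if t: "t : {0<..<1} - F" for t
 proof -
  have t1: "t : {0..1}" using t by simp
  have nb: "at t within {0..1} ~= bot" using at_within_Icc_neq_bot[of 0 1 t] t1 by simp
  have pd: "(p has_vector_derivative snd (left_velocity G \<gamma> t)) (at t within {0..1})"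
   unfolding p_def[abs_def] by (rule has_vector_derivative_at_within[OF F(6)[OF t]])
  \<comment> \<open>\<open>?b\<close> collects the motion in \<open>N i\<close> and the compensating
    motion of the splitting. Conjugated by \<open>s\<close> at \<open>u + p t\<close> it becomes the
    left-translated curve of \<open>\<mu>\<close>.\<close>
  let ?b = "%r. act i (- p t) (inv\<^bsub>N i\<^esub> (n t) \<otimes>\<^bsub>N i\<^esub> n r) \<otimes>\<^bsub>N i\<^esub> inv\<^bsub>N i\<^esub> (\<sigma> i (p r - p t))"
  have "velocity_at (N i) ?b t {0..1} (fst (left_velocity G \<gamma> t) $ i + - d\<sigma> i (snd (left_velocity G \<gamma> t)))"
   by (rule Ni.velocity_at_mult[OF F(7)[OF t, of i, folded p_def n_def] Ni.velocity_at_inv[OF \<sigma>_velocity[OF t1 pd] nb]])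
  from \<psi>_velocity[OF this, of "u + p t"]
  have "velocity_at (N i) (%r. inv\<^bsub>N i\<^esub> (\<mu> t) \<otimes>\<^bsub>N i\<^esub> \<mu> r) t {0..1}
   (d\<psi> i (u + p t) (fst (left_velocity G \<gamma> t) $ i + - d\<sigma> i (snd (left_velocity G \<gamma> t))))"
  proof (rule velocity_at_cong)
   fix r :: real assume r: "r : {0..1}"
   note nn = nc[OF t1] nc[OF r]
   let ?\<tau> = "\<sigma> i (p t)" and ?d = "\<sigma> i (p r - p t)"
   have \<sigma>r: "\<sigma> i (p r) = ?\<tau> \<otimes>\<^bsub>N i\<^esub> act i (p t) ?d" using \<sigma>_add[of i "p t" "p r - p t"] by simp
   have "act i (p t) (act i (- p t) (inv\<^bsub>N i\<^esub> (n t) \<otimes>\<^bsub>N i\<^esub> n r)) = inv\<^bsub>N i\<^esub> (n t) \<otimes>\<^bsub>N i\<^esub> n r"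
    using act_add[of "inv\<^bsub>N i\<^esub> (n t) \<otimes>\<^bsub>N i\<^esub> n r" i "p t" "- p t"] nn by (simp add: act_zero)
   then have "\<psi> i (p t) (?b r) = ?\<tau> \<otimes>\<^bsub>N i\<^esub> (inv\<^bsub>N i\<^esub> (n t) \<otimes>\<^bsub>N i\<^esub> n r \<otimes>\<^bsub>N i\<^esub> inv\<^bsub>N i\<^esub> (act i (p t) ?d)) \<otimes>\<^bsub>N i\<^esub> inv\<^bsub>N i\<^esub> ?\<tau>"
    unfolding \<psi>_def using nn act_mult[of "act i (- p t) (inv\<^bsub>N i\<^esub> (n t) \<otimes>\<^bsub>N i\<^esub> n r)" i "inv\<^bsub>N i\<^esub> ?d" "p t"] act_inv[of ?d i "p t"] by simp
   also have "\<dots> = inv\<^bsub>N i\<^esub> (n t \<otimes>\<^bsub>N i\<^esub> inv\<^bsub>N i\<^esub> ?\<tau>) \<otimes>\<^bsub>N i\<^esub> (n r \<otimes>\<^bsub>N i\<^esub> inv\<^bsub>N i\<^esub> (\<sigma> i (p r)))"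
    unfolding \<sigma>r using nn by (simp add: Ni.inv_mult_group Ni.m_assoc)
   finally have "\<psi> i u (\<psi> i (p t) (?b r)) = \<psi> i u (inv\<^bsub>N i\<^esub> (n t \<otimes>\<^bsub>N i\<^esub> inv\<^bsub>N i\<^esub> ?\<tau>)) \<otimes>\<^bsub>N i\<^esub> \<mu> r"
    unfolding \<mu>_def using nn by (simp add: \<psi>_mult)
   moreover have "\<psi> i u (inv\<^bsub>N i\<^esub> (n t \<otimes>\<^bsub>N i\<^esub> inv\<^bsub>N i\<^esub> ?\<tau>)) = inv\<^bsub>N i\<^esub> (\<mu> t)"
    unfolding \<mu>_def using nn \<psi>_mult[of "inv\<^bsub>N i\<^esub> (n t \<otimes>\<^bsub>N i\<^esub> inv\<^bsub>N i\<^esub> ?\<tau>)" i "n t \<otimes>\<^bsub>N i\<^esub> inv\<^bsub>N i\<^esub> ?\<tau>" u]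
    by (intro Ni.inv_equality[symmetric]) auto
   moreover have "\<psi> i u (\<psi> i (p t) (?b r)) = \<psi> i (u + p t) (?b r)" using nn by (intro \<psi>_add) auto
   ultimately show "inv\<^bsub>N i\<^esub> (\<mu> t) \<otimes>\<^bsub>N i\<^esub> \<mu> r = \<psi> i (u + p t) (?b r)" by simp
  qed
  from velocity_at_unique[OF this nb] show ?thesis
   unfolding left_velocity_def left_curve_def[abs_def] p_def by simp
 qed
 show ?thesis by (rule that[OF F(1) path[unfolded \<mu>_def[abs_def] n_def p_def] vel[unfolded \<mu>_def[abs_def] n_def p_def]])
qed

end

lemma integral_le_off_finite:
 fixes f g :: "real => real"
 assumes "finite S" "f integrable_on T" "g integrable_on T" "!!x. x : T - S ==> f x <= g x"
 shows "integral T f <= integral T g"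
proof -
 define f' where "f' x = (if x : S then g x else f x)" for x
 have "f' integrable_on T" by (rule integrable_spike_finite[OF assms(1) _ assms(2)]) (simp add: f'_def)
 moreover have "integral T f' = integral T f"
  by (rule integral_spike[OF negligible_finite[OF assms(1)]]) (simp add: f'_def)
 ultimately show ?thesis using integral_le[of f' T g] assms(3,4) by (simp add: f'_def)
qed

text \<open>The norm inequality for the integral of the plane-valued function
  \<open>(\<nu>, \<zeta>)\<close>.\<close>

lemma norm_vector_integral_bound:
 fixes \<nu> \<zeta> :: "real => real"
 assumes "\<nu> integrable_on S" "\<zeta> integrable_on S" "(%t. sqrt ((\<nu> t)\<^sup>2 + (\<zeta> t)\<^sup>2)) integrable_on S"
 shows "(integral S \<nu>)\<^sup>2 + (integral S \<zeta>)\<^sup>2 <= (integral S (%t. sqrt ((\<nu> t)\<^sup>2 + (\<zeta> t)\<^sup>2)))\<^sup>2"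
proof -
 have hi: "((%t. (\<nu> t, \<zeta> t)) has_integral (integral S \<nu>, integral S \<zeta>)) S"
 proof -
  have b: "bounded_linear (%x::real. (x, 0::real))" "bounded_linear (%x::real. (0::real, x))"
   by (intro bounded_linear_Pair bounded_linear_ident bounded_linear_zero)+
  show ?thesis
   using has_integral_add[OF has_integral_linear[OF integrable_integral[OF assms(1)] b(1)] has_integral_linear[OF integrable_integral[OF assms(2)] b(2)]]
   by (simp add: comp_def)
 qed
 have "norm (integral S (%t. (\<nu> t, \<zeta> t))) <= integral S (%t. sqrt ((\<nu> t)\<^sup>2 + (\<zeta> t)\<^sup>2))"
  by (rule integral_norm_bound_integral[OF has_integral_integrable[OF hi] assms(3)]) (simp add: norm_Pair)
 then have "sqrt ((integral S \<nu>)\<^sup>2 + (integral S \<zeta>)\<^sup>2) <= integral S (%t. sqrt ((\<nu> t)\<^sup>2 + (\<zeta> t)\<^sup>2))"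
  unfolding integral_unique[OF hi] by (simp add: norm_Pair)
 then show ?thesis using power_mono[of "sqrt ((integral S \<nu>)\<^sup>2 + (integral S \<zeta>)\<^sup>2)" _ 2] by simp
qed

text \<open>The cuts are made at equal increments of \<open>t + integral {0..t} f\<close> rather
  than of the integral alone, because this function is strictly increasing even where
  \<open>f\<close> vanishes. The summand 2 comes from rounding up the total increment.\<close>

lemma integral_partition:
 fixes f :: "real => real"
 assumes f: "f integrable_on {0..1}" "!!t. t : {0..1} ==> f t >= 0"
 obtains L \<tau> where "\<tau> 0 = (0::real)" "\<tau> L = 1" "!!j. j <= L ==> \<tau> j : {0..1}" "!!j. j < L ==> \<tau> j <= \<tau> (Suc j)"
  "!!j. j < L ==> integral {\<tau> j..\<tau> (Suc j)} f <= 1" "real L <= integral {0..1} f + 2"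
proof -
 define l where "l = integral {0..1} f"
 have l: "l >= 0" unfolding l_def by (rule integral_nonneg[OF f])
 define L where "L = nat \<lceil>l + 1\<rceil>"
 have L: "real L >= l + 1" "real L <= l + 2" "L > 0" unfolding L_def using l by linarith+
 define \<Phi> where "\<Phi> t = t + integral {0..t} f" for t
 have sub: "f integrable_on {a..b}" if "0 <= a" "b <= 1" for a b
  by (rule integrable_on_subinterval[OF f(1)]) (use that in auto)
 have diff: "\<Phi> b - \<Phi> a = b - a + integral {a..b} f" if "0 <= a" "a <= b" "b <= 1" for a b
  using Henstock_Kurzweil_Integration.integral_combine[of 0 a b f] sub[of 0 b] that unfolding \<Phi>_def by simp
 have nn: "integral {a..b} f >= 0" if "0 <= a" "b <= 1" for a b
  by (rule integral_nonneg[OF sub[OF that]]) (use f(2) that in auto)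
 have mono: "\<Phi> a < \<Phi> b" if "0 <= a" "a < b" "b <= 1" for a b using diff[of a b] nn[of a b] that by simp
 have cont: "continuous_on {0..1} \<Phi>"
  unfolding \<Phi>_def by (intro continuous_intros indefinite_integral_continuous_1 f(1))
 have \<Phi>01: "\<Phi> 0 = 0" "\<Phi> 1 = l + 1" unfolding \<Phi>_def l_def by simp_all
 have "\<exists>t. 0 <= t & t <= 1 & \<Phi> t = real j * (l + 1) / real L" if "j <= L" for j
 proof (rule IVT')
  show "\<Phi> 0 <= real j * (l + 1) / real L" using \<Phi>01 l by simp
  have "real j * (l + 1) <= real L * (l + 1)" using that l by (intro mult_right_mono) auto
  then show "real j * (l + 1) / real L <= \<Phi> 1" using \<Phi>01 L(3) by (simp add: field_simps)
 qed (use cont in auto)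
 then obtain \<tau> where \<tau>: "!!j. j <= L ==> 0 <= \<tau> j & \<tau> j <= 1 & \<Phi> (\<tau> j) = real j * (l + 1) / real L" by metis
 have inj: "a <= b" if "a : {0..1}" "b : {0..1}" "\<Phi> a <= \<Phi> b" for a b
  using mono[of b a] that by (cases "a <= b") auto
 have \<tau>r: "\<tau> j : {0..1}" if "j <= L" for j using \<tau>[OF that] by simp
 show ?thesis
 proof (rule that[of \<tau> L])
  show "\<tau> 0 = 0" using inj[of "\<tau> 0" 0] \<tau>[of 0] \<Phi>01 by simp
  show "\<tau> L = 1" using inj[of 1 "\<tau> L"] \<tau>[of L] \<Phi>01 L(3) by simp
  fix j assume j: "j < L"
  have "real j * (l + 1) / real L <= real (Suc j) * (l + 1) / real L" using l by (intro divide_right_mono mult_right_mono) auto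
  then show le: "\<tau> j <= \<tau> (Suc j)" using inj[of "\<tau> j" "\<tau> (Suc j)"] \<tau>[of j] \<tau>[of "Suc j"] j by simp
  have "integral {\<tau> j..\<tau> (Suc j)} f <= \<Phi> (\<tau> (Suc j)) - \<Phi> (\<tau> j)" using diff[of "\<tau> j" "\<tau> (Suc j)"] \<tau>[of j] \<tau>[of "Suc j"] j le by simp
  also have "\<dots> = (l + 1) / real L" using \<tau>[of j] \<tau>[of "Suc j"] j by (simp add: diff_divide_distrib[symmetric] algebra_simps)
  also have "\<dots> <= 1" using L by simp
  finally show "integral {\<tau> j..\<tau> (Suc j)} f <= 1" .
 qed (use \<tau>r L l_def in auto)
qed

lemma axis_nth_eq: "axis i X $ j = (if j = i then X else 0)"
 by (simp add: axis_def)

section \<open>Lengths of paths\<close>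

text \<open>\<open>ge\<close> and \<open>m\<close> are as provided by
  \<open>inner_product_extension\<close>. As parameters of the locale they can be shared by several
  splittings, which the uniqueness argument uses.\<close>

locale sol_metric = sol_splitting N \<alpha> D act s
 for N :: "'i::finite => ('a::{t2_space, second_countable_topology}, 'e::euclidean_space) lie_struct"
  and \<alpha> :: "'i => real ^ 'k => real" and D act s +
 fixes g ge :: "('e ^ 'i) \<times> (real ^ 'k) => ('e ^ 'i) \<times> (real ^ 'k) => real" and m :: real
 assumes ge_g: "X : model (semidirect N act) ==> Y : model (semidirect N act) ==> ge X Y = g X Y"
  and ge_sym: "ge X Y = ge Y X" and ge_add: "ge (X + Y) Z = ge X Z + ge Y Z" and ge_scale: "ge (r *\<^sub>R X) Z = r * ge X Z"
  and ge_nonneg: "ge X X >= 0" and ge_cont: "continuous_on UNIV (%X. ge X X)"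
  and m: "m > 0" and ge_low: "X : model (semidirect N act) ==> m * (norm X)\<^sup>2 <= ge X X"
  and perp: "X : nil_algebra N ==> g (differential vector_group (semidirect N act) s v) X = 0"
begin

definition "ds u = (\<chi> i. d\<sigma> i u, u)"
text \<open>The inner product on R^k for which the splitting is isometric.\<close>

definition "Q u v = ge (ds u) (ds v)"
definition "gn X = sqrt (ge X X)"

lemma differential_s_ds: "differential vector_group G s v = ds v"
 unfolding ds_def by (rule differential_s)

lemma ds_linear: "linear ds"
 using linear_add[OF bounded_linear.linear[OF d\<sigma>_linear]] linear_scale[OF bounded_linear.linear[OF d\<sigma>_linear]]
 unfolding ds_def by (intro linearI) (auto simp: vec_eq_iff)

lemma ds_model: "ds u : model G"
 unfolding ds_def G_sel(4) using d\<sigma>_model by simp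

lemma Q_sym: "Q u v = Q v u" and Q_add: "Q (u + v) w = Q u w + Q v w" and Q_scale: "Q (r *\<^sub>R u) w = r * Q u w"
 and Q_nonneg: "Q u u >= 0"
 unfolding Q_def linear_add[OF ds_linear] linear_scale[OF ds_linear] by (rule ge_sym ge_add ge_scale ge_nonneg)+

lemma Q_pos: "u ~= 0 ==> Q u u > 0"
proof -
 assume "u ~= 0"
 then have "0 < m * (norm (ds u))\<^sup>2" using m unfolding ds_def by (simp add: prod_eq_iff)
 then show ?thesis unfolding Q_def using ge_low[OF ds_model, of u] by simp
qed

lemma gradient: "\<exists>e. (\<forall>u. Q u e = \<alpha> i u) & \<alpha> i e > 0"
 using gradient_exists[of Q "\<alpha> i", OF Q_sym Q_add Q_scale Q_pos linear_\<alpha> \<alpha>_nonzero] by metis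

definition "grad i = (SOME e. (\<forall>u. Q u e = \<alpha> i u) & \<alpha> i e > 0)"

lemma Q_grad: "Q u (grad i) = \<alpha> i u" and \<alpha>_grad: "\<alpha> i (grad i) > 0"
 using someI_ex[OF gradient[of i]] unfolding grad_def by simp_all

lemma detour: "detour Q \<alpha> grad"
 by unfold_locales (rule Q_sym Q_add Q_scale Q_nonneg Q_grad \<alpha>_grad)+

lemma Q_cauchy_schwarz: "\<bar>Q u v\<bar> <= sqrt (Q u u) * sqrt (Q v v)"
 by (rule cauchy_schwarz_form[of Q, OF Q_sym Q_add Q_scale Q_nonneg])

lemma gn_continuous: "continuous_on UNIV gn"
 unfolding gn_def[abs_def] by (intro continuous_intros ge_cont)

lemma gn_nonneg: "gn X >= 0" unfolding gn_def using ge_nonneg by simp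

lemma gn_scale: "gn (r *\<^sub>R X) = \<bar>r\<bar> * gn X"
proof -
 have "ge (r *\<^sub>R X) (r *\<^sub>R X) = r\<^sup>2 * ge X X" using ge_sym[of X "r *\<^sub>R X"] by (simp add: ge_scale power2_eq_square)
 then show ?thesis unfolding gn_def by (simp add: real_sqrt_mult)
qed

lemma gn_upper: obtains M where "M > 0" "!!X. gn X <= M * norm X"
proof -
 have "\<exists>Y\<in>sphere (0 :: ('e ^ 'i) \<times> (real ^ 'k)) 1. \<forall>X\<in>sphere 0 1. gn X <= gn Y"
  by (rule continuous_attains_sup[OF compact_sphere _ continuous_on_subset[OF gn_continuous subset_UNIV]]) simp
 then obtain Y where "\<forall>X\<in>sphere 0 1. gn X <= gn Y" by (elim bexE)
 then have Y: "gn X <= gn Y" if "norm X = 1" for X using that by simp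
 have "gn X <= (gn Y + 1) * norm X" for X
 proof (cases "X = 0")
  case True then show ?thesis using gn_scale[of 0 X] by simp
 next
  case False
  have "gn X = norm X * gn (X /\<^sub>R norm X)" using gn_scale[of "norm X" "X /\<^sub>R norm X"] False by simp
  also have "\<dots> <= norm X * (gn Y + 1)" using Y[of "X /\<^sub>R norm X"] False by (intro mult_left_mono) auto
  finally show ?thesis by (simp add: mult.commute)
 qed
 then show ?thesis using that[of "gn Y + 1"] gn_nonneg[of Y] by simp
qed

lemma gn_lower: "X : model G ==> norm X <= gn X / sqrt m"
proof -
 assume "X : model G"
 then have "sqrt (m * (norm X)\<^sup>2) <= gn X" unfolding gn_def by (intro real_sqrt_le_mono ge_low)
 then show ?thesis using m by (simp add: real_sqrt_mult field_simps)
qed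

lemma nil_model: "(!!i. X $ i : model (N i)) ==> (X, 0) : model G"
 unfolding G_sel(4) by simp

text \<open>Pythagoras: a velocity is the sum of the lift \<open>ds (snd Y)\<close> and a vector of
  the nilpotent algebra, which are orthogonal by perpendicularity.\<close>

lemma ge_split:
 assumes Y: "Y : model G"
 shows "ge Y Y = (gn (fst Y - (\<chi> i. d\<sigma> i (snd Y)), 0))\<^sup>2 + Q (snd Y) (snd Y)"
  "(fst Y - (\<chi> i. d\<sigma> i (snd Y))) $ i : model (N i)"
proof -
 define Z where "Z = fst Y - (\<chi> i. d\<sigma> i (snd Y))"
 have Zi: "Z $ i : model (N i)" for i
  unfolding Z_def using Y d\<sigma>_model subspace_diff[OF subspace_N] unfolding G_sel(4) by auto
 have Zm: "(Z, 0) : model G" using nil_model[OF Zi] .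
 have "(Z, 0) : nil_algebra N" unfolding nil_algebra_def using Zi by blast
 then have 0: "ge (ds (snd Y)) (Z, 0) = 0" using perp[of "(Z, 0)" "snd Y"] ge_g[OF ds_model Zm] by (simp add: differential_s_ds)
 have Yeq: "Y = (Z, 0) + ds (snd Y)" unfolding Z_def ds_def by (simp add: prod_eq_iff)
 have "ge Y Y = ge (Z, 0) Y + ge (ds (snd Y)) Y" using ge_add[of "(Z, 0)" "ds (snd Y)" Y] Yeq by simp
 also have "ge (Z, 0) Y = ge (Z, 0) (Z, 0) + ge (ds (snd Y)) (Z, 0)"
  using ge_add[of "(Z, 0)" "ds (snd Y)" "(Z, 0)"] Yeq ge_sym[of Y "(Z, 0)"] by simp
 also have "ge (ds (snd Y)) Y = ge (ds (snd Y)) (Z, 0) + ge (ds (snd Y)) (ds (snd Y))"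
  using ge_add[of "(Z, 0)" "ds (snd Y)" "ds (snd Y)"] Yeq ge_sym[of Y "ds (snd Y)"] ge_sym[of "(Z, 0)" "ds (snd Y)"] by simp
 finally show "ge Y Y = (gn (fst Y - (\<chi> i. d\<sigma> i (snd Y)), 0))\<^sup>2 + Q (snd Y) (snd Y)"
  unfolding 0 Q_def gn_def Z_def[symmetric] using ge_nonneg[of "(Z, 0)"] by simp
 show "(fst Y - (\<chi> i. d\<sigma> i (snd Y))) $ i : model (N i)" using Zi unfolding Z_def .
qed

lemma axis_model: "X : model (N i) ==> (axis i X, 0) : model G"
 using subspace_0[OF subspace_N] by (intro nil_model) (simp add: axis_nth_eq)

lemma factor_length:
 assumes c: "piecewise_smooth_path (N i) x y c"
 shows "path_length (N i) (%X Y. g (axis i X, 0) (axis i Y, 0)) c = integral {0..1} (%t. gn (axis i (left_velocity (N i) c t), 0))"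
  "(%t. gn (axis i (left_velocity (N i) c t), 0)) integrable_on {0..1}"
proof -
 interpret Ni: lie_grp "N i" ..
 obtain F where F: "finite F" "!!t. t : {0<..<1} - F ==> velocity_at (N i) (%r. inv\<^bsub>N i\<^esub> (c t) \<otimes>\<^bsub>N i\<^esub> c r) t {0..1} (left_velocity (N i) c t)"
  using Ni.piecewise_smooth_path_velocity[OF c] by metis
 show "path_length (N i) (%X Y. g (axis i X, 0) (axis i Y, 0)) c = integral {0..1} (%t. gn (axis i (left_velocity (N i) c t), 0))"
  unfolding path_length_def
 proof (rule integral_spike[of "F Un {0, 1}"])
  fix t assume "t : {0..1} - (F Un {0, 1})"
  then have "t : {0<..<1} - F" by auto
  then have "left_velocity (N i) c t : model (N i)" using F(2) unfolding velocity_at_def by blast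
  then show "gn (axis i (left_velocity (N i) c t), 0) = sqrt (g (axis i (left_velocity (N i) c t), 0) (axis i (left_velocity (N i) c t), 0))"
   unfolding gn_def using ge_g axis_model by simp
 qed (use F(1) in \<open>simp add: negligible_finite\<close>)
 have "continuous_on UNIV (%X. gn (axis i X, 0))"
  by (rule continuous_on_compose2[OF gn_continuous]) (auto intro!: continuous_intros linear_continuous_on bounded_linear_axis bounded_linear_Pair bounded_linear_zero)
 from pw_continuous_imp_integrable[OF pw_continuous_compose[OF Ni.pw_continuous_left_velocity[OF c] this]]
 show "(%t. gn (axis i (left_velocity (N i) c t), 0)) integrable_on {0..1}" .
qed

lemma factor_dist_le:
 assumes c: "piecewise_smooth_path (N i) x y c"
 shows "factor_dist N g i x y <= integral {0..1} (%t. gn (axis i (left_velocity (N i) c t), 0))"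
 unfolding factor_dist_def path_dist_def factor_length(1)[OF c, symmetric]
proof (rule cInf_lower)
 show "bdd_below {path_length (N i) (%X Y. g (axis i X, 0) (axis i Y, 0)) c |c. piecewise_smooth_path (N i) x y c}"
 proof (rule bdd_belowI[of _ 0])
  fix l assume "l : {path_length (N i) (%X Y. g (axis i X, 0) (axis i Y, 0)) c |c. piecewise_smooth_path (N i) x y c}"
  then obtain c' where c': "piecewise_smooth_path (N i) x y c'" "l = path_length (N i) (%X Y. g (axis i X, 0) (axis i Y, 0)) c'" by blast
  show "0 <= l" unfolding c'(2) factor_length(1)[OF c'(1)] by (rule integral_nonneg[OF factor_length(2)[OF c'(1)] gn_nonneg])
 qed
qed (use c in blast)

text \<open>The infimum need not be attained, so distance at most 1 only provides paths of length
  below any bound greater than 1; the bound 2 is taken.\<close>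

lemma factor_dist_path:
 assumes x: "x : carrier (N i)" and y: "y : carrier (N i)" and d: "factor_dist N g i x y <= 1"
 obtains c where "piecewise_smooth_path (N i) x y c" "integral {0..1} (%t. gn (axis i (left_velocity (N i) c t), 0)) <= 2"
proof -
 let ?S = "{path_length (N i) (%X Y. g (axis i X, 0) (axis i Y, 0)) c |c. piecewise_smooth_path (N i) x y c}"
 have "?S ~= {}" using lie_grp.piecewise_smooth_path_exists[OF lie_grp_N connected_N x y] by blast
 moreover have "Inf ?S < 2" using d unfolding factor_dist_def path_dist_def by simp
 ultimately have "\<exists>l\<in>?S. l < 2" by (rule cInf_lessD)
 then obtain l where "l : ?S" "l < 2" by (elim bexE)
 then obtain c where c: "piecewise_smooth_path (N i) x y c" "l = path_length (N i) (%X Y. g (axis i X, 0) (axis i Y, 0)) c" by blast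
 show ?thesis using that[OF c(1)] \<open>l < 2\<close> unfolding c(2) factor_length(1)[OF c(1)] by simp
qed

end

lemma norm_axis_eq: "norm (axis i X :: 'e::real_normed_vector ^ 'i::finite) = norm X"
proof -
 have "(\<Sum>j\<in>UNIV. (norm ((axis i X :: 'e ^ 'i) $ j))\<^sup>2) = (\<Sum>j\<in>UNIV. if j = i then (norm X)\<^sup>2 else 0)"
  by (rule sum.cong) (simp_all add: axis_def)
 also have "\<dots> = (norm X)\<^sup>2" by simp
 finally show ?thesis unfolding norm_vec_def L2_set_def by simp
qed

section \<open>Horizontal and vertical length, and the discretised path\<close>

context sol_metric begin

definition "nilc z i = fst z i \<otimes>\<^bsub>N i\<^esub> inv\<^bsub>N i\<^esub> (\<sigma> i (snd z))"

lemma ds_continuous: "continuous_on S ds"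
 by (rule linear_continuous_on[OF linear_conv_bounded_linear[THEN iffD1, OF ds_linear]])

lemma G_length_integrable:
 assumes \<gamma>: "piecewise_smooth_path G x y \<gamma>"
 shows "(%t. gn (left_velocity G \<gamma> t)) integrable_on {0..1}"
  "path_length G g \<gamma> = integral {0..1} (%t. gn (left_velocity G \<gamma> t))"
proof -
 obtain F where F: "finite F" "!!t. t : {0<..<1} - F ==> left_velocity G \<gamma> t : model G" "pw_continuous (left_velocity G \<gamma>)"
  by (rule piecewise_smooth_path_G[OF \<gamma>], rule that, assumption+)
 show "(%t. gn (left_velocity G \<gamma> t)) integrable_on {0..1}"
  by (rule pw_continuous_imp_integrable[OF pw_continuous_compose[OF F(3) gn_continuous]])
 show "path_length G g \<gamma> = integral {0..1} (%t. gn (left_velocity G \<gamma> t))" unfolding path_length_def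
 proof (rule integral_spike[of "F Un {0, 1}"])
  fix t assume "t : {0..1} - (F Un {0, 1})"
  then have "t : {0<..<1} - F" by auto
  from F(2)[OF this] show "gn (left_velocity G \<gamma> t) = sqrt (g (left_velocity G \<gamma> t) (left_velocity G \<gamma> t))"
   unfolding gn_def using ge_g by simp
 qed (use F(1) in \<open>simp add: negligible_finite\<close>)
qed

text \<open>\<open>\<nu>\<close> is the horizontal speed, that of the lift of the projected
  velocity, and \<open>\<zeta>\<close> is the vertical speed.\<close>

definition "\<nu> \<gamma> t = gn (ds (snd (left_velocity G \<gamma> t)))"
definition "\<zeta> \<gamma> t = gn (left_velocity G \<gamma> t - ds (snd (left_velocity G \<gamma> t)))"
definition "speed \<gamma> t = sqrt ((\<nu> \<gamma> t)\<^sup>2 + (\<zeta> \<gamma> t)\<^sup>2)"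

lemma perp_part: "(fst Y - (\<chi> i. d\<sigma> i (snd Y)), 0) = Y - ds (snd Y)"
 unfolding ds_def by (simp add: prod_eq_iff)

lemma perp_part_model:
 assumes "Y : model G" shows "Y - ds (snd Y) : model G"
proof -
 have "(fst Y - (\<chi> i. d\<sigma> i (snd Y)), 0) : model G" by (rule nil_model[OF ge_split(2)[OF assms]])
 then show ?thesis unfolding perp_part .
qed

lemma
 assumes \<gamma>: "piecewise_smooth_path G x y \<gamma>"
 shows \<nu>_integrable: "\<nu> \<gamma> integrable_on {0..1}" and \<zeta>_integrable: "\<zeta> \<gamma> integrable_on {0..1}"
  and speed_integrable: "speed \<gamma> integrable_on {0..1}"
  and speed_integral: "integral {0..1} (speed \<gamma>) = path_length G g \<gamma>"
  and weighted_integrable: "(%t. a * exp (- (b - \<alpha> i (snd (\<gamma> t))) / 2) * \<zeta> \<gamma> t) integrable_on {0..1}"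
proof -
 obtain F where F: "finite F" "!!t. t : {0<..<1} - F ==> left_velocity G \<gamma> t : model G" "pw_continuous (left_velocity G \<gamma>)"
   "continuous_on {0..1} (%t. snd (\<gamma> t))"
  by (rule piecewise_smooth_path_G[OF \<gamma>], rule that, assumption+)
 have c\<nu>: "continuous_on UNIV (%Y :: ('e ^ 'i) \<times> (real ^ 'k). gn (ds (snd Y)))"
  by (intro continuous_on_compose2[OF gn_continuous] continuous_on_compose2[OF ds_continuous[of UNIV]] continuous_intros) auto
 have c\<zeta>: "continuous_on UNIV (%Y. gn (Y - ds (snd Y)))"
  by (intro continuous_on_compose2[OF gn_continuous] continuous_on_compose2[OF ds_continuous[of UNIV]] continuous_intros) auto
 have cs: "continuous_on UNIV (%Y. sqrt ((gn (ds (snd Y)))\<^sup>2 + (gn (Y - ds (snd Y)))\<^sup>2))"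
  by (intro continuous_intros c\<nu> c\<zeta>)
 have c\<alpha>: "continuous_on UNIV (\<alpha> i)" by (rule linear_continuous_on[OF linear_conv_bounded_linear[THEN iffD1, OF linear_\<alpha>]])
 have cw: "continuous_on UNIV (%p. a * exp (- (b - \<alpha> i (fst p)) / 2) * gn (snd p - ds (snd (snd p))))"
  by (intro continuous_intros continuous_on_compose2[OF c\<zeta>] continuous_on_compose2[OF c\<alpha>]) auto
 note I = pw_continuous_imp_integrable[OF pw_continuous_compose[OF F(3)]]
 show "\<nu> \<gamma> integrable_on {0..1}" using I[OF c\<nu>] unfolding \<nu>_def[abs_def] .
 show "\<zeta> \<gamma> integrable_on {0..1}" using I[OF c\<zeta>] unfolding \<zeta>_def[abs_def] .
 show "speed \<gamma> integrable_on {0..1}" using I[OF cs] unfolding speed_def[abs_def] \<nu>_def \<zeta>_def .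
 show "(%t. a * exp (- (b - \<alpha> i (snd (\<gamma> t))) / 2) * \<zeta> \<gamma> t) integrable_on {0..1}"
  using pw_continuous_imp_integrable[OF pw_continuous_compose[OF pw_continuous_Pair[OF continuous_imp_pw_continuous[OF F(4)] F(3)] cw]]
  unfolding \<zeta>_def by simp
 show "integral {0..1} (speed \<gamma>) = path_length G g \<gamma>" unfolding G_length_integrable(2)[OF \<gamma>]
 proof (rule integral_spike[of "F Un {0, 1}"])
  fix t assume "t : {0..1} - (F Un {0, 1})"
  then have "t : {0<..<1} - F" by auto
  from ge_split(1)[OF F(2)[OF this]]
  show "gn (left_velocity G \<gamma> t) = speed \<gamma> t"
   unfolding perp_part speed_def \<nu>_def \<zeta>_def gn_def[of "left_velocity G \<gamma> t"] using ge_nonneg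
   by (simp add: Q_def[symmetric] gn_def[of "ds _"] Q_nonneg add.commute)
 qed (use F(1) in \<open>simp add: negligible_finite\<close>)
qed

lemma \<nu>_nonneg: "\<nu> \<gamma> t >= 0" and \<zeta>_nonneg: "\<zeta> \<gamma> t >= 0" and speed_nonneg: "speed \<gamma> t >= 0"
 unfolding \<nu>_def \<zeta>_def speed_def using gn_nonneg by simp_all

text \<open>The projected velocity is paired under \<open>Q\<close> with the total displacement
  \<open>w\<close> and integrated; Cauchy-Schwarz then bounds the norm of \<open>w\<close> by the
  horizontal length. \<open>norm_vector_integral_bound\<close> combines this with the vertical
  length.\<close>

lemma projected_step:
 assumes \<gamma>: "piecewise_smooth_path G x y \<gamma>" and ab: "0 <= a" "a <= b" "b <= 1"
 defines "w \<equiv> snd (\<gamma> b) - snd (\<gamma> a)"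
 shows "Q w w + (integral {a..b} (\<zeta> \<gamma>))\<^sup>2 <= (integral {a..b} (speed \<gamma>))\<^sup>2" "sqrt (Q w w) <= integral {a..b} (speed \<gamma>)"
proof -
 obtain F where F: "finite F" "continuous_on {0..1} (%t. snd (\<gamma> t))"
  "!!t. t : {0<..<1} - F ==> ((%r. snd (\<gamma> r)) has_vector_derivative snd (left_velocity G \<gamma> t)) (at t)"
  by (rule piecewise_smooth_path_G[OF \<gamma>], rule that, assumption+)
 have sub: "{a..b} <= {0..1}" using ab by auto
 note I = integrable_on_subinterval[OF _ sub]
 note i\<nu> = I[OF \<nu>_integrable[OF \<gamma>]] and i\<zeta> = I[OF \<zeta>_integrable[OF \<gamma>]] and isp = I[OF speed_integrable[OF \<gamma>]]
 have "linear (%u. Q u w)" by (rule linearI) (simp_all add: Q_add Q_scale)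
 then have bl: "bounded_linear (%u. Q u w)" by (simp add: linear_conv_bounded_linear)
 have "((%t. Q (snd (left_velocity G \<gamma> t)) w) has_integral Q (snd (\<gamma> b)) w - Q (snd (\<gamma> a)) w) {a..b}"
 proof (rule fundamental_theorem_of_calculus_interior_strong[OF F(1) ab(2)])
  show "continuous_on {a..b} (%t. Q (snd (\<gamma> t)) w)"
   by (rule continuous_on_compose2[OF linear_continuous_on[OF bl, of UNIV] continuous_on_subset[OF F(2) sub]]) simp
  show "((%t. Q (snd (\<gamma> t)) w) has_vector_derivative Q (snd (left_velocity G \<gamma> t)) w) (at t)" if "t : {a<..<b} - F" for t
   by (rule bounded_linear.has_vector_derivative[OF bl F(3)]) (use that ab in auto)
 qed
 moreover have "Q (snd (\<gamma> b)) w - Q (snd (\<gamma> a)) w = Q w w"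
  using Q_add[of w "snd (\<gamma> a)" w] unfolding w_def by simp
 ultimately have hi: "((%t. Q (snd (left_velocity G \<gamma> t)) w) has_integral Q w w) {a..b}" by simp
 have "Q w w <= integral {a..b} (\<nu> \<gamma>) * sqrt (Q w w)"
 proof (rule has_integral_le[OF hi has_integral_mult_left[OF integrable_integral[OF i\<nu>]]])
  show "Q (snd (left_velocity G \<gamma> t)) w <= \<nu> \<gamma> t * sqrt (Q w w)" for t
   using Q_cauchy_schwarz[of "snd (left_velocity G \<gamma> t)" w] unfolding \<nu>_def gn_def Q_def[symmetric] by simp
 qed
 moreover have "Q w w = sqrt (Q w w) * sqrt (Q w w)" using Q_nonneg by simp
 moreover have n\<nu>: "integral {a..b} (\<nu> \<gamma>) >= 0" by (rule integral_nonneg[OF i\<nu>]) (rule \<nu>_nonneg)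
 ultimately have le: "sqrt (Q w w) <= integral {a..b} (\<nu> \<gamma>)"
  using mult_le_cancel_right[of "sqrt (Q w w)" "sqrt (Q w w)" "integral {a..b} (\<nu> \<gamma>)"] Q_nonneg[of w] by (cases "Q w w = 0") auto
 then have "Q w w <= (integral {a..b} (\<nu> \<gamma>))\<^sup>2" using power_mono[OF le, of 2] Q_nonneg by simp
 moreover have "(integral {a..b} (\<nu> \<gamma>))\<^sup>2 + (integral {a..b} (\<zeta> \<gamma>))\<^sup>2 <= (integral {a..b} (speed \<gamma>))\<^sup>2"
  using norm_vector_integral_bound[OF i\<nu> i\<zeta>] isp unfolding speed_def[abs_def] by simp
 ultimately show 1: "Q w w + (integral {a..b} (\<zeta> \<gamma>))\<^sup>2 <= (integral {a..b} (speed \<gamma>))\<^sup>2" by linarith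
 have "integral {a..b} (speed \<gamma>) >= 0" by (rule integral_nonneg[OF isp]) (rule speed_nonneg)
 moreover have "Q w w <= (integral {a..b} (speed \<gamma>))\<^sup>2" using 1 zero_le_power2[of "integral {a..b} (\<zeta> \<gamma>)"] by linarith
 ultimately show "sqrt (Q w w) <= integral {a..b} (speed \<gamma>)" by (intro real_le_lsqrt) auto
qed

text \<open>The vertices are the projections of the cut points, and \<open>x j\<close> is the
  vertical length of a piece. If the path stays at or below level \<open>H\<close>, then
  \<open>\<psi>_path\<close> with \<open>\<alpha> i u = - H\<close> gives a path of length above 1
  whose speed is at most a multiple of the vertical speed times an exponential of the depth.\<close>

lemma discretization:
 obtains A C where "A > 0" "C > 0"
  "!!\<gamma> z. piecewise_smooth_path G \<one>\<^bsub>G\<^esub> z \<gamma> ==> \<exists>L w x. w 0 = 0 & w L = snd z & real L <= path_length G g \<gamma> + 2 &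
   (\<forall>j<L. Q (w (Suc j) - w j) (w (Suc j) - w j) + (x j)\<^sup>2 <= 1) &
   (\<forall>i H u. \<alpha> i u = - H --> 1 < factor_dist N g i \<one>\<^bsub>N i\<^esub> (\<psi> i u (nilc z i)) -->
    (\<exists>j\<le>L. \<alpha> i (w j) >= H - A) \<or> 1 <= (\<Sum>j<L. C * exp (- (1 / 2) * (H - \<alpha> i (w j))) * x j))"
proof -
 obtain M where M: "M > 0" "!!X. gn X <= M * norm X" using gn_upper by metis
 have "\<exists>C. C > 0 & (\<forall>v X. \<alpha> i v <= 0 --> X : model (N i) --> norm (d\<psi> i v X) <= C * exp (\<alpha> i v / 2) * norm X)" for i
  by (rule d\<psi>_decay[of i]) blast
 then have "\<forall>i. \<exists>C. C > 0 & (\<forall>v X. \<alpha> i v <= 0 --> X : model (N i) --> norm (d\<psi> i v X) <= C * exp (\<alpha> i v / 2) * norm X)" ..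
 from choice[OF this] obtain C\<psi> where C\<psi>': "\<forall>i. C\<psi> i > 0 & (\<forall>v X. \<alpha> i v <= 0 --> X : model (N i) --> norm (d\<psi> i v X) <= C\<psi> i * exp (\<alpha> i v / 2) * norm X)" ..
 have C\<psi>: "C\<psi> i > 0" and C\<psi>d: "\<alpha> i v <= 0 ==> X : model (N i) ==> norm (d\<psi> i v X) <= C\<psi> i * exp (\<alpha> i v / 2) * norm X" for i v X
  using C\<psi>' by simp_all
 \<comment> \<open>Bounds the variation of every root along a piece of length at most 1, by
   Cauchy-Schwarz against the gradients; the summand 1 makes positivity evident.\<close>
 define A where "A = 1 + (\<Sum>i\<in>UNIV. sqrt (\<alpha> i (grad i)))"
 have gr0: "sqrt (\<alpha> i (grad i)) >= 0" for i using \<alpha>_grad[of i] by simp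
 have A: "A > 0" unfolding A_def using sum_nonneg[of UNIV "%i. sqrt (\<alpha> i (grad i))"] gr0 by (simp add: add_pos_nonneg)
 have Ai: "sqrt (\<alpha> i (grad i)) <= A" for i
  unfolding A_def using member_le_sum[of i UNIV "%i. sqrt (\<alpha> i (grad i))"] gr0 by simp
 \<comment> \<open>Collects the comparison of \<open>gn\<close> with the Euclidean norm in both
   directions and the decay constants of all factors.\<close>
 define C0 where "C0 = M * (\<Sum>i\<in>UNIV. C\<psi> i) / sqrt m"
 have S\<psi>: "C\<psi> i <= (\<Sum>i\<in>UNIV. C\<psi> i)" for i
  using member_le_sum[of i UNIV C\<psi>] C\<psi> by (simp add: less_imp_le)
 have C0: "C0 > 0" unfolding C0_def using M(1) m C\<psi> by (simp add: sum_pos)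
 \<comment> \<open>The extra factor lets the weight at time \<open>t\<close> be replaced by the
   weight at the first vertex of its piece.\<close>
 define C where "C = C0 * exp (A / 2)"
 have C: "C > 0" unfolding C_def using C0 by simp
 show ?thesis
 proof (rule that[OF A C])
  fix \<gamma> z assume \<gamma>: "piecewise_smooth_path G \<one>\<^bsub>G\<^esub> z \<gamma>"
  have ends: "\<gamma> 0 = \<one>\<^bsub>G\<^esub>" "\<gamma> 1 = z" using \<gamma> unfolding piecewise_smooth_path_def by simp_all
  obtain F where F: "finite F" "!!t. t : {0<..<1} - F ==> left_velocity G \<gamma> t : model G"
   by (rule piecewise_smooth_path_G[OF \<gamma>], rule that, assumption+)
  obtain L \<tau> where \<tau>: "\<tau> 0 = (0::real)" "\<tau> L = 1" "!!j. j <= L ==> \<tau> j : {0..1}" "!!j. j < L ==> \<tau> j <= \<tau> (Suc j)"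
   "!!j. j < L ==> integral {\<tau> j..\<tau> (Suc j)} (speed \<gamma>) <= 1" "real L <= integral {0..1} (speed \<gamma>) + 2"
   by (rule integral_partition[OF speed_integrable[OF \<gamma>]], rule speed_nonneg, rule that, assumption+)
  define p where "p t = snd (\<gamma> t)" for t
  define w where "w j = p (\<tau> j)" for j
  define x where "x j = integral {\<tau> j..\<tau> (Suc j)} (\<zeta> \<gamma>)" for j
  have L0: "L ~= 0" using \<tau>(1,2) by (intro notI) simp
  have near: "\<bar>\<alpha> i (p t) - \<alpha> i (w j)\<bar> <= A" if j: "j < L" and t: "t : {\<tau> j..\<tau> (Suc j)}" for i j t
  proof -
   let ?d = "p t - p (\<tau> j)"
   have b: "0 <= \<tau> j" "\<tau> (Suc j) <= 1" using \<tau>(3)[of j] \<tau>(3)[of "Suc j"] j by auto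
   have "sqrt (Q ?d ?d) <= integral {\<tau> j..t} (speed \<gamma>)"
    unfolding p_def by (rule projected_step(2)[OF \<gamma>]) (use b t in auto)
   also have "\<dots> <= integral {\<tau> j..\<tau> (Suc j)} (speed \<gamma>)"
    by (rule integral_subset_le) (use b t speed_nonneg in \<open>auto intro!: integrable_on_subinterval[OF speed_integrable[OF \<gamma>]]\<close>)
   also have "\<dots> <= 1" by (rule \<tau>(5)[OF j])
   finally have 1: "sqrt (Q ?d ?d) <= 1" .
   have "\<bar>\<alpha> i ?d\<bar> <= sqrt (Q ?d ?d) * sqrt (\<alpha> i (grad i))" using Q_cauchy_schwarz[of ?d "grad i"] by (simp add: Q_grad)
   also have "\<dots> <= 1 * sqrt (\<alpha> i (grad i))" by (rule mult_right_mono[OF 1 gr0])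
   finally show ?thesis using Ai[of i] unfolding \<alpha>_diff w_def by simp
  qed
  have piece: "\<exists>j<k. t : {\<tau> j..\<tau> (Suc j)}" if "k <= L" "k ~= 0" "0 <= t" "t <= \<tau> k" for k t
   using that
  proof (induction k)
   case (Suc k)
   show ?case
   proof (cases "t <= \<tau> k & k ~= 0")
    case True then show ?thesis using Suc less_Suc_eq by auto
   next
    case False then show ?thesis using Suc.prems \<tau>(1) by (intro exI[of _ k]) auto
   qed
  qed simp
  have "(\<exists>j\<le>L. \<alpha> i (w j) >= H - A) \<or> 1 <= (\<Sum>j<L. C * exp (- (1 / 2) * (H - \<alpha> i (w j))) * x j)"
   if u: "\<alpha> i u = - H" and far: "1 < factor_dist N g i \<one>\<^bsub>N i\<^esub> (\<psi> i u (nilc z i))" for i H u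
  proof (cases "\<exists>t\<in>{0..1}. \<alpha> i (p t) > H")
   \<comment> \<open>The path itself rises above \<open>H\<close>, so the first vertex of that piece
     is at most \<open>A\<close> below \<open>H\<close>.\<close>
   case True
   then obtain t where t: "t : {0..1}" "\<alpha> i (p t) > H" by blast
   obtain j where j: "j < L" "t : {\<tau> j..\<tau> (Suc j)}" using piece[of L t] L0 t \<tau>(2) by auto
   show ?thesis using near[OF j, of i] t(2) j(1) by (intro disjI1 exI[of _ j]) auto
  next
   case False
   define f where "f t = C0 * exp (- (H - \<alpha> i (p t)) / 2) * \<zeta> \<gamma> t" for t
   have fi: "f integrable_on {0..1}" unfolding f_def[abs_def] p_def by (rule weighted_integrable[OF \<gamma>])
   obtain F' where F': "finite F'"
    "piecewise_smooth_path (N i) \<one>\<^bsub>N i\<^esub> (\<psi> i u (fst z i \<otimes>\<^bsub>N i\<^esub> inv\<^bsub>N i\<^esub> (\<sigma> i (snd z))))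
     (%t. \<psi> i u (fst (\<gamma> t) i \<otimes>\<^bsub>N i\<^esub> inv\<^bsub>N i\<^esub> (\<sigma> i (snd (\<gamma> t)))))"
    "!!t. t : {0<..<1} - F' ==> left_velocity (N i) (%t. \<psi> i u (fst (\<gamma> t) i \<otimes>\<^bsub>N i\<^esub> inv\<^bsub>N i\<^esub> (\<sigma> i (snd (\<gamma> t))))) t =
     d\<psi> i (u + snd (\<gamma> t)) (fst (left_velocity G \<gamma> t) $ i - d\<sigma> i (snd (left_velocity G \<gamma> t)))"
    by (rule \<psi>_path[OF \<gamma>, of i u], rule that, assumption+)
   note fl = factor_length(2)[OF F'(2)] and fd = factor_dist_le[OF F'(2)]
   have "1 < integral {0..1} (%t. gn (axis i (left_velocity (N i) (%t. \<psi> i u (fst (\<gamma> t) i \<otimes>\<^bsub>N i\<^esub> inv\<^bsub>N i\<^esub> (\<sigma> i (snd (\<gamma> t))))) t), 0))"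
    using far fd unfolding nilc_def by simp
   also have "\<dots> <= integral {0..1} f"
   proof (rule integral_le_off_finite[of "F Un F' Un {0, 1}", OF _ fl fi])
    fix t assume "t : {0..1} - (F Un F' Un {0, 1})"
    then have t: "t : {0<..<1} - F" "t : {0<..<1} - F'" "t : {0..1}" by auto
    define Y where "Y = left_velocity G \<gamma> t"
    have Y: "Y : model G" unfolding Y_def by (rule F(2)[OF t(1)])
    define Z where "Z = fst Y $ i - d\<sigma> i (snd Y)"
    have Zeq: "Z = fst (Y - ds (snd Y)) $ i" unfolding Z_def ds_def by simp
    have Zm: "Z : model (N i)" using ge_split(2)[OF Y, of i] unfolding Z_def by simp
    have "norm Z <= norm (fst (Y - ds (snd Y)))" unfolding Zeq by (rule Finite_Cartesian_Product.norm_nth_le)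
    also have "\<dots> <= norm (Y - ds (snd Y))" by (metis norm_fst_le prod.collapse)
    also have "\<dots> <= \<zeta> \<gamma> t / sqrt m" unfolding \<zeta>_def Y_def[symmetric] by (rule gn_lower[OF perp_part_model[OF Y]])
    finally have nZ: "norm Z <= \<zeta> \<gamma> t / sqrt m" .
    have le: "\<alpha> i (u + p t) <= 0" using False t(3) u by (auto simp: \<alpha>_add not_less)
    have "gn (axis i (d\<psi> i (u + p t) Z), 0) <= M * norm (axis i (d\<psi> i (u + p t) Z) :: 'e ^ 'i, 0 :: real ^ 'k)" by (rule M(2))
    also have "norm (axis i (d\<psi> i (u + p t) Z) :: 'e ^ 'i, 0 :: real ^ 'k) = norm (d\<psi> i (u + p t) Z)"
     by (simp add: norm_Pair norm_axis_eq)
    also have "\<dots> <= C\<psi> i * exp (\<alpha> i (u + p t) / 2) * norm Z" by (rule C\<psi>d[OF le Zm])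
    also have "\<dots> <= (\<Sum>i\<in>UNIV. C\<psi> i) * exp (\<alpha> i (u + p t) / 2) * (\<zeta> \<gamma> t / sqrt m)"
     by (intro mult_mono S\<psi> nZ order_refl mult_nonneg_nonneg) (use C\<psi> in \<open>auto simp: less_imp_le sum_nonneg\<close>)
    finally have "gn (axis i (d\<psi> i (u + p t) Z), 0) <= M * ((\<Sum>i\<in>UNIV. C\<psi> i) * exp (\<alpha> i (u + p t) / 2) * (\<zeta> \<gamma> t / sqrt m))"
     using M(1) by simp
    also have "\<dots> = f t" unfolding f_def C0_def \<alpha>_add u by simp
    finally show "gn (axis i (left_velocity (N i) (%t. \<psi> i u (fst (\<gamma> t) i \<otimes>\<^bsub>N i\<^esub> inv\<^bsub>N i\<^esub> (\<sigma> i (snd (\<gamma> t))))) t), 0) <= f t"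
     unfolding F'(3)[OF t(2)] Z_def Y_def p_def .
   qed (use F(1) F'(1) in auto)
   also have "integral {0..1} f <= (\<Sum>j<L. C * exp (- (1 / 2) * (H - \<alpha> i (w j))) * x j)"
   proof -
    have "integral {0..\<tau> k} f <= (\<Sum>j<k. C * exp (- (1 / 2) * (H - \<alpha> i (w j))) * x j)" if "k <= L" for k
     using that
    proof (induction k)
     case 0 then show ?case using \<tau>(1) by simp
    next
     case (Suc k)
     then have k: "k < L" "0 <= \<tau> k" "\<tau> k <= \<tau> (Suc k)" "\<tau> (Suc k) <= 1" using \<tau>(3)[of k] \<tau>(3)[of "Suc k"] \<tau>(4)[of k] by auto
     have sub: "{\<tau> k..\<tau> (Suc k)} <= {0..1}" "{0..\<tau> (Suc k)} <= {0..1}" using k by auto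
     have "integral {\<tau> k..\<tau> (Suc k)} f <= integral {\<tau> k..\<tau> (Suc k)} (%t. (C * exp (- (1 / 2) * (H - \<alpha> i (w k)))) * \<zeta> \<gamma> t)"
     proof (rule integral_le[OF integrable_on_subinterval[OF fi sub(1)] integrable_on_mult_right[OF integrable_on_subinterval[OF \<zeta>_integrable[OF \<gamma>] sub(1)]]])
      fix t assume t: "t : {\<tau> k..\<tau> (Suc k)}"
      have "exp (- (H - \<alpha> i (p t)) / 2) <= exp (A / 2 + - (1 / 2) * (H - \<alpha> i (w k)))"
       using near[OF k(1) t, of i] by (simp add: field_simps)
      then have "C0 * exp (- (H - \<alpha> i (p t)) / 2) * \<zeta> \<gamma> t <= C0 * exp (A / 2 + - (1 / 2) * (H - \<alpha> i (w k))) * \<zeta> \<gamma> t"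
       using C0 \<zeta>_nonneg by (intro mult_right_mono mult_left_mono) auto
      then show "f t <= (C * exp (- (1 / 2) * (H - \<alpha> i (w k)))) * \<zeta> \<gamma> t"
       unfolding f_def C_def exp_add by (simp add: mult.assoc)
     qed
     then have "integral {\<tau> k..\<tau> (Suc k)} f <= C * exp (- (1 / 2) * (H - \<alpha> i (w k))) * x k"
      unfolding x_def by simp
     moreover have "integral {0..\<tau> k} f + integral {\<tau> k..\<tau> (Suc k)} f = integral {0..\<tau> (Suc k)} f"
      by (rule Henstock_Kurzweil_Integration.integral_combine[OF k(2,3) integrable_on_subinterval[OF fi sub(2)]])
     ultimately show ?case using Suc by simp
    qed
    from this[of L] show ?thesis using \<tau>(2) by simp
   qed
   finally show ?thesis by simp
  qed
  moreover have "Q (w (Suc j) - w j) (w (Suc j) - w j) + (x j)\<^sup>2 <= 1" if j: "j < L" for j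
  proof -
   have b: "0 <= \<tau> j" "\<tau> (Suc j) <= 1" using \<tau>(3)[of j] \<tau>(3)[of "Suc j"] j by auto
   have "Q (w (Suc j) - w j) (w (Suc j) - w j) + (x j)\<^sup>2 <= (integral {\<tau> j..\<tau> (Suc j)} (speed \<gamma>))\<^sup>2"
    unfolding w_def x_def p_def by (rule projected_step(1)[OF \<gamma> b(1) \<tau>(4)[OF j] b(2)])
   also have "\<dots> <= 1"
    by (rule power_le_one[OF integral_nonneg \<tau>(5)[OF j]])
     (use b speed_nonneg in \<open>auto intro!: integrable_on_subinterval[OF speed_integrable[OF \<gamma>]]\<close>)
   finally show ?thesis .
  qed
  moreover have "w 0 = 0" "w L = snd z" unfolding w_def p_def \<tau>(1,2) ends G_sel(3) by simp_all
  moreover have "real L <= path_length G g \<gamma> + 2" using \<tau>(6) unfolding speed_integral[OF \<gamma>] .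
  ultimately show "\<exists>L w x. w 0 = 0 & w L = snd z & real L <= path_length G g \<gamma> + 2 &
   (\<forall>j<L. Q (w (Suc j) - w j) (w (Suc j) - w j) + (x j)\<^sup>2 <= 1) &
   (\<forall>i H u. \<alpha> i u = - H --> 1 < factor_dist N g i \<one>\<^bsub>N i\<^esub> (\<psi> i u (nilc z i)) -->
    (\<exists>j\<le>L. \<alpha> i (w j) >= H - A) \<or> 1 <= (\<Sum>j<L. C * exp (- (1 / 2) * (H - \<alpha> i (w j))) * x j))"
   by (intro exI[of _ L] exI[of _ w] exI[of _ x] conjI allI impI)
 qed
qed

end

section \<open>Left translation of paths\<close>

context sol_group begin

lemma G_left_translate_smooth:
 assumes x: "x : carrier G" and ab: "a < b" and \<gamma>: "smooth_path_on G {a..b} \<gamma>"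
 shows "smooth_path_on G {a..b} (%t. x \<cdot> \<gamma> t)"
proof -
 have \<gamma>': "smooth_path_on (N i) {a..b} (%t. fst (\<gamma> t) i)" "smooth_on UNIV {a..b} (%t. snd (\<gamma> t))" for i
  using \<gamma> unfolding smooth_path_G_iff[OF ab] by blast+
 have "smooth_path_on (N i) {a..b} (%t. fst x i \<otimes>\<^bsub>N i\<^esub> act i (snd x) (fst (\<gamma> t) i))" for i
 proof -
  interpret Ni: lie_grp "N i" ..
  have xi: "fst x i : carrier (N i)" using x unfolding G_sel by auto
  have "smooth_path_on (N i) {a..b} (%t. act i (snd x) (fst (\<gamma> t) i))"
   using smooth_map_compose[OF source_atlas_interval[OF ab] Ni.target_G Ni.target_G _ act_smooth] \<gamma>'(1) unfolding smooth_path_on_iff by blast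
  then show ?thesis by (rule Ni.left_translate_smooth[OF xi ab])
 qed
 moreover have "smooth_on UNIV {a..b} (%t. snd x + snd (\<gamma> t))"
  using \<gamma>'(2) unfolding smooth_on_def by (auto intro: Ck_on_add Ck_on_const)
 ultimately show ?thesis unfolding smooth_path_G_iff[OF ab] G_sel(2) by simp
qed

lemma G_left_translate_continuous:
 assumes x: "x : carrier G" and \<gamma>: "continuous_on S \<gamma>" "\<gamma> ` S <= carrier G"
 shows "continuous_on S (%t. x \<cdot> \<gamma> t)"
proof -
 have c: "continuous_on S (%t. fst (\<gamma> t) i)" for i
  by (rule continuous_on_product_then_coordinatewise[OF continuous_on_fst[OF \<gamma>(1)]])
 have "continuous_on S (%t. fst x i \<otimes>\<^bsub>N i\<^esub> act i (snd x) (fst (\<gamma> t) i))" for i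
 proof -
  interpret Ni: lie_grp "N i" ..
  have xi: "fst x i : carrier (N i)" using x unfolding G_sel by auto
  have im: "fst (\<gamma> t) i : carrier (N i)" if "t : S" for t
  proof -
   have "\<gamma> t : carrier G" using \<gamma>(2) that by blast
   then show ?thesis unfolding G_sel by auto
  qed
  have ca: "continuous_on S (%t. act i (snd x) (fst (\<gamma> t) i))"
   by (rule continuous_on_compose2[OF smooth_mapD(3)[OF act_smooth] c]) (use im in auto)
  show ?thesis
   using continuous_on_compose2[OF Ni.continuous_on_mult continuous_on_Pair[OF continuous_on_const[of S "fst x i"] ca]] xi im by (simp add: image_subset_iff)
 qed
 then have c1: "continuous_on S (%t i. fst x i \<otimes>\<^bsub>N i\<^esub> act i (snd x) (fst (\<gamma> t) i))"
  by (rule continuous_on_coordinatewise_then_product)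
 show ?thesis unfolding G_sel(2)
  by (rule continuous_on_Pair[OF c1 continuous_on_add[OF continuous_on_const continuous_on_snd[OF \<gamma>(1)]]])
qed

lemma G_left_translate_path:
 assumes x: "x : carrier G" and \<gamma>: "piecewise_smooth_path G y z \<gamma>"
 shows "piecewise_smooth_path G (x \<cdot> y) (x \<cdot> z) (%t. x \<cdot> \<gamma> t)"
proof -
 interpret G: group G by (rule group_G)
 obtain F where c: "\<gamma> 0 = y" "\<gamma> 1 = z" "\<gamma> ` {0..1} <= carrier G" "continuous_on {0..1} \<gamma>" "finite F"
  "!!a b. 0 <= a ==> a < b ==> b <= 1 ==> {a<..<b} Int F = {} ==> smooth_path_on G {a..b} \<gamma>"
  using piecewise_smooth_pathD[OF \<gamma>] by metis
 show ?thesis unfolding piecewise_smooth_path_def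
 proof (intro conjI exI[of _ F] allI impI)
  show "(%t. x \<cdot> \<gamma> t) ` {0..1} <= carrier G" using c(3) x by (auto intro!: G.m_closed)
  show "continuous_on {0..1} (%t. x \<cdot> \<gamma> t)" by (rule G_left_translate_continuous[OF x c(4,3)])
  fix a b :: real assume "0 <= a & a < b & b <= 1 & {a<..<b} Int F = {}"
  then show "smooth_path_on G {a..b} (%t. x \<cdot> \<gamma> t)" by (intro G_left_translate_smooth[OF x] c(6)) auto
 qed (use c in auto)
qed

lemma left_curve_translate:
 assumes "x : carrier G" "\<gamma> ` {0..1} <= carrier G" "t : {0..1}" "r : {0..1}"
 shows "left_curve G (%t. x \<cdot> \<gamma> t) t r = left_curve G \<gamma> t r"
 unfolding left_curve_def using group.inv_translate_mult[OF group_G, of x "\<gamma> t" "\<gamma> r"] assms by (auto simp: image_subset_iff)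

lemma has_derivative_left_curve_translate:
 assumes x: "x : carrier G" and im: "\<gamma> ` {0..1} <= carrier G" and t: "t : {0..1}"
  and d: "(left_curve G \<gamma> t has_vector_derivative X) (at t within {0..1})"
 shows "(left_curve G (%t. x \<cdot> \<gamma> t) t has_vector_derivative X) (at t within {0..1})"
 by (rule has_vector_derivative_transform[OF t left_curve_translate[OF x im t] d])

lemma left_velocity_eqI:
 "t : {0..1} ==> (left_curve H \<gamma> t has_vector_derivative X) (at t within {0..1}) ==> left_velocity H \<gamma> t = X"
 unfolding left_velocity_def by (rule vector_derivative_within) (use at_within_Icc_neq_bot[of 0 1 t] in auto)

text \<open>Equality holds also where neither curve has a derivative: the derivative predicates
  agree for every candidate vector, hence so do the values of
  \<open>vector_derivative\<close>.\<close>

lemma left_velocity_translate: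
 assumes x: "x : carrier G" and im: "\<gamma> ` {0..1} <= carrier G" and t: "t : {0..1}"
 shows "left_velocity G (%t. x \<cdot> \<gamma> t) t = left_velocity G \<gamma> t"
proof -
 have "((left_curve G (%t. x \<cdot> \<gamma> t) t has_vector_derivative X) (at t within {0..1})) = ((left_curve G \<gamma> t has_vector_derivative X) (at t within {0..1}))" for X
 proof
  assume l: "(left_curve G (%t. x \<cdot> \<gamma> t) t has_vector_derivative X) (at t within {0..1})"
  show "(left_curve G \<gamma> t has_vector_derivative X) (at t within {0..1})"
   by (rule has_vector_derivative_transform[OF t _ l]) (simp add: left_curve_translate[OF x im t])
 next
  assume "(left_curve G \<gamma> t has_vector_derivative X) (at t within {0..1})"
  then show "(left_curve G (%t. x \<cdot> \<gamma> t) t has_vector_derivative X) (at t within {0..1})"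
   by (rule has_derivative_left_curve_translate[OF x im t])
 qed
 then show ?thesis unfolding left_velocity_def vector_derivative_def by simp
qed

end

context sol_metric begin

section \<open>Box paths\<close>

text \<open>The subintervals are indexed by the factors in \<open>I\<close> themselves, so that no
  factor occurs twice and paths with disjoint index sets join without renumbering; \<open>X\<close>
  is the left velocity off \<open>F\<close>.\<close>

definition "box_data I \<gamma> a b F X \<longleftrightarrow> finite F & (\<forall>i\<in>I. 0 <= a i & a i <= b i & b i <= (1::real)) &
  (\<forall>i\<in>I. \<forall>j\<in>I. i ~= j --> {a i<..<b i} Int {a j<..<b j} = {}) &
  (\<forall>t\<in>{0..1} - F. (left_curve G \<gamma> t has_vector_derivative X t) (at t within {0..1})) &
  (\<forall>t\<in>{0..1} - F. \<forall>i\<in>I. t : {a i..b i} --> X t : factor_algebra N i) &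
  (\<forall>t\<in>{0..1} - F. t ~: (\<Union>i\<in>I. {a i..b i}) --> X t : range ds)"

definition "box_on I \<gamma> \<longleftrightarrow> (\<exists>a b F X. box_data I \<gamma> a b F X)"

lemma box_dataD:
 assumes "box_data I \<gamma> a b F X"
 shows "finite F" "i : I ==> 0 <= a i & a i <= b i & b i <= 1"
  "i : I ==> j : I ==> i ~= j ==> {a i<..<b i} Int {a j<..<b j} = {}"
  "t : {0..1} - F ==> (left_curve G \<gamma> t has_vector_derivative X t) (at t within {0..1})"
  "t : {0..1} - F ==> i : I ==> t : {a i..b i} ==> X t : factor_algebra N i"
  "t : {0..1} - F ==> t ~: (\<Union>i\<in>I. {a i..b i}) ==> X t : range ds"
 using assms[unfolded box_data_def] by simp_all

lemma box_onI:
 fixes a b :: "'i => real"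
 assumes "finite F" "!!i. i : I ==> 0 <= a i & a i <= b i & b i <= 1"
  "!!i j. i : I ==> j : I ==> i ~= j ==> {a i<..<b i} Int {a j<..<b j} = {}"
  "!!t. t : {0..1} - F ==> (left_curve G \<gamma> t has_vector_derivative X t) (at t within {0..1})"
  "!!t i. t : {0..1} - F ==> i : I ==> t : {a i..b i} ==> X t : factor_algebra N i"
  "!!t. t : {0..1} - F ==> t ~: (\<Union>i\<in>I. {a i..b i}) ==> X t : range ds"
 shows "box_on I \<gamma>"
 unfolding box_on_def box_data_def
 by (intro exI[of _ a] exI[of _ b] exI[of _ F] exI[of _ X] conjI ballI impI assms)

lemma box_on_imp_box_path:
 assumes "box_on I \<gamma>" shows "box_path N act s \<gamma>"
proof -
 obtain a b F X where B0: "box_data I \<gamma> a b F X" using assms unfolding box_on_def by blast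
 note B = box_dataD[OF B0]
 obtain \<iota> where \<iota>: "bij_betw \<iota> {0..<card I} I" using ex_bij_betw_nat_finite[of I] by auto
 then have \<iota>': "inj_on \<iota> {..<card I}" "\<iota> ` {..<card I} = I" unfolding bij_betw_def by (simp_all add: atLeast0LessThan)
 have \<iota>I: "\<iota> j : I" if "j < card I" for j using \<iota>'(2) that by blast
 have \<iota>n: "\<iota> j ~= \<iota> l" if "j < card I" "l < card I" "j ~= l" for j l using \<iota>'(1) that by (auto simp: inj_on_def)
 have lv: "left_velocity G \<gamma> t = X t" if "t : {0..1} - F" for t using left_velocity_eqI[OF _ B(4)[OF that]] that by simp
 have un: "(\<Union>j<card I. {a (\<iota> j)..b (\<iota> j)}) = (\<Union>i\<in>I. {a i..b i})"
 proof -
  have "(\<Union>i\<in>\<iota> ` {..<card I}. {a i..b i}) = (\<Union>j<card I. {a (\<iota> j)..b (\<iota> j)})" by simp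
  then show ?thesis unfolding \<iota>'(2) by (rule sym)
 qed
 have rds: "range (differential vector_group G s) = range ds" using differential_s_ds by simp
 have "card I <= CARD('i) + 1" using card_mono[of UNIV I] by simp
 moreover have "left_curve G \<gamma> t differentiable at t within {0..1} &
   (\<forall>j<card I. t : {a (\<iota> j)..b (\<iota> j)} --> left_velocity G \<gamma> t : factor_algebra N (\<iota> j)) &
   (t ~: (\<Union>j<card I. {a (\<iota> j)..b (\<iota> j)}) --> left_velocity G \<gamma> t : range (differential vector_group G s))"
  if t: "t : {0..1} - F" for t
  unfolding lv[OF t] un rds using B(4)[OF t] B(5)[OF t \<iota>I] B(6)[OF t] by (auto simp: differentiable_def has_vector_derivative_def)
 ultimately show ?thesis unfolding box_path_def
  by (intro exI[of _ "card I"] exI[of _ "%j. a (\<iota> j)"] exI[of _ "%j. b (\<iota> j)"] exI[of _ \<iota>] exI[of _ F] conjI)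
   (use B(1) B(2)[OF \<iota>I] B(3)[OF \<iota>I \<iota>I \<iota>n] \<iota>'(1) in simp_all)
qed

lemma factor_algebra_scale: "X : factor_algebra N i ==> r *\<^sub>R X : factor_algebra N i"
proof -
 assume "X : factor_algebra N i"
 then obtain Y where Y: "Y : model (N i)" "X = (axis i Y, 0)" unfolding factor_algebra_def by blast
 have "r *\<^sub>R X = (axis i (r *\<^sub>R Y), 0)" unfolding Y(2) by (simp add: vec_eq_iff axis_nth_eq)
 moreover have "r *\<^sub>R Y : model (N i)" by (rule subspace_scale[OF subspace_N Y(1)])
 ultimately show ?thesis unfolding factor_algebra_def by blast
qed

lemma range_ds_scale: "X : range ds ==> r *\<^sub>R X : range ds"
 using linear_scale[OF ds_linear, of r, symmetric] by auto

lemma left_curve_join: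
 assumes t: "t : {0..1} - {1/2}"
  and 1: "t < 1/2 ==> (left_curve G \<gamma> (2 * t) has_vector_derivative X) (at (2 * t) within {0..1})"
  and 2: "t > 1/2 ==> (left_curve G \<gamma>' (2 * t - 1) has_vector_derivative X) (at (2 * t - 1) within {0..1})"
 shows "(left_curve G (\<gamma> +++ \<gamma>') t has_vector_derivative 2 *\<^sub>R X) (at t within {0..1})"
proof -
 have aff: "((%r. 2 * r + k) has_vector_derivative 2) (at t within S)" for k :: real and S
  by (auto intro!: derivative_eq_intros simp: has_real_derivative_iff_has_vector_derivative[symmetric])
 consider "t < 1/2" | "t > 1/2" using t by fastforce
 then show ?thesis
 proof cases
  case c: 1
  have "(left_curve G \<gamma> (2 * t) has_vector_derivative X) (at (2 * t + 0) within (%r. 2 * r + 0) ` {0..1/2})"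
  proof (rule has_vector_derivative_within_subset)
   show "(left_curve G \<gamma> (2 * t) has_vector_derivative X) (at (2 * t + 0) within {0..1})" using 1[OF c] by simp
  qed auto
  from vector_diff_chain_within[OF aff this]
  have d: "((left_curve G \<gamma> (2 * t) o (%r. 2 * r + 0)) has_vector_derivative 2 *\<^sub>R X) (at t within {0..1/2})" .
  have "(left_curve G (\<gamma> +++ \<gamma>') t has_vector_derivative 2 *\<^sub>R X) (at t within {0..1/2})"
   by (rule has_vector_derivative_transform[OF _ _ d]) (use c t in \<open>auto simp: left_curve_def joinpaths_def\<close>)
  moreover have "at t within {0..1/2} = at t within {0..1}"
   by (rule at_within_nhd[of _ "{..<1/2}"]) (use c in auto)
  ultimately show ?thesis by simp
 next
  case c: 2
  have "(left_curve G \<gamma>' (2 * t - 1) has_vector_derivative X) (at (2 * t + (-1)) within (%r. 2 * r + (-1)) ` {1/2..1})"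
  proof (rule has_vector_derivative_within_subset)
   show "(left_curve G \<gamma>' (2 * t - 1) has_vector_derivative X) (at (2 * t + (-1)) within {0..1})" using 2[OF c] by simp
  qed auto
  from vector_diff_chain_within[OF aff this]
  have d: "((left_curve G \<gamma>' (2 * t - 1) o (%r. 2 * r + (-1))) has_vector_derivative 2 *\<^sub>R X) (at t within {1/2..1})" .
  have "(left_curve G (\<gamma> +++ \<gamma>') t has_vector_derivative 2 *\<^sub>R X) (at t within {1/2<..1})"
   by (rule has_vector_derivative_transform[OF _ _ has_vector_derivative_within_subset[OF d]]) (use c t in \<open>auto simp: left_curve_def joinpaths_def\<close>)
  moreover have "at t within {1/2<..1} = at t within {0..1}"
   by (rule at_within_nhd[of _ "{1/2<..}"]) (use c in auto)
  ultimately show ?thesis by simp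
 qed
qed

text \<open>The relation that is built up piece by piece: under joining, factor sets are united and
  lengths add. \<open>P\<close> records points that the projection passes through, from which the
  half-space visits are read off.\<close>

definition "box_conn I x y l P \<longleftrightarrow> (\<exists>\<gamma>. piecewise_smooth_path G x y \<gamma> & path_length G g \<gamma> <= l & box_on I \<gamma> & P <= (%t. snd (\<gamma> t)) ` {0..1})"

lemma box_conn_join:
 assumes 1: "box_conn I x y l P" and 2: "box_conn I' y z l' P'" and disj: "I Int I' = {}"
 shows "box_conn (I Un I') x z (l + l') (P Un P')"
proof -
 obtain \<gamma> where \<gamma>: "piecewise_smooth_path G x y \<gamma>" "path_length G g \<gamma> <= l" "box_on I \<gamma>" "P <= (%t. snd (\<gamma> t)) ` {0..1}"
  using 1 unfolding box_conn_def by blast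
 obtain \<gamma>' where \<gamma>': "piecewise_smooth_path G y z \<gamma>'" "path_length G g \<gamma>' <= l'" "box_on I' \<gamma>'" "P' <= (%t. snd (\<gamma>' t)) ` {0..1}"
  using 2 unfolding box_conn_def by blast
 obtain a b F X where B0: "box_data I \<gamma> a b F X" using \<gamma>(3) unfolding box_on_def by blast
 note B = box_dataD[OF B0]
 obtain a' b' F' X' where B'0: "box_data I' \<gamma>' a' b' F' X'" using \<gamma>'(3) unfolding box_on_def by blast
 note B' = box_dataD[OF B'0]
 \<comment> \<open>The junction is exceptional: the two one-sided velocities may differ there, and
   closed subintervals of both halves may contain it.\<close>
 define F2 where "F2 = insert (1/2) ((%t. 2 * t) -` F Un (%t. 2 * t - 1) -` F')"
 have F2: "finite F2" unfolding F2_def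
  by (intro finite.insertI finite_UnI finite_vimageI B(1) B'(1)) (auto simp: inj_on_def)
 define Y where "Y t = (if t < 1/2 then 2 *\<^sub>R X (2 * t) else 2 *\<^sub>R X' (2 * t - 1))" for t
 have d: "(left_curve G (\<gamma> +++ \<gamma>') t has_vector_derivative Y t) (at t within {0..1})" if t: "t : {0..1} - F2" for t
 proof -
  have "(left_curve G (\<gamma> +++ \<gamma>') t has_vector_derivative 2 *\<^sub>R (if t < 1/2 then X (2 * t) else X' (2 * t - 1))) (at t within {0..1})"
   by (rule left_curve_join) (use t B(4)[of "2 * t"] B'(4)[of "2 * t - 1"] in \<open>auto simp: F2_def\<close>)
  then show ?thesis unfolding Y_def by (simp split: if_splits)
 qed
 define a2 where "a2 i = (if i : I then a i / 2 else (a' i + 1) / 2)" for i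
 define b2 where "b2 i = (if i : I then b i / 2 else (b' i + 1) / 2)" for i
 have ab1: "a2 i = a i / 2" "b2 i = b i / 2" if "i : I" for i unfolding a2_def b2_def using that by simp_all
 have ab2: "a2 i = (a' i + 1) / 2" "b2 i = (b' i + 1) / 2" if "i : I'" for i unfolding a2_def b2_def using that disj by auto
 have box: "box_on (I Un I') (\<gamma> +++ \<gamma>')"
 proof (rule box_onI[OF F2, of "I Un I'" a2 b2, OF _ _ d])
  show "0 <= a2 i & a2 i <= b2 i & b2 i <= 1" if "i : I Un I'" for i
  proof (cases "i : I")
   case True then show ?thesis using B(2)[OF True] ab1[OF True] by auto
  next
   case False
   then have i: "i : I'" using that by blast
   show ?thesis using B'(2)[OF i] ab2[OF i] by auto
  qed
 next
  fix i j assume ij: "i : I Un I'" "j : I Un I'" "i ~= j"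
  have d1: "x ~: {a2 i<..<b2 i} Int {a2 j<..<b2 j}" if "i : I" "j : I" for x
  proof
   assume x: "x : {a2 i<..<b2 i} Int {a2 j<..<b2 j}"
   then have "2 * x : {a i<..<b i} Int {a j<..<b j}" using ab1[OF that(1)] ab1[OF that(2)] by auto
   then show False using B(3)[OF that ij(3)] by blast
  qed
  have d2: "x ~: {a2 i<..<b2 i} Int {a2 j<..<b2 j}" if "i : I'" "j : I'" for x
  proof
   assume x: "x : {a2 i<..<b2 i} Int {a2 j<..<b2 j}"
   then have "2 * x - 1 : {a' i<..<b' i} Int {a' j<..<b' j}" using ab2[OF that(1)] ab2[OF that(2)] by auto
   then show False using B'(3)[OF that ij(3)] by blast
  qed
  have s1: "x < 1/2" if "x : {a2 i<..<b2 i}" "i : I" for x i using that(1) B(2)[OF that(2)] ab1[OF that(2)] by auto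
  have s2: "1/2 < x" if "x : {a2 i<..<b2 i}" "i : I'" for x i using that(1) B'(2)[OF that(2)] ab2[OF that(2)] by auto
  have "x ~: {a2 i<..<b2 i} Int {a2 j<..<b2 j}" for x
   using d1[of x] d2[of x] s1[of x i] s1[of x j] s2[of x i] s2[of x j] ij(1,2) by fastforce
  then show "{a2 i<..<b2 i} Int {a2 j<..<b2 j} = {}" by blast
 next
  fix t i assume t: "t : {0..1} - F2" and i: "i : I Un I'" and ti: "t : {a2 i..b2 i}"
  have t2: "t ~= 1/2" "2 * t ~: F" "2 * t - 1 ~: F'" "0 <= t" "t <= 1" using t unfolding F2_def by auto
  show "Y t : factor_algebra N i"
  proof (cases "i : I")
   case True
   then have "t < 1/2" "2 * t : {a i..b i}" using ti B(2)[OF True] ab1[OF True] t2(1) by auto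
   then show ?thesis unfolding Y_def using factor_algebra_scale[OF B(5)[OF _ True]] t2 by simp
  next
   case False
   then have i': "i : I'" using i by blast
   then have "\<not> t < 1/2" "2 * t - 1 : {a' i..b' i}" using ti B'(2)[OF i'] ab2[OF i'] t2(1) by auto
   then show ?thesis unfolding Y_def using factor_algebra_scale[OF B'(5)[OF _ i']] t2 by simp
  qed
 next
  fix t assume t: "t : {0..1} - F2" and nt: "t ~: (\<Union>i\<in>I Un I'. {a2 i..b2 i})"
  have t2: "t ~= 1/2" "2 * t ~: F" "2 * t - 1 ~: F'" "0 <= t" "t <= 1" using t unfolding F2_def by auto
  show "Y t : range ds"
  proof (cases "t < 1/2")
   case True
   have "2 * t ~: {a i..b i}" if "i : I" for i
   proof -
    have "t ~: {a2 i..b2 i}" using nt that by blast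
    then show ?thesis using ab1[OF that] by auto
   qed
   then have "2 * t ~: (\<Union>i\<in>I. {a i..b i})" by blast
   then show ?thesis unfolding Y_def using True range_ds_scale[OF B(6)[of "2 * t"]] t2 by simp
  next
   case False
   have "2 * t - 1 ~: {a' i..b' i}" if "i : I'" for i
   proof -
    have "t ~: {a2 i..b2 i}" using nt that by blast
    then show ?thesis using ab2[OF that] by auto
   qed
   then have "2 * t - 1 ~: (\<Union>i\<in>I'. {a' i..b' i})" by blast
   then show ?thesis unfolding Y_def using False range_ds_scale[OF B'(6)[of "2 * t - 1"]] t2 by simp
  qed
 qed
 have path: "piecewise_smooth_path G x z (\<gamma> +++ \<gamma>')" by (rule piecewise_smooth_path_join[OF \<gamma>(1) \<gamma>'(1)])
 define f where "f t = gn (left_velocity G \<gamma> t)" for t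
 define f' where "f' t = gn (left_velocity G \<gamma>' t)" for t
 have len: "path_length G g (\<gamma> +++ \<gamma>') = integral {0..1} f + integral {0..1} f'"
 proof -
  have h1: "((%t. 2 * f (2 * t + 0)) has_integral integral {0..1} f) {0..1/2}"
  proof -
   have "((%t. f (2 *\<^sub>R t + 0)) has_integral (1 / \<bar>2\<bar> ^ DIM(real)) *\<^sub>R integral {0..1} f) ((%x. (1/2) *\<^sub>R x + - ((1/2) *\<^sub>R 0)) ` cbox 0 1)"
    by (rule has_integral_affinity) (use integrable_integral[OF G_length_integrable(1)[OF \<gamma>(1), folded f_def]] in simp_all)
   then have "((%t. f (2 * t + 0)) has_integral integral {0..1} f / 2) {0..1/2}"
    by (simp add: image_affinity_atLeastAtMost)
   from has_integral_mult_right[OF this, of 2] show ?thesis by simp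
  qed
  have h2: "((%t. 2 * f' (2 * t + (-1))) has_integral integral {0..1} f') {1/2..1}"
  proof -
   have "((%t. f' (2 *\<^sub>R t + (-1))) has_integral (1 / \<bar>2\<bar> ^ DIM(real)) *\<^sub>R integral {0..1} f') ((%x. (1/2) *\<^sub>R x + - ((1/2) *\<^sub>R (-1))) ` cbox 0 1)"
    by (rule has_integral_affinity) (use integrable_integral[OF G_length_integrable(1)[OF \<gamma>'(1), folded f'_def]] in simp_all)
   moreover have "(%x::real. (1/2) *\<^sub>R x + - ((1/2) *\<^sub>R (-1))) ` cbox 0 1 = {1/2..1}"
    using image_affinity_atLeastAtMost[of "1/2" "1/2" 0 "1::real"] by (simp add: cbox_interval)
   ultimately have "((%t. f' (2 * t + (-1))) has_integral integral {0..1} f' / 2) {1/2..1}" by simp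
   from has_integral_mult_right[OF this, of 2] show ?thesis by simp
  qed
  have lv: "left_velocity G (\<gamma> +++ \<gamma>') t = Y t" if "t : {0..1} - F2" for t
   using left_velocity_eqI[OF _ d[OF that]] that by simp
  have k1: "((%t. gn (left_velocity G (\<gamma> +++ \<gamma>') t)) has_integral integral {0..1} f) {0..1/2}"
  proof (rule has_integral_spike_finite[OF F2 _ h1])
   fix t assume t: "t : {0..1/2} - F2"
   then have t2: "t : {0..1} - F2" "t < 1/2" "2 * t : {0..1} - F" unfolding F2_def by auto
   show "gn (left_velocity G (\<gamma> +++ \<gamma>') t) = 2 * f (2 * t + 0)"
    unfolding lv[OF t2(1)] Y_def f_def using t2(2) left_velocity_eqI[OF _ B(4)[OF t2(3)]] t2(3) gn_scale[of 2] by simp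
  qed
  have k2: "((%t. gn (left_velocity G (\<gamma> +++ \<gamma>') t)) has_integral integral {0..1} f') {1/2..1}"
  proof (rule has_integral_spike_finite[OF F2 _ h2])
   fix t assume t: "t : {1/2..1} - F2"
   then have t2: "t : {0..1} - F2" "\<not> t < 1/2" "2 * t - 1 : {0..1} - F'" unfolding F2_def by auto
   show "gn (left_velocity G (\<gamma> +++ \<gamma>') t) = 2 * f' (2 * t + (-1))"
    unfolding lv[OF t2(1)] Y_def f'_def using t2(2) left_velocity_eqI[OF _ B'(4)[OF t2(3)]] t2(3) gn_scale[of 2] by simp
  qed
  have "((%t. gn (left_velocity G (\<gamma> +++ \<gamma>') t)) has_integral integral {0..1} f + integral {0..1} f') {0..1}"
   by (rule has_integral_combine[OF _ _ k1 k2]) auto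
  then show ?thesis unfolding G_length_integrable(2)[OF path] by (rule integral_unique)
 qed
 have ends: "\<gamma> 1 = y" "\<gamma>' 0 = y" using \<gamma>(1) \<gamma>'(1) unfolding piecewise_smooth_path_def by simp_all
 have "P Un P' <= (%t. snd ((\<gamma> +++ \<gamma>') t)) ` {0..1}"
 proof
  fix v assume "v : P Un P'"
  then consider t where "t : {0..1}" "v = snd (\<gamma> t)" | t where "t : {0..1}" "v = snd (\<gamma>' t)" using \<gamma>(4) \<gamma>'(4) by blast
  then show "v : (%t. snd ((\<gamma> +++ \<gamma>') t)) ` {0..1}"
  proof cases
   case (1 t) then show ?thesis by (intro image_eqI[of _ _ "t / 2"]) (auto simp: joinpaths_def)
  next
   case (2 t) then show ?thesis using ends by (intro image_eqI[of _ _ "(t + 1) / 2"]) (auto simp: joinpaths_def add_divide_distrib)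
  qed
 qed
 then show ?thesis unfolding box_conn_def
  using path box len \<gamma>(2) \<gamma>'(2) unfolding G_length_integrable(2)[OF \<gamma>(1)] G_length_integrable(2)[OF \<gamma>'(1)] f_def f'_def
  by (intro exI[of _ "\<gamma> +++ \<gamma>'"]) auto
qed

end

section \<open>Elementary box paths and their assembly\<close>

context sol_metric begin

lemma s_smooth_path:
 assumes "a < b" shows "smooth_path_on G {a..b} (%t. s (t *\<^sub>R u))"
proof -
 have "smooth_on UNIV {a..b} (%t::real. t *\<^sub>R u)"
  unfolding smooth_on_def using Ck_on_linear[OF bounded_linear_scaleR_left] by blast
 then show ?thesis unfolding smooth_path_G_iff[OF assms] using \<sigma>_smooth_path[OF assms] by (simp add: \<sigma>_def)
qed

lemma smooth_imp_piecewise: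
 assumes "smooth_path_on G {0..1} c" shows "piecewise_smooth_path G (c 0) (c 1) c"
 unfolding piecewise_smooth_path_def
proof (intro conjI exI[of _ "{}"] allI impI)
 show "c ` {0..1} <= carrier G" "continuous_on {0..1} c" using smooth_path_onD[OF assms] by simp_all
 fix a b :: real assume "0 <= a & a < b & b <= 1 & {a<..<b} Int {} = {}"
 then show "smooth_path_on G {a..b} c" using smooth_path_on_subset[OF assms] by auto
qed auto

lemma s_zero: "s 0 = \<one>\<^bsub>G\<^esub>"
 by (simp add: prod_eq_iff fun_eq_iff G_sel(3) \<sigma>_def[symmetric])

lemma s_neg: "inv\<^bsub>G\<^esub> (s v) = s (- v)"
 using s_add[of "- v" v] s_closed by (intro group.inv_equality[OF group_G]) (simp_all add: s_zero)

lemma s_line_derivative: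
 assumes t: "t : {0..1}"
 shows "(left_curve G (%t. s (t *\<^sub>R u)) t has_vector_derivative ds u) (at t within {0..1})"
proof -
 have d: "((%r. r *\<^sub>R u) has_vector_derivative u) (at t within {0..1})"
  by (auto intro!: derivative_eq_intros simp: has_vector_derivative_def)
 have 1: "((%r. coord (N i) (\<sigma> i (r *\<^sub>R u - t *\<^sub>R u))) has_vector_derivative d\<sigma> i u) (at t within {0..1})" for i
  using \<sigma>_velocity[OF t d] unfolding velocity_at_def by blast
 have 2: "((%r. r *\<^sub>R u - t *\<^sub>R u) has_vector_derivative u) (at t within {0..1})"
  using has_vector_derivative_diff[OF d has_vector_derivative_const] by simp
 have 3: "((%r. \<Sum>i\<in>UNIV. axis i (coord (N i) (\<sigma> i (r *\<^sub>R u - t *\<^sub>R u)))) has_vector_derivative (\<Sum>i\<in>UNIV. axis i (d\<sigma> i u))) (at t within {0..1})"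
  by (intro has_vector_derivative_sum bounded_linear.has_vector_derivative[OF bounded_linear_axis 1])
 have "left_curve G (%t. s (t *\<^sub>R u)) t = (%r. ((\<chi> i. coord (N i) (\<sigma> i (r *\<^sub>R u - t *\<^sub>R u))), r *\<^sub>R u - t *\<^sub>R u))"
  unfolding left_curve_def s_neg s_add[symmetric] G_sel(5) by (simp add: fun_eq_iff \<sigma>_def)
 then show ?thesis using has_vector_derivative_Pair[OF 3[unfolded sum_axis] 2] unfolding ds_def by simp
qed

text \<open>A line in a left coset of the splitting has constant left velocity
  \<open>ds u\<close>.\<close>

lemma box_conn_line:
 assumes x: "x : carrier G"
 shows "box_conn {} x (x \<cdot> s u) (sqrt (Q u u)) {snd x, snd x + u}"
proof -
 interpret G: group G by (rule group_G)
 let ?\<gamma> = "%t. x \<cdot> s (t *\<^sub>R u)"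
 have path: "piecewise_smooth_path G x (x \<cdot> s u) ?\<gamma>"
  using smooth_imp_piecewise[OF G_left_translate_smooth[OF x _ s_smooth_path]] x by (simp add: s_zero)
 have im: "(%t. s (t *\<^sub>R u)) ` {0..1} <= carrier G" using s_closed by auto
 have d: "(left_curve G ?\<gamma> t has_vector_derivative ds u) (at t within {0..1})" if "t : {0..1}" for t
  by (rule has_derivative_left_curve_translate[OF x im that s_line_derivative[OF that]])
 have "path_length G g ?\<gamma> = integral {0..1} (%t::real. sqrt (Q u u))"
  unfolding G_length_integrable(2)[OF path]
 proof (rule integral_cong)
  fix t :: real assume "t : {0..1}"
  from left_velocity_eqI[OF this d[OF this]] show "gn (left_velocity G ?\<gamma> t) = sqrt (Q u u)" unfolding gn_def Q_def by simp
 qed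
 then have len: "path_length G g ?\<gamma> <= sqrt (Q u u)" by simp
 have box: "box_on {} ?\<gamma>"
  by (rule box_onI[of "{}" "{}" "%_. 0" "%_. 0" ?\<gamma> "%_. ds u"]) (use d in auto)
 have "snd (?\<gamma> 0) = snd x" "snd (?\<gamma> 1) = snd x + u" unfolding G_sel(2) by simp_all
 then have "{snd x, snd x + u} <= (%t. snd (?\<gamma> t)) ` {0..1}" by (metis (no_types, lifting) atLeastAtMost_iff empty_subsetI image_eqI insert_subset order_refl zero_le_one)
 then show ?thesis unfolding box_conn_def using path len box by blast
qed

definition "single i h = (%j. if j = i then h else \<one>\<^bsub>N j\<^esub>, 0 :: real ^ 'k)"

lemma single_closed: "h : carrier (N i) ==> single i h : carrier G"
 unfolding single_def G_sel(1) using group.is_monoid[OF group_N] by (auto intro: monoid.one_closed)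

lemma single_mult_inv:
 assumes "h : carrier (N i)" "h' : carrier (N i)"
 shows "inv\<^bsub>G\<^esub> (single i h) \<cdot> single i h' = single i (inv\<^bsub>N i\<^esub> h \<otimes>\<^bsub>N i\<^esub> h')"
proof -
 have "act j 0 (inv\<^bsub>N j\<^esub> \<one>\<^bsub>N j\<^esub> \<otimes>\<^bsub>N j\<^esub> \<one>\<^bsub>N j\<^esub>) = \<one>\<^bsub>N j\<^esub>" for j
 proof -
  interpret Nj: lie_grp "N j" ..
  show ?thesis by (simp add: act_zero)
 qed
 moreover have "act i 0 (inv\<^bsub>N i\<^esub> h \<otimes>\<^bsub>N i\<^esub> h') = inv\<^bsub>N i\<^esub> h \<otimes>\<^bsub>N i\<^esub> h'"
 proof -
  interpret Ni: lie_grp "N i" ..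
  show ?thesis using assms by (simp add: act_zero)
 qed
 ultimately show ?thesis
  unfolding inv_mult_G[OF single_closed[OF assms(1)] single_closed[OF assms(2)]] by (auto simp: single_def fun_eq_iff)
qed

text \<open>The path of \<open>factor_dist_path\<close> inside one coset of \<open>N i\<close>; its
  single subinterval is the whole time interval.\<close>

lemma box_conn_jump:
 assumes x: "x : carrier G" and h: "h : carrier (N i)" and d: "factor_dist N g i \<one>\<^bsub>N i\<^esub> h <= 1"
 shows "box_conn {i} x (x \<cdot> single i h) 2 {}"
proof -
 interpret G: group G by (rule group_G)
 interpret Ni: lie_grp "N i" ..
 obtain c where c: "piecewise_smooth_path (N i) \<one>\<^bsub>N i\<^esub> h c" "integral {0..1} (%t. gn (axis i (left_velocity (N i) c t), 0)) <= 2"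
  using factor_dist_path[OF Ni.one_closed h d] by metis
 obtain F where cc: "c 0 = \<one>\<^bsub>N i\<^esub>" "c 1 = h" "c ` {0..1} <= carrier (N i)" "continuous_on {0..1} c" "finite F"
  "!!a b. 0 <= a ==> a < b ==> b <= 1 ==> {a<..<b} Int F = {} ==> smooth_path_on (N i) {a..b} c"
  using piecewise_smooth_pathD[OF c(1)] by metis
 have cm: "c t : carrier (N i)" if "t : {0..1}" for t using cc(3) that by blast
 obtain F' where F': "finite F'" "!!t. t : {0<..<1} - F' ==> velocity_at (N i) (%r. inv\<^bsub>N i\<^esub> (c t) \<otimes>\<^bsub>N i\<^esub> c r) t {0..1} (left_velocity (N i) c t)"
  using Ni.piecewise_smooth_path_velocity[OF c(1)] by metis
 let ?e = "%t. single i (c t)" and ?v = "%t. left_velocity (N i) c t"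
 have ecar: "?e ` {0..1} <= carrier G" using cm single_closed by auto
 have one: "single i \<one>\<^bsub>N i\<^esub> = \<one>\<^bsub>G\<^esub>" unfolding single_def G_sel(3) by auto
 have sm: "smooth_path_on G {a..b} ?e" if ab: "0 <= a" "a < b" "b <= 1" "{a<..<b} Int F = {}" for a b
 proof -
  have "smooth_path_on (N j) {a..b} (%t. fst (?e t) j)" for j
  proof (cases "j = i")
   case True then show ?thesis using cc(6)[OF ab] by (simp add: single_def)
  next
   case False
   interpret Nj: lie_grp "N j" ..
   show ?thesis using False Nj.smooth_path_const[OF Nj.one_closed] by (simp add: single_def)
  qed
  then show ?thesis unfolding smooth_path_G_iff[OF ab(2)] by (simp add: single_def smooth_on_def Ck_on_const)
 qed
 have "continuous_on {0..1} (%t. fst (?e t) j)" for j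
  by (cases "j = i") (simp_all add: single_def cc(4))
 then have ce: "continuous_on {0..1} ?e"
  unfolding single_def using continuous_on_coordinatewise_then_product[of "{0..1}" "%t j. if j = i then c t else \<one>\<^bsub>N j\<^esub>"]
  by (intro continuous_on_Pair continuous_on_const) (simp add: single_def)
 have "piecewise_smooth_path G \<one>\<^bsub>G\<^esub> (single i h) ?e"
  unfolding piecewise_smooth_path_def using cc(1,2,5) one ecar ce sm by (intro conjI exI[of _ F] allI impI) auto
 from G_left_translate_path[OF x this] have path: "piecewise_smooth_path G x (x \<cdot> single i h) (%t. x \<cdot> ?e t)" using x by simp
 have vel: "(left_curve G (%t. x \<cdot> ?e t) t has_vector_derivative (axis i (?v t), 0)) (at t within {0..1})" "?v t : model (N i)"
  if t: "t : {0..1} - (F' Un {0, 1})" for t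
 proof -
  have t': "t : {0<..<1} - F'" "t : {0..1}" using t by auto
  note v = F'(2)[OF t'(1), unfolded velocity_at_def]
  show "?v t : model (N i)" using v by blast
  have "((%r. coord (N i) (inv\<^bsub>N i\<^esub> (c t) \<otimes>\<^bsub>N i\<^esub> c r)) has_vector_derivative ?v t) (at t within {0..1})" using v by blast
  from has_vector_derivative_Pair[OF bounded_linear.has_vector_derivative[OF bounded_linear_axis this] has_vector_derivative_const]
  have d: "((%r. (axis i (coord (N i) (inv\<^bsub>N i\<^esub> (c t) \<otimes>\<^bsub>N i\<^esub> c r)), 0 :: real ^ 'k)) has_vector_derivative (axis i (?v t), 0)) (at t within {0..1})" .
  have "(left_curve G ?e t has_vector_derivative (axis i (?v t), 0)) (at t within {0..1})"
  proof (rule has_vector_derivative_transform[OF t'(2) _ d])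
   fix r :: real assume r: "r : {0..1}"
   show "left_curve G ?e t r = (axis i (coord (N i) (inv\<^bsub>N i\<^esub> (c t) \<otimes>\<^bsub>N i\<^esub> c r)), 0)"
    unfolding left_curve_def single_mult_inv[OF cm[OF t'(2)] cm[OF r]] G_sel(5)
    by (simp add: single_def vec_eq_iff axis_nth_eq lie_grp.coord_one[OF lie_grp_N])
  qed
  then show "(left_curve G (%t. x \<cdot> ?e t) t has_vector_derivative (axis i (?v t), 0)) (at t within {0..1})"
   by (rule has_derivative_left_curve_translate[OF x ecar t'(2)])
 qed
 have "path_length G g (%t. x \<cdot> ?e t) = integral {0..1} (%t. gn (axis i (?v t), 0))"
  unfolding G_length_integrable(2)[OF path]
 proof (rule integral_spike[of "F' Un {0, 1}"])
  fix t assume t: "t : {0..1} - (F' Un {0, 1})"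
  then show "gn (axis i (?v t), 0) = gn (left_velocity G (%t. x \<cdot> ?e t) t)"
   using left_velocity_eqI[OF _ vel(1)[OF t]] by simp
 qed (use F'(1) in \<open>simp add: negligible_finite\<close>)
 then have len: "path_length G g (%t. x \<cdot> ?e t) <= 2" using c(2) by simp
 have box: "box_on {i} (%t. x \<cdot> ?e t)"
 proof (rule box_onI[of "F' Un {0, 1}" "{i}" "%_. 0" "%_. 1", OF _ _ _ vel(1)])
  have "(axis j' (?v t), 0) : factor_algebra N j" if "t : {0..1} - (F' Un {0, 1})" "j : {i}" "j' = i" for t j j'
   using vel(2)[OF that(1)] that(2,3) unfolding factor_algebra_def by blast
  then show "!!t j. t : {0..1} - (F' Un {0, 1}) ==> j : {i} ==> t : {0..1} ==> (axis i (?v t), 0) : factor_algebra N j" by blast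
 qed (use F'(1) in auto)
 show ?thesis unfolding box_conn_def using path len box by blast
qed

lemma box_conn_mono: "box_conn I x y l P ==> l <= l' ==> P' <= P ==> box_conn I x y l' P'"
 unfolding box_conn_def by (meson order_trans)

text \<open>A jump by \<open>\<psi> i (- u) h\<close> made at projection \<open>u\<close> has the
  effect of multiplying by \<open>h\<close> before moving along the splitting. When \<open>u\<close>
  is suitably far inside the half-space, the conjugated element is short.\<close>

lemma s_single:
 assumes h: "h : carrier (N i)"
 shows "s u \<cdot> single i (\<psi> i (- u) h) = single i h \<cdot> s u"
proof -
 interpret G: group G by (rule group_G)
 have e: "single i (\<psi> i (- u) h) = (%j. if j = i then \<psi> i (- u) h else \<one>\<^bsub>N j\<^esub>, 0)" unfolding single_def ..
 have "s u \<cdot> single i (\<psi> i (- u) h) \<cdot> inv\<^bsub>G\<^esub> (s u) = (%j. \<psi> j u (if j = i then \<psi> i (- u) h else \<one>\<^bsub>N j\<^esub>), 0)"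
  unfolding e by (rule conj_G) (use h group.is_monoid[OF group_N] in \<open>auto intro: monoid.one_closed\<close>)
 also have "\<dots> = single i h" unfolding single_def using h by (auto simp: fun_eq_iff \<psi>_add \<psi>_zero)
 finally have "s u \<cdot> single i (\<psi> i (- u) h) \<cdot> inv\<^bsub>G\<^esub> (s u) \<cdot> s u = single i h \<cdot> s u" by simp
 then show ?thesis using single_closed[OF \<psi>_closed[OF h]] s_closed by (simp add: G.m_assoc)
qed

text \<open>The part of \<open>z\<close> inserted so far: \<open>S\<close> is the set of factors
  whose jump has been made.\<close>

definition "partial z S = (%i. if i : S then nilc z i else \<one>\<^bsub>N i\<^esub>, 0 :: real ^ 'k)"

lemma nilc_closed: "z : carrier G ==> nilc z i : carrier (N i)"
proof -
 interpret Ni: lie_grp "N i" ..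
 assume "z : carrier G"
 then show ?thesis unfolding nilc_def G_sel(1) by auto
qed

lemma partial_closed: "z : carrier G ==> partial z S : carrier G"
proof -
 assume "z : carrier G"
 then have "nilc z i : carrier (N i)" "\<one>\<^bsub>N i\<^esub> : carrier (N i)" for i
  using nilc_closed monoid.one_closed[OF group.is_monoid[OF group_N]] by auto
 then show ?thesis unfolding partial_def G_sel(1) by simp
qed

lemma partial_insert:
 assumes z: "z : carrier G" and i: "i ~: S"
 shows "partial z S \<cdot> single i (nilc z i) = partial z (insert i S)"
proof -
 have "(if j : S then nilc z j else \<one>\<^bsub>N j\<^esub>) \<otimes>\<^bsub>N j\<^esub> act j 0 (if j = i then nilc z i else \<one>\<^bsub>N j\<^esub>) = (if j : insert i S then nilc z j else \<one>\<^bsub>N j\<^esub>)" for j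
 proof -
  interpret Nj: lie_grp "N j" ..
  show ?thesis
  proof (cases "j = i")
   case True
   then have "i = j" "j ~: S" using i by auto
   then show ?thesis using nilc_closed[OF z, of j] by (simp add: act_zero)
  next
   case False then show ?thesis using nilc_closed[OF z, of j] by (simp add: act_zero)
  qed
 qed
 then show ?thesis unfolding partial_def single_def G_sel(2) by (simp add: fun_eq_iff)
qed

lemma partial_UNIV:
 assumes z: "z : carrier G" shows "partial z UNIV \<cdot> s (snd z) = z"
proof -
 have "nilc z j \<otimes>\<^bsub>N j\<^esub> act j 0 (\<sigma> j (snd z)) = fst z j" for j
 proof -
  interpret Nj: lie_grp "N j" ..
  have "fst z j : carrier (N j)" using z unfolding G_sel(1) by auto
  then show ?thesis unfolding nilc_def by (simp add: act_zero Nj.m_assoc)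
 qed
 then show ?thesis unfolding partial_def G_sel(2) by (simp add: prod_eq_iff fun_eq_iff \<sigma>_def)
qed

text \<open>At the vertex \<open>w\<close> each \<open>i\<close> in \<open>T\<close> is served by an
  excursion: move to \<open>u i\<close>, jump in \<open>N i\<close>, and return. This accounts for
  the factor 2 and the summand 2.\<close>

lemma box_conn_jumps:
 assumes x: "x : carrier G" and z: "z : carrier G"
  and near: "!!i. factor_dist N g i \<one>\<^bsub>N i\<^esub> (\<psi> i (- u i) (nilc z i)) <= 1"
  and T: "finite T" "T Int S = {}"
 shows "box_conn T (x \<cdot> partial z S \<cdot> s w) (x \<cdot> partial z (S Un T) \<cdot> s w)
  (\<Sum>i\<in>T. 2 * sqrt (Q (u i - w) (u i - w)) + 2) ((%i. snd x + u i) ` T)"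
 using T
proof (induction T rule: finite_induct)
 case empty
 interpret G: group G by (rule group_G)
 have p: "x \<cdot> partial z S \<cdot> s w : carrier G" using x partial_closed[OF z] s_closed by simp
 have "Q 0 0 = 0" using Q_scale[of 0 0 0] by simp
 then show ?case using box_conn_mono[OF box_conn_line[OF p, of 0], of 0 "{}"] p by (simp add: s_zero)
next
 case (insert i T)
 interpret G: group G by (rule group_G)
 let ?S = "S Un T"
 have iS: "i ~: ?S" using insert by blast
 note cl = x partial_closed[OF z] s_closed nilc_closed[OF z] single_closed[OF nilc_closed[OF z]] single_closed[OF \<psi>_closed[OF nilc_closed[OF z]]]
 let ?d = "u i - w"
 have p1: "x \<cdot> partial z ?S \<cdot> s w : carrier G" and p2: "x \<cdot> partial z ?S \<cdot> s (u i) : carrier G"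
  and p3: "x \<cdot> partial z (insert i ?S) \<cdot> s (u i) : carrier G" using cl by simp_all
 have e1: "x \<cdot> partial z ?S \<cdot> s w \<cdot> s ?d = x \<cdot> partial z ?S \<cdot> s (u i)"
  using s_add[of w ?d] cl by (simp add: G.m_assoc)
 have e2: "x \<cdot> partial z ?S \<cdot> s (u i) \<cdot> single i (\<psi> i (- u i) (nilc z i)) = x \<cdot> partial z (insert i ?S) \<cdot> s (u i)"
  unfolding partial_insert[OF z iS, symmetric] using s_single[OF nilc_closed[OF z], of "u i" i] cl by (simp add: G.m_assoc)
 have e3: "x \<cdot> partial z (insert i ?S) \<cdot> s (u i) \<cdot> s (- ?d) = x \<cdot> partial z (insert i ?S) \<cdot> s w"
  using s_add[of "u i" "- ?d"] cl by (simp add: G.m_assoc)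
 have snd1: "snd (x \<cdot> partial z ?S \<cdot> s w) + ?d = snd x + u i" unfolding G_sel(2) partial_def by simp
 have 1: "box_conn {} (x \<cdot> partial z ?S \<cdot> s w) (x \<cdot> partial z ?S \<cdot> s (u i)) (sqrt (Q ?d ?d)) {snd x + u i}"
  using box_conn_mono[OF box_conn_line[OF p1, of ?d] order_refl, of "{snd x + u i}"] unfolding e1 snd1 by simp
 have 2: "box_conn {i} (x \<cdot> partial z ?S \<cdot> s (u i)) (x \<cdot> partial z (insert i ?S) \<cdot> s (u i)) 2 {}"
  using box_conn_jump[OF p2 \<psi>_closed[OF nilc_closed[OF z]] near[of i]] unfolding e2 .
 have Qm: "Q (- ?d) (- ?d) = Q ?d ?d" using Q_scale[of "-1" ?d "- ?d"] Q_scale[of "-1" ?d ?d] Q_sym[of ?d "- ?d"] by simp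
 have 3: "box_conn {} (x \<cdot> partial z (insert i ?S) \<cdot> s (u i)) (x \<cdot> partial z (insert i ?S) \<cdot> s w) (sqrt (Q ?d ?d)) {}"
  using box_conn_mono[OF box_conn_line[OF p3, of "- ?d"] order_refl, of "{}"] unfolding e3 Qm by simp
 have 4: "box_conn T (x \<cdot> partial z S \<cdot> s w) (x \<cdot> partial z ?S \<cdot> s w)
  (\<Sum>i\<in>T. 2 * sqrt (Q (u i - w) (u i - w)) + 2) ((%i. snd x + u i) ` T)" using insert by simp
 from box_conn_join[OF box_conn_join[OF box_conn_join[OF 4 1] 2] 3] insert(2)
 have "box_conn (insert i T) (x \<cdot> partial z S \<cdot> s w) (x \<cdot> partial z (insert i ?S) \<cdot> s w)
  ((\<Sum>i\<in>T. 2 * sqrt (Q (u i - w) (u i - w)) + 2) + sqrt (Q ?d ?d) + 2 + sqrt (Q ?d ?d)) (insert (snd x + u i) ((%i. snd x + u i) ` T))"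
  by simp
 then have "box_conn (insert i T) (x \<cdot> partial z S \<cdot> s w) (x \<cdot> partial z (insert i ?S) \<cdot> s w)
  (\<Sum>i\<in>insert i T. 2 * sqrt (Q (u i - w) (u i - w)) + 2) ((%i. snd x + u i) ` insert i T)"
  by (rule box_conn_mono) (use insert(1,2) in auto)
 then show ?case by (simp add: Un_insert_right)
qed

text \<open>The polygon is followed in a coset of the splitting, and factor \<open>i\<close> is
  inserted by an excursion from vertex \<open>J i\<close> to \<open>u i\<close>. Since every
  \<open>J i\<close> is at most \<open>L\<close>, all of \<open>z\<close> has been built up at the
  end.\<close>

lemma box_conn_chain:
 assumes x: "x : carrier G" and z: "z : carrier G"
  and near: "!!i. factor_dist N g i \<one>\<^bsub>N i\<^esub> (\<psi> i (- u i) (nilc z i)) <= 1"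
  and w: "w 0 = 0" "w L = snd z" and J: "!!i. J i <= L"
 shows "box_conn UNIV x (x \<cdot> z) ((\<Sum>j<L. sqrt (Q (w (Suc j) - w j) (w (Suc j) - w j))) +
  (\<Sum>i\<in>UNIV. 2 * sqrt (Q (u i - w (J i)) (u i - w (J i))) + 2)) (range (%i. snd x + u i))"
proof -
 interpret G: group G by (rule group_G)
 let ?c = "%i. 2 * sqrt (Q (u i - w (J i)) (u i - w (J i))) + 2"
 let ?p = "%S v. x \<cdot> partial z S \<cdot> s v"
 have pc: "?p S v : carrier G" for S v using x partial_closed[OF z] s_closed by simp
 have p0: "?p {} (w 0) = x" using x unfolding w(1) s_zero by (simp add: partial_def G_sel(3)[symmetric])
 have jumps: "box_conn {i. J i = k} (?p {i. J i < k} (w k)) (?p {i. J i < Suc k} (w k)) (\<Sum>i\<in>{i. J i = k}. ?c i) ((%i. snd x + u i) ` {i. J i = k})" for k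
 proof -
  have "{i. J i < k} Un {i. J i = k} = {i. J i < Suc k}" by auto
  moreover have "(\<Sum>i\<in>{i. J i = k}. 2 * sqrt (Q (u i - w k) (u i - w k)) + 2) = (\<Sum>i\<in>{i. J i = k}. ?c i)" by (rule sum.cong) auto
  ultimately show ?thesis using box_conn_jumps[OF x z near, of "{i. J i = k}" "{i. J i < k}" "w k"] by auto
 qed
 \<comment> \<open>After the excursions at vertex \<open>k\<close>, exactly the factors with
   \<open>J i <= k\<close> have been inserted.\<close>
 have main: "box_conn {i. J i < Suc k} x (?p {i. J i < Suc k} (w k)) ((\<Sum>j<k. sqrt (Q (w (Suc j) - w j) (w (Suc j) - w j))) + (\<Sum>i\<in>{i. J i < Suc k}. ?c i))
  ((%i. snd x + u i) ` {i. J i < Suc k})" for k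
 proof (induction k)
  case 0
  show ?case using jumps[of 0] p0 by simp
 next
  case (Suc k)
  let ?d = "w (Suc k) - w k"
  have eq: "?p {i. J i < Suc k} (w k) \<cdot> s ?d = ?p {i. J i < Suc k} (w (Suc k))"
   using s_add[of "w k" ?d] x partial_closed[OF z] s_closed by (simp add: G.m_assoc)
  have 1: "box_conn {} (?p {i. J i < Suc k} (w k)) (?p {i. J i < Suc k} (w (Suc k))) (sqrt (Q ?d ?d)) {}"
   using box_conn_mono[OF box_conn_line[OF pc[of "{i. J i < Suc k}" "w k"], of ?d] order_refl, of "{}"] unfolding eq by simp
  have s: "{i. J i < Suc k} Un {} Un {i. J i = Suc k} = {i. J i < Suc (Suc k)}" by auto
  have "(\<Sum>i\<in>{i. J i < Suc (Suc k)}. ?c i) = (\<Sum>i\<in>{i. J i < Suc k}. ?c i) + (\<Sum>i\<in>{i. J i = Suc k}. ?c i)"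
   unfolding s[symmetric] Un_empty_right by (rule sum.union_disjoint) auto
  moreover have "(%i. snd x + u i) ` {i. J i < Suc k} Un {} Un (%i. snd x + u i) ` {i. J i = Suc k} = (%i. snd x + u i) ` {i. J i < Suc (Suc k)}"
   unfolding s[symmetric] by blast
  moreover have "box_conn ({i. J i < Suc k} Un {} Un {i. J i = Suc k}) x (?p {i. J i < Suc (Suc k)} (w (Suc k)))
   ((\<Sum>j<k. sqrt (Q (w (Suc j) - w j) (w (Suc j) - w j))) + (\<Sum>i\<in>{i. J i < Suc k}. ?c i) + sqrt (Q ?d ?d) + (\<Sum>i\<in>{i. J i = Suc k}. ?c i))
   ((%i. snd x + u i) ` {i. J i < Suc k} Un {} Un (%i. snd x + u i) ` {i. J i = Suc k})"
   by (rule box_conn_join[OF box_conn_join[OF Suc 1] jumps]) auto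
  ultimately show ?case unfolding s by (simp add: algebra_simps)
 qed
 have "{i. J i < Suc L} = UNIV" using J by (auto simp: less_Suc_eq_le)
 moreover have "?p UNIV (w L) = x \<cdot> z"
  using partial_UNIV[OF z] partial_closed[OF z] s_closed x unfolding w(2) by (simp add: G.m_assoc)
 ultimately show ?thesis using main[of L] by simp
qed

end

section \<open>Half-space levels and the box geodesic\<close>

text \<open>The infimum may be minus infinity; then any real number, such as \<open>a\<close>,
  serves as \<open>h\<close>. Otherwise \<open>h\<close> is taken 1 above a point \<open>H'\<close>
  that is at most 1/2 below the infimum and where \<open>f\<close> still exceeds 1: this
  \<open>h\<close> is beyond the infimum, while \<open>f\<close> is large at
  \<open>h - 1\<close>.\<close>

lemma level_choice:
 fixes f :: "real => real" and a :: real
 assumes bound: "\<exists>H. \<forall>H'\<ge>H. f H' <= 1"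
 shows "\<exists>h. (\<forall>r\<ge>h. f r <= 1 & Inf (ereal ` {H. \<forall>H'\<ge>H. f H' <= 1}) <= ereal r) & (h = a \<or> f (h - 1) > 1)"
proof (cases "\<forall>r. f r <= 1")
 case True
 have "Inf (ereal ` {H. \<forall>H'\<ge>H. f H' <= 1}) <= ereal r" for r by (rule Inf_lower) (use True in auto)
 then show ?thesis using True by (intro exI[of _ a]) auto
next
 case False
 then obtain r0 where r0: "f r0 > 1" by (auto simp: not_le)
 let ?S = "{H. \<forall>H'\<ge>H. f H' <= 1}"
 have "r0 <= H" if "H : ?S" for H
 proof (rule ccontr)
  assume "\<not> r0 <= H"
  then have "f r0 <= 1" using that by simp
  then show False using r0 by simp
 qed
 then have bdd: "bdd_below ?S" by (rule bdd_belowI)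
 have ne: "?S ~= {}" using bound by blast
 define I where "I = Inf ?S"
 have "I - 1 / 2 ~: ?S" using cInf_lower[OF _ bdd, of "I - 1 / 2"] unfolding I_def by auto
 then obtain H' where H': "H' >= I - 1 / 2" "f H' > 1" by (auto simp: not_le)
 have "f r <= 1 & Inf (ereal ` ?S) <= ereal r" if r: "r >= H' + 1" for r
 proof -
  have "Inf ?S < r" using H'(1) r unfolding I_def by simp
  from cInf_lessD[OF ne this] obtain H where H: "H : ?S" "H < r" by (elim bexE)
  have "Inf (ereal ` ?S) <= ereal H" by (rule Inf_lower[OF imageI[OF H(1)]])
  also have "ereal H <= ereal r" using H(2) by simp
  finally show ?thesis using H by simp
 qed
 then show ?thesis using H'(2) by (intro exI[of _ "H' + 1"]) simp
qed

context sol_group begin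

lemma piecewise_smooth_path_G_exists:
 assumes x: "x : carrier G" and y: "y : carrier G"
 obtains \<gamma> where "piecewise_smooth_path G x y \<gamma>"
proof -
 have xi: "fst x i : carrier (N i)" and yi: "fst y i : carrier (N i)" for i using x y unfolding G_sel(1) by auto
 have "\<exists>c. piecewise_smooth_path (N i) (fst x i) (fst y i) c" for i
  using lie_grp.piecewise_smooth_path_exists[OF lie_grp_N connected_N xi yi] by blast
 then obtain c where c: "!!i. piecewise_smooth_path (N i) (fst x i) (fst y i) (c i)" by metis
 have c0: "c i 0 = fst x i" "c i 1 = fst y i" and cim: "c i ` {0..1} <= carrier (N i)" and cc: "continuous_on {0..1} (c i)"
  and cF: "\<exists>F. finite F & (\<forall>a b. 0 <= a & a < b & b <= 1 & {a<..<b} Int F = {} --> smooth_path_on (N i) {a..b} (c i))" for i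
  using c[of i] unfolding piecewise_smooth_path_def by blast+
 have "\<forall>i. \<exists>F. finite F & (\<forall>a b. 0 <= a & a < b & b <= 1 & {a<..<b} Int F = {} --> smooth_path_on (N i) {a..b} (c i))" using cF ..
 from choice[OF this] obtain F where F: "\<forall>i. finite (F i) & (\<forall>a b. 0 <= a & a < b & b <= 1 & {a<..<b} Int F i = {} --> smooth_path_on (N i) {a..b} (c i))" ..
 define \<gamma> where "\<gamma> t = (%i. c i t, snd x + t *\<^sub>R (snd y - snd x))" for t
 have "piecewise_smooth_path G x y \<gamma>" unfolding piecewise_smooth_path_def
 proof (intro conjI exI[of _ "\<Union>i. F i"] allI impI)
  show "\<gamma> 0 = x" "\<gamma> 1 = y" unfolding \<gamma>_def using c0 by (simp_all add: prod_eq_iff)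
  show "\<gamma> ` {0..1} <= carrier G" unfolding \<gamma>_def G_sel(1) using cim by auto
  show "continuous_on {0..1} \<gamma>" unfolding \<gamma>_def
   by (rule continuous_on_Pair[OF continuous_on_coordinatewise_then_product[OF cc]]) (intro continuous_intros)
  show "finite (\<Union>i. F i)" using F by simp
  fix a b :: real assume "0 <= a & a < b & b <= 1 & {a<..<b} Int (\<Union>i. F i) = {}"
  then have ab: "0 <= a" "a < b" "b <= 1" "{a<..<b} Int F i = {}" for i by blast+
  have "smooth_path_on (N i) {a..b} (c i)" for i using F ab by simp
  moreover have "smooth_on UNIV {a..b} (%t. snd x + t *\<^sub>R (snd y - snd x))"
   unfolding smooth_on_def by (rule allI) (rule Ck_on_add[OF Ck_on_const Ck_on_linear[OF bounded_linear_scaleR_left]])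
  ultimately show "smooth_path_on G {a..b} \<gamma>" unfolding smooth_path_G_iff[OF ab(2)] \<gamma>_def by simp
 qed
 then show ?thesis by (rule that)
qed

lemma subspace_G: "subspace (model G)"
 unfolding G_sel(4) using subspace_0[OF subspace_N] subspace_add[OF subspace_N] subspace_scale[OF subspace_N]
 by (intro subspaceI) (auto simp: mem_Times_iff)

end

context sol_metric begin

lemma nil_component_eq:
 assumes x: "x : carrier G" and y: "y : carrier G"
 shows "nil_component N act s x y i = nilc (inv\<^bsub>G\<^esub> x \<cdot> y) i"
proof -
 define z where "z = inv\<^bsub>G\<^esub> x \<cdot> y"
 have "act i (snd z) (act i (- snd z) (inv\<^bsub>N i\<^esub> (\<sigma> i (snd z)))) = inv\<^bsub>N i\<^esub> (\<sigma> i (snd z))"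
  using act_add[of "inv\<^bsub>N i\<^esub> (\<sigma> i (snd z))" i "snd z" "- snd z"] act_zero group.inv_closed[OF group_N \<sigma>_closed] by simp
 then have "fst (z \<cdot> inv\<^bsub>G\<^esub> (s (snd z))) i = nilc z i" unfolding inv_G[OF s_closed] G_sel(2) nilc_def by (simp add: \<sigma>_def)
 then show ?thesis unfolding nil_component_def Let_def z_def .
qed

lemma path_length_translate:
 assumes x: "x : carrier G" and \<gamma>: "\<gamma> ` {0..1} <= carrier G"
 shows "path_length G g (%t. x \<cdot> \<gamma> t) = path_length G g \<gamma>"
 unfolding path_length_def by (rule integral_cong) (simp add: left_velocity_translate[OF x \<gamma>])

lemma near_minimal_path:
 assumes x: "x : carrier G" and y: "y : carrier G"
 obtains \<gamma> where "piecewise_smooth_path G \<one>\<^bsub>G\<^esub> (inv\<^bsub>G\<^esub> x \<cdot> y) \<gamma>" "path_length G g \<gamma> <= path_dist G g x y + 1"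
proof -
 interpret G: group G by (rule group_G)
 let ?S = "{path_length G g c | c. piecewise_smooth_path G x y c}"
 have ne: "?S ~= {}" using piecewise_smooth_path_G_exists[OF x y] by blast
 have "Inf ?S < path_dist G g x y + 1" unfolding path_dist_def by simp
 from cInf_lessD[OF ne this] obtain l where l: "l : ?S" "l < path_dist G g x y + 1" by (elim bexE)
 then obtain c where c: "piecewise_smooth_path G x y c" "l = path_length G g c" by blast
 have "c ` {0..1} <= carrier G" using c(1) unfolding piecewise_smooth_path_def by blast
 then have "path_length G g (%t. inv\<^bsub>G\<^esub> x \<cdot> c t) = l" unfolding c(2) by (rule path_length_translate[OF G.inv_closed[OF x]])
 moreover have "piecewise_smooth_path G \<one>\<^bsub>G\<^esub> (inv\<^bsub>G\<^esub> x \<cdot> y) (%t. inv\<^bsub>G\<^esub> x \<cdot> c t)"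
  using G_left_translate_path[OF G.inv_closed[OF x] c(1)] x by simp
 ultimately show ?thesis using that l(2) by (metis less_imp_le)
qed

text \<open>For \<open>H\<close> far above the whole polygon both alternatives of
  \<open>discretization\<close> fail. Hence the distance there is at most 1, and the half-space
  level is not plus infinity.\<close>

lemma exp_sum_small:
 fixes b x :: "nat => real"
 assumes C: "C > 0"
 shows "\<exists>H0. \<forall>H\<ge>H0. (\<forall>j\<le>L. b j < H - A) & (\<Sum>j<L. C * exp (- (1 / 2) * (H - b j)) * x j) < 1"
proof -
 define B where "B = (\<Sum>j<L. C * exp (b j / 2) * \<bar>x j\<bar>)"
 define M where "M = (\<Sum>j\<le>L. \<bar>b j\<bar>)"
 have B: "B >= 0" unfolding B_def using C by (intro sum_nonneg) simp
 have M: "b j <= M" if "j <= L" for j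
  using member_le_sum[of j "{..L}" "%j. \<bar>b j\<bar>"] that unfolding M_def by simp
 have "(\<forall>j\<le>L. b j < H - A) & (\<Sum>j<L. C * exp (- (1 / 2) * (H - b j)) * x j) < 1"
  if H: "H >= max (M + A + 1) (2 * B)" for H
 proof
  show "\<forall>j\<le>L. b j < H - A" using M H by fastforce
  have "(\<Sum>j<L. C * exp (- (1 / 2) * (H - b j)) * x j) <= (\<Sum>j<L. exp (- H / 2) * (C * exp (b j / 2) * \<bar>x j\<bar>))"
  proof (rule sum_mono)
   fix j
   have "exp (- (1 / 2) * (H - b j)) = exp (- H / 2) * exp (b j / 2)"
    unfolding exp_add[symmetric] by (simp add: field_simps)
   moreover have "C * (exp (- H / 2) * exp (b j / 2)) * x j <= C * (exp (- H / 2) * exp (b j / 2)) * \<bar>x j\<bar>"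
    by (rule mult_left_mono) (use C in auto)
   ultimately show "C * exp (- (1 / 2) * (H - b j)) * x j <= exp (- H / 2) * (C * exp (b j / 2) * \<bar>x j\<bar>)" by (simp add: mult_ac)
  qed
  also have "\<dots> = exp (- H / 2) * B" unfolding B_def by (simp add: sum_distrib_left)
  also have "\<dots> < 1"
  proof -
   have "B < exp (H / 2)" using exp_ge_add_one_self[of "H / 2"] H B by linarith
   then have "exp (- H / 2) * B < exp (- H / 2) * exp (H / 2)" by simp
   then show ?thesis by (simp add: exp_add[symmetric])
  qed
  finally show "(\<Sum>j<L. C * exp (- (1 / 2) * (H - b j)) * x j) < 1" .
 qed
 then show ?thesis by blast
qed

lemma box_geodesic:
 "\<exists>K. \<forall>x\<in>carrier G. \<forall>y\<in>carrier G. \<exists>\<gamma>. piecewise_smooth_path G x y \<gamma> & half_space_visiting N \<alpha> act g s x y \<gamma> &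
  box_path N act s \<gamma> & path_length G g \<gamma> <= path_dist G g x y + K"
proof -
 interpret G: group G by (rule group_G)
 interpret d: detour Q \<alpha> grad by (rule detour)
 obtain A C where AC: "A > 0" "C > 0" and disc:
  "!!\<gamma> z. piecewise_smooth_path G \<one>\<^bsub>G\<^esub> z \<gamma> ==> \<exists>L w x. w 0 = 0 & w L = snd z & real L <= path_length G g \<gamma> + 2 &
   (\<forall>j<L. Q (w (Suc j) - w j) (w (Suc j) - w j) + (x j)\<^sup>2 <= 1) &
   (\<forall>i H u. \<alpha> i u = - H --> 1 < factor_dist N g i \<one>\<^bsub>N i\<^esub> (\<psi> i u (nilc z i)) -->
    (\<exists>j\<le>L. \<alpha> i (w j) >= H - A) \<or> 1 <= (\<Sum>j<L. C * exp (- (1 / 2) * (H - \<alpha> i (w j))) * x j))"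
  by (rule discretization, rule that, assumption+)
 \<comment> \<open>\<open>A + 1\<close> and \<open>C * exp (1 / 2)\<close> absorb the shift by 1
   between \<open>h i\<close> and the point where \<open>level_choice\<close> provides a distance
   above 1.\<close>
 obtain K where K: "!!L w x h. (!!j. j < L ==> Q (w (Suc j) - w j) (w (Suc j) - w j) + (x j)\<^sup>2 <= 1) ==>
   (!!i. (\<exists>j\<le>L. \<alpha> i (w j) >= h i - (A + 1)) \<or> 1 <= (\<Sum>j<L. (C * exp (1 / 2)) * exp (- (1 / 2) * (h i - \<alpha> i (w j))) * x j)) ==>
   \<exists>w' J u. w' 0 = w 0 & w' L = w L & (\<forall>i. J i <= L & \<alpha> i (u i) >= h i) &
    (\<Sum>j<L. sqrt (Q (w' (Suc j) - w' j) (w' (Suc j) - w' j))) +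
    2 * (\<Sum>i\<in>UNIV. sqrt (Q (u i - w' (J i)) (u i - w' (J i)))) <= real L + K"
 proof -
  have k: "1 / 2 > (0 :: real)" "C * exp (1 / 2) > 0" "A + 1 >= 0" using AC by simp_all
  show ?thesis
  proof (rule d.visiting_polygon[OF k], goal_cases)
   case (1 K)
   show thesis by (rule that[of K], rule 1, assumption+)
  qed
 qed
 have "\<exists>v. \<alpha> i v = 1" for i
 proof -
  obtain v where "\<alpha> i v ~= 0" using \<alpha>_nonzero by blast
  then have "\<alpha> i ((1 / \<alpha> i v) *\<^sub>R v) = 1" unfolding \<alpha>_scale by simp
  then show ?thesis ..
 qed
 then obtain v1 where v1: "!!i. \<alpha> i (v1 i) = 1" by metis
 show ?thesis
 \<comment> \<open>Beyond \<open>K\<close>: 2 for the jump in each factor, 1 for the near-minimal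
   path, and 2 for the rounding in \<open>integral_partition\<close>.\<close>
 proof (intro exI[of _ "K + 2 * real CARD('i) + 3"] ballI)
  fix x y assume x: "x : carrier G" and y: "y : carrier G"
  define z where "z = inv\<^bsub>G\<^esub> x \<cdot> y"
  have z: "z : carrier G" unfolding z_def using x y by simp
  have xz: "x \<cdot> z = y" unfolding z_def using G.mult_inv_cancel(1)[OF x y] .
  obtain \<gamma>0 where \<gamma>0: "piecewise_smooth_path G \<one>\<^bsub>G\<^esub> z \<gamma>0" "path_length G g \<gamma>0 <= path_dist G g x y + 1"
   using near_minimal_path[OF x y] unfolding z_def by metis
  obtain L w xs where L': "w 0 = 0" "w L = snd z" "real L <= path_length G g \<gamma>0 + 2"
   "\<forall>j<L. Q (w (Suc j) - w j) (w (Suc j) - w j) + (xs j)\<^sup>2 <= 1"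
   "\<forall>i H u. \<alpha> i u = - H --> 1 < factor_dist N g i \<one>\<^bsub>N i\<^esub> (\<psi> i u (nilc z i)) -->
    (\<exists>j\<le>L. \<alpha> i (w j) >= H - A) \<or> 1 <= (\<Sum>j<L. C * exp (- (1 / 2) * (H - \<alpha> i (w j))) * xs j)"
   using disc[OF \<gamma>0(1)] by (elim exE conjE)
  note L = L'(1-3) L'(4,5)[rule_format]
  define f where "f i H = factor_dist N g i \<one>\<^bsub>N i\<^esub>
   (automorphism_of (N i) (lin_exp (%Y. - H *\<^sub>R splitting_derivation N \<alpha> act s i Y)) (nil_component N act s x y i))" for i H
  have f: "f i H = factor_dist N g i \<one>\<^bsub>N i\<^esub> (\<psi> i u (nilc z i))" if "\<alpha> i u = - H" for i u H
   unfolding f_def nil_component_eq[OF x y] z_def[symmetric] automorphism_of_splitting[OF that nilc_closed[OF z]] ..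
  have far: "(\<exists>j\<le>L. \<alpha> i (w j) >= H - A) \<or> 1 <= (\<Sum>j<L. C * exp (- (1 / 2) * (H - \<alpha> i (w j))) * xs j)" if "f i H > 1" for i H
  proof -
   have u: "\<alpha> i (- H *\<^sub>R v1 i) = - H" unfolding \<alpha>_scale v1 by simp
   show ?thesis using L(5)[OF u] that unfolding f[OF u] by blast
  qed
  have bound: "\<exists>H. \<forall>H'\<ge>H. f i H' <= 1" for i
  proof -
   obtain H0 where H0: "\<forall>H\<ge>H0. (\<forall>j\<le>L. \<alpha> i (w j) < H - A) & (\<Sum>j<L. C * exp (- (1 / 2) * (H - \<alpha> i (w j))) * xs j) < 1"
    using exp_sum_small[OF AC(2), of L "%j. \<alpha> i (w j)" A xs] ..
   have "f i H <= 1" if H: "H >= H0" for H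
   proof (rule ccontr)
    assume "\<not> f i H <= 1"
    then have "f i H > 1" by simp
    from far[OF this] H0[rule_format, OF H] show False by (auto simp: not_le)
   qed
   then show ?thesis by blast
  qed
  \<comment> \<open>The free parameter is \<open>\<alpha> i (w 0)\<close>: when it is chosen as
    \<open>h i\<close>, the starting vertex already meets the requirement.\<close>
  have "\<forall>i. \<exists>h. (\<forall>r\<ge>h. f i r <= 1 & Inf (ereal ` {H. \<forall>H'\<ge>H. f i H' <= 1}) <= ereal r) & (h = \<alpha> i (w 0) \<or> f i (h - 1) > 1)"
   using level_choice[OF bound] ..
  from choice[OF this] obtain h where h: "\<forall>i. (\<forall>r\<ge>h i. f i r <= 1 & Inf (ereal ` {H. \<forall>H'\<ge>H. f i H' <= 1}) <= ereal r) & (h i = \<alpha> i (w 0) \<or> f i (h i - 1) > 1)" ..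
  have "\<exists>w' J u. w' 0 = w 0 & w' L = w L & (\<forall>i. J i <= L & \<alpha> i (u i) >= h i) &
    (\<Sum>j<L. sqrt (Q (w' (Suc j) - w' j) (w' (Suc j) - w' j))) +
    2 * (\<Sum>i\<in>UNIV. sqrt (Q (u i - w' (J i)) (u i - w' (J i)))) <= real L + K"
  proof (rule K[of L w xs h, OF L(4)])
   fix i
   have "h i = \<alpha> i (w 0) \<or> f i (h i - 1) > 1" using h by blast
   then show "(\<exists>j\<le>L. \<alpha> i (w j) >= h i - (A + 1)) \<or> 1 <= (\<Sum>j<L. (C * exp (1 / 2)) * exp (- (1 / 2) * (h i - \<alpha> i (w j))) * xs j)"
   proof
    assume "h i = \<alpha> i (w 0)"
    then show ?thesis using AC(1) by (intro disjI1 exI[of _ 0]) simp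
   next
    assume f1: "f i (h i - 1) > 1"
    have ce: "C * exp (- (1 / 2) * (h i - 1 - \<alpha> i (w j))) = C * exp (1 / 2) * exp (- (1 / 2) * (h i - \<alpha> i (w j)))" for j
     unfolding mult.assoc exp_add[symmetric] by (simp add: field_simps)
    show ?thesis using far[OF f1] unfolding ce
    proof
     assume "\<exists>j\<le>L. \<alpha> i (w j) >= h i - 1 - A"
     then obtain j where "j <= L" "\<alpha> i (w j) >= h i - 1 - A" by blast
     then show ?thesis by (intro disjI1 exI[of _ j]) simp
    qed (rule disjI2)
   qed
  qed
  then obtain w' J u where w'': "w' 0 = w 0" "w' L = w L" "\<forall>i. J i <= L & \<alpha> i (u i) >= h i"
   "(\<Sum>j<L. sqrt (Q (w' (Suc j) - w' j) (w' (Suc j) - w' j))) + 2 * (\<Sum>i\<in>UNIV. sqrt (Q (u i - w' (J i)) (u i - w' (J i)))) <= real L + K"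
   by (elim exE conjE)
  have w': "w' 0 = w 0" "w' L = w L" "J i <= L" "\<alpha> i (u i) >= h i"
   "(\<Sum>j<L. sqrt (Q (w' (Suc j) - w' j) (w' (Suc j) - w' j))) + 2 * (\<Sum>i\<in>UNIV. sqrt (Q (u i - w' (J i)) (u i - w' (J i)))) <= real L + K" for i
   using w'' by blast+
  have level: "f i (\<alpha> i (u i)) <= 1" "Inf (ereal ` {H. \<forall>H'\<ge>H. f i H' <= 1}) <= ereal (\<alpha> i (u i))" for i
   using h w'(4)[of i] by blast+
  have near: "factor_dist N g i \<one>\<^bsub>N i\<^esub> (\<psi> i (- u i) (nilc z i)) <= 1" for i
   using level(1)[of i] f[of i "- u i" "\<alpha> i (u i)"] by (simp add: \<alpha>_neg)
  have "box_conn UNIV x (x \<cdot> z) ((\<Sum>j<L. sqrt (Q (w' (Suc j) - w' j) (w' (Suc j) - w' j))) +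
   (\<Sum>i\<in>UNIV. 2 * sqrt (Q (u i - w' (J i)) (u i - w' (J i))) + 2)) (range (%i. snd x + u i))"
   by (rule box_conn_chain[OF x z near]) (use w' L(1,2) in auto)
  then obtain \<gamma> where \<gamma>: "piecewise_smooth_path G x y \<gamma>" "box_on UNIV \<gamma>" "range (%i. snd x + u i) <= (%t. snd (\<gamma> t)) ` {0..1}"
   "path_length G g \<gamma> <= (\<Sum>j<L. sqrt (Q (w' (Suc j) - w' j) (w' (Suc j) - w' j))) + (\<Sum>i\<in>UNIV. 2 * sqrt (Q (u i - w' (J i)) (u i - w' (J i))) + 2)"
   unfolding box_conn_def xz by blast
  have "(\<Sum>i\<in>UNIV. 2 * sqrt (Q (u i - w' (J i)) (u i - w' (J i))) + 2) = 2 * (\<Sum>i\<in>UNIV. sqrt (Q (u i - w' (J i)) (u i - w' (J i)))) + 2 * real CARD('i)"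
   by (simp add: sum.distrib sum_distrib_left)
  then have len: "path_length G g \<gamma> <= path_dist G g x y + (K + 2 * real CARD('i) + 3)" using \<gamma>(4) w''(4) L(3) \<gamma>0(2) by linarith
  have "half_space_visiting N \<alpha> act g s x y \<gamma>" unfolding half_space_visiting_def
  proof
   fix i
   have "snd x + u i : (%t. snd (\<gamma> t)) ` {0..1}" using \<gamma>(3) by blast
   then obtain t where t: "t : {0..1}" "snd x + u i = snd (\<gamma> t)" by (elim imageE)
   have "\<gamma> ` {0..1} <= carrier G" using \<gamma>(1) unfolding piecewise_smooth_path_def by blast
   then have \<gamma>t: "\<gamma> t : carrier G" using t(1) by blast
   have "snd (inv\<^bsub>G\<^esub> x \<cdot> \<gamma> t) = u i" unfolding inv_mult_G[OF x \<gamma>t] using t(2)[symmetric] by simp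
   moreover have "u i : half_space N \<alpha> act g s x y i"
    using level(2)[of i] unfolding half_space_def half_space_level_def f_def by simp
   ultimately have "snd (inv\<^bsub>G\<^esub> x \<cdot> \<gamma> t) : half_space N \<alpha> act g s x y i" by (simp only:)
   then show "\<exists>t\<in>{0..1}. snd (inv\<^bsub>G\<^esub> x \<cdot> \<gamma> t) : half_space N \<alpha> act g s x y i" using t(1) by (rule bexI)
  qed
  then show "\<exists>\<gamma>. piecewise_smooth_path G x y \<gamma> & half_space_visiting N \<alpha> act g s x y \<gamma> &
   box_path N act s \<gamma> & path_length G g \<gamma> <= path_dist G g x y + (K + 2 * real CARD('i) + 3)"
   using \<gamma>(1) box_on_imp_box_path[OF \<gamma>(2)] len by blast
 qed
qed

end

text \<open>The difference \<open>W\<close> of the two lifts of \<open>v\<close> projects to zero,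
  so it lies in the nilpotent algebra. Both lifts are orthogonal to it, hence \<open>W\<close> is
  orthogonal to itself and vanishes; equal differentials give equal splittings.\<close>

lemma perpendicular_splitting_unique:
 assumes "sol_metric N \<alpha> D act s g ge m" "sol_metric N \<alpha> D act s' g ge m" shows "s = s'"
proof -
 interpret s: sol_metric N \<alpha> D act s g ge m by fact
 interpret s': sol_metric N \<alpha> D act s' g ge m by fact
 show ?thesis
 proof (rule s.splitting_unique[OF s.sol_splitting_axioms s'.sol_splitting_axioms])
  fix i v
  define W where "W = s.ds v - s'.ds v"
  have W: "W = ((\<chi> i. s.d\<sigma> i v - s'.d\<sigma> i v), 0)" unfolding W_def s.ds_def s'.ds_def by (simp add: vec_eq_iff)
  have Wi: "fst W $ i : model (N i)" for i
   unfolding W using subspace_diff[OF s.subspace_N s.d\<sigma>_model s'.d\<sigma>_model] by simp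
  have Wm: "W : model (semidirect N act)" using s.nil_model[of "fst W"] Wi unfolding W by simp
  have Wn: "W : nil_algebra N" unfolding nil_algebra_def using Wi unfolding W by auto
  have "ge (s.ds v) W = 0" "ge (s'.ds v) W = 0"
   using s.perp[OF Wn, of v] s'.perp[OF Wn, of v] s.ge_g[OF s.ds_model Wm] s.ge_g[OF s'.ds_model Wm]
   by (simp_all add: s.differential_s_ds s'.differential_s_ds)
  moreover have "s.ds v = W + s'.ds v" unfolding W_def by simp
  ultimately have "ge W W = 0" using s.ge_add[of W "s'.ds v" W] by simp
  then have "m * (norm W)\<^sup>2 <= 0" using s.ge_low[OF Wm] by simp
  then have "W = 0" using s.m by (simp add: mult_le_0_iff)
  then have "(\<chi> i. s.d\<sigma> i v - s'.d\<sigma> i v) = 0" unfolding W by (simp add: prod_eq_iff)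
  then show "s.d\<sigma> i v = s'.d\<sigma> i v" by (simp add: vec_eq_iff)
 qed
qed

theorem proposition7p4:
  fixes N :: "'i::finite \<Rightarrow>
      ('a::{t2_space, second_countable_topology}, 'e::euclidean_space) lie_struct"
    and \<alpha> :: "'i \<Rightarrow> real ^ 'k \<Rightarrow> real"
    and D :: "'i \<Rightarrow> 'e \<Rightarrow> 'e"
    and act :: "'i \<Rightarrow> real ^ 'k \<Rightarrow> 'a \<Rightarrow> 'a"
    and g :: "('e ^ 'i) \<times> (real ^ 'k) \<Rightarrow> ('e ^ 'i) \<times> (real ^ 'k) \<Rightarrow> real"
  assumes "higher_rank_sol_type N \<alpha> D act"
    and "inner_product_on (model (semidirect N act)) g"
  shows "\<exists>K::real. \<forall>s. perpendicular_splitting N act g s \<longrightarrow>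
           (\<forall>x\<in>carrier (semidirect N act). \<forall>y\<in>carrier (semidirect N act).
              \<exists>\<gamma>. piecewise_smooth_path (semidirect N act) x y \<gamma> \<and>
                  half_space_visiting N \<alpha> act g s x y \<gamma> \<and>
                  box_path N act s \<gamma> \<and>
                  path_length (semidirect N act) g \<gamma>
                    \<le> path_dist (semidirect N act) g x y + K)"
proof -
 interpret sol_group N \<alpha> D act by unfold_locales (rule assms(1))
 obtain ge m where ge: "!!X Y. X : model G ==> Y : model G ==> ge X Y = g X Y" "!!X Y. ge X Y = ge Y X"
  "!!X Y Z. ge (X + Y) Z = ge X Z + ge Y Z" "!!r X Z. ge (r *\<^sub>R X) Z = r * ge X Z" "!!X. ge X X >= 0"
  "continuous_on UNIV (%X. ge X X)" "m > 0" "!!X. X : model G ==> m * (norm X)\<^sup>2 <= ge X X"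
  by (rule inner_product_extension[OF subspace_G assms(2)], rule that, assumption+)
 have metric: "sol_metric N \<alpha> D act s g ge m" if s: "perpendicular_splitting N act g s" for s
 proof -
  have "lie_hom vector_group G s" "!!v. snd (s v) = v" "!!v X. X : nil_algebra N ==> g (differential vector_group G s v) X = 0"
   using s unfolding perpendicular_splitting_def by blast+
  then show ?thesis by unfold_locales (rule ge | assumption)+
 qed
 show ?thesis
 \<comment> \<open>\<open>K\<close> has to be fixed before \<open>s\<close>. If a perpendicular
   splitting exists, it is unique and its constant is taken; otherwise the claim is vacuous.\<close>
 proof (cases "\<exists>s. perpendicular_splitting N act g s")
  case True
  then obtain s0 where s0: "perpendicular_splitting N act g s0" ..
  interpret s0: sol_metric N \<alpha> D act s0 g ge m by (rule metric[OF s0])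
  have "s = s0" if "perpendicular_splitting N act g s" for s
   by (rule perpendicular_splitting_unique[OF metric[OF that] metric[OF s0]])
  then show ?thesis using s0.box_geodesic by metis
 qed simp
qed

end
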